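(* Let $N=N(n)$ be positive integers and $c_n = n/N$. For each $n\ge 1$ let $Z_n$ be a random $n\times N$ complex matrix, $T_n$ a (possibly random) $n\times n$ non-negative definite Hermitian matrix, and $W_n$ a (possibly random) $N\times N$ diagonal matrix with non-negative real entries, all defined on a common probability space. Set $$B_n = \frac1N\, T_n^{1/2} Z_n W_n Z_n^* T_n^{1/2},$$ and let $F_n=F^{B_n}$ be its empirical spectrum distribution. Assume: (a) for each $n$ the entries $(Z_n)_{ij}$ are independent, and all entries, for all $n,i,j$, are identically distributed complex random variables with $\mathbb{E}[(Z_n)_{ij}]=0$ and $\mathbb{E}[|(Z_n)_{ij}|^2]=1$; (b) $c_n = n/N(n)\to c\in(0,\infty)$ as $n\to\infty$; (c) almost surely, $F^{T_n}$ converges weakly to $H$, where $H$ is a (nonrandom) probability distribution function on $[0,\infty)$; (d) almost surely, $F^{W_n}$ converges weakly to $D$, where $D$ is a (nonrandom) probability distribution function on $[0,\infty)$ with $\int x\,dD(x)<\infty$, and almost surely $\int x\,dF^{W_n}(x)\to\int x\,dD(x)$; (e) for each $n$, $Z_n$, $T_n$ and $W_n$ are independent. Then, almost surely, $F_n$ converges weakly to a nonrandom probability distribution function $F$, whose Cauchy-Stieltjes transform $m:=m_F$ satisfies, for all $z\in\mathbb{C}_+$, $$m(z)=\int\frac{1}{\tau\,\tilde m(z)-z}\,dH(\tau),$$ where, for all $z\in\mathbb{C}_+$, $\tilde m(z)$ is the unique solution in $\mathbb{C}\setminus\mathbb{C}_+$ of the equation $$\tilde m(z)=\int\frac{\delta}{1+\delta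 c\int\frac{\tau}{\tau\tilde m(z)-z}\,dH(\tau)}\,dD(\delta).$$
   Context: $\mathbb{C}_+=\{z\in\mathbb{C}:\Im z>0\}$. For a Hermitian $k\times k$ matrix $A$ with eigenvalues $\mu_1,\dots,\mu_k$ (with multiplicity), its empirical spectrum distribution is the distribution function $F^A=\frac1k\sum_{i=1}^k \mathbf 1_{[\mu_i,+\infty)}$. For a probability distribution function $G$ on $\mathbb{R}$, its Cauchy-Stieltjes transform is $m_G(z)=\int\frac{1}{\tau-z}\,dG(\tau)$, $z\in\mathbb{C}_+$. $M^*$ denotes the conjugate transpose and $T_n^{1/2}$ the non-negative definite square root. Being a solution of the equation for $\tilde m(z)$ includes that the integrals appearing in it are well defined (absolutely convergent).
   Formalization: At δ=0 the outer integrand counts as 0 with no convergence required of the inner integral; this matters only if D is the point mass at 0, where (e.g. W_n=0, H of infinite mean) the only candidate m̃=0 has a divergent inner integral and the literal claim fails. *)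

theory Defs
  imports "HOL-Probability.Probability" "Jordan_Normal_Form.Schur_Decomposition"
begin

definition nonneg_definite :: "complex mat \<Rightarrow> bool" where
  "nonneg_definite A \<longleftrightarrow> square_mat A \<and> mat_adjoint A = A \<and>
     (\<forall>v \<in> carrier_vec (dim_row A). 0 \<le> Re ((A *\<^sub>v v) \<bullet>c v))"

definition psd_sqrt :: "complex mat \<Rightarrow> complex mat" where
  "psd_sqrt A = (THE S. nonneg_definite S \<and> S * S = A)"

text \<open>\<^const>\<open>proots\<close> of the characteristic polynomial is the multiset of eigenvalues with
  algebraic multiplicity. For Hermitian matrices all of them are real, so that taking real
  parts loses nothing.\<close>

definition esd :: "complex mat \<Rightarrow> real \<Rightarrow> real" where
  "esd A x = (1 / real (dim_row A)) * (\<Sum>\<mu>\<in>#proots (char_poly A). indicator {Re \<mu>..} x)"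

definition prob_distribution_function :: "(real \<Rightarrow> real) \<Rightarrow> bool" where
  "prob_distribution_function F \<longleftrightarrow> mono F \<and> (\<forall>x. continuous (at_right x) F) \<and>
     (F \<longlongrightarrow> 0) at_bot \<and> (F \<longlongrightarrow> 1) at_top"

definition prob_distribution_function_nonneg :: "(real \<Rightarrow> real) \<Rightarrow> bool" where
  "prob_distribution_function_nonneg F \<longleftrightarrow>
     prob_distribution_function F \<and> (\<forall>x<0. F x = 0)"

definition upper_half_plane :: "complex set" where
  "upper_half_plane = {z. Im z > 0}"

definition cauchy_stieltjes :: "(real \<Rightarrow> real) \<Rightarrow> complex \<Rightarrow> complex" where
  "cauchy_stieltjes G z =
     (LINT \<tau>|interval_measure G. 1 / (complex_of_real \<tau> - z))"

text \<open>The Borel space on the matrices of a fixed size, identified with arrays of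
  entries: a map into it is measurable iff its values have that size and every entry is
  a complex random variable.\<close>

definition borel_mat :: "nat \<Rightarrow> nat \<Rightarrow> complex mat measure" where
  "borel_mat r k = vimage_algebra (carrier_mat r k)
     (\<lambda>A. \<lambda>ij \<in> {..<r} \<times> {..<k}. A $$ ij) (\<Pi>\<^sub>M ij \<in> {..<r} \<times> {..<k}. borel)"

text \<open>\<open>w\<close> satisfies the fixed-point equation at \<open>z\<close>, all integrals being well defined:
  the inner integral is absolutely convergent, no denominator vanishes, and the outer
  integral is absolutely convergent. At \<open>\<delta> = 0\<close> the outer integrand is read as \<open>0\<close> without
  requirement on the inner integral. This matters only if \<open>D\<close> is the point mass at \<open>0\<close>:
  then \<open>w = 0\<close>, and the inner integral diverges if \<open>H\<close> has infinite mean.\<close>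

definition solves_fixed_point ::
  "real \<Rightarrow> (real \<Rightarrow> real) \<Rightarrow> (real \<Rightarrow> real) \<Rightarrow> complex \<Rightarrow> complex \<Rightarrow> bool" where
  "solves_fixed_point c H D z w \<longleftrightarrow>
     (let inner = (\<lambda>\<tau>. complex_of_real \<tau> / (complex_of_real \<tau> * w - z));
          denom = (\<lambda>\<delta>. 1 + complex_of_real (\<delta> * c) * (LINT \<tau>|interval_measure H. inner \<tau>));
          outer = (\<lambda>\<delta>. complex_of_real \<delta> / denom \<delta>)
      in (AE \<delta> in interval_measure D. \<delta> \<noteq> 0 \<longrightarrow>
            (AE \<tau> in interval_measure H. complex_of_real \<tau> * w - z \<noteq> 0) \<and>
            integrable (interval_measure H) inner \<and> denom \<delta> \<noteq> 0) \<and>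
         integrable (interval_measure D) outer \<and>
         w = (LINT \<delta>|interval_measure D. outer \<delta>))"

end

theory Submission
  imports Defs
begin

text \<open>With the spectral decomposition \<open>T = U diag(t) U\<^sup>*\<close> the Cauchy-Stieltjes transform of \<open>F\<^sub>n\<close> at \<open>z\<close> is the
  normalised trace of the resolvent \<open>R\<close> of \<open>(1/N) \<Sum>\<^sub>j w\<^sub>j r\<^sub>j r\<^sub>j\<^sup>*\<close>, where \<open>r\<^sub>j = diag(t)\<^sup>1\<^sup>/\<^sup>2 U\<^sup>* z\<^sub>j\<close> and \<open>z\<^sub>j\<close> is the
  \<open>j\<close>-th column of \<open>Z\<close>. Changing one column changes the trace by a bounded amount, so conditionally on \<open>T\<close>
  and \<open>W\<close> the bounded difference inequality and the Borel-Cantelli lemma reduce almost sure convergence to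
  that of the conditional mean, which is a deterministic function of \<open>t\<close> and \<open>w\<close>.

  For the mean, \<open>t\<close> and \<open>w\<close> are first truncated at a level \<open>K\<close>; by rank inequalities this costs only the mass of
  their distributions beyond \<open>K\<close>. For bounded \<open>t\<close> and \<open>w\<close>, the quadratic forms \<open>z\<^sub>j\<^sup>* A z\<^sub>j\<close> concentrate around \<open>tr A\<close>,
  and the resolvent identity together with Sherman-Morrison shows that \<open>R\<close> is close, in the mean and on
  diagonal test matrices, to \<open>(\<omega> diag(t) - z)\<^sup>-\<^sup>1\<close> with \<open>\<omega> = \<integral> \<delta> / (1 + \<delta> \<gamma>) dF\<^sup>W\<close> and \<open>\<gamma> = (1/N) E tr(T R)\<close>.
  Limit points of \<open>(\<gamma>, \<omega>)\<close> solve the truncated fixed point equations; as \<open>K\<close> tends to infinity, their solutions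
  accumulate at solutions of the equation in the theorem. Uniqueness of the latter follows from a Cauchy-Schwarz
  argument and turns accumulation into convergence.

  At \<open>z = i y\<close> the solution stays bounded, so that \<open>-i y m(i y)\<close> tends to \<open>1\<close>. This gives tightness, and weak
  convergence follows from convergence of the transforms at countably many points.\<close>

section \<open>Resolvents of sums of rank one matrices\<close>

text \<open>The shape of the proof is dictated by weak moments: \<open>H\<close> may have infinite
  mean, \<open>D\<close> has only a first moment, the entries only a second one. The inner integral
  of the equation, which is the limit of \<gamma> divided by \<open>c\<close>, has no a priori
  bound, and a solution at truncation level \<open>K\<close> is only obtained as a limit point. So a
  subsequential limit of the bounded means is compared with truncated solutions, with
  \<open>n\<close> growing at fixed \<open>K\<close> and \<open>K\<close> growing afterwards.
  Uniqueness is applied to the untruncated equation alone: there, imaginary parts yield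
  \<open>c * B * C < 1\<close> for the integrals \<open>B\<close>, \<open>C\<close> of the squared
  moduli of inner and outer integrand. The same sign information at finite size,
  \<open>0 \<le> Im (z * b)\<close> for quadratic forms \<open>b\<close> of resolvents, keeps every
  denominator \<open>1 + w * b\<close> at distance \<open>Im z / cmod z\<close> from zero, uniformly
  in \<open>n\<close> and \<open>K\<close>. Existence of a solution is a by-product of the
  convergence at a single realisation. Eigenvectors and eigenvalues of \<open>T\<close> are chosen
  realisation by realisation, without measurability; events are therefore expressed through a
  rational function of the matrix entries with the same value.\<close>

text \<open>Since the dimension varies, matrices of size \<open>n\<close> are functions of two indices, of which only the values
  below \<open>n\<close> matter; the matrices of the statement enter through \<open>kmat\<close> below.\<close>

definition kapp :: "nat \<Rightarrow> (nat \<Rightarrow> nat \<Rightarrow> complex) \<Rightarrow> (nat \<Rightarrow> complex) \<Rightarrow> nat \<Rightarrow> complex" where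
  "kapp n A x = (\<lambda>i. \<Sum>k<n. A i k * x k)"

definition kmul :: "nat \<Rightarrow> (nat \<Rightarrow> nat \<Rightarrow> complex) \<Rightarrow> (nat \<Rightarrow> nat \<Rightarrow> complex) \<Rightarrow> nat \<Rightarrow> nat \<Rightarrow> complex" where
  "kmul n A B = (\<lambda>i k. \<Sum>l<n. A i l * B l k)"

definition kip :: "nat \<Rightarrow> (nat \<Rightarrow> complex) \<Rightarrow> (nat \<Rightarrow> complex) \<Rightarrow> complex" where
  "kip n x y = (\<Sum>i<n. cnj (x i) * y i)"

definition knorm :: "nat \<Rightarrow> (nat \<Rightarrow> complex) \<Rightarrow> real" where
  "knorm n x = L2_set (\<lambda>i. cmod (x i)) {..<n}"

definition kadj :: "(nat \<Rightarrow> nat \<Rightarrow> complex) \<Rightarrow> nat \<Rightarrow> nat \<Rightarrow> complex" where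
  "kadj A = (\<lambda>i k. cnj (A k i))"

definition ktr :: "nat \<Rightarrow> (nat \<Rightarrow> nat \<Rightarrow> complex) \<Rightarrow> complex" where
  "ktr n A = (\<Sum>i<n. A i i)"

definition kherm :: "nat \<Rightarrow> (nat \<Rightarrow> nat \<Rightarrow> complex) \<Rightarrow> bool" where
  "kherm n A \<longleftrightarrow> (\<forall>i<n. \<forall>k<n. A i k = cnj (A k i))"

definition kbounded :: "nat \<Rightarrow> real \<Rightarrow> (nat \<Rightarrow> nat \<Rightarrow> complex) \<Rightarrow> bool" where
  "kbounded n C A \<longleftrightarrow> 0 \<le> C \<and> (\<forall>x. knorm n (kapp n A x) \<le> C * knorm n x)"

definition kdiag :: "(nat \<Rightarrow> complex) \<Rightarrow> nat \<Rightarrow> nat \<Rightarrow> complex" where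
  "kdiag d = (\<lambda>i k. if i = k then d i else 0)"

definition kunitary :: "nat \<Rightarrow> (nat \<Rightarrow> nat \<Rightarrow> complex) \<Rightarrow> bool" where
  "kunitary n U \<longleftrightarrow>
     (\<forall>i<n. \<forall>k<n. kmul n U (kadj U) i k = (if i = k then 1 else 0)) \<and>
     (\<forall>i<n. \<forall>k<n. kmul n (kadj U) U i k = (if i = k then 1 else 0))"

definition kgram :: "(nat \<Rightarrow> real) \<Rightarrow> (nat \<Rightarrow> nat \<Rightarrow> complex) \<Rightarrow> nat \<Rightarrow> nat \<Rightarrow> nat \<Rightarrow> complex" where
  "kgram w r J = (\<lambda>i k. \<Sum>j<J. of_real (w j) * r j i * cnj (r j k))"

text \<open>Only a right inverse is demanded. For Hermitian \<open>B\<close> and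
  \<open>0 < Im z\<close> the map \<open>B - z\<close> is injective, so \<open>R\<close> is
  determined on indices below \<open>n\<close> (\<open>resolvent_kernel_unique\<close>), and
  resolvents built by updates or from a spectral decomposition are interchangeable.\<close>

definition is_resolvent :: "nat \<Rightarrow> (nat \<Rightarrow> nat \<Rightarrow> complex) \<Rightarrow> complex \<Rightarrow> (nat \<Rightarrow> nat \<Rightarrow> complex) \<Rightarrow> bool" where
  "is_resolvent n B z R \<longleftrightarrow> (\<forall>x. \<forall>i<n. kapp n B (kapp n R x) i - z * kapp n R x i = x i)"

text \<open>The kernel of \<open>(\<Sum>\<^sub>j w\<^sub>j x\<^sub>j y\<^sub>j\<^sup>* - z)\<^sup>-\<^sup>1\<close>, built by Sherman-Morrison updates. This makes it a measurable
  function of the data, without a matrix inverse, also where the denominators vanish.\<close>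

fun smk :: "nat \<Rightarrow> complex \<Rightarrow> (nat \<Rightarrow> real) \<Rightarrow> (nat \<Rightarrow> nat \<Rightarrow> complex) \<Rightarrow> (nat \<Rightarrow> nat \<Rightarrow> complex) \<Rightarrow>
    nat \<Rightarrow> nat \<Rightarrow> nat \<Rightarrow> complex" where
  "smk n z w x y 0 = kdiag (\<lambda>_. - 1 / z)"
| "smk n z w x y (Suc J) = (\<lambda>i k. smk n z w x y J i k -
     of_real (w J) * kapp n (smk n z w x y J) (x J) i * (\<Sum>l<n. cnj (y J l) * smk n z w x y J l k) /
     (1 + of_real (w J) * kip n (y J) (kapp n (smk n z w x y J) (x J))))"

section \<open>Calculus of kernels: inner product, norm, trace, operator bound\<close>

lemma kapp_cong: "(\<And>k. k < n \<Longrightarrow> A i k = A' i k) \<Longrightarrow> (\<And>k. k < n \<Longrightarrow> x k = x' k) \<Longrightarrow> kapp n A x i = kapp n A' x' i"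
  unfolding kapp_def by (intro sum.cong) auto

lemma kip_cong: "(\<And>k. k < n \<Longrightarrow> x k = x' k) \<Longrightarrow> (\<And>k. k < n \<Longrightarrow> y k = y' k) \<Longrightarrow> kip n x y = kip n x' y'"
  unfolding kip_def by (intro sum.cong) auto

lemma knorm_cong: "(\<And>k. k < n \<Longrightarrow> x k = x' k) \<Longrightarrow> knorm n x = knorm n x'"
  unfolding knorm_def L2_set_def by simp

lemma knorm_nonneg [simp]: "0 \<le> knorm n x"
  unfolding knorm_def by (rule L2_set_nonneg)

lemma knorm_sq: "(knorm n x)\<^sup>2 = (\<Sum>i<n. (cmod (x i))\<^sup>2)"
  unfolding knorm_def L2_set_def by (simp add: sum_nonneg)

lemma kip_self: "kip n x x = of_real ((knorm n x)\<^sup>2)"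
  unfolding knorm_sq kip_def of_real_sum
  by (intro sum.cong refl) (simp add: complex_norm_square mult.commute del: of_real_power)

lemma knorm_eq_0: "knorm n x = 0 \<longleftrightarrow> (\<forall>i<n. x i = 0)"
  unfolding knorm_def by (subst L2_set_eq_0_iff) auto

lemma kip_cauchy: "cmod (kip n x y) \<le> knorm n x * knorm n y"
proof -
  have "cmod (kip n x y) \<le> (\<Sum>i<n. \<bar>cmod (x i)\<bar> * \<bar>cmod (y i)\<bar>)"
    unfolding kip_def by (rule order_trans[OF norm_sum]) (simp add: norm_mult)
  also have "\<dots> \<le> knorm n x * knorm n y"
    unfolding knorm_def by (rule L2_set_mult_ineq)
  finally show ?thesis .
qed

lemma kip_cnj: "cnj (kip n x y) = kip n y x"
  unfolding kip_def by (simp add: mult.commute)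

lemma kip_diff_left: "kip n (\<lambda>i. x i - y i) u = kip n x u - kip n y u"
  and kip_diff_right: "kip n u (\<lambda>i. x i - y i) = kip n u x - kip n u y"
  and kip_smult_left: "kip n (\<lambda>i. c * x i) u = cnj c * kip n x u"
  and kip_smult_right: "kip n u (\<lambda>i. c * x i) = c * kip n u x"
  unfolding kip_def
  by (simp_all add: algebra_simps sum_subtractf sum_distrib_left)

lemma kapp_diff: "kapp n A (\<lambda>i. x i - y i) i = kapp n A x i - kapp n A y i"
  and kapp_smult: "kapp n A (\<lambda>i. c * x i) i = c * kapp n A x i"
  unfolding kapp_def by (simp_all add: algebra_simps sum_subtractf sum_distrib_left)

lemma kapp_kmul: "kapp n (kmul n A B) x i = kapp n A (kapp n B x) i"
  unfolding kapp_def kmul_def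
  by (simp add: sum_distrib_left sum_distrib_right mult.assoc) (rule sum.swap)

lemma kmul_assoc: "kmul n (kmul n A B) C = kmul n A (kmul n B C)"
proof (intro ext)
  fix i k
  have "kmul n (kmul n A B) C i k = (\<Sum>l<n. \<Sum>m<n. A i m * (B m l * C l k))"
    unfolding kmul_def by (simp add: sum_distrib_right mult.assoc)
  also have "\<dots> = (\<Sum>m<n. \<Sum>l<n. A i m * (B m l * C l k))" by (rule sum.swap)
  also have "\<dots> = kmul n A (kmul n B C) i k"
    unfolding kmul_def by (simp add: sum_distrib_left)
  finally show "kmul n (kmul n A B) C i k = kmul n A (kmul n B C) i k" .
qed

lemma ktr_kmul_commute: "ktr n (kmul n A B) = ktr n (kmul n B A)"
  unfolding ktr_def kmul_def by (subst sum.swap) (simp add: mult.commute)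

lemma kip_kapp_adj: "kip n x (kapp n A y) = kip n (kapp n (kadj A) x) y"
proof -
  have "kip n x (kapp n A y) = (\<Sum>i<n. \<Sum>k<n. cnj (x i) * A i k * y k)"
    unfolding kip_def kapp_def by (simp add: sum_distrib_left mult.assoc)
  also have "\<dots> = (\<Sum>k<n. \<Sum>i<n. cnj (x i) * A i k * y k)" by (rule sum.swap)
  also have "\<dots> = kip n (kapp n (kadj A) x) y"
    unfolding kip_def kapp_def kadj_def cnj_sum sum_distrib_right by (intro sum.cong refl) simp
  finally show ?thesis .
qed

lemma kip_kherm: "kherm n B \<Longrightarrow> kip n x (kapp n B y) = kip n (kapp n B x) y"
  unfolding kip_kapp_adj
  by (intro kip_cong kapp_cong) (metis kherm_def kadj_def, simp_all)

lemma khermD: "kherm n A \<Longrightarrow> i < n \<Longrightarrow> k < n \<Longrightarrow> cnj (A k i) = A i k"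
  unfolding kherm_def by metis

lemma Im_kip_kherm:
  assumes "kherm n B" shows "Im (kip n x (kapp n B x)) = 0"
proof -
  have "cnj (kip n x (kapp n B x)) = kip n x (kapp n B x)"
    unfolding kip_cnj by (rule kip_kherm[OF assms, symmetric])
  thus ?thesis by (simp add: complex_eq_iff)
qed

lemma knorm_kapp_unit: "k < n \<Longrightarrow> kapp n A (\<lambda>i. if i = k then 1 else 0) i = A i k"
  unfolding kapp_def by (simp add: if_distrib cong: if_cong)

lemma knorm_unit: "k < n \<Longrightarrow> knorm n (\<lambda>i. if i = k then 1 else 0) = 1"
  unfolding knorm_def L2_set_def by (simp add: if_distrib[of "\<lambda>x. (cmod x)\<^sup>2"] cong: if_cong)

lemma norm_le_knorm: "i < n \<Longrightarrow> cmod (x i) \<le> knorm n x"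
  unfolding knorm_def by (rule member_le_L2_set[of "{..<n}" i "\<lambda>i. cmod (x i)", simplified])

lemma kboundedD: "kbounded n C A \<Longrightarrow> knorm n (kapp n A x) \<le> C * knorm n x"
  unfolding kbounded_def by auto

lemma kbounded_nonneg: "kbounded n C A \<Longrightarrow> 0 \<le> C"
  unfolding kbounded_def by auto

lemma kbounded_entry:
  assumes "kbounded n C A" "i < n" "k < n"
  shows "cmod (A i k) \<le> C"
proof -
  let ?e = "\<lambda>i. if i = k then 1 else (0::complex)"
  have "cmod (A i k) = cmod (kapp n A ?e i)" using assms by (simp add: knorm_kapp_unit)
  also have "\<dots> \<le> knorm n (kapp n A ?e)" by (rule norm_le_knorm[OF assms(2)])
  also have "\<dots> \<le> C * knorm n ?e" by (rule kboundedD[OF assms(1)])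
  finally show ?thesis using knorm_unit[OF assms(3)] by simp
qed

lemma kbounded_ktr:
  assumes "kbounded n C A" shows "cmod (ktr n A) \<le> real n * C"
proof -
  have "cmod (ktr n A) \<le> (\<Sum>i<n. C)"
    unfolding ktr_def by (rule sum_norm_le) (use kbounded_entry[OF assms] in auto)
  thus ?thesis by simp
qed

text \<open>Each of the \<open>n\<close> columns is the image of a unit vector. That the sum grows
  like \<open>n\<close> and not like \<open>n\<^sup>2\<close> is what makes quadratic forms
  concentrate.\<close>

lemma kbounded_hs:
  assumes "kbounded n C A"
  shows "(\<Sum>i<n. \<Sum>k<n. (cmod (A i k))\<^sup>2) \<le> real n * C\<^sup>2"
proof -
  have "(\<Sum>i<n. (cmod (A i k))\<^sup>2) \<le> C\<^sup>2" if k: "k < n" for k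
  proof -
    let ?e = "\<lambda>i. if i = k then 1 else (0::complex)"
    have "(\<Sum>i<n. (cmod (A i k))\<^sup>2) = (knorm n (kapp n A ?e))\<^sup>2"
      unfolding knorm_sq using knorm_kapp_unit[OF k] by simp
    also have "\<dots> \<le> (C * knorm n ?e)\<^sup>2" by (intro power_mono kboundedD[OF assms]) simp
    finally show ?thesis using knorm_unit[OF k] by simp
  qed
  hence "(\<Sum>k<n. \<Sum>i<n. (cmod (A i k))\<^sup>2) \<le> (\<Sum>k<n. C\<^sup>2)" by (intro sum_mono) auto
  thus ?thesis by (subst sum.swap) simp
qed

lemma kbounded_kmul:
  assumes "kbounded n C A" "kbounded n D B"
  shows "kbounded n (C * D) (kmul n A B)"
  unfolding kbounded_def
proof (intro conjI allI)
  show "0 \<le> C * D" using assms by (simp add: kbounded_def)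
  fix x
  have "knorm n (kapp n (kmul n A B) x) = knorm n (kapp n A (kapp n B x))"
    by (intro knorm_cong) (simp add: kapp_kmul)
  also have "\<dots> \<le> C * (D * knorm n x)"
    by (rule order_trans[OF kboundedD[OF assms(1)]])
       (intro mult_left_mono kboundedD[OF assms(2)] kbounded_nonneg[OF assms(1)])
  finally show "knorm n (kapp n (kmul n A B) x) \<le> C * D * knorm n x" by (simp add: mult.assoc)
qed

lemma kapp_kdiag: "i < n \<Longrightarrow> kapp n (kdiag d) x i = d i * x i"
  unfolding kapp_def kdiag_def by (simp add: if_distrib[of "\<lambda>y. y * _"] cong: if_cong)

lemma kmul_kdiag_left: "i < n \<Longrightarrow> kmul n (kdiag d) A i k = d i * A i k"
  unfolding kmul_def kdiag_def by (simp add: if_distrib[of "\<lambda>y. y * _"] cong: if_cong)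

lemma kmul_kdiag_right: "k < n \<Longrightarrow> kmul n A (kdiag d) i k = A i k * d k"
  unfolding kmul_def kdiag_def by (simp add: if_distrib[of "\<lambda>y. _ * y"] cong: if_cong)

lemma kbounded_kdiag:
  assumes "\<And>i. i < n \<Longrightarrow> cmod (d i) \<le> C" "0 \<le> C"
  shows "kbounded n C (kdiag d)"
  unfolding kbounded_def
proof (intro conjI allI assms)
  fix x
  have "(knorm n (kapp n (kdiag d) x))\<^sup>2 = (\<Sum>i<n. (cmod (d i))\<^sup>2 * (cmod (x i))\<^sup>2)"
    unfolding knorm_sq by (simp add: kapp_kdiag norm_mult power_mult_distrib)
  also have "\<dots> \<le> (\<Sum>i<n. C\<^sup>2 * (cmod (x i))\<^sup>2)"
    by (intro sum_mono mult_right_mono power_mono assms) auto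
  also have "\<dots> = (C * knorm n x)\<^sup>2"
    by (simp add: power_mult_distrib knorm_sq sum_distrib_left)
  finally show "knorm n (kapp n (kdiag d) x) \<le> C * knorm n x"
    by (rule power2_le_imp_le) (simp add: assms)
qed

lemma kbounded_isometry:
  assumes "\<And>i k. i < n \<Longrightarrow> k < n \<Longrightarrow> kmul n (kadj U) U i k = (if i = k then 1 else 0)"
  shows "kbounded n 1 U"
  unfolding kbounded_def
proof (intro conjI allI)
  fix x
  have "of_real ((knorm n (kapp n U x))\<^sup>2) = kip n (kapp n (kadj U) (kapp n U x)) x"
    unfolding kip_self[symmetric] kip_kapp_adj ..
  also have "\<dots> = kip n (kapp n (kdiag (\<lambda>_. 1)) x) x"
    unfolding kapp_kmul[symmetric]
    by (intro kip_cong kapp_cong) (auto simp: assms kdiag_def)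
  also have "\<dots> = kip n x x" by (intro kip_cong) (auto simp: kapp_kdiag)
  finally have "(knorm n (kapp n U x))\<^sup>2 = (knorm n x)\<^sup>2"
    unfolding kip_self of_real_eq_iff .
  thus "knorm n (kapp n U x) \<le> 1 * knorm n x" by (simp add: power2_eq_iff_nonneg)
qed simp

lemma kadj_kadj [simp]: "kadj (kadj U) = U"
  by (simp add: kadj_def)

lemma kunitary_kbounded: "kunitary n U \<Longrightarrow> kbounded n 1 U"
  and kunitary_kbounded_adj: "kunitary n U \<Longrightarrow> kbounded n 1 (kadj U)"
  by (intro kbounded_isometry; simp add: kunitary_def)+

section \<open>Gram kernels and resolvents in the upper half plane\<close>

lemma kherm_kgram: "kherm n (kgram w r J)"
  unfolding kherm_def kgram_def by (simp add: mult_ac)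

lemma kapp_kgram: "kapp n (kgram w r J) x i = (\<Sum>j<J. of_real (w j) * kip n (r j) x * r j i)"
proof -
  have "kapp n (kgram w r J) x i = (\<Sum>k<n. \<Sum>j<J. of_real (w j) * r j i * cnj (r j k) * x k)"
    unfolding kapp_def kgram_def by (simp add: sum_distrib_right)
  also have "\<dots> = (\<Sum>j<J. \<Sum>k<n. of_real (w j) * r j i * cnj (r j k) * x k)" by (rule sum.swap)
  also have "\<dots> = (\<Sum>j<J. of_real (w j) * kip n (r j) x * r j i)"
    unfolding kip_def sum_distrib_left sum_distrib_right
    by (intro sum.cong refl) (simp add: mult_ac)
  finally show ?thesis .
qed

lemma kip_sum_right: "kip n y (\<lambda>i. \<Sum>j\<in>A. f j i) = (\<Sum>j\<in>A. kip n y (f j))"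
  unfolding kip_def sum_distrib_left by (rule sum.swap)

lemma kip_kgram: "kip n x (kapp n (kgram w r J) x) = of_real (\<Sum>j<J. w j * (cmod (kip n x (r j)))\<^sup>2)"
proof -
  have "kip n x (kapp n (kgram w r J) x) = (\<Sum>j<J. of_real (w j) * kip n (r j) x * kip n x (r j))"
    unfolding kapp_kgram[abs_def] kip_sum_right kip_smult_right ..
  also have "\<dots> = of_real (\<Sum>j<J. w j * (cmod (kip n x (r j)))\<^sup>2)"
    unfolding of_real_sum
    by (intro sum.cong refl)
       (simp add: complex_norm_square kip_cnj[of n x "r _"] mult_ac del: of_real_power)
  finally show ?thesis .
qed

text \<open>Substituting \<open>x = (B - z) u\<close> with \<open>u = R x\<close> gives a form in
  \<open>u\<close>. The two sign statements that follow, for the form and for \<open>z\<close> times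
  the form, are imaginary parts of this identity.\<close>

lemma kip_kapp_resolvent:
  assumes "kherm n B" "is_resolvent n B z R"
  shows "kip n x (kapp n R x) = kip n (kapp n R x) (kapp n B (kapp n R x)) - cnj z * of_real ((knorm n (kapp n R x))\<^sup>2)"
proof -
  let ?u = "kapp n R x"
  have "kip n x ?u = kip n (\<lambda>i. kapp n B ?u i - z * ?u i) ?u"
    using assms(2) by (intro kip_cong) (auto simp: is_resolvent_def)
  also have "\<dots> = kip n (kapp n B ?u) ?u - cnj z * kip n ?u ?u"
    by (simp add: kip_diff_left kip_smult_left)
  also have "kip n (kapp n B ?u) ?u = kip n ?u (kapp n B ?u)"
    using kip_kherm[OF assms(1)] by simp
  finally show ?thesis unfolding kip_self .
qed

lemma Im_kip_resolvent:
  assumes "kherm n B" "is_resolvent n B z R"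
  shows "Im (kip n x (kapp n R x)) = Im z * (knorm n (kapp n R x))\<^sup>2"
  unfolding kip_kapp_resolvent[OF assms] using Im_kip_kherm[OF assms(1)] by (simp del: of_real_power)

text \<open>After multiplication by \<open>z\<close> the term with \<open>z * cnj z\<close> is real,
  and the form of \<open>B\<close> contributes \<open>Im z\<close> times a nonnegative real number.
  This is the sign from which \<open>denominator_bound\<close> draws its uniform estimate.\<close>

lemma Im_z_kip_resolvent:
  assumes "kherm n B" "is_resolvent n B z R" "\<And>u. 0 \<le> Re (kip n u (kapp n B u))" "0 < Im z"
  shows "0 \<le> Im (z * kip n x (kapp n R x))"
proof -
  let ?u = "kapp n R x"
  have "z * (a - cnj z * of_real b) = z * a - of_real ((cmod z)\<^sup>2 * b)" for a b
    by (simp add: algebra_simps complex_norm_square del: of_real_power)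
  then have "z * kip n x ?u = z * kip n ?u (kapp n B ?u) - of_real ((cmod z)\<^sup>2 * (knorm n ?u)\<^sup>2)"
    unfolding kip_kapp_resolvent[OF assms(1,2)] .
  hence "Im (z * kip n x ?u) = Im z * Re (kip n ?u (kapp n B ?u))"
    using Im_kip_kherm[OF assms(1)] by (simp del: of_real_power of_real_mult)
  thus ?thesis using assms(3)[of ?u] assms(4) by simp
qed

lemma kherm_shift_injective:
  assumes "kherm n B" "0 < Im z" "\<And>i. i < n \<Longrightarrow> kapp n B u i - z * u i = 0" "i < n"
  shows "u i = 0"
proof -
  have "0 = kip n u (\<lambda>i. kapp n B u i - z * u i)"
    unfolding kip_def by (simp add: assms(3))
  also have "\<dots> = kip n u (kapp n B u) - z * of_real ((knorm n u)\<^sup>2)"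
    by (simp add: kip_diff_right kip_smult_right kip_self)
  finally have "Im z * (knorm n u)\<^sup>2 = 0"
    using Im_kip_kherm[OF assms(1), of u]
    by (metis Im_complex_of_real Re_complex_of_real add_0 diff_0 eq_iff_diff_eq_0 minus_complex.simps(2) mult_zero_right neg_equal_0_iff_equal times_complex.simps(2) zero_complex.simps(2))
  thus ?thesis using assms(2,4) by (simp add: knorm_eq_0)
qed

lemma resolvent_unique:
  assumes "kherm n B" "0 < Im z" "is_resolvent n B z R" "\<And>i. i < n \<Longrightarrow> kapp n B u i - z * u i = x i" "i < n"
  shows "kapp n R x i = u i"
proof -
  have "(\<lambda>i. kapp n R x i - u i) i = 0"
  proof (rule kherm_shift_injective[OF assms(1,2) _ assms(5)])
    fix i assume "i < n"
    thus "kapp n B (\<lambda>i. kapp n R x i - u i) i - z * (kapp n R x i - u i) = 0"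
      unfolding kapp_diff using assms(3,4) by (simp add: is_resolvent_def algebra_simps)
  qed
  thus ?thesis by simp
qed

lemma knorm_resolvent:
  assumes "kherm n B" "0 < Im z" "is_resolvent n B z R"
  shows "kbounded n (1 / Im z) R"
  unfolding kbounded_def
proof (intro conjI allI)
  fix x
  let ?u = "kapp n R x"
  have "Im z * (knorm n ?u)\<^sup>2 \<le> cmod (kip n x ?u)"
    using Im_kip_resolvent[OF assms(1,3), of x] abs_Im_le_cmod[of "kip n x ?u"] by linarith
  also have "\<dots> \<le> knorm n x * knorm n ?u" by (rule kip_cauchy)
  finally have "(Im z * knorm n ?u) * knorm n ?u \<le> knorm n x * knorm n ?u"
    by (simp add: power2_eq_square mult.assoc)
  hence "knorm n ?u = 0 \<or> Im z * knorm n ?u \<le> knorm n x"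
    using knorm_nonneg[of n ?u] unfolding mult_le_cancel_right by linarith
  thus "knorm n ?u \<le> 1 / Im z * knorm n x"
    using assms(2) by (auto simp: field_simps)
qed (use assms in simp)

lemma kip_left_resolvent:
  assumes "kherm n B" "0 < Im z" "is_resolvent n B z R"
  shows "kip n x (kapp n R (\<lambda>i. kapp n B y i - z * y i)) = kip n x y"
  by (rule kip_cong) (auto intro: resolvent_unique[OF assms])

text \<open>The adjoint of \<open>R\<close> inverts \<open>B - cnj z\<close>. The forms of
  \<open>R\<close> and of its adjoint at \<open>x\<close> are conjugate, and their imaginary parts
  are, up to sign, \<open>Im z\<close> times the squares of the two norms.\<close>

lemma knorm_kadj_resolvent:
  assumes "kherm n B" "0 < Im z" "is_resolvent n B z R"
  shows "knorm n (kapp n (kadj R) x) = knorm n (kapp n R x)"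
proof -
  let ?u = "kapp n (kadj R) x"
  have "kip n (\<lambda>i. kapp n B ?u i - cnj z * ?u i) y = kip n x y" for y
  proof -
    have "kip n (\<lambda>i. kapp n B ?u i - cnj z * ?u i) y = kip n ?u (\<lambda>i. kapp n B y i - z * y i)"
      by (simp add: kip_diff_left kip_diff_right kip_smult_left kip_smult_right kip_kherm[OF assms(1)])
    also have "\<dots> = kip n x y"
      unfolding kip_kapp_adj[symmetric] by (rule kip_left_resolvent[OF assms])
    finally show ?thesis .
  qed
  from this[of ?u] have *: "kip n x ?u = kip n ?u (kapp n B ?u) - z * of_real ((knorm n ?u)\<^sup>2)"
    by (simp add: kip_diff_left kip_smult_left kip_self kip_kherm[OF assms(1)])
  have "Im (kip n x ?u) = - (Im z * (knorm n ?u)\<^sup>2)"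
    unfolding * using Im_kip_kherm[OF assms(1)] by (simp del: of_real_power)
  moreover have "kip n x ?u = cnj (kip n x (kapp n R x))"
    unfolding kip_cnj kip_kapp_adj by simp
  hence "Im (kip n x ?u) = - Im (kip n x (kapp n R x))" by simp
  ultimately have "Im z * (knorm n ?u)\<^sup>2 = Im z * (knorm n (kapp n R x))\<^sup>2"
    using Im_kip_resolvent[OF assms(1,3), of x] by linarith
  hence "(knorm n ?u)\<^sup>2 = (knorm n (kapp n R x))\<^sup>2" using assms(2) by auto
  thus ?thesis by (rule power2_eq_imp_eq) simp_all
qed

text \<open>The imaginary part is \<open>s * Im z\<close> times the squared norm of
  \<open>R r\<close>. If it vanishes, then \<open>s = 0\<close> or \<open>R r = 0\<close>, and the
  denominator equals 1.\<close>

lemma rank_one_denominator: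
  assumes "kherm n B" "0 < Im z" "is_resolvent n B z R"
  shows "1 + of_real s * kip n r (kapp n R r) \<noteq> 0"
proof
  assume 0: "1 + of_real s * kip n r (kapp n R r) = 0"
  hence "Im (1 + of_real s * kip n r (kapp n R r)) = 0" by simp
  hence "s * (Im z * (knorm n (kapp n R r))\<^sup>2) = 0"
    by (simp add: Im_kip_resolvent[OF assms(1,3)])
  hence "s = 0 \<or> kip n r (kapp n R r) = 0"
    using assms(2) by (auto simp: knorm_eq_0 kip_def)
  thus False using 0 by auto
qed

section \<open>Rank one perturbations and traces of resolvents\<close>

definition krank1 :: "(nat \<Rightarrow> nat \<Rightarrow> complex) \<Rightarrow> real \<Rightarrow> (nat \<Rightarrow> complex) \<Rightarrow> nat \<Rightarrow> nat \<Rightarrow> complex" where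
  "krank1 B s r = (\<lambda>i k. B i k + of_real s * r i * cnj (r k))"

lemma kapp_krank1: "kapp n (krank1 B s r) x i = kapp n B x i + of_real s * kip n r x * r i"
  unfolding kapp_def krank1_def kip_def
  by (simp add: algebra_simps sum.distrib sum_distrib_left)

lemma kherm_krank1: "kherm n B \<Longrightarrow> kherm n (krank1 B s r)"
  unfolding kherm_def krank1_def
  by (metis (no_types, lifting) complex_cnj_add complex_cnj_cnj complex_cnj_complex_of_real complex_cnj_mult mult.assoc mult.commute)

text \<open>Two vectors are kept because \<open>smk\<close> is also applied to a non-Hermitian
  factorisation of the model, see \<open>norm_trace_kspectral\<close>.\<close>

definition sherman_morrison :: "nat \<Rightarrow> (nat \<Rightarrow> nat \<Rightarrow> complex) \<Rightarrow> real \<Rightarrow> (nat \<Rightarrow> complex) \<Rightarrow> (nat \<Rightarrow> complex) \<Rightarrow>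
    nat \<Rightarrow> nat \<Rightarrow> complex" where
  "sherman_morrison n R s x y = (\<lambda>i k. R i k -
     of_real s * kapp n R x i * (\<Sum>l<n. cnj (y l) * R l k) / (1 + of_real s * kip n y (kapp n R x)))"

lemma kip_kapp_sum: "(\<Sum>k<n. (\<Sum>l<n. cnj (y l) * R l k) * x k) = kip n y (kapp n R x)"
proof -
  have "(\<Sum>k<n. (\<Sum>l<n. cnj (y l) * R l k) * x k) = (\<Sum>k<n. \<Sum>l<n. cnj (y l) * R l k * x k)"
    by (simp add: sum_distrib_right)
  also have "\<dots> = (\<Sum>l<n. \<Sum>k<n. cnj (y l) * R l k * x k)" by (rule sum.swap)
  also have "\<dots> = kip n y (kapp n R x)"
    unfolding kip_def kapp_def by (simp add: sum_distrib_left mult.assoc)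
  finally show ?thesis .
qed

lemma kapp_sherman_morrison:
  "kapp n (sherman_morrison n R s x y) u i =
     kapp n R u i - of_real s * kip n y (kapp n R u) / (1 + of_real s * kip n y (kapp n R x)) * kapp n R x i"
proof -
  let ?d = "1 + of_real s * kip n y (kapp n R x)"
  have "kapp n (sherman_morrison n R s x y) u i
     = kapp n R u i - (\<Sum>k<n. of_real s * kapp n R x i / ?d * ((\<Sum>l<n. cnj (y l) * R l k) * u k))"
    unfolding kapp_def[of n "sherman_morrison n R s x y" u] kapp_def[of n R u]
    by (simp add: sherman_morrison_def left_diff_distrib sum_subtractf mult.assoc)
  thus ?thesis unfolding sum_distrib_left[symmetric] kip_kapp_sum by simp
qed

lemma is_resolvent_krank1:
  assumes "kherm n B" "0 < Im z" "is_resolvent n B z R"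
  shows "is_resolvent n (krank1 B s r) z (sherman_morrison n R s r r)"
  unfolding is_resolvent_def
proof (intro allI impI)
  fix u i assume i: "i < n"
  define b where "b = kip n r (kapp n R r)"
  define a where "a = kip n r (kapp n R u)"
  define q where "q = of_real s * a / (1 + of_real s * b)"
  have nz: "1 + of_real s * b \<noteq> 0" unfolding b_def by (rule rank_one_denominator[OF assms])
  let ?R = "sherman_morrison n R s r r"
  have *: "kapp n ?R u = (\<lambda>i. kapp n R u i - q * kapp n R r i)"
    unfolding kapp_sherman_morrison q_def a_def b_def by (intro ext) simp
  have r: "kapp n B (kapp n R x) i - z * kapp n R x i = x i" for x
    using assms(3) i by (simp add: is_resolvent_def)
  have "kapp n (krank1 B s r) (kapp n ?R u) i - z * kapp n ?R u i
      = (kapp n B (kapp n R u) i - z * kapp n R u i) - q * (kapp n B (kapp n R r) i - z * kapp n R r i)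
        + of_real s * (a - q * b) * r i"
    unfolding kapp_krank1 * kapp_diff kapp_smult kip_diff_right kip_smult_right a_def b_def
    by (simp add: algebra_simps)
  also have "\<dots> = u i - q * r i + of_real s * (a - q * b) * r i" unfolding r ..
  also have "\<dots> = u i + (of_real s * a - q * (1 + of_real s * b)) * r i" by (simp add: algebra_simps)
  also have "\<dots> = u i" using nz by (simp add: q_def)
  finally show "kapp n (krank1 B s r) (kapp n ?R u) i - z * kapp n ?R u i = u i" .
qed

lemma is_resolvent_smk:
  assumes "0 < Im z"
  shows "is_resolvent n (kgram w r J) z (smk n z w r r J)"
proof (induction J)
  case 0
  have "z \<noteq> 0" using assms by auto
  moreover have "kapp n (kgram w r 0) y i = 0" for y i by (simp add: kapp_def kgram_def)
  ultimately show ?case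
    by (auto simp: is_resolvent_def kapp_kdiag)
next
  case (Suc J)
  have 1: "smk n z w r r (Suc J) = sherman_morrison n (smk n z w r r J) (w J) (r J) (r J)"
    by (simp add: sherman_morrison_def)
  have 2: "kgram w r (Suc J) = krank1 (kgram w r J) (w J) (r J)"
    by (simp add: kgram_def krank1_def)
  show ?case unfolding 1 2 by (rule is_resolvent_krank1[OF kherm_kgram assms Suc.IH])
qed

lemma resolvent_kernel_unique:
  assumes "kherm n B" "0 < Im z" "is_resolvent n B z R" "is_resolvent n B z R'" "i < n" "k < n"
  shows "R i k = R' i k"
proof -
  let ?e = "\<lambda>i. if i = k then 1 else (0::complex)"
  have "kapp n R ?e i = kapp n R' ?e i"
    using assms(4) by (intro resolvent_unique[OF assms(1-3) _ assms(5)]) (auto simp: is_resolvent_def)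
  thus ?thesis using assms(6) by (simp add: knorm_kapp_unit)
qed

lemma ktr_kmul_sherman_morrison:
  "ktr n (kmul n C (sherman_morrison n R s r r)) - ktr n (kmul n C R)
    = - of_real s * kip n (kapp n (kadj R) r) (kapp n C (kapp n R r)) / (1 + of_real s * kip n r (kapp n R r))"
proof -
  let ?d = "1 + of_real s * kip n r (kapp n R r)"
  let ?c = "of_real s / ?d"
  have e: "sherman_morrison n R s r r l i = R l i - ?c * (kapp n R r l * cnj (kapp n (kadj R) r i))" for l i
  proof -
    have "(\<Sum>l<n. cnj (r l) * R l i) = cnj (kapp n (kadj R) r i)"
      unfolding kapp_def kadj_def by (simp add: mult.commute)
    thus ?thesis unfolding sherman_morrison_def by simp
  qed
  have "ktr n (kmul n C (sherman_morrison n R s r r)) - ktr n (kmul n C R)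
     = - (\<Sum>i<n. \<Sum>l<n. ?c * (cnj (kapp n (kadj R) r i) * (C i l * kapp n R r l)))"
    unfolding ktr_def kmul_def e
    by (simp add: right_diff_distrib sum_subtractf mult_ac)
  also have "\<dots> = - ?c * kip n (kapp n (kadj R) r) (kapp n C (kapp n R r))"
    unfolding kip_def kapp_def[of n C] sum_distrib_left[symmetric] by simp
  finally show ?thesis by simp
qed

text \<open>By Sherman-Morrison the difference is at most \<open>\<bar>s\<bar> * K\<close> times the
  squared norm of \<open>R r\<close>, divided by the modulus of the denominator. The imaginary part
  of that denominator is \<open>s * Im z\<close> times the same squared norm, so \<open>s\<close>
  and \<open>r\<close> cancel.\<close>

lemma ktr_rank_one_bound:
  assumes "kherm n B" "0 < Im z" "is_resolvent n B z R" "is_resolvent n (krank1 B s r) z R'" "kbounded n K C"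
  shows "cmod (ktr n (kmul n C R') - ktr n (kmul n C R)) \<le> K / Im z"
proof -
  let ?S = "sherman_morrison n R s r r"
  let ?d = "1 + of_real s * kip n r (kapp n R r)"
  have "R' l i = ?S l i" if "l < n" "i < n" for l i
    by (rule resolvent_kernel_unique[OF kherm_krank1[OF assms(1)] assms(2,4) is_resolvent_krank1[OF assms(1-3)] that])
  hence "ktr n (kmul n C R') = ktr n (kmul n C ?S)"
    unfolding ktr_def kmul_def by (intro sum.cong refl) simp
  hence *: "cmod (ktr n (kmul n C R') - ktr n (kmul n C R))
     = \<bar>s\<bar> * cmod (kip n (kapp n (kadj R) r) (kapp n C (kapp n R r))) / cmod ?d"
    by (simp add: ktr_kmul_sherman_morrison norm_divide norm_mult)
  let ?u = "knorm n (kapp n R r)"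
  have "cmod (kip n (kapp n (kadj R) r) (kapp n C (kapp n R r))) \<le> ?u * (K * ?u)"
    by (rule order_trans[OF kip_cauchy])
       (simp add: knorm_kadj_resolvent[OF assms(1-3)] mult_left_mono kboundedD[OF assms(5)])
  hence "\<bar>s\<bar> * cmod (kip n (kapp n (kadj R) r) (kapp n C (kapp n R r))) \<le> \<bar>s\<bar> * (?u * (K * ?u))"
    by (intro mult_left_mono) auto
  also have "\<dots> = K / Im z * \<bar>Im ?d\<bar>"
    using assms(2) by (simp add: Im_kip_resolvent[OF assms(1,3)] abs_mult power2_eq_square)
  also have "\<dots> \<le> K / Im z * cmod ?d"
    using assms(2) kbounded_nonneg[OF assms(5)] by (intro mult_left_mono abs_Im_le_cmod) auto
  finally show ?thesis unfolding *
    using rank_one_denominator[OF assms(1-3), of s r] by (simp add: divide_le_eq)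
qed

lemma kgram_upd_zero:
  "j < J \<Longrightarrow> kgram w r J = krank1 (kgram (w(j := 0)) r J) (w j) (r j)"
proof (intro ext)
  fix i k assume j: "j < J"
  have "kgram w r J i k = of_real (w j) * r j i * cnj (r j k) + (\<Sum>l\<in>{..<J} - {j}. of_real (w l) * r l i * cnj (r l k))"
    unfolding kgram_def using j by (subst sum.remove[of _ j]) auto
  also have "(\<Sum>l\<in>{..<J} - {j}. of_real (w l) * r l i * cnj (r l k))
     = (\<Sum>l\<in>{..<J} - {j}. of_real ((w(j := 0)) l) * r l i * cnj (r l k))" by (intro sum.cong) auto
  also have "\<dots> = kgram (w(j := 0)) r J i k"
    unfolding kgram_def using j by (subst (2) sum.remove[of _ j]) auto
  finally show "kgram w r J i k = krank1 (kgram (w(j := 0)) r J) (w j) (r j) i k"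
    by (simp add: krank1_def)
qed

text \<open>A column of weight zero contributes a trivial update whatever its vectors are. Setting a
  weight to zero therefore removes a column without renumbering, and the removed column may be
  altered freely.\<close>

lemma smk_cong:
  assumes "\<And>j. j < J \<Longrightarrow> w j = w' j" "\<And>j. j < J \<Longrightarrow> w j \<noteq> 0 \<Longrightarrow> x j = x' j \<and> y j = y' j"
  shows "smk n z w x y J = smk n z w' x' y' J"
  using assms
proof (induction J)
  case (Suc J)
  have eq: "smk n z w x y J = smk n z w' x' y' J" using Suc by auto
  show ?case
  proof (cases "w J = 0")
    case True
    thus ?thesis using Suc.prems(1)[of J, symmetric] by (simp add: eq)
  next
    case False
    thus ?thesis using Suc.prems(1)[of J, symmetric] Suc.prems(2)[of J] by (simp add: eq)
  qed
qed simp

lemma ktr_kmul_smk_weight_bound: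
  assumes "0 < Im z" "kbounded n K C" "j < J"
  shows "cmod (ktr n (kmul n C (smk n z w r r J)) - ktr n (kmul n C (smk n z (w(j := b)) r r J))) \<le> K / Im z"
proof -
  let ?w' = "w(j := b)"
  have "kgram w r J = krank1 (kgram ?w' r J) (w j - b) (r j)"
    unfolding kgram_upd_zero[OF assms(3), of w] kgram_upd_zero[OF assms(3), of ?w']
    by (simp add: krank1_def fun_eq_iff algebra_simps)
  hence "is_resolvent n (krank1 (kgram ?w' r J) (w j - b) (r j)) z (smk n z w r r J)"
    using is_resolvent_smk[OF assms(1), of n w r J] by simp
  from ktr_rank_one_bound[OF kherm_kgram assms(1) is_resolvent_smk[OF assms(1)] this assms(2)]
  show ?thesis .
qed

text \<open>The old column is taken out and the new one put in: two rank one changes.\<close>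

lemma ktr_kmul_smk_column_bound:
  assumes "0 < Im z" "kbounded n K C"
  shows "cmod (ktr n (kmul n C (smk n z w r r J)) - ktr n (kmul n C (smk n z w (r(j := q)) (r(j := q)) J))) \<le> 2 * K / Im z"
proof (cases "j < J")
  case True
  let ?r = "r(j := q)" and ?w = "w(j := 0)"
  have *: "smk n z ?w r r J = smk n z ?w ?r ?r J" by (rule smk_cong) auto
  have "cmod (ktr n (kmul n C (smk n z w r r J)) - ktr n (kmul n C (smk n z ?w r r J))) \<le> K / Im z"
    and "cmod (ktr n (kmul n C (smk n z w ?r ?r J)) - ktr n (kmul n C (smk n z ?w ?r ?r J))) \<le> K / Im z"
    by (rule ktr_kmul_smk_weight_bound[OF assms True])+
  from norm_diff_triangle_le[OF this(1)] this(2) show ?thesis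
    unfolding * by (metis norm_minus_commute mult_2 add_divide_distrib)
next
  case False
  hence "smk n z w r r J = smk n z w (r(j := q)) (r(j := q)) J" by (intro smk_cong) auto
  thus ?thesis using assms kbounded_nonneg[OF assms(2)] by simp
qed

lemma ktr_kmul_id: "ktr n (kmul n (kdiag (\<lambda>_. 1)) A) = ktr n A"
  unfolding ktr_def by (intro sum.cong) (auto simp: kmul_kdiag_left)

lemma kbounded_id: "kbounded n 1 (kdiag (\<lambda>_. 1))"
  by (rule kbounded_kdiag) auto

lemma ktr_smk_weights_bound:
  assumes "0 < Im z"
  shows "cmod (ktr n (smk n z w r r J) - ktr n (smk n z w' r r J)) \<le> real (card {j. j < J \<and> w j \<noteq> w' j}) / Im z"
proof -
  have *: "finite S \<Longrightarrow> S \<subseteq> {..<J} \<Longrightarrow>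
      cmod (ktr n (smk n z w r r J) - ktr n (smk n z (\<lambda>j. if j \<in> S then w' j else w j) r r J)) \<le> real (card S) / Im z" for S
  proof (induction S rule: finite_induct)
    case (insert j S)
    let ?v = "\<lambda>S j. if j \<in> S then w' j else w j"
    have "?v (insert j S) = (?v S)(j := w' j)" by (auto simp: fun_eq_iff)
    hence "cmod (ktr n (smk n z (?v S) r r J) - ktr n (smk n z (?v (insert j S)) r r J)) \<le> 1 / Im z"
      using ktr_kmul_smk_weight_bound[OF assms kbounded_id, of j J n "?v S" r "w' j"] insert.prems
      by (simp add: ktr_kmul_id)
    moreover have "cmod (ktr n (smk n z w r r J) - ktr n (smk n z (?v S) r r J)) \<le> real (card S) / Im z"
      using insert by simp
    ultimately have "cmod (ktr n (smk n z w r r J) - ktr n (smk n z (?v (insert j S)) r r J)) \<le> real (card S) / Im z + 1 / Im z"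
      by (intro norm_diff_triangle_le)
    moreover have "real (card (insert j S)) / Im z = real (card S) / Im z + 1 / Im z"
      using insert by (simp add: add_divide_distrib)
    ultimately show ?case by (simp only:)
  qed simp
  have "smk n z w' r r J = smk n z (\<lambda>j. if j \<in> {j. j < J \<and> w j \<noteq> w' j} then w' j else w j) r r J"
    by (rule smk_cong) auto
  thus ?thesis using *[of "{j. j < J \<and> w j \<noteq> w' j}"] by auto
qed

text \<open>A Hermitian modification of a single row and column is a difference of two rank one
  matrices: \<open>u a\<^sup>* + a u\<^sup>* = ((u + a) (u + a)\<^sup>* - (u - a) (u - a)\<^sup>*) / 2\<close>.\<close>

lemma ktr_row_column_bound:
  assumes "kherm n B" "kherm n B'" "0 < Im z" "is_resolvent n B z R" "is_resolvent n B' z R'"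
    and "m < n" "\<And>i k. i < n \<Longrightarrow> k < n \<Longrightarrow> i \<noteq> m \<Longrightarrow> k \<noteq> m \<Longrightarrow> B i k = B' i k"
  shows "cmod (ktr n R - ktr n R') \<le> 2 / Im z"
proof -
  define a where "a = (\<lambda>i. if i = m then (B' m m - B m m) / 2 else B' i m - B i m)"
  define p where "p = (\<lambda>i. (if i = m then 1 else 0) + a i)"
  define q where "q = (\<lambda>i. (if i = m then 1 else 0) - a i)"
  let ?B1 = "krank1 B (1/2) p"
  let ?R1 = "sherman_morrison n R (1/2) p p"
  let ?B2 = "krank1 ?B1 (-1/2) q"
  have r1: "is_resolvent n ?B1 z ?R1" by (rule is_resolvent_krank1[OF assms(1,3,4)])
  have h1: "kherm n ?B1" by (rule kherm_krank1[OF assms(1)])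
  have am: "cnj (a m) = a m"
    by (simp add: a_def khermD[OF assms(1,6,6)] khermD[OF assms(2,6,6)])
  have eq: "?B2 i k = B' i k" if ik: "i < n" "k < n" for i k
  proof -
    have "?B2 i k = B i k + (if i = m then 1 else 0) * cnj (a k) + a i * (if k = m then 1 else 0)"
      unfolding krank1_def p_def q_def by (simp add: algebra_simps)
    moreover have "cnj (a k) = B' m k - B m k" if "k \<noteq> m"
      using that by (simp add: a_def khermD[OF assms(1,6) ik(2)] khermD[OF assms(2,6) ik(2)])
    ultimately show ?thesis using assms(7)[OF ik]
      by (cases "i = m"; cases "k = m") (simp_all add: am, simp_all add: a_def field_simps)
  qed
  have "kapp n ?B2 x i = kapp n B' x i" if "i < n" for x i
    by (rule kapp_cong) (rule eq[OF that], simp_all)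
  hence r2: "is_resolvent n ?B2 z R'" using assms(5) unfolding is_resolvent_def by simp
  have "cmod (ktr n ?R1 - ktr n R) \<le> 1 / Im z"
    using ktr_rank_one_bound[OF assms(1,3,4) r1 kbounded_id] by (simp add: ktr_kmul_id)
  moreover have "cmod (ktr n R' - ktr n ?R1) \<le> 1 / Im z"
    using ktr_rank_one_bound[OF h1 assms(3) r1 r2 kbounded_id] by (simp add: ktr_kmul_id)
  ultimately have "cmod (ktr n R' - ktr n R) \<le> 1 / Im z + 1 / Im z" using norm_diff_triangle_le by blast
  thus ?thesis by (simp add: norm_minus_commute)
qed

text \<open>Altering \<open>s\<close> at one index affects one row and one column of the Gram
  kernel, a perturbation of rank at most two; hence the factor 2 per index.\<close>

lemma ktr_smk_scale_bound:
  assumes "0 < Im z"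
  shows "cmod (ktr n (smk n z w (\<lambda>j i. of_real (s i) * y j i) (\<lambda>j i. of_real (s i) * y j i) J)
      - ktr n (smk n z w (\<lambda>j i. of_real (s' i) * y j i) (\<lambda>j i. of_real (s' i) * y j i) J))
    \<le> 2 * real (card {i. i < n \<and> s i \<noteq> s' i}) / Im z"
proof -
  let ?f = "\<lambda>s. smk n z w (\<lambda>j i. of_real (s i) * y j i) (\<lambda>j i. of_real (s i) * y j i) J"
  let ?g = "\<lambda>s. kgram w (\<lambda>j i. of_real (s i) * y j i) J"
  have *: "finite S \<Longrightarrow> S \<subseteq> {..<n} \<Longrightarrow>
      cmod (ktr n (?f s) - ktr n (?f (\<lambda>j. if j \<in> S then s' j else s j))) \<le> 2 * real (card S) / Im z" for S
  proof (induction S rule: finite_induct)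
    case (insert m S)
    let ?v = "\<lambda>S j. if j \<in> S then s' j else s j"
    have "cmod (ktr n (?f (?v S)) - ktr n (?f (?v (insert m S)))) \<le> 2 / Im z"
    proof (rule ktr_row_column_bound[OF kherm_kgram kherm_kgram assms is_resolvent_smk[OF assms] is_resolvent_smk[OF assms]])
      show "m < n" using insert.prems by auto
      show "?g (?v S) i k = ?g (?v (insert m S)) i k" if "i \<noteq> m" "k \<noteq> m" for i k
        unfolding kgram_def using that by (intro sum.cong) auto
    qed
    moreover have "cmod (ktr n (?f s) - ktr n (?f (?v S))) \<le> 2 * real (card S) / Im z"
      using insert by simp
    ultimately have "cmod (ktr n (?f s) - ktr n (?f (?v (insert m S)))) \<le> 2 * real (card S) / Im z + 2 / Im z"
      by (intro norm_diff_triangle_le)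
    moreover have "2 * real (card (insert m S)) / Im z = 2 * real (card S) / Im z + 2 / Im z"
      using insert by (simp add: add_divide_distrib)
    ultimately show ?case by (simp only:)
  qed simp
  let ?S = "{i. i < n \<and> s i \<noteq> s' i}"
  let ?s = "\<lambda>j. if j \<in> ?S then s' j else s j"
  \<comment> \<open>\<open>?s\<close> is known to agree with \<open>s'\<close> only below
    \<open>n\<close>; this identifies the Gram kernels, and hence the resolvents, on the indices
    that enter the trace.\<close>
  have "ktr n (?f ?s) = ktr n (?f s')"
    unfolding ktr_def
  proof (rule sum.cong[OF refl])
    fix i assume i: "i \<in> {..<n}"
    have eq: "?g s' a k = ?g ?s a k" if "a < n" "k < n" for a k
      unfolding kgram_def using that by (intro sum.cong) auto
    have "kapp n (?g ?s) x a = kapp n (?g s') x a" if "a < n" for x a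
      by (rule kapp_cong) (use that in \<open>auto simp: eq\<close>)
    hence "is_resolvent n (?g ?s) z (?f s')"
      using is_resolvent_smk[OF assms, of n w "\<lambda>j i. of_real (s' i) * y j i" J]
      unfolding is_resolvent_def by simp
    thus "?f ?s i i = ?f s' i i"
      using i by (intro resolvent_kernel_unique[OF kherm_kgram assms is_resolvent_smk[OF assms]]) auto
  qed
  thus ?thesis using *[of ?S] by auto
qed

text \<open>The two sums are \<open>Q M\<close> and \<open>M Q\<close>, where \<open>M\<close> is
  the sum over \<open>j\<close> of \<open>w j\<close> times \<open>x' j\<close> times the adjoint of
  \<open>y j\<close>; such products have resolvents intertwined by \<open>Q\<close> and of equal
  trace. The induction runs over the updates themselves and thus covers singular \<open>Q\<close>
  and vanishing denominators, where no inverse exists. It serves for unitary \<open>Q\<close> and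
  for \<open>Q = U diag(sqrt t)\<close>.\<close>

lemma smk_intertwine:
  assumes x: "\<And>j i. j < J \<Longrightarrow> i < n \<Longrightarrow> x j i = kapp n Q (x' j) i"
    and y: "\<And>j i. j < J \<Longrightarrow> i < n \<Longrightarrow> y' j i = kapp n (kadj Q) (y j) i"
  shows "(\<forall>u. \<forall>i<n. kapp n (smk n z w x y J) (kapp n Q u) i = kapp n Q (kapp n (smk n z w x' y' J) u) i)
    \<and> ktr n (smk n z w x y J) = ktr n (smk n z w x' y' J)"
  using assms
proof (induction J)
  case 0
  have "kapp n (kdiag (\<lambda>_. -1/z)) (kapp n Q u) i = kapp n Q (kapp n (kdiag (\<lambda>_. -1/z)) u) i" if "i < n" for u i
  proof -
    have "kapp n Q (kapp n (kdiag (\<lambda>_. -1/z)) u) i = kapp n Q (\<lambda>i. -1/z * u i) i"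
      by (rule kapp_cong) (simp_all add: kapp_kdiag)
    thus ?thesis using that by (simp only: kapp_kdiag kapp_smult)
  qed
  thus ?case by simp
next
  case (Suc J)
  let ?R = "smk n z w x y J" and ?R' = "smk n z w x' y' J"
  have IH: "(\<forall>u. \<forall>i<n. kapp n ?R (kapp n Q u) i = kapp n Q (kapp n ?R' u) i) \<and> ktr n ?R = ktr n ?R'"
    by (rule Suc.IH; use Suc.prems in simp)
  have IH1: "kapp n ?R (kapp n Q u) i = kapp n Q (kapp n ?R' u) i" if "i < n" for u i
    using IH that by blast
  have IH2: "ktr n ?R = ktr n ?R'" using IH by blast
  have Rx: "kapp n ?R (x J) i = kapp n Q (kapp n ?R' (x' J)) i" if "i < n" for i
    unfolding IH1[OF that, symmetric] by (rule kapp_cong) (use Suc.prems in auto)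
  have yQ: "kip n (y J) (kapp n Q u) = kip n (y' J) u" for u
    unfolding kip_kapp_adj by (rule kip_cong) (use Suc.prems in auto)
  have yRx: "kip n (y J) (kapp n ?R (x J)) = kip n (y' J) (kapp n ?R' (x' J))"
    unfolding yQ[symmetric] by (rule kip_cong) (auto simp: Rx)
  have yRQ: "kip n (y J) (kapp n ?R (kapp n Q u)) = kip n (y' J) (kapp n ?R' u)" for u
    unfolding yQ[symmetric] by (rule kip_cong) (auto simp: IH1)
  have yRRx: "kip n (y J) (kapp n ?R (kapp n ?R (x J))) = kip n (y' J) (kapp n ?R' (kapp n ?R' (x' J)))"
    unfolding yRQ[symmetric] by (rule kip_cong[OF refl], rule kapp_cong[OF refl], rule Rx)
  have S: "smk n z w x y (Suc J) = sherman_morrison n (smk n z w x y J) (w J) (x J) (y J)" for x y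
    by (simp add: sherman_morrison_def)
  have tr: "ktr n (smk n z w x y (Suc J)) = ktr n (smk n z w x y J)
      - of_real (w J) * kip n (y J) (kapp n (smk n z w x y J) (kapp n (smk n z w x y J) (x J)))
        / (1 + of_real (w J) * kip n (y J) (kapp n (smk n z w x y J) (x J)))" for x y
  proof -
    let ?T = "smk n z w x y J"
    let ?d = "1 + of_real (w J) * kip n (y J) (kapp n ?T (x J))"
    have "ktr n (smk n z w x y (Suc J)) = ktr n ?T
       - (\<Sum>i<n. of_real (w J) / ?d * ((\<Sum>l<n. cnj (y J l) * ?T l i) * kapp n ?T (x J) i))"
      unfolding ktr_def by (simp add: sum_subtractf mult_ac)
    thus ?thesis unfolding sum_distrib_left[symmetric] kip_kapp_sum by simp
  qed
  have "kapp n (smk n z w x y (Suc J)) (kapp n Q u) i = kapp n Q (kapp n (smk n z w x' y' (Suc J)) u) i" if i: "i < n" for u i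
  proof -
    have "kapp n Q (kapp n (smk n z w x' y' (Suc J)) u) i
        = kapp n Q (\<lambda>i. kapp n ?R' u i - of_real (w J) * kip n (y' J) (kapp n ?R' u) / (1 + of_real (w J) * kip n (y' J) (kapp n ?R' (x' J))) * kapp n ?R' (x' J) i) i"
      unfolding S by (rule arg_cong[where f = "\<lambda>v. kapp n Q v i"]) (intro ext kapp_sherman_morrison)
    thus ?thesis unfolding S kapp_sherman_morrison kapp_diff kapp_smult yRx yRQ using i by (simp add: IH1 Rx)
  qed
  thus ?case unfolding tr IH2 yRx yRRx by blast
qed

section \<open>Concentration of measure\<close>

lemma bounded_integrable:
  fixes f :: "'a \<Rightarrow> 'b::{banach, second_countable_topology}"
  assumes "prob_space M" "f \<in> borel_measurable M" "\<And>x. x \<in> space M \<Longrightarrow> norm (f x) \<le> B"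
  shows "integrable M f"
proof -
  interpret prob_space M by fact
  show ?thesis by (rule integrable_const_bound[where B = B]) (use assms in auto)
qed

lemma bounded_integral_norm_le:
  fixes f :: "'a \<Rightarrow> 'b::{banach, second_countable_topology}"
  assumes "prob_space M" "f \<in> borel_measurable M" "\<And>x. x \<in> space M \<Longrightarrow> norm (f x) \<le> B"
  shows "norm (integral\<^sup>L M f) \<le> B"
proof -
  interpret prob_space M by fact
  have "norm (integral\<^sup>L M f) \<le> (\<integral>x. norm (f x) \<partial>M)" by (rule integral_norm_bound)
  also have "\<dots> \<le> (\<integral>x. B \<partial>M)"
    by (rule integral_mono) (use bounded_integrable[OF assms] assms in auto)
  finally show ?thesis by (simp add: prob_space)
qed

text \<open>Integrating out coordinate \<open>i\<close> gives a function \<open>g\<close> which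
  inherits the bound and the bounded differences, while for fixed other coordinates
  \<open>f - g\<close> is centred with values in \<open>[-c, c]\<close>. Each coordinate thus costs
  one factor from Hoeffding's lemma.\<close>

lemma mcdiarmid_mgf:
  fixes f :: "('i \<Rightarrow> 'a) \<Rightarrow> real"
  assumes \<nu>: "prob_space \<nu>" and I: "finite I" and l: "0 < l" and c: "0 \<le> c"
    and "f \<in> borel_measurable (PiM I (\<lambda>_. \<nu>))"
    and "\<And>x. x \<in> space (PiM I (\<lambda>_. \<nu>)) \<Longrightarrow> \<bar>f x\<bar> \<le> B"
    and "\<And>x j y. x \<in> space (PiM I (\<lambda>_. \<nu>)) \<Longrightarrow> j \<in> I \<Longrightarrow> y \<in> space \<nu> \<Longrightarrow> \<bar>f x - f (x(j := y))\<bar> \<le> c"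
  shows "(\<integral>\<^sup>+x. ennreal (exp (l * (f x - integral\<^sup>L (PiM I (\<lambda>_. \<nu>)) f))) \<partial>PiM I (\<lambda>_. \<nu>))
    \<le> ennreal (exp (l\<^sup>2 * c\<^sup>2 * real (card I) / 2))"
  using I assms(5-7)
proof (induction I arbitrary: f rule: finite_induct)
  case empty
  interpret E: prob_space "PiM ({}::'i set) (\<lambda>_. \<nu>)" by (rule prob_space_PiM) (rule \<nu>)
  define q where "q = f (\<lambda>_. undefined)"
  have q: "f x = q" if "x \<in> space (PiM ({}::'i set) (\<lambda>_. \<nu>))" for x
    using that by (simp add: space_PiM q_def)
  have "integral\<^sup>L (PiM ({}::'i set) (\<lambda>_. \<nu>)) f = (\<integral>x. q \<partial>PiM ({}::'i set) (\<lambda>_. \<nu>))"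
    by (rule Bochner_Integration.integral_cong[OF refl q])
  hence Eq: "integral\<^sup>L (PiM ({}::'i set) (\<lambda>_. \<nu>)) f = q" by (simp add: E.prob_space)
  have "(\<integral>\<^sup>+x. ennreal (exp (l * (f x - integral\<^sup>L (PiM ({}::'i set) (\<lambda>_. \<nu>)) f))) \<partial>PiM ({}::'i set) (\<lambda>_. \<nu>))
     = (\<integral>\<^sup>+x. 1 \<partial>PiM ({}::'i set) (\<lambda>_. \<nu>))" unfolding Eq by (rule nn_integral_cong) (simp add: q)
  thus ?case by (simp add: E.emeasure_space_1)
next
  case (insert i I)
  interpret \<nu>: prob_space \<nu> by (rule \<nu>)
  interpret PP: product_sigma_finite "\<lambda>_::'i. \<nu>" by unfold_locales
  let ?P = "PiM I (\<lambda>_. \<nu>)" and ?P' = "PiM (insert i I) (\<lambda>_. \<nu>)"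
  interpret P: prob_space ?P by (rule prob_space_PiM) (rule \<nu>)
  interpret P': prob_space ?P' by (rule prob_space_PiM) (rule \<nu>)
  note [measurable] = insert.prems(1)
  have upd: "x(i := y) \<in> space ?P'" if "x \<in> space ?P" "y \<in> space \<nu>" for x y
    using that by (auto simp: space_PiM PiE_def extensional_def)
  have updm: "(\<lambda>y. x(i := y)) \<in> measurable \<nu> ?P'" if "x \<in> space ?P" for x
    using measurable_compose[OF measurable_Pair1'[OF that] measurable_add_dim[of i I "\<lambda>_. \<nu>"]] by simp
  define g where "g x = (\<integral>y. f (x(i := y)) \<partial>\<nu>)" for x
  have fm: "(\<lambda>y. f (x(i := y))) \<in> borel_measurable \<nu>" if "x \<in> space ?P" for x
    by (rule measurable_compose[OF updm[OF that] insert.prems(1)])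
  have fb: "\<bar>f (x(i := y))\<bar> \<le> B" if "x \<in> space ?P" "y \<in> space \<nu>" for x y
    by (rule insert.prems(2)[OF upd[OF that]])
  have fint: "integrable \<nu> (\<lambda>y. f (x(i := y)))" if "x \<in> space ?P" for x
    by (rule bounded_integrable[OF \<nu> fm[OF that], where B = B]) (simp add: fb[OF that])
  have joint: "(\<lambda>p. f ((fst p)(i := snd p))) \<in> borel_measurable (?P \<Otimes>\<^sub>M \<nu>)"
    using measurable_compose[OF measurable_add_dim[of i I "\<lambda>_. \<nu>"] insert.prems(1)]
    by (simp add: case_prod_beta)
  have gm: "g \<in> borel_measurable ?P"
    unfolding g_def using joint by (intro \<nu>.borel_measurable_lebesgue_integral) (simp add: case_prod_beta)
  have gb: "\<bar>g x\<bar> \<le> B" if "x \<in> space ?P" for x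
    unfolding g_def using bounded_integral_norm_le[OF \<nu> fm[OF that], of B] fb[OF that] by simp
  have gd: "\<bar>g x - g (x(j := y))\<bar> \<le> c" if x: "x \<in> space ?P" and j: "j \<in> I" and y: "y \<in> space \<nu>" for x j y
  proof -
    have x': "x(j := y) \<in> space ?P" using x j y by (auto simp: space_PiM PiE_def extensional_def)
    have "g x - g (x(j := y)) = (\<integral>u. f (x(i := u)) - f (x(j := y, i := u)) \<partial>\<nu>)"
      unfolding g_def by (rule Bochner_Integration.integral_diff[symmetric]) (use fint x x' in auto)
    also have "\<bar>\<dots>\<bar> \<le> c"
    proof (rule bounded_integral_norm_le[OF \<nu>, where 'b = real, simplified])
      show "(\<lambda>u. f (x(i := u)) - f (x(j := y, i := u))) \<in> borel_measurable \<nu>"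
        using fm[OF x] fm[OF x'] by simp
      fix u assume u: "u \<in> space \<nu>"
      have "x(j := y, i := u) = (x(i := u))(j := y)" using j insert.hyps by (auto simp: fun_eq_iff)
      moreover have "\<bar>f (x(i := u)) - f ((x(i := u))(j := y))\<bar> \<le> c"
        by (rule insert.prems(3)[OF upd[OF x u] _ y]) (use j in simp)
      ultimately show "\<bar>f (x(i := u)) - f (x(j := y, i := u))\<bar> \<le> c" by (simp only:)
    qed
    finally show ?thesis .
  qed
  have "integral\<^sup>L ?P' f = integral\<^sup>L ?P g"
    unfolding g_def
    by (rule PP.product_integral_insert[OF insert.hyps(1,2)])
       (rule bounded_integrable[OF _ insert.prems(1), where B = B], unfold_locales, simp add: insert.prems(2))
  note Ef = this
  define e where "e = integral\<^sup>L ?P g"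
  have inner: "(\<integral>\<^sup>+y. ennreal (exp (l * (f (x(i := y)) - e))) \<partial>\<nu>)
      \<le> ennreal (exp (l * (g x - e))) * ennreal (exp (l\<^sup>2 * c\<^sup>2 / 2))" if x: "x \<in> space ?P" for x
  proof -
    let ?h = "\<lambda>y. f (x(i := y)) - g x"
    \<comment> \<open>The interval has length \<open>2 * c\<close>, so the exponent is
      \<open>l\<^sup>2 * (2 * c)\<^sup>2 / 8 = l\<^sup>2 * c\<^sup>2 / 2\<close>.\<close>
    interpret H: interval_bounded_random_variable \<nu> ?h "-c" c
    proof
      show "?h \<in> borel_measurable \<nu>" using fm[OF x] by simp
      show "AE y in \<nu>. ?h y \<in> {-c..c}"
      proof (rule AE_I2)
        fix y assume y: "y \<in> space \<nu>"
        have "?h y = (\<integral>u. f (x(i := y)) - f (x(i := u)) \<partial>\<nu>)"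
          unfolding g_def using fint[OF x] by (subst Bochner_Integration.integral_diff) (auto simp: \<nu>.prob_space)
        also have "\<bar>\<dots>\<bar> \<le> c"
        proof (rule bounded_integral_norm_le[OF \<nu>, where 'b = real, simplified])
          show "(\<lambda>u. f (x(i := y)) - f (x(i := u))) \<in> borel_measurable \<nu>" using fm[OF x] by simp
          fix u assume u: "u \<in> space \<nu>"
          have "\<bar>f (x(i := y)) - f ((x(i := y))(i := u))\<bar> \<le> c"
            by (rule insert.prems(3)[OF upd[OF x y] _ u]) simp
          thus "\<bar>f (x(i := y)) - f (x(i := u))\<bar> \<le> c" by (simp only: fun_upd_upd)
        qed
        finally show "?h y \<in> {-c..c}" by auto
      qed
    qed
    have "(\<integral>y. ?h y \<partial>\<nu>) = 0"
      using fint[OF x] by (simp add: g_def \<nu>.prob_space)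
    from H.Hoeffdings_lemma_nn_integral_0[OF l this]
    have *: "(\<integral>\<^sup>+y. ennreal (exp (l * ?h y)) \<partial>\<nu>) \<le> ennreal (exp (l\<^sup>2 * c\<^sup>2 / 2))"
      by (simp add: power2_eq_square algebra_simps)
    have "(\<integral>\<^sup>+y. ennreal (exp (l * (f (x(i := y)) - e))) \<partial>\<nu>)
       = (\<integral>\<^sup>+y. ennreal (exp (l * (g x - e))) * ennreal (exp (l * ?h y)) \<partial>\<nu>)"
      by (intro nn_integral_cong) (simp add: exp_add[symmetric] ennreal_mult[symmetric] algebra_simps)
    also have "\<dots> = ennreal (exp (l * (g x - e))) * (\<integral>\<^sup>+y. ennreal (exp (l * ?h y)) \<partial>\<nu>)"
      by (rule nn_integral_cmult) (use fm[OF x] in simp)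
    finally show ?thesis using mult_left_mono[OF *] by simp
  qed
  have "(\<integral>\<^sup>+x. ennreal (exp (l * (f x - e))) \<partial>?P') = (\<integral>\<^sup>+x. (\<integral>\<^sup>+y. ennreal (exp (l * (f (x(i := y)) - e))) \<partial>\<nu>) \<partial>?P)"
    by (rule PP.product_nn_integral_insert[OF insert.hyps(1,2)]) simp
  also have "\<dots> \<le> (\<integral>\<^sup>+x. ennreal (exp (l * (g x - e))) * ennreal (exp (l\<^sup>2 * c\<^sup>2 / 2)) \<partial>?P)"
    by (rule nn_integral_mono) (rule inner)
  also have "\<dots> = (\<integral>\<^sup>+x. ennreal (exp (l * (g x - e))) \<partial>?P) * ennreal (exp (l\<^sup>2 * c\<^sup>2 / 2))"
    by (rule nn_integral_multc) (use gm in simp)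
  also have "\<dots> \<le> ennreal (exp (l\<^sup>2 * c\<^sup>2 * real (card I) / 2)) * ennreal (exp (l\<^sup>2 * c\<^sup>2 / 2))"
    unfolding e_def by (intro mult_right_mono insert.IH gm gb gd) auto
  also have "\<dots> = ennreal (exp (l\<^sup>2 * c\<^sup>2 * real (card (insert i I)) / 2))"
    using insert.hyps by (simp add: ennreal_mult[symmetric] exp_add[symmetric] field_simps)
  finally show ?case unfolding Ef e_def .
qed

lemma mcdiarmid_tail:
  fixes f :: "('i \<Rightarrow> 'a) \<Rightarrow> real"
  assumes \<nu>: "prob_space \<nu>" and I: "finite I" "I \<noteq> {}" and c: "0 < c" and e: "0 < e"
    and m: "f \<in> borel_measurable (PiM I (\<lambda>_. \<nu>))"
    and b: "\<And>x. x \<in> space (PiM I (\<lambda>_. \<nu>)) \<Longrightarrow> \<bar>f x\<bar> \<le> B"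
    and d: "\<And>x j y. x \<in> space (PiM I (\<lambda>_. \<nu>)) \<Longrightarrow> j \<in> I \<Longrightarrow> y \<in> space \<nu> \<Longrightarrow> \<bar>f x - f (x(j := y))\<bar> \<le> c"
  shows "emeasure (PiM I (\<lambda>_. \<nu>)) {x \<in> space (PiM I (\<lambda>_. \<nu>)). e \<le> f x - integral\<^sup>L (PiM I (\<lambda>_. \<nu>)) f}
    \<le> ennreal (exp (- e\<^sup>2 / (2 * c\<^sup>2 * real (card I))))"
proof -
  let ?P = "PiM I (\<lambda>_. \<nu>)" and ?m = "real (card I)"
  let ?E = "integral\<^sup>L ?P f"
  have m0: "0 < ?m" using I by (simp add: card_gt_0_iff)
  \<comment> \<open>Minimises the exponent
    \<open>- l * e + l\<^sup>2 * c\<^sup>2 * ?m / 2\<close>.\<close>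
  define l where "l = e / (c\<^sup>2 * ?m)"
  have l: "0 < l" using e c m0 by (simp add: l_def)
  note [measurable] = m
  have "emeasure ?P {x \<in> space ?P. e \<le> f x - ?E} \<le> (\<integral>\<^sup>+x. ennreal (exp (- l * e)) * ennreal (exp (l * (f x - ?E))) \<partial>?P)"
  proof -
    have "emeasure ?P {x \<in> space ?P. e \<le> f x - ?E} = (\<integral>\<^sup>+x. indicator {x \<in> space ?P. e \<le> f x - ?E} x \<partial>?P)"
      by (rule nn_integral_indicator[symmetric]) simp
    also have "\<dots> \<le> (\<integral>\<^sup>+x. ennreal (exp (- l * e)) * ennreal (exp (l * (f x - ?E))) \<partial>?P)"
    proof (rule nn_integral_mono)
      fix x
      have "1 \<le> exp (- l * e) * exp (l * (f x - ?E))" if "e \<le> f x - ?E"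
        using that l by (simp add: exp_add[symmetric])
      thus "indicator {x \<in> space ?P. e \<le> f x - ?E} x \<le> ennreal (exp (- l * e)) * ennreal (exp (l * (f x - ?E)))"
        by (auto simp: indicator_def ennreal_mult[symmetric] ennreal_1[symmetric] simp del: ennreal_1 intro!: ennreal_leI)
    qed
    finally show ?thesis .
  qed
  also have "\<dots> = ennreal (exp (- l * e)) * (\<integral>\<^sup>+x. ennreal (exp (l * (f x - ?E))) \<partial>?P)"
    by (rule nn_integral_cmult) simp
  also have "\<dots> \<le> ennreal (exp (- l * e)) * ennreal (exp (l\<^sup>2 * c\<^sup>2 * ?m / 2))"
    by (intro mult_left_mono mcdiarmid_mgf[OF \<nu> I(1) l less_imp_le[OF c] m b d]) auto
  also have "\<dots> = ennreal (exp (- e\<^sup>2 / (2 * c\<^sup>2 * ?m)))"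
    using c m0 by (simp add: ennreal_mult[symmetric] exp_add[symmetric] l_def power2_eq_square field_simps)
  finally show ?thesis .
qed

text \<open>The absolute moment is bounded through
  \<open>\<bar>t\<bar> \<le> s * (exp (t / s) + exp (- t / s))\<close>. For \<open>s\<close> equal
  to \<open>c\<close> times the root of the number of coordinates, both exponential moments are at
  most \<open>exp (1/2)\<close>, and \<open>2 * exp (1/2) \<le> 4\<close>.\<close>

lemma mcdiarmid_L1:
  fixes f :: "('i \<Rightarrow> 'a) \<Rightarrow> real"
  assumes \<nu>: "prob_space \<nu>" and I: "finite I" "I \<noteq> {}" and c: "0 < c"
    and m: "f \<in> borel_measurable (PiM I (\<lambda>_. \<nu>))"
    and b: "\<And>x. x \<in> space (PiM I (\<lambda>_. \<nu>)) \<Longrightarrow> \<bar>f x\<bar> \<le> B"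
    and d: "\<And>x j y. x \<in> space (PiM I (\<lambda>_. \<nu>)) \<Longrightarrow> j \<in> I \<Longrightarrow> y \<in> space \<nu> \<Longrightarrow> \<bar>f x - f (x(j := y))\<bar> \<le> c"
  shows "(\<integral>x. \<bar>f x - integral\<^sup>L (PiM I (\<lambda>_. \<nu>)) f\<bar> \<partial>PiM I (\<lambda>_. \<nu>)) \<le> 4 * c * sqrt (real (card I))"
proof -
  let ?P = "PiM I (\<lambda>_. \<nu>)"
  define s where "s = c * sqrt (real (card I))"
  interpret P: prob_space ?P by (rule prob_space_PiM) (rule \<nu>)
  let ?E = "integral\<^sup>L ?P f"
  have s: "0 < s" using I c by (simp add: s_def card_gt_0_iff)
  note [measurable] = m
  define l where "l = 1 / s"
  have l: "0 < l" using s by (simp add: l_def)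
  have "l\<^sup>2 * c\<^sup>2 * real (card I) = (l * s)\<^sup>2" by (simp add: s_def power_mult_distrib)
  also have "\<dots> = 1" using s by (simp add: l_def)
  finally have ls: "l\<^sup>2 * c\<^sup>2 * real (card I) = 1" .
  have 1: "(\<integral>\<^sup>+x. ennreal (exp (l * (f x - ?E))) \<partial>?P) \<le> ennreal (exp (1/2))"
    using mcdiarmid_mgf[OF \<nu> I(1) l less_imp_le[OF c] m b d] unfolding ls by simp
  have 2: "(\<integral>\<^sup>+x. ennreal (exp (l * (- f x - integral\<^sup>L ?P (\<lambda>x. - f x)))) \<partial>?P) \<le> ennreal (exp (1/2))"
    using mcdiarmid_mgf[OF \<nu> I(1) l less_imp_le[OF c], of "\<lambda>x. - f x" B] m b d unfolding ls
    by (simp add: abs_minus_commute)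
  have int: "integrable ?P (\<lambda>x. \<bar>f x - ?E\<bar>)"
    using bounded_integrable[OF P.prob_space_axioms m, of B] b by auto
  have "ennreal (\<integral>x. \<bar>f x - ?E\<bar> \<partial>?P) = (\<integral>\<^sup>+x. ennreal \<bar>f x - ?E\<bar> \<partial>?P)"
    by (rule nn_integral_eq_integral[symmetric]) (use int in auto)
  also have "\<dots> \<le> (\<integral>\<^sup>+x. ennreal s * (ennreal (exp (l * (f x - ?E))) + ennreal (exp (l * (- f x - integral\<^sup>L ?P (\<lambda>x. - f x))))) \<partial>?P)"
  proof (rule nn_integral_mono)
    fix x
    let ?t = "f x - ?E"
    have "l * \<bar>?t\<bar> \<le> exp (l * \<bar>?t\<bar>)" using exp_ge_add_one_self[of "l * \<bar>?t\<bar>"] by linarith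
    also have "\<dots> \<le> exp (l * ?t) + exp (l * (- ?t))" by (cases "?t \<ge> 0") auto
    finally have "s * (l * \<bar>?t\<bar>) \<le> s * (exp (l * ?t) + exp (l * (- ?t)))" using s by (intro mult_left_mono) auto
    hence "\<bar>?t\<bar> \<le> s * (exp (l * ?t) + exp (l * (- ?t)))" using s by (simp add: l_def)
    moreover have "- f x - integral\<^sup>L ?P (\<lambda>x. - f x) = - ?t" by simp
    ultimately show "ennreal \<bar>?t\<bar> \<le> ennreal s * (ennreal (exp (l * ?t)) + ennreal (exp (l * (- f x - integral\<^sup>L ?P (\<lambda>x. - f x)))))"
      using s by (simp add: ennreal_plus[symmetric] ennreal_mult[symmetric] ennreal_leI del: ennreal_plus)
  qed
  also have "\<dots> = ennreal s * ((\<integral>\<^sup>+x. ennreal (exp (l * (f x - ?E))) \<partial>?P)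
        + (\<integral>\<^sup>+x. ennreal (exp (l * (- f x - integral\<^sup>L ?P (\<lambda>x. - f x)))) \<partial>?P))"
    by (subst nn_integral_cmult, simp, subst nn_integral_add) auto
  also have "\<dots> \<le> ennreal s * (ennreal (exp (1/2)) + ennreal (exp (1/2)))"
    by (intro mult_left_mono add_mono 1 2) auto
  also have "\<dots> = ennreal (s * (2 * exp (1/2)))"
    using s by (simp add: ennreal_plus[symmetric] ennreal_mult[symmetric] del: ennreal_plus)
  finally have "(\<integral>x. \<bar>f x - ?E\<bar> \<partial>?P) \<le> s * (2 * exp (1/2))" using s by simp
  also have "exp (1/2::real) \<le> 2"
    using exp_bound_half[of "1/2::real"] by simp
  hence "s * (2 * exp (1/2)) \<le> s * 4" using s by (intro mult_left_mono) auto
  finally show ?thesis by (simp add: s_def)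
qed

section \<open>Second moments of linear and quadratic forms in independent entries\<close>

lemma integral_PiM_component:
  fixes g :: "'a \<Rightarrow> 'b::{banach, second_countable_topology}"
  assumes "prob_space \<nu>" "i \<in> I" "g \<in> borel_measurable \<nu>"
  shows "(\<integral>x. g (x i) \<partial>PiM I (\<lambda>_. \<nu>)) = (\<integral>y. g y \<partial>\<nu>)"
    and "integrable (PiM I (\<lambda>_. \<nu>)) (\<lambda>x. g (x i)) \<longleftrightarrow> integrable \<nu> g"
proof -
  have d: "distr (PiM I (\<lambda>_. \<nu>)) \<nu> (\<lambda>x. x i) = \<nu>"
    using distr_PiM_component[of I "\<lambda>_. \<nu>" i] assms by simp
  have m: "(\<lambda>x. x i) \<in> measurable (PiM I (\<lambda>_. \<nu>)) \<nu>" by (rule measurable_component_singleton[OF assms(2)])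
  show "(\<integral>x. g (x i) \<partial>PiM I (\<lambda>_. \<nu>)) = (\<integral>y. g y \<partial>\<nu>)"
    using integral_distr[OF m assms(3)] unfolding d by simp
  show "integrable (PiM I (\<lambda>_. \<nu>)) (\<lambda>x. g (x i)) \<longleftrightarrow> integrable \<nu> g"
    using integrable_distr_eq[OF m assms(3)] unfolding d by simp
qed

text \<open>A centred increment is orthogonal to the constant \<open>q\<close>. With
  \<open>q\<close> a function of the earlier coordinates this is the orthogonality of martingale
  differences behind both moment bounds of the next locale.\<close>

lemma integral_norm_sq_add_centered:
  fixes X :: "'a \<Rightarrow> complex"
  assumes "prob_space M" "X \<in> borel_measurable M" "\<And>x. x \<in> space M \<Longrightarrow> cmod (X x) \<le> B" "(\<integral>x. X x \<partial>M) = 0"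
  shows "(\<integral>x. (cmod (q + X x))\<^sup>2 \<partial>M) = (cmod q)\<^sup>2 + (\<integral>x. (cmod (X x))\<^sup>2 \<partial>M)"
proof -
  interpret prob_space M by fact
  have iX: "integrable M X" by (rule bounded_integrable[OF assms(1-3)])
  have iX2: "integrable M (\<lambda>x. (cmod (X x))\<^sup>2)"
    by (rule bounded_integrable[OF assms(1), where B = "B\<^sup>2"]) (use assms(2,3) in \<open>auto intro!: power_mono\<close>)
  have "(cmod (q + X x))\<^sup>2 = (cmod q)\<^sup>2 + 2 * Re (cnj q * X x) + (cmod (X x))\<^sup>2" for x
    unfolding cmod_power2 by (simp add: power2_eq_square algebra_simps)
  hence "(\<integral>x. (cmod (q + X x))\<^sup>2 \<partial>M) = (\<integral>x. (cmod q)\<^sup>2 + 2 * Re (cnj q * X x) + (cmod (X x))\<^sup>2 \<partial>M)" by simp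
  also have "\<dots> = (cmod q)\<^sup>2 + 2 * (\<integral>x. Re (cnj q * X x) \<partial>M) + (\<integral>x. (cmod (X x))\<^sup>2 \<partial>M)"
    using iX iX2 by (simp add: prob_space)
  also have "(\<integral>x. Re (cnj q * X x) \<partial>M) = Re (cnj q * (\<integral>x. X x \<partial>M))"
    using iX by simp
  finally show ?thesis using assms(4) by simp
qed

text \<open>\<open>h y\<close> stands for the entry \<open>y\<close> after cutting and recentring.
  Its second moment \<open>s2\<close> need not be 1, which is why \<open>quad\<close> subtracts
  \<open>s2\<close> times the trace.\<close>

locale centered_bounded =
  fixes \<mu> :: "complex measure" and h :: "complex \<Rightarrow> complex" and L :: real
  assumes \<mu>: "prob_space \<mu>" and h_meas: "h \<in> borel_measurable \<mu>"
    and h_bound: "\<And>y. cmod (h y) \<le> L" and h_mean: "(\<integral>y. h y \<partial>\<mu>) = 0"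
begin

interpretation \<mu>: prob_space \<mu> by (rule \<mu>)

interpretation PP: product_sigma_finite "\<lambda>_::nat. \<mu>" by unfold_locales

abbreviation "PM n \<equiv> PiM {..<n::nat} (\<lambda>_. \<mu>)"

lemma prob_PM: "prob_space (PM n)"
  by (rule prob_space_PiM) (rule \<mu>)

lemma L_nonneg: "0 \<le> L"
  using order_trans[OF norm_ge_zero h_bound] .

lemma h_component [measurable]: "i < n \<Longrightarrow> (\<lambda>x. h (x i)) \<in> borel_measurable (PM n)"
  using measurable_compose[OF measurable_component_singleton[of i "{..<n}" "\<lambda>_. \<mu>"] h_meas] by simp

lemma h_int: "integrable \<mu> h"
  by (rule bounded_integrable[OF \<mu> h_meas]) (rule h_bound)

lemma h2_int: "integrable \<mu> (\<lambda>y. (cmod (h y))\<^sup>2)"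
  by (rule bounded_integrable[OF \<mu>, where B = "L\<^sup>2"]) (use h_meas h_bound in \<open>auto intro!: power_mono\<close>)

lemma linear_second_moment:
  "(\<integral>x. (cmod (\<Sum>k<n. a k * h (x k)))\<^sup>2 \<partial>PM n) \<le> L\<^sup>2 * (\<Sum>k<n. (cmod (a k))\<^sup>2)"
proof (induction n)
  case (Suc n)
  let ?Q = "\<lambda>x. \<Sum>k<n. a k * h (x k)"
  have b: "cmod (\<Sum>k<m. a k * h (x k)) \<le> (\<Sum>k<m. cmod (a k) * L)" for m x
    by (rule sum_norm_le) (simp add: norm_mult h_bound mult_left_mono)
  have m: "(\<lambda>x. \<Sum>k<m. a k * h (x k)) \<in> borel_measurable (PM m)" for m
    by (intro borel_measurable_sum borel_measurable_times borel_measurable_const h_component) auto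
  have i: "integrable (PM m) (\<lambda>x. (cmod (\<Sum>k<m. a k * h (x k)))\<^sup>2)" for m
    by (rule bounded_integrable[OF prob_PM, where B = "(\<Sum>k<m. cmod (a k) * L)\<^sup>2"])
       (use m in \<open>auto intro!: power_mono b\<close>)
  have "(\<integral>x. (cmod (\<Sum>k<Suc n. a k * h (x k)))\<^sup>2 \<partial>PM (Suc n))
     = (\<integral>x. \<integral>y. (cmod (\<Sum>k<Suc n. a k * h ((x(n := y)) k)))\<^sup>2 \<partial>\<mu> \<partial>PM n)"
    unfolding lessThan_Suc by (rule PP.product_integral_insert) (use i[of "Suc n"] in \<open>auto simp: lessThan_Suc\<close>)
  also have "\<dots> = (\<integral>x. \<integral>y. (cmod (?Q x + a n * h y))\<^sup>2 \<partial>\<mu> \<partial>PM n)"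
    by simp
  also have "\<dots> = (\<integral>x. (cmod (?Q x))\<^sup>2 + (\<integral>y. (cmod (a n * h y))\<^sup>2 \<partial>\<mu>) \<partial>PM n)"
    by (subst integral_norm_sq_add_centered[OF \<mu>, where B = "cmod (a n) * L"])
       (use h_meas h_mean in \<open>auto simp: norm_mult h_bound mult_left_mono\<close>)
  also have "\<dots> = (\<integral>x. (cmod (?Q x))\<^sup>2 \<partial>PM n) + (\<integral>y. (cmod (a n * h y))\<^sup>2 \<partial>\<mu>)"
    using i[of n] prob_space.prob_space[OF prob_PM[of n]] finite_measure.integrable_const[OF prob_space.finite_measure[OF prob_PM[of n]]]
    by (subst Bochner_Integration.integral_add) auto
  also have "(\<integral>y. (cmod (a n * h y))\<^sup>2 \<partial>\<mu>) \<le> L\<^sup>2 * (cmod (a n))\<^sup>2"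
  proof -
    have "norm (\<integral>y. (cmod (a n * h y))\<^sup>2 \<partial>\<mu>) \<le> L\<^sup>2 * (cmod (a n))\<^sup>2"
      by (rule bounded_integral_norm_le[OF \<mu>])
         (use h_meas in \<open>auto simp: norm_mult power_mult_distrib mult.commute[of "L\<^sup>2"] intro!: mult_left_mono power_mono h_bound\<close>)
    thus ?thesis by simp
  qed
  finally show ?case using Suc.IH by (simp add: algebra_simps)
qed simp

definition "s2 = (\<integral>y. (cmod (h y))\<^sup>2 \<partial>\<mu>)"

lemma s2_bounds: "0 \<le> s2" "s2 \<le> L\<^sup>2"
proof -
  show "0 \<le> s2" unfolding s2_def by simp
  have "norm (\<integral>y. (cmod (h y))\<^sup>2 \<partial>\<mu>) \<le> L\<^sup>2"
    by (rule bounded_integral_norm_le[OF \<mu>]) (use h_meas in \<open>auto intro!: power_mono h_bound\<close>)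
  thus "s2 \<le> L\<^sup>2" unfolding s2_def by simp
qed

definition quad :: "(nat \<Rightarrow> nat \<Rightarrow> complex) \<Rightarrow> nat \<Rightarrow> (nat \<Rightarrow> complex) \<Rightarrow> complex" where
  "quad A n x = (\<Sum>i<n. \<Sum>k<n. cnj (h (x i)) * A i k * h (x k)) - of_real s2 * (\<Sum>i<n. A i i)"

lemma quad_meas: "quad A n \<in> borel_measurable (PM n)"
  unfolding quad_def
  by (intro borel_measurable_diff borel_measurable_sum borel_measurable_times borel_measurable_const
      h_component borel_measurable_continuous_on[of cnj] continuous_intros) auto

lemma quad_bound: "cmod (quad A n x) \<le> (\<Sum>i<n. \<Sum>k<n. L * cmod (A i k) * L) + s2 * (\<Sum>i<n. cmod (A i i))"
proof -
  have "cmod (\<Sum>i<n. \<Sum>k<n. cnj (h (x i)) * A i k * h (x k)) \<le> (\<Sum>i<n. \<Sum>k<n. L * cmod (A i k) * L)"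
    by (intro sum_norm_le) (auto simp: norm_mult intro!: mult_mono mult_nonneg_nonneg h_bound L_nonneg)
  moreover have "cmod (of_real s2 * (\<Sum>i<n. A i i)) \<le> s2 * (\<Sum>i<n. cmod (A i i))"
    using s2_bounds by (auto simp: norm_mult intro!: mult_left_mono norm_sum)
  ultimately show ?thesis unfolding quad_def by (intro order_trans[OF norm_triangle_ineq4]) simp
qed

lemma quad_sq_int: "integrable (PM n) (\<lambda>x. (cmod (quad A n x))\<^sup>2)"
  by (rule bounded_integrable[OF prob_PM]) (use quad_meas in \<open>auto intro!: power_mono quad_bound\<close>)

text \<open>Coordinate \<open>n\<close> adds the increment \<open>inc\<close>, which is centred
  given the earlier coordinates and has three parts: row \<open>n\<close>, column \<open>n\<close>
  and the diagonal entry. Squaring three summands gives the factor 3, and the three parts are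
  exactly what the Hilbert-Schmidt sum gains from \<open>n\<close> to \<open>Suc n\<close>.\<close>

lemma quadratic_second_moment:
  "(\<integral>x. (cmod (quad A n x))\<^sup>2 \<partial>PM n) \<le> 3 * L^4 * (\<Sum>i<n. \<Sum>k<n. (cmod (A i k))\<^sup>2)"
proof (induction n)
  case (Suc n)
  define \<alpha> where "\<alpha> x = (\<Sum>k<n. A n k * h (x k))" for x
  define \<beta> where "\<beta> x = (\<Sum>i<n. cnj (A i n) * h (x i))" for x
  define inc where "inc x y = cnj (h y) * \<alpha> x + h y * cnj (\<beta> x) + A n n * of_real ((cmod (h y))\<^sup>2 - s2)" for x y
  have split: "quad A (Suc n) (x(n := y)) = quad A n x + inc x y" for x y
  proof -
    have "(\<Sum>i<Suc n. \<Sum>k<Suc n. cnj (h ((x(n := y)) i)) * A i k * h ((x(n := y)) k))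
       = (\<Sum>i<n. \<Sum>k<n. cnj (h (x i)) * A i k * h (x k)) + (\<Sum>i<n. cnj (h (x i)) * A i n) * h y
         + cnj (h y) * (\<Sum>k<n. A n k * h (x k)) + A n n * of_real ((cmod (h y))\<^sup>2)"
      by (simp add: sum.distrib sum_distrib_left sum_distrib_right mult.assoc complex_norm_square del: of_real_power)
    moreover have "(\<Sum>i<n. cnj (h (x i)) * A i n) = cnj (\<beta> x)"
      unfolding \<beta>_def by (simp add: mult.commute)
    ultimately show ?thesis
      unfolding quad_def inc_def \<alpha>_def by (simp add: algebra_simps del: of_real_power)
  qed
  have \<alpha>b: "cmod (\<alpha> x) \<le> (\<Sum>k<n. cmod (A n k) * L)" for x
    unfolding \<alpha>_def by (rule sum_norm_le) (simp add: norm_mult h_bound mult_left_mono)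
  have \<beta>b: "cmod (\<beta> x) \<le> (\<Sum>k<n. cmod (A k n) * L)" for x
    unfolding \<beta>_def by (rule sum_norm_le) (simp add: norm_mult h_bound mult_left_mono)
  have hb: "\<bar>(cmod (h y))\<^sup>2 - s2\<bar> \<le> L\<^sup>2" for y
  proof -
    have "(cmod (h y))\<^sup>2 \<le> L\<^sup>2" by (intro power_mono h_bound) simp
    moreover have "0 \<le> (cmod (h y))\<^sup>2" by simp
    ultimately show ?thesis using s2_bounds by linarith
  qed
  have mh: "inc x \<in> borel_measurable \<mu>" for x
    unfolding inc_def using h_meas
    by (intro borel_measurable_add borel_measurable_times borel_measurable_const
       borel_measurable_continuous_on[of cnj] continuous_intros) auto
  have incb: "cmod (inc x y) \<le> L * cmod (\<alpha> x) + L * cmod (\<beta> x) + cmod (A n n) * L\<^sup>2" for x y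
    unfolding inc_def
    by (intro norm_triangle_le add_mono order_trans[OF norm_triangle_ineq])
       (auto simp: norm_mult simp del: of_real_diff intro!: mult_mono h_bound hb L_nonneg)
  have inc0: "(\<integral>y. inc x y \<partial>\<mu>) = 0" for x
  proof -
    have "(\<integral>y. inc x y \<partial>\<mu>) = cnj (\<integral>y. h y \<partial>\<mu>) * \<alpha> x + (\<integral>y. h y \<partial>\<mu>) * cnj (\<beta> x)
        + A n n * of_real ((\<integral>y. (cmod (h y))\<^sup>2 \<partial>\<mu>) - s2)"
      unfolding inc_def using h_int h2_int
      by (simp add: \<mu>.prob_space integrable_cnj del: of_real_power)
    thus ?thesis by (simp add: h_mean s2_def)
  qed
  have inc2: "(\<integral>y. (cmod (inc x y))\<^sup>2 \<partial>\<mu>)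
      \<le> 3 * (L\<^sup>2 * (cmod (\<alpha> x))\<^sup>2) + 3 * (L\<^sup>2 * (cmod (\<beta> x))\<^sup>2) + 3 * (L^4 * (cmod (A n n))\<^sup>2)" (is "_ \<le> ?r") for x
  proof -
    have "(cmod (inc x y))\<^sup>2 \<le> ?r" for y
    proof -
      let ?a = "L * cmod (\<alpha> x)" and ?b = "L * cmod (\<beta> x)" and ?c = "cmod (A n n) * L\<^sup>2"
      have "(cmod (inc x y))\<^sup>2 \<le> (?a + ?b + ?c)\<^sup>2" by (intro power_mono incb) simp
      also have "\<dots> \<le> 3 * ?a\<^sup>2 + 3 * ?b\<^sup>2 + 3 * ?c\<^sup>2"
        using sum_squares_bound[of ?a ?b] sum_squares_bound[of ?a ?c] sum_squares_bound[of ?b ?c]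
        by (simp add: power2_eq_square algebra_simps)
      also have "\<dots> = ?r" by (simp add: power_mult_distrib power4_eq_xxxx power2_eq_square mult_ac)
      finally show ?thesis .
    qed
    hence "norm (\<integral>y. (cmod (inc x y))\<^sup>2 \<partial>\<mu>) \<le> ?r"
      by (intro bounded_integral_norm_le[OF \<mu>]) (use mh in auto)
    thus ?thesis by simp
  qed
  have \<alpha>m: "\<alpha> \<in> borel_measurable (PM n)" and \<beta>m: "\<beta> \<in> borel_measurable (PM n)"
    unfolding \<alpha>_def \<beta>_def by (intro borel_measurable_sum borel_measurable_times borel_measurable_const h_component; simp)+
  have i\<alpha>: "integrable (PM n) (\<lambda>x. (cmod (\<alpha> x))\<^sup>2)"
    by (rule bounded_integrable[OF prob_PM]) (use \<alpha>m in \<open>auto intro!: power_mono \<alpha>b\<close>)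
  have i\<beta>: "integrable (PM n) (\<lambda>x. (cmod (\<beta> x))\<^sup>2)"
    by (rule bounded_integrable[OF prob_PM]) (use \<beta>m in \<open>auto intro!: power_mono \<beta>b\<close>)
  interpret Pn: prob_space "PM n" by (rule prob_PM)
  have sq: "integrable (PM (Suc n)) (\<lambda>x. (cmod (quad A (Suc n) x))\<^sup>2)" by (rule quad_sq_int)
  have "(\<integral>x. (cmod (quad A (Suc n) x))\<^sup>2 \<partial>PM (Suc n))
     = (\<integral>x. \<integral>y. (cmod (quad A (Suc n) (x(n := y))))\<^sup>2 \<partial>\<mu> \<partial>PM n)"
    using sq unfolding lessThan_Suc by (intro PP.product_integral_insert) (auto simp: lessThan_Suc)
  also have "\<dots> = (\<integral>x. (cmod (quad A n x))\<^sup>2 + (\<integral>y. (cmod (inc x y))\<^sup>2 \<partial>\<mu>) \<partial>PM n)"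
    unfolding split
    by (intro Bochner_Integration.integral_cong refl integral_norm_sq_add_centered[OF \<mu> mh incb inc0])
  also have "\<dots> \<le> (\<integral>x. (cmod (quad A n x))\<^sup>2 + (3 * (L\<^sup>2 * (cmod (\<alpha> x))\<^sup>2) + 3 * (L\<^sup>2 * (cmod (\<beta> x))\<^sup>2) + 3 * (L^4 * (cmod (A n n))\<^sup>2)) \<partial>PM n)"
  proof (rule integral_mono')
    show "integrable (PM n) (\<lambda>x. (cmod (quad A n x))\<^sup>2 + (3 * (L\<^sup>2 * (cmod (\<alpha> x))\<^sup>2) + 3 * (L\<^sup>2 * (cmod (\<beta> x))\<^sup>2) + 3 * (L^4 * (cmod (A n n))\<^sup>2)))"
      using quad_sq_int i\<alpha> i\<beta> by simp
    show "(cmod (quad A n x))\<^sup>2 + (\<integral>y. (cmod (inc x y))\<^sup>2 \<partial>\<mu>) \<le> (cmod (quad A n x))\<^sup>2 + (3 * (L\<^sup>2 * (cmod (\<alpha> x))\<^sup>2) + 3 * (L\<^sup>2 * (cmod (\<beta> x))\<^sup>2) + 3 * (L^4 * (cmod (A n n))\<^sup>2))" for x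
      using inc2[of x] by simp
  qed simp
  also have "\<dots> = (\<integral>x. (cmod (quad A n x))\<^sup>2 \<partial>PM n) + (3 * (L\<^sup>2 * (\<integral>x. (cmod (\<alpha> x))\<^sup>2 \<partial>PM n))
      + 3 * (L\<^sup>2 * (\<integral>x. (cmod (\<beta> x))\<^sup>2 \<partial>PM n)) + 3 * (L^4 * (cmod (A n n))\<^sup>2))"
    using quad_sq_int i\<alpha> i\<beta> by (simp add: Pn.prob_space)
  also have "\<dots> \<le> 3 * L^4 * (\<Sum>i<n. \<Sum>k<n. (cmod (A i k))\<^sup>2) + (3 * (L\<^sup>2 * (L\<^sup>2 * (\<Sum>k<n. (cmod (A n k))\<^sup>2)))
      + 3 * (L\<^sup>2 * (L\<^sup>2 * (\<Sum>i<n. (cmod (A i n))\<^sup>2))) + 3 * (L^4 * (cmod (A n n))\<^sup>2))"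
    using linear_second_moment[of n "\<lambda>k. A n k"] linear_second_moment[of n "\<lambda>i. cnj (A i n)"]
    unfolding \<alpha>_def \<beta>_def by (intro add_mono Suc.IH mult_left_mono) (simp_all)
  also have "\<dots> = 3 * L^4 * (\<Sum>i<Suc n. \<Sum>k<Suc n. (cmod (A i k))\<^sup>2)"
    by (simp add: sum.distrib algebra_simps power4_eq_xxxx power2_eq_square[of L])
  finally show ?case .
qed (simp add: quad_def)

end

lemma (in prob_space) second_moment_imp_first:
  fixes X :: "'a \<Rightarrow> complex"
  assumes "X \<in> borel_measurable M" "integrable M (\<lambda>x. (cmod (X x))\<^sup>2)"
  shows "integrable M X" "(\<integral>x. cmod (X x) \<partial>M) \<le> 1 + (\<integral>x. (cmod (X x))\<^sup>2 \<partial>M)"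
proof -
  have le: "cmod (X x) \<le> 1 + (cmod (X x))\<^sup>2" for x
    using sum_squares_bound[of 1 "cmod (X x)"] norm_ge_zero[of "X x"] by (simp del: norm_ge_zero)
  show i: "integrable M X"
    by (rule Bochner_Integration.integrable_bound[where f = "\<lambda>x. 1 + (cmod (X x))\<^sup>2"]) (use assms le in auto)
  have "(\<integral>x. cmod (X x) \<partial>M) \<le> (\<integral>x. 1 + (cmod (X x))\<^sup>2 \<partial>M)"
    by (rule integral_mono) (use i assms le in auto)
  thus "(\<integral>x. cmod (X x) \<partial>M) \<le> 1 + (\<integral>x. (cmod (X x))\<^sup>2 \<partial>M)"
    using assms by (simp add: prob_space)
qed

text \<open>Only second moments are available: the entries are cut at a fixed level, the bounded part is
  handled by orthogonality of the martingale differences of the quadratic form, the remainder has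
  small variance.\<close>

lemma truncation:
  fixes \<mu> :: "complex measure"
  assumes \<mu>: "prob_space \<mu>" and sets: "sets \<mu> = sets borel" and mean: "(\<integral>y. y \<partial>\<mu>) = 0"
    and var: "integrable \<mu> (\<lambda>y. (cmod y)\<^sup>2)" "(\<integral>y. (cmod y)\<^sup>2 \<partial>\<mu>) = 1" and e: "0 < e"
  obtains h L where "centered_bounded \<mu> h L" "(\<integral>y. (cmod (y - h y))\<^sup>2 \<partial>\<mu>) \<le> e"
    "integrable \<mu> (\<lambda>y. (cmod (y - h y))\<^sup>2)" "(\<integral>y. (cmod (h y))\<^sup>2 \<partial>\<mu>) \<le> 10"
proof -
  interpret prob_space \<mu> by (rule \<mu>)
  have idm: "(\<lambda>y. y) \<in> borel_measurable \<mu>" using sets by (simp add: measurable_ident_sets)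
  have m: "f \<in> borel_measurable \<mu>" if "f \<in> borel_measurable borel" for f :: "complex \<Rightarrow> 'b::topological_space"
    using that sets by (simp cong: measurable_cong_sets)
  note y1 = second_moment_imp_first[OF idm var(1)]
  define t where "t l y = (if cmod y \<le> real l then y else 0)" for l and y :: complex
  have tm: "t l \<in> borel_measurable \<mu>" for l unfolding t_def by (rule m) simp
  have tb: "cmod (t l y) \<le> cmod y" "cmod (t l y) \<le> real l" for l y by (auto simp: t_def)
  have ti: "integrable \<mu> (t l)" for l
    by (rule Bochner_Integration.integrable_bound[OF y1(1) tm]) (use tb in auto)
  have tlim: "(\<lambda>l. t l y) \<longlonglongrightarrow> y" for y
  proof (rule tendsto_eventually)
    have "eventually (\<lambda>l. real l \<ge> cmod y) sequentially"
      by (rule filterlim_real_sequentially[THEN filterlim_at_top[THEN iffD1, rule_format]])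
    thus "eventually (\<lambda>l. t l y = y) sequentially" by eventually_elim (simp add: t_def)
  qed
  define a where "a l = (\<integral>y. t l y \<partial>\<mu>)" for l
  have alim: "a \<longlonglongrightarrow> 0"
    unfolding a_def mean[symmetric]
    by (rule integral_dominated_convergence[where w = cmod]) (use tm idm integrable_norm[OF y1(1)] tlim tb(1) in simp_all)
  \<comment> \<open>The first absolute moment of an entry is at most 1 plus its second moment, hence
    2.\<close>
  have ab: "cmod (a l) \<le> 2" for l
  proof -
    have "cmod (a l) \<le> (\<integral>y. cmod (t l y) \<partial>\<mu>)" unfolding a_def by (rule integral_norm_bound)
    also have "\<dots> \<le> (\<integral>y. cmod y \<partial>\<mu>)" by (intro integral_mono integrable_norm ti y1(1) tb(1))
    finally show ?thesis using y1(2) var(2) by simp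
  qed
  define h where "h l y = t l y - a l" for l y
  have hm: "h l \<in> borel_measurable \<mu>" for l unfolding h_def using tm by simp
  have cb: "centered_bounded \<mu> (h l) (real l + 2)" for l
  proof (rule centered_bounded.intro)
    show "prob_space \<mu>" by (rule \<mu>)
    show "h l \<in> borel_measurable \<mu>" by (rule hm)
    show "cmod (h l y) \<le> real l + 2" for y
      unfolding h_def using tb(2)[of l y] ab[of l] norm_triangle_ineq4[of "t l y" "a l"] by linarith
    show "(\<integral>y. h l y \<partial>\<mu>) = 0" unfolding h_def using ti by (simp add: a_def prob_space)
  qed
  have gb: "cmod (y - h l y) \<le> cmod y + 2" for l y
  proof -
    have "cmod (y - t l y) \<le> cmod y" by (simp add: t_def)
    moreover have eq: "y - h l y = (y - t l y) + a l" by (simp add: h_def)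
    ultimately show ?thesis unfolding eq using ab[of l] norm_triangle_ineq[of "y - t l y" "a l"] by linarith
  qed
  have sq: "(p + 2)\<^sup>2 \<le> 2 * p\<^sup>2 + 8" for p :: real
    using sum_squares_bound[of p 2] by (simp add: power2_eq_square algebra_simps)
  have gb2: "(cmod (y - h l y))\<^sup>2 \<le> 2 * (cmod y)\<^sup>2 + 8" for l y
    using order_trans[OF power_mono[OF gb, of y l 2] sq] by simp
  have bi: "integrable \<mu> (\<lambda>y. 2 * (cmod y)\<^sup>2 + 8)" using var(1) by simp
  have gm: "(\<lambda>y. (cmod (y - h l y))\<^sup>2) \<in> borel_measurable \<mu>" for l using idm hm by simp
  have gi: "integrable \<mu> (\<lambda>y. (cmod (y - h l y))\<^sup>2)" for l
    by (rule Bochner_Integration.integrable_bound[OF bi gm]) (use gb2 in auto)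
  \<comment> \<open>The pointwise bound \<open>2 * (cmod y)\<^sup>2 + 8\<close> integrates to
    \<open>2 + 8\<close>.\<close>
  have h2: "(\<integral>y. (cmod (h l y))\<^sup>2 \<partial>\<mu>) \<le> 10" for l
  proof -
    have hb: "(cmod (h l y))\<^sup>2 \<le> 2 * (cmod y)\<^sup>2 + 8" for y
    proof -
      have "cmod (h l y) \<le> cmod y + 2"
        unfolding h_def using tb(1)[of l y] ab[of l] norm_triangle_ineq4[of "t l y" "a l"] by linarith
      from order_trans[OF power_mono[OF this, of 2] sq] show ?thesis by simp
    qed
    have "(\<integral>y. (cmod (h l y))\<^sup>2 \<partial>\<mu>) \<le> (\<integral>y. 2 * (cmod y)\<^sup>2 + 8 \<partial>\<mu>)"
      by (rule integral_mono'[OF bi]) (use hb in auto)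
    thus ?thesis using var by (simp add: prob_space)
  qed
  have "(\<lambda>l. \<integral>y. (cmod (y - h l y))\<^sup>2 \<partial>\<mu>) \<longlonglongrightarrow> (\<integral>y. (cmod (y - (y - 0)))\<^sup>2 \<partial>\<mu>)"
  proof (rule integral_dominated_convergence[OF _ _ bi])
    show "AE y in \<mu>. (\<lambda>l. (cmod (y - h l y))\<^sup>2) \<longlonglongrightarrow> (cmod (y - (y - 0)))\<^sup>2"
      unfolding h_def by (intro AE_I2 tendsto_intros tlim alim)
  qed (use gm gb2 in auto)
  hence "eventually (\<lambda>l. (\<integral>y. (cmod (y - h l y))\<^sup>2 \<partial>\<mu>) < e) sequentially"
    by (rule order_tendstoD) (use e in simp)
  then obtain l where "(\<integral>y. (cmod (y - h l y))\<^sup>2 \<partial>\<mu>) < e"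
    by (auto simp: eventually_sequentially)
  thus ?thesis using that[OF cb[of l] _ gi h2] by simp
qed

text \<open>Write an entry as \<open>h y + (y - h y)\<close>. The centred form in the bounded parts
  is of order \<open>sqrt n\<close>, by \<open>quadratic_second_moment\<close> and
  \<open>kbounded_hs\<close>; every other term is of order \<open>n\<close> with a small factor. The
  index \<open>n0\<close> is uniform in \<open>A\<close>, so that \<open>A\<close> may later be
  random and independent of \<open>x\<close>.\<close>

lemma quadratic_form_concentration:
  fixes \<mu> :: "complex measure"
  assumes \<mu>: "prob_space \<mu>" and sets: "sets \<mu> = sets borel" and mean: "(\<integral>y. y \<partial>\<mu>) = 0"
    and var: "integrable \<mu> (\<lambda>y. (cmod y)\<^sup>2)" "(\<integral>y. (cmod y)\<^sup>2 \<partial>\<mu>) = 1" and e: "0 < e"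
  shows "\<exists>n0. \<forall>n\<ge>n0. \<forall>A C. 0 < C \<longrightarrow> kbounded n C A \<longrightarrow>
    integrable (PiM {..<n} (\<lambda>_. \<mu>)) (\<lambda>x. kip n x (kapp n A x) - ktr n A) \<and>
    (\<integral>x. cmod (kip n x (kapp n A x) - ktr n A) \<partial>PiM {..<n} (\<lambda>_. \<mu>)) \<le> e * real n * C"
proof -
  \<comment> \<open>The errors add up to \<open>3 * (\<kappa> / (2 * s)) + 35/2 * s\<close>. The
    choice \<kappa> \<le> \<open>e * s / 3\<close> makes the first summand at most
    \<open>e / 2\<close>, and \<open>s = e / 36\<close> keeps the second below
    \<open>e / 2\<close>.\<close>
  define s where "s = e / 36"
  have s: "0 < s" using e by (simp add: s_def)
  obtain h L where cb: "centered_bounded \<mu> h L" and g2: "(\<integral>y. (cmod (y - h y))\<^sup>2 \<partial>\<mu>) \<le> e * s / 3"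
    and gi: "integrable \<mu> (\<lambda>y. (cmod (y - h y))\<^sup>2)" and h2: "(\<integral>y. (cmod (h y))\<^sup>2 \<partial>\<mu>) \<le> 10"
    using truncation[OF \<mu> sets mean var, of "e * s / 3"] e s by auto
  interpret centered_bounded \<mu> h L by (rule cb)
  interpret \<mu>: prob_space \<mu> by (rule \<mu>)
  define \<kappa> where "\<kappa> = (\<integral>y. (cmod (y - h y))\<^sup>2 \<partial>\<mu>)"
  have \<kappa>0: "0 \<le> \<kappa>" unfolding \<kappa>_def by simp
  have s2le: "s2 \<le> 10" using h2 by (simp add: s2_def)
  \<comment> \<open>Here \<open>a\<close> will be the small factor: it may carry the large
    coefficient \<open>1 / (2 * s)\<close>, and products are integrated through squares
    only.\<close>
  have young: "a * b \<le> a\<^sup>2 / (2 * s) + s / 2 * b\<^sup>2" for a b :: real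
  proof -
    have "0 \<le> (a - s * b)\<^sup>2 / (2 * s)" using s by simp
    also have "\<dots> = a\<^sup>2 / (2 * s) + s / 2 * b\<^sup>2 - a * b" using s by (simp add: power2_eq_square field_simps)
    finally show ?thesis by simp
  qed
  have idm: "(\<lambda>y. y) \<in> borel_measurable \<mu>" using sets by (simp add: measurable_ident_sets)
  have s2near: "\<bar>s2 - 1\<bar> \<le> \<kappa> / (2 * s) + 11 * s"
  proof -
    have "\<bar>(cmod (h y))\<^sup>2 - (cmod y)\<^sup>2\<bar> \<le> (cmod (y - h y))\<^sup>2 / (2 * s) + s * ((cmod (h y))\<^sup>2 + (cmod y)\<^sup>2)" for y
    proof -
      have "\<bar>(cmod (h y))\<^sup>2 - (cmod y)\<^sup>2\<bar> = \<bar>cmod (h y) - cmod y\<bar> * (cmod (h y) + cmod y)"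
        by (simp add: power2_eq_square square_diff_square_factored abs_mult mult.commute)
      also have "\<dots> \<le> cmod (y - h y) * (cmod (h y) + cmod y)"
        using norm_triangle_ineq3[of "h y" y] by (intro mult_right_mono) (auto simp: norm_minus_commute)
      also have "\<dots> \<le> (cmod (y - h y))\<^sup>2 / (2 * s) + s / 2 * (cmod (h y) + cmod y)\<^sup>2" by (rule young)
      also have "(cmod (h y) + cmod y)\<^sup>2 \<le> 2 * ((cmod (h y))\<^sup>2 + (cmod y)\<^sup>2)"
        using sum_squares_bound[of "cmod (h y)" "cmod y"] by (simp add: power2_eq_square algebra_simps)
      hence "s / 2 * (cmod (h y) + cmod y)\<^sup>2 \<le> s / 2 * (2 * ((cmod (h y))\<^sup>2 + (cmod y)\<^sup>2))" using s by (intro mult_left_mono) auto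
      finally show ?thesis by (simp add: algebra_simps)
    qed
    note pw = this
    have "\<bar>s2 - 1\<bar> = \<bar>\<integral>y. (cmod (h y))\<^sup>2 - (cmod y)\<^sup>2 \<partial>\<mu>\<bar>"
      using h2_int var by (simp add: s2_def)
    also have "\<dots> \<le> (\<integral>y. \<bar>(cmod (h y))\<^sup>2 - (cmod y)\<^sup>2\<bar> \<partial>\<mu>)" by (rule integral_abs_bound)
    also have "\<dots> \<le> (\<integral>y. (cmod (y - h y))\<^sup>2 / (2 * s) + s * ((cmod (h y))\<^sup>2 + (cmod y)\<^sup>2) \<partial>\<mu>)"
      by (rule integral_mono') (use pw gi h2_int var s in auto)
    also have "\<dots> = \<kappa> / (2 * s) + s * (s2 + 1)"
      using gi h2_int var by (simp add: \<kappa>_def s2_def)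
    also have "s * (s2 + 1) \<le> s * 11" using s s2le by (intro mult_left_mono) auto
    finally show ?thesis by simp
  qed
  \<comment> \<open>Makes the centred form in the bounded entries negligible: its second moment
    divided by \<open>2 * (s * C * real n)\<close> is then at most
    \<open>s * C * real n / 2\<close>.\<close>
  obtain n0 :: nat where n0: "3 * L^4 / s\<^sup>2 \<le> real n0" using real_arch_simple by blast
  show ?thesis
  proof (intro exI[of _ n0] allI impI)
    fix n A C assume n: "n0 \<le> n" and C: "0 < C" and A: "kbounded n C A"
    let ?P = "PiM {..<n} (\<lambda>_. \<mu>)"
    interpret P: prob_space ?P by (rule prob_PM)
    let ?h = "\<lambda>x i. h (x i)" and ?g = "\<lambda>x i. x i - h (x i)"
    have n3: "3 * L^4 \<le> s\<^sup>2 * real n"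
    proof -
      have "3 * L^4 / s\<^sup>2 \<le> real n" using n0 n by linarith
      thus ?thesis using s by (simp add: field_simps)
    qed
    have cm: "(\<lambda>x. f (x i)) \<in> borel_measurable ?P" if "i < n" "f \<in> borel_measurable \<mu>" for f :: "complex \<Rightarrow> complex" and i
      using measurable_compose[OF measurable_component_singleton[of i "{..<n}" "\<lambda>_. \<mu>"] that(2)] that(1) by simp
    have normint: "integrable ?P (\<lambda>x. (knorm n (\<lambda>i. f (x i)))\<^sup>2) \<and>
        (\<integral>x. (knorm n (\<lambda>i. f (x i)))\<^sup>2 \<partial>?P) = real n * (\<integral>y. (cmod (f y))\<^sup>2 \<partial>\<mu>)"
      if f: "integrable \<mu> (\<lambda>y. (cmod (f y))\<^sup>2)" for f
    proof -
      have "integrable ?P (\<lambda>x. (cmod (f (x i)))\<^sup>2)" if "i < n" for i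
        using integral_PiM_component(2)[OF \<mu>, of i "{..<n}" "\<lambda>y. (cmod (f y))\<^sup>2"] that f by auto
      moreover have "(\<integral>x. (cmod (f (x i)))\<^sup>2 \<partial>?P) = (\<integral>y. (cmod (f y))\<^sup>2 \<partial>\<mu>)" if "i < n" for i
        using integral_PiM_component(1)[OF \<mu>, of i "{..<n}" "\<lambda>y. (cmod (f y))\<^sup>2"] that f by auto
      ultimately show ?thesis
        unfolding knorm_sq by (subst Bochner_Integration.integral_sum) (auto intro!: Bochner_Integration.integrable_sum)
    qed
    have n1: "integrable ?P (\<lambda>x. (knorm n x)\<^sup>2)" "(\<integral>x. (knorm n x)\<^sup>2 \<partial>?P) = real n"
      using normint[of "\<lambda>y. y"] var by simp_all
    have nh: "integrable ?P (\<lambda>x. (knorm n (?h x))\<^sup>2)" "(\<integral>x. (knorm n (?h x))\<^sup>2 \<partial>?P) \<le> real n * 10"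
      using normint[of h] h2_int h2 by (auto intro: mult_left_mono)
    have ng: "integrable ?P (\<lambda>x. (knorm n (?g x))\<^sup>2)" "(\<integral>x. (knorm n (?g x))\<^sup>2 \<partial>?P) = real n * \<kappa>"
      using normint[of "\<lambda>y. y - h y"] gi by (simp_all add: \<kappa>_def)
    define X where "X x = kip n x (kapp n A x) - ktr n A" for x
    \<comment> \<open>Three kinds of error: the centred form in the cut entries, the defect
      \<open>s2 - 1\<close> of their variance, and the forms containing the remainder
      \<open>y - h y\<close>.\<close>
    have dec: "X x = quad A n x + of_real (s2 - 1) * ktr n A + (kip n (?g x) (kapp n A x) + kip n (?h x) (kapp n A (?g x)))" for x
    proof -
      have "quad A n x = kip n (?h x) (kapp n A (?h x)) - of_real s2 * ktr n A"
        unfolding quad_def kip_def kapp_def ktr_def by (simp add: sum_distrib_left mult.assoc)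
      moreover have "kapp n A (?g x) = (\<lambda>i. kapp n A x i - kapp n A (?h x) i)" by (rule ext) (rule kapp_diff)
      ultimately show ?thesis unfolding X_def by (simp add: kip_diff_left kip_diff_right algebra_simps)
    qed
    define bd where "bd x = ((cmod (quad A n x))\<^sup>2 / (2 * (s * C * real n)) + s * C * real n / 2)
      + (\<kappa> / (2 * s) + 11 * s) * (real n * C)
      + (C * ((knorm n (?g x))\<^sup>2 / (2 * s) + s / 2 * (knorm n x)\<^sup>2) + C * ((knorm n (?g x))\<^sup>2 / (2 * s) + s / 2 * (knorm n (?h x))\<^sup>2))" for x
    have le: "cmod (X x) \<le> bd x" if n: "n \<noteq> 0" for x
    proof -
      have t: "0 < s * C * real n" using s C n by simp
      have "cmod (quad A n x) \<le> (cmod (quad A n x))\<^sup>2 / (2 * (s * C * real n)) + s * C * real n / 2"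
      proof -
        have "0 \<le> (cmod (quad A n x) - s * C * real n)\<^sup>2 / (2 * (s * C * real n))" using t by simp
        also have "\<dots> = (cmod (quad A n x))\<^sup>2 / (2 * (s * C * real n)) + s * C * real n / 2 - cmod (quad A n x)"
          using t s C n by (simp add: power2_eq_square field_simps)
        finally show ?thesis by simp
      qed
      moreover have "cmod (of_real (s2 - 1) * ktr n A) \<le> (\<kappa> / (2 * s) + 11 * s) * (real n * C)"
        unfolding norm_mult norm_of_real by (intro mult_mono s2near kbounded_ktr[OF A]) (use order_trans[OF abs_ge_zero s2near] in auto)
      moreover have "cmod (kip n (?g x) (kapp n A x)) \<le> C * ((knorm n (?g x))\<^sup>2 / (2 * s) + s / 2 * (knorm n x)\<^sup>2)"
      proof -
        have "cmod (kip n (?g x) (kapp n A x)) \<le> knorm n (?g x) * (C * knorm n x)"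
          by (rule order_trans[OF kip_cauchy]) (intro mult_left_mono kboundedD[OF A] knorm_nonneg)
        also have "\<dots> = C * (knorm n (?g x) * knorm n x)" by simp
        also have "\<dots> \<le> C * ((knorm n (?g x))\<^sup>2 / (2 * s) + s / 2 * (knorm n x)\<^sup>2)" using C by (intro mult_left_mono young) auto
        finally show ?thesis .
      qed
      moreover have "cmod (kip n (?h x) (kapp n A (?g x))) \<le> C * ((knorm n (?g x))\<^sup>2 / (2 * s) + s / 2 * (knorm n (?h x))\<^sup>2)"
      proof -
        have "cmod (kip n (?h x) (kapp n A (?g x))) \<le> knorm n (?h x) * (C * knorm n (?g x))"
          by (rule order_trans[OF kip_cauchy]) (intro mult_left_mono kboundedD[OF A] knorm_nonneg)
        also have "\<dots> = C * (knorm n (?g x) * knorm n (?h x))" by simp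
        also have "\<dots> \<le> C * ((knorm n (?g x))\<^sup>2 / (2 * s) + s / 2 * (knorm n (?h x))\<^sup>2)" using C by (intro mult_left_mono young) auto
        finally show ?thesis .
      qed
      ultimately show ?thesis unfolding dec bd_def
        by (intro order_trans[OF norm_triangle_ineq] add_mono)
    qed
    have Xm: "X \<in> borel_measurable ?P"
      unfolding X_def kip_def kapp_def
      by (intro borel_measurable_diff borel_measurable_sum borel_measurable_times borel_measurable_const
        cm[of _ "\<lambda>y. y"] cm[of _ cnj] idm borel_measurable_continuous_on[of cnj] continuous_intros) auto
    have bdi: "integrable ?P bd" unfolding bd_def using quad_sq_int n1 nh ng by simp
    have zero: "n = 0 \<Longrightarrow> X = (\<lambda>_. 0)" unfolding X_def kip_def ktr_def by simp
    have Xi: "integrable ?P X"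
    proof (cases "n = 0")
      case False
      show ?thesis by (rule Bochner_Integration.integrable_bound[OF bdi Xm]) (use le[OF False] in \<open>auto intro: order_trans[OF _ abs_ge_self]\<close>)
    qed (simp add: zero)
    have "(\<integral>x. cmod (X x) \<partial>?P) \<le> e * real n * C"
    proof (cases "n = 0")
      case False
      have "(\<integral>x. cmod (X x) \<partial>?P) \<le> (\<integral>x. bd x \<partial>?P)"
        by (rule integral_mono') (use bdi le[OF False] order_trans[OF norm_ge_zero le[OF False]] in auto)
      also have "\<dots> = ((\<integral>x. (cmod (quad A n x))\<^sup>2 \<partial>?P) / (2 * (s * C * real n)) + s * C * real n / 2)
        + (\<kappa> / (2 * s) + 11 * s) * (real n * C)
        + (C * (real n * \<kappa> / (2 * s) + s / 2 * real n) + C * (real n * \<kappa> / (2 * s) + s / 2 * (\<integral>x. (knorm n (?h x))\<^sup>2 \<partial>?P)))"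
        unfolding bd_def using quad_sq_int n1 nh ng by (simp add: P.prob_space)
      also have "\<dots> \<le> (s * C * real n / 2 + s * C * real n / 2)
        + (\<kappa> / (2 * s) + 11 * s) * (real n * C)
        + (C * (real n * \<kappa> / (2 * s) + s / 2 * real n) + C * (real n * \<kappa> / (2 * s) + s / 2 * (real n * 10)))"
      proof (intro add_mono mult_left_mono order_refl nh(2))
        have "(\<integral>x. (cmod (quad A n x))\<^sup>2 \<partial>?P) \<le> 3 * L^4 * (\<Sum>i<n. \<Sum>k<n. (cmod (A i k))\<^sup>2)" by (rule quadratic_second_moment)
        also have "\<dots> \<le> 3 * L^4 * (real n * C\<^sup>2)" by (intro mult_left_mono kbounded_hs[OF A]) auto
        also have "\<dots> \<le> s\<^sup>2 * real n * (real n * C\<^sup>2)" by (intro mult_right_mono n3) auto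
        also have "\<dots> = (s * C * real n / 2) * (2 * (s * C * real n))" by (simp add: power2_eq_square)
        finally show "(\<integral>x. (cmod (quad A n x))\<^sup>2 \<partial>?P) / (2 * (s * C * real n)) \<le> s * C * real n / 2"
          using s C False by (simp add: divide_le_eq)
      qed (use s C \<kappa>0 in auto)
      also have "\<dots> = (3 * (\<kappa> / (2 * s)) + 35/2 * s) * (real n * C)" by (simp add: algebra_simps)
      also have "\<dots> \<le> e * (real n * C)"
      proof (intro mult_right_mono)
        have "\<kappa> / (2 * s) \<le> (e * s / 3) / (2 * s)" using g2 s unfolding \<kappa>_def by (intro divide_right_mono) auto
        also have "\<dots> = e / 6" using s by simp
        finally show "3 * (\<kappa> / (2 * s)) + 35/2 * s \<le> e" using s unfolding s_def by simp
      qed (use C in simp)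
      finally show ?thesis by (simp add: mult.assoc)
    qed (simp add: zero)
    thus "integrable ?P (\<lambda>x. kip n x (kapp n A x) - ktr n A) \<and>
      (\<integral>x. cmod (kip n x (kapp n A x) - ktr n A) \<partial>?P) \<le> e * real n * C"
      using Xi unfolding X_def by blast
  qed
qed

section \<open>The deterministic equivalent\<close>

lemma borel_measurable_cnj [measurable (raw)]:
  "f \<in> borel_measurable M \<Longrightarrow> (\<lambda>x. cnj (f x)) \<in> borel_measurable M"
  by (rule borel_measurable_continuous_on[of cnj]) (intro continuous_intros)

lemma kapp_measurable:
  assumes "\<And>k. k < n \<Longrightarrow> (\<lambda>p. A p i k) \<in> borel_measurable M" "\<And>k. k < n \<Longrightarrow> (\<lambda>p. x p k) \<in> borel_measurable M"
  shows "(\<lambda>p. kapp n (A p) (x p) i) \<in> borel_measurable M"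
  unfolding kapp_def by (intro borel_measurable_sum borel_measurable_times assms) auto

lemma kip_measurable:
  assumes "\<And>k. k < n \<Longrightarrow> (\<lambda>p. x p k) \<in> borel_measurable M" "\<And>k. k < n \<Longrightarrow> (\<lambda>p. y p k) \<in> borel_measurable M"
  shows "(\<lambda>p. kip n (x p) (y p)) \<in> borel_measurable M"
  unfolding kip_def by (intro borel_measurable_sum borel_measurable_times borel_measurable_cnj assms) auto

lemma smk_measurable:
  assumes "\<And>j. j < J \<Longrightarrow> (\<lambda>p. w p j) \<in> borel_measurable M"
    and "\<And>j i. j < J \<Longrightarrow> i < n \<Longrightarrow> (\<lambda>p. x p j i) \<in> borel_measurable M"
    and "\<And>j i. j < J \<Longrightarrow> i < n \<Longrightarrow> (\<lambda>p. y p j i) \<in> borel_measurable M"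
    and "i < n" "k < n"
  shows "(\<lambda>p. smk n z (w p) (x p) (y p) J i k) \<in> borel_measurable M"
  using assms
proof (induction J arbitrary: i k)
  case (Suc J)
  note IH = Suc.IH[OF less_SucI[THEN Suc.prems(1)] less_SucI[THEN Suc.prems(2)] less_SucI[THEN Suc.prems(3)]]
  have wm: "(\<lambda>p. complex_of_real (w p J)) \<in> borel_measurable M"
    using Suc.prems(1)[of J] by simp
  show ?case
    unfolding smk.simps
    by (intro borel_measurable_diff borel_measurable_divide borel_measurable_times borel_measurable_add
        borel_measurable_sum borel_measurable_const wm borel_measurable_cnj
        kapp_measurable kip_measurable IH Suc.prems) auto
qed simp

text \<open>Multiplication by \<open>z\<close> gives imaginary part
  \<open>Im z + s * Im (z * b)\<close>, which is at least \<open>Im z\<close>. The estimate is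
  uniform in \<open>s\<close> and \<open>b\<close>; for quadratic forms of resolvents the sign comes
  from \<open>Im_z_kip_resolvent\<close>.\<close>

lemma denominator_bound:
  assumes "0 < Im z" "0 \<le> Im (z * b)" "0 \<le> s"
  shows "Im z / cmod z \<le> cmod (1 + of_real s * b)" "1 + of_real s * b \<noteq> 0"
    "cmod (1 / (1 + of_real s * b)) \<le> cmod z / Im z"
proof -
  have z: "0 < cmod z" using assms(1) by auto
  have "z * (1 + of_real s * b) = z + of_real s * (z * b)" by (simp add: algebra_simps)
  moreover have "Im (of_real s * q) = s * Im q" for q by simp
  ultimately have "Im (z * (1 + of_real s * b)) = Im z + s * Im (z * b)" by (metis plus_complex.simps(2))
  hence "Im z \<le> Im (z * (1 + of_real s * b))"
    using assms by simp
  also have "\<dots> \<le> cmod z * cmod (1 + of_real s * b)"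
    unfolding norm_mult[symmetric] by (rule order_trans[OF abs_ge_self abs_Im_le_cmod])
  finally have *: "Im z \<le> cmod z * cmod (1 + of_real s * b)" .
  thus 1: "Im z / cmod z \<le> cmod (1 + of_real s * b)" using z by (simp add: field_simps)
  have "0 < cmod (1 + of_real s * b)" by (rule less_le_trans[OF divide_pos_pos[OF assms(1) z] 1])
  thus "1 + of_real s * b \<noteq> 0" by auto
  show "cmod (1 / (1 + of_real s * b)) \<le> cmod z / Im z"
    using frac_le[of 1 1 "Im z / cmod z" "cmod (1 + of_real s * b)"] 1 z assms(1) by (simp add: norm_divide)
qed

lemma Im_weight_div_nonpos:
  assumes "0 \<le> Im b" "0 \<le> s"
  shows "Im (of_real s / (1 + of_real s * b)) \<le> 0"
  using assms by (simp add: Im_divide divide_nonneg_nonneg)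

lemma shifted_denominator:
  assumes "0 < Im z" "Im om \<le> 0" "0 \<le> t"
  shows "Im z \<le> cmod (of_real t * om - z)" "of_real t * om - z \<noteq> 0" "cmod (1 / (of_real t * om - z)) \<le> 1 / Im z"
proof -
  have "Im z \<le> - Im (of_real t * om - z)" using assms by (simp add: mult_nonneg_nonpos)
  also have "\<dots> \<le> cmod (of_real t * om - z)" using abs_Im_le_cmod[of "of_real t * om - z"] by linarith
  finally show 1: "Im z \<le> cmod (of_real t * om - z)" .
  thus "of_real t * om - z \<noteq> 0" using assms(1) by auto
  show "cmod (1 / (of_real t * om - z)) \<le> 1 / Im z"
    using 1 assms(1) by (simp add: norm_divide frac_le)
qed

lemma resolvent_diagonal:
  assumes "kherm n B" "0 < Im z" "is_resolvent n B z R" "i < n"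
  shows "0 \<le> Im (R i i)" "(\<And>u. 0 \<le> Re (kip n u (kapp n B u))) \<Longrightarrow> 0 \<le> Im (z * R i i)"
proof -
  let ?e = "\<lambda>k. if k = i then 1 else (0::complex)"
  have *: "kip n ?e (kapp n R ?e) = R i i"
    using assms(4) by (simp add: kip_def knorm_kapp_unit if_distrib[of cnj] if_distrib[of "\<lambda>y. y * _"] cong: if_cong)
  show "0 \<le> Im (R i i)"
    using Im_kip_resolvent[OF assms(1,3), of ?e] assms(2) unfolding * by simp
  show "0 \<le> Im (z * R i i)" if "\<And>u. 0 \<le> Re (kip n u (kapp n B u))"
    using Im_z_kip_resolvent[OF assms(1,3) that assms(2), of ?e] unfolding * .
qed

text \<open>Fixed size and bounded spectra; the concentration input is condensed into the number
  \<epsilon> of \<open>QF\<close>. The map \<open>Y\<close> absorbs the rotation of a column by the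
  adjoint of \<open>U\<close>: rotated columns generally lose the independence of their entries, but
  their quadratic forms still satisfy \<open>QF\<close>.\<close>

locale matrix_model =
  fixes \<nu> :: "(nat \<Rightarrow> complex) measure" and n N :: nat and z :: complex
    and t w :: "nat \<Rightarrow> real" and K \<epsilon> :: real and Y :: "(nat \<Rightarrow> complex) \<Rightarrow> nat \<Rightarrow> complex"
  assumes \<nu>: "prob_space \<nu>" and N: "0 < N" and z: "0 < Im z" and K: "1 \<le> K"
    and t: "\<And>i. i < n \<Longrightarrow> 0 \<le> t i \<and> t i \<le> K" and w: "\<And>j. j < N \<Longrightarrow> 0 \<le> w j \<and> w j \<le> K"
    and Y: "\<And>i. i < n \<Longrightarrow> (\<lambda>x. Y x i) \<in> borel_measurable \<nu>"
    and \<epsilon>: "0 \<le> \<epsilon>"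
    and QF: "\<And>A C. 0 < C \<Longrightarrow> kbounded n C A \<Longrightarrow>
      integrable \<nu> (\<lambda>x. kip n (Y x) (kapp n A (Y x)) - ktr n A) \<and>
      (\<integral>x. cmod (kip n (Y x) (kapp n A (Y x)) - ktr n A) \<partial>\<nu>) \<le> \<epsilon> * real n * C"
begin

abbreviation "P \<equiv> PiM {..<N} (\<lambda>_. \<nu>)"
abbreviation "v \<equiv> Im z"
abbreviation "\<zeta> \<equiv> cmod z / Im z"

definition "r x j i = of_real (sqrt (t i)) * Y (x j) i" for x :: "nat \<Rightarrow> nat \<Rightarrow> complex" and j i :: nat
definition "wt j = w j / real N" for j
definition "R x = smk n z wt (r x) (r x) N" for x
text \<open>The resolvent with column \<open>j\<close> removed; it does not depend on that column
  (\<open>R'_independent\<close>).\<close>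

definition "R' j x = smk n z (wt(j := 0)) (r x) (r x) N" for j x
definition "G x = kgram wt (r x) N" for x
definition "g x = (\<Sum>i<n. of_real (t i) * R x i i) / of_nat N" for x
definition "\<gamma> = (\<integral>x. g x \<partial>P)"
definition "om = (\<Sum>j<N. of_real (w j) / (1 + of_real (w j) * \<gamma>)) / of_nat N"
definition "d i = 1 / (of_real (t i) * om - z)" for i

sublocale P: prob_space P by (rule prob_space_PiM) (rule \<nu>)
sublocale \<nu>: prob_space \<nu> by (rule \<nu>)
sublocale PP: product_sigma_finite "\<lambda>_::nat. \<nu>" by unfold_locales

lemma K0: "0 \<le> K" using K by simp

lemma wt_nonneg: "j < N \<Longrightarrow> 0 \<le> wt j" using w by (simp add: wt_def)

lemma r_measurable: "j < N \<Longrightarrow> i < n \<Longrightarrow> (\<lambda>x. r x j i) \<in> borel_measurable P"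
  unfolding r_def
  by (intro borel_measurable_times borel_measurable_const measurable_compose[OF _ Y] measurable_component_singleton) auto

lemma R_measurable: "i < n \<Longrightarrow> k < n \<Longrightarrow> (\<lambda>x. R x i k) \<in> borel_measurable P"
  and R'_measurable: "i < n \<Longrightarrow> k < n \<Longrightarrow> (\<lambda>x. R' j x i k) \<in> borel_measurable P"
  unfolding R_def R'_def by (intro smk_measurable r_measurable; simp)+

lemma res: "is_resolvent n (G x) z (R x)"
  and res': "is_resolvent n (kgram (wt(j := 0)) (r x) N) z (R' j x)"
  unfolding G_def R_def R'_def by (rule is_resolvent_smk[OF z])+

lemma psd: "0 \<le> Re (kip n u (kapp n (G x) u))"
  and psd': "0 \<le> Re (kip n u (kapp n (kgram (wt(j := 0)) (r x) N) u))"
  unfolding G_def kip_kgram Re_complex_of_real by (intro sum_nonneg mult_nonneg_nonneg; simp add: wt_nonneg)+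

lemma R_bounded: "kbounded n (1 / v) (R x)" and R'_bounded: "kbounded n (1 / v) (R' j x)"
  using knorm_resolvent[OF kherm_kgram z] res res' unfolding G_def by blast+

lemma g_measurable: "g \<in> borel_measurable P"
  unfolding g_def by (intro borel_measurable_divide borel_measurable_sum borel_measurable_times borel_measurable_const R_measurable) auto

lemma weighted_trace_bound:
  assumes "\<And>i. i < n \<Longrightarrow> cmod (b i) \<le> C" "0 \<le> C"
  shows "cmod ((\<Sum>i<n. b i * R x i i) / of_nat N) \<le> real n / real N * C / v"
proof -
  have "cmod (\<Sum>i<n. b i * R x i i) \<le> (\<Sum>i<n. C * (1 / v))"
  proof (rule sum_norm_le)
    fix i assume "i \<in> {..<n}"
    thus "cmod (b i * R x i i) \<le> C * (1 / v)"
      unfolding norm_mult by (intro mult_mono assms kbounded_entry[OF R_bounded]) auto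
  qed
  hence "cmod (\<Sum>i<n. b i * R x i i) / real N \<le> (\<Sum>i<n. C * (1 / v)) / real N" by (rule divide_right_mono) simp
  thus ?thesis by (simp add: norm_divide mult_ac)
qed

lemma g_bound: "cmod (g x) \<le> real n / real N * K / v"
  unfolding g_def by (rule weighted_trace_bound) (use t K0 in auto)

lemma g_integrable: "integrable P g"
  by (rule bounded_integrable[OF P.prob_space_axioms g_measurable g_bound])

lemma Im_g: "0 \<le> Im (g x)" and Im_zg: "0 \<le> Im (z * g x)"
proof -
  have "Im (g x) = (\<Sum>i<n. t i * Im (R x i i)) / real N" by (simp add: g_def)
  also have "0 \<le> \<dots>"
    by (intro divide_nonneg_nonneg sum_nonneg mult_nonneg_nonneg)
       (use t resolvent_diagonal(1)[OF kherm_kgram z res[unfolded G_def]] in auto)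
  finally show "0 \<le> Im (g x)" .
  have "z * g x = (\<Sum>i<n. of_real (t i) * (z * R x i i)) / of_nat N"
    by (simp add: g_def sum_distrib_left mult_ac)
  hence "Im (z * g x) = (\<Sum>i<n. t i * Im (z * R x i i)) / real N" by simp
  also have "0 \<le> \<dots>"
    by (intro divide_nonneg_nonneg sum_nonneg mult_nonneg_nonneg)
       (use t resolvent_diagonal(2)[OF kherm_kgram z res[unfolded G_def] _ psd[unfolded G_def]] in auto)
  finally show "0 \<le> Im (z * g x)" .
qed

lemma Im_\<gamma>: "0 \<le> Im \<gamma>" and Im_z\<gamma>: "0 \<le> Im (z * \<gamma>)"
proof -
  have "Im \<gamma> = (\<integral>x. Im (g x) \<partial>P)" unfolding \<gamma>_def using g_integrable by simp
  thus "0 \<le> Im \<gamma>" using Im_g by simp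
  have "Im (z * \<gamma>) = (\<integral>x. Im (z * g x) \<partial>P)"
    unfolding \<gamma>_def using g_integrable by (subst integral_Im) auto
  thus "0 \<le> Im (z * \<gamma>)" using Im_zg by simp
qed

lemma \<gamma>_bound: "cmod \<gamma> \<le> real n / real N * K / v"
  unfolding \<gamma>_def by (rule bounded_integral_norm_le[OF P.prob_space_axioms g_measurable g_bound])

lemma Im_om: "Im om \<le> 0"
  unfolding om_def using Im_weight_div_nonpos[OF Im_\<gamma>] w
  by (auto simp: divide_nonpos_nonneg intro!: sum_nonpos divide_nonpos_nonneg)

lemma d_bound: "i < n \<Longrightarrow> cmod (d i) \<le> 1 / v"
  unfolding d_def by (rule shifted_denominator(3)[OF z Im_om]) (use t in auto)

text \<open>\<open>b\<close> is the form in the Sherman-Morrison denominator when column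
  \<open>j\<close> is put back, and \<open>g'\<close> is the trace with which \<open>QF\<close>
  compares it. One rank one change separates \<open>g'\<close> from \<open>g\<close>.\<close>

definition "b j x = kip n (r x j) (kapp n (R' j x) (r x j)) / of_nat N" for j x
definition "g' j x = (\<Sum>i<n. of_real (t i) * R' j x i i) / of_nat N" for j x

lemma Im_zb: "0 \<le> Im (z * b j x)"
proof -
  have "z * b j x = z * kip n (r x j) (kapp n (R' j x) (r x j)) / of_nat N" by (simp add: b_def)
  thus ?thesis using Im_z_kip_resolvent[OF kherm_kgram res' psd' z, of "r x j" j x] by simp
qed

text \<open>Sherman-Morrison for the removal of column \<open>j\<close>: on the right the vector
  \<open>r x j\<close> meets a kernel independent of it, at the price of a scalar
  denominator.\<close>

lemma kip_removed_column:
  assumes "j < N"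
  shows "kip n (r x j) (kapp n (R x) u) = kip n (r x j) (kapp n (R' j x) u) / (1 + of_real (w j) * b j x)"
proof -
  let ?S = "sherman_morrison n (R' j x) (wt j) (r x j) (r x j)"
  let ?a = "kip n (r x j) (kapp n (R' j x) u)"
  have "is_resolvent n (G x) z ?S"
    unfolding G_def kgram_upd_zero[OF assms, of wt] by (rule is_resolvent_krank1[OF kherm_kgram z res'])
  hence "R x i k = ?S i k" if "i < n" "k < n" for i k
    using resolvent_kernel_unique[OF kherm_kgram z] res that unfolding G_def by blast
  hence "kip n (r x j) (kapp n (R x) u) = kip n (r x j) (kapp n ?S u)"
    by (intro kip_cong kapp_cong) auto
  also have "kapp n ?S u = (\<lambda>i. kapp n (R' j x) u i - of_real (wt j) * ?a / (1 + of_real (w j) * b j x) * kapp n (R' j x) (r x j) i)"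
    by (rule ext) (simp add: kapp_sherman_morrison b_def wt_def)
  also have "kip n (r x j) \<dots> = ?a - ?a * (of_real (w j) * b j x) / (1 + of_real (w j) * b j x)"
    unfolding kip_diff_right kip_smult_right by (simp add: b_def wt_def)
  also have "\<dots> = ?a / (1 + of_real (w j) * b j x)"
    using denominator_bound(2)[OF z Im_zb, of "w j" j x] w[OF assms] by (simp add: field_simps)
  finally show ?thesis .
qed

text \<open>The diagonal entries satisfy \<open>1 = (G R) i i - z * R i i\<close>, and
  \<open>d i\<close> is the inverse of \<open>t i * om - z\<close>; so \<open>d i - R i i\<close> is
  \<open>d i\<close> times the difference of \<open>(G R) i i\<close> and
  \<open>t i * om * R i i\<close>. Both \<open>G\<close> and \<open>om\<close> are sums over
  columns, and the deviation becomes one comparison per column.\<close>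

lemma sum_diagonal_deviation:
  "(\<Sum>i<n. a i * (d i - R x i i)) =
     (\<Sum>j<N. of_real (wt j) * kip n (r x j) (kapp n (R x) (\<lambda>i. a i * d i * r x j i))
        - of_real (w j) / (1 + of_real (w j) * \<gamma>) * ((\<Sum>i<n. of_real (t i) * a i * d i * R x i i) / of_nat N))"
proof -
  have *: "d i - R x i i = d i * ((\<Sum>j<N. of_real (wt j) * (\<Sum>k<n. cnj (r x j k) * R x k i) * r x j i) - of_real (t i) * om * R x i i)"
    if i: "i < n" for i
  proof -
    have "kapp n (G x) (\<lambda>k. R x k i) i - z * R x i i = 1"
    proof -
      let ?e = "\<lambda>k. if k = i then 1 else (0::complex)"
      have "kapp n (R x) ?e k = R x k i" for k using i by (rule knorm_kapp_unit)
      hence eq: "kapp n (R x) ?e = (\<lambda>k. R x k i)" by auto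
      have "kapp n (G x) (kapp n (R x) ?e) i - z * kapp n (R x) ?e i = ?e i"
        using res[of x] i unfolding is_resolvent_def by blast
      thus ?thesis unfolding eq by simp
    qed
    hence "(\<Sum>j<N. of_real (wt j) * (\<Sum>k<n. cnj (r x j k) * R x k i) * r x j i) = 1 + z * R x i i"
      unfolding G_def kapp_kgram kip_def by (simp add: algebra_simps)
    hence "d i * ((\<Sum>j<N. of_real (wt j) * (\<Sum>k<n. cnj (r x j k) * R x k i) * r x j i) - of_real (t i) * om * R x i i)
       = d i * (1 - (of_real (t i) * om - z) * R x i i)" by (simp add: algebra_simps)
    also have "\<dots> = d i - R x i i"
      using shifted_denominator(2)[OF z Im_om, of "t i"] t[OF i] by (simp add: d_def field_simps)
    finally show ?thesis by simp
  qed
  have "(\<Sum>i<n. a i * (d i - R x i i))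
    = (\<Sum>i<n. (\<Sum>j<N. of_real (wt j) * ((\<Sum>k<n. cnj (r x j k) * R x k i) * (a i * d i * r x j i)))
        - om * (of_real (t i) * a i * d i * R x i i))"
    by (intro sum.cong refl) (simp add: * sum_distrib_left right_diff_distrib mult_ac)
  also have "\<dots> = (\<Sum>j<N. of_real (wt j) * (\<Sum>i<n. (\<Sum>k<n. cnj (r x j k) * R x k i) * (a i * d i * r x j i)))
       - om * (\<Sum>i<n. of_real (t i) * a i * d i * R x i i)"
    unfolding sum_subtractf sum_distrib_left by (subst sum.swap) (rule refl)
  also have "om * (\<Sum>i<n. of_real (t i) * a i * d i * R x i i)
     = (\<Sum>j<N. of_real (w j) / (1 + of_real (w j) * \<gamma>) * ((\<Sum>i<n. of_real (t i) * a i * d i * R x i i) / of_nat N))"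
    unfolding om_def sum_distrib_right[symmetric] by simp
  finally show ?thesis unfolding kip_kapp_sum sum_subtractf .
qed

end

context matrix_model begin

text \<open>For \<open>a = 1\<close> these are \<open>b\<close> and \<open>g'\<close>. General
  weights occur because the deviation of the diagonal is tested against
  \<open>a i * d i\<close>.\<close>

definition "bilin a j x = kip n (r x j) (kapp n (R' j x) (\<lambda>i. a i * r x j i)) / of_nat N" for a :: "nat \<Rightarrow> complex" and j x
definition "trc a j x = (\<Sum>i<n. of_real (t i) * a i * R' j x i i) / of_nat N" for a :: "nat \<Rightarrow> complex" and j x

lemma R'_independent:
  assumes "\<And>k. k \<noteq> j \<Longrightarrow> x k = y k"
  shows "R' j x = R' j y"
  unfolding R'_def by (rule smk_cong) (auto simp: r_def assms fun_eq_iff split: if_splits)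

text \<open>Column \<open>j\<close> is integrated first with the others fixed. Then
  \<open>R' j\<close> is constant and \<open>QF\<close> applies to
  \<open>diag(sqrt t) R' diag(sqrt t a)\<close>, a kernel with bound
  \<open>K * C / v\<close>.\<close>

lemma bilin_trc_L1:
  assumes j: "j < N" and a: "\<And>i. i < n \<Longrightarrow> cmod (a i) \<le> C" and C: "0 < C"
  shows "integrable P (\<lambda>x. cmod (bilin a j x - trc a j x))"
    "(\<integral>x. cmod (bilin a j x - trc a j x) \<partial>P) \<le> \<epsilon> * (real n / real N) * (K * C / v)"
proof -
  let ?q = "\<lambda>i. complex_of_real (sqrt (t i))"
  define A where "A x = kmul n (kdiag ?q) (kmul n (R' j x) (kdiag (\<lambda>i. ?q i * a i)))" for x
  have sqrt_le: "cmod (?q i) \<le> sqrt K" if "i < n" for i using t[OF that] by simp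
  have Ab: "kbounded n (K * C / v) (A x)" for x
  proof -
    have "kbounded n (sqrt K * (1 / v * (sqrt K * C))) (A x)"
      unfolding A_def
      by (intro kbounded_kmul kbounded_kdiag R'_bounded)
         (use sqrt_le a C K0 in \<open>auto simp: norm_mult intro!: mult_mono\<close>)
    moreover have "sqrt K * (1 / v * (sqrt K * C)) = (sqrt K * sqrt K) * C / v" by simp
    hence "sqrt K * (1 / v * (sqrt K * C)) = K * C / v" using K0 real_sqrt_mult_self[of K] by (simp only: abs_of_nonneg)
    ultimately show ?thesis by (simp only:)
  qed
  have Ae: "A x i k = ?q i * R' j x i k * (?q k * a k)" if "i < n" "k < n" for x i k
    unfolding A_def using that by (simp add: kmul_kdiag_left kmul_kdiag_right mult.assoc)
  have trA: "ktr n (A x) = (\<Sum>i<n. of_real (t i) * a i * R' j x i i)" for x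
    unfolding ktr_def
  proof (rule sum.cong[OF refl])
    fix i assume "i \<in> {..<n}"
    hence "A x i i = (?q i * ?q i) * a i * R' j x i i" by (simp add: Ae)
    also have "?q i * ?q i = of_real (t i)"
      using t[of i] \<open>i \<in> {..<n}\<close> by (simp flip: of_real_mult)
    finally show "A x i i = of_real (t i) * a i * R' j x i i" .
  qed
  have kipA: "kip n (Y (x j)) (kapp n (A x) (Y (x j))) = kip n (r x j) (kapp n (R' j x) (\<lambda>i. a i * r x j i))" for x
    unfolding kip_def kapp_def r_def
    by (intro sum.cong refl) (simp add: Ae sum_distrib_left mult_ac)
  define F where "F x = cmod (kip n (Y (x j)) (kapp n (A x) (Y (x j))) - ktr n (A x))" for x
  have F: "cmod (bilin a j x - trc a j x) = F x / real N" for x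
    unfolding F_def kipA trA bilin_def trc_def diff_divide_distrib[symmetric] by (simp add: norm_divide)
  have Fm: "F \<in> borel_measurable P"
    unfolding F_def[abs_def] kipA trA
    by (intro measurable_compose[OF _ borel_measurable_norm] borel_measurable_diff kip_measurable kapp_measurable borel_measurable_sum
       borel_measurable_times borel_measurable_const r_measurable R'_measurable j) auto
  let ?J = "{..<N} - {j}"
  have ins: "{..<N} = insert j ?J" using j by auto
  have upd: "F (x(j := y)) = cmod (kip n (Y y) (kapp n (A x) (Y y)) - ktr n (A x))" for x y
  proof -
    have "R' j (x(j := y)) = R' j x" by (rule R'_independent) auto
    hence "A (x(j := y)) = A x" unfolding A_def by simp
    thus ?thesis unfolding F_def by simp
  qed
  have C0: "0 < K * C / v" using K C z by simp
  have "(\<integral>\<^sup>+x. ennreal (F x) \<partial>P) = (\<integral>\<^sup>+x. (\<integral>\<^sup>+y. ennreal (F (x(j := y))) \<partial>\<nu>) \<partial>PiM ?J (\<lambda>_. \<nu>))"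
    using Fm ins by (subst ins, intro PP.product_nn_integral_insert) auto
  also have "\<dots> \<le> (\<integral>\<^sup>+x. ennreal (\<epsilon> * real n * (K * C / v)) \<partial>PiM ?J (\<lambda>_. \<nu>))"
  proof (rule nn_integral_mono)
    fix x
    have "(\<integral>\<^sup>+y. ennreal (F (x(j := y))) \<partial>\<nu>) = ennreal (\<integral>y. cmod (kip n (Y y) (kapp n (A x) (Y y)) - ktr n (A x)) \<partial>\<nu>)"
      unfolding upd using QF[OF C0 Ab[of x]] by (intro nn_integral_eq_integral) auto
    also have "\<dots> \<le> ennreal (\<epsilon> * real n * (K * C / v))" using QF[OF C0 Ab[of x]] by (intro ennreal_leI) simp
    finally show "(\<integral>\<^sup>+y. ennreal (F (x(j := y))) \<partial>\<nu>) \<le> ennreal (\<epsilon> * real n * (K * C / v))" .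
  qed
  also have "\<dots> = ennreal (\<epsilon> * real n * (K * C / v))"
  proof -
    interpret Q: prob_space "PiM ?J (\<lambda>_. \<nu>)" by (rule prob_space_PiM) (rule \<nu>)
    show ?thesis by (simp add: Q.emeasure_space_1)
  qed
  finally have nn: "(\<integral>\<^sup>+x. ennreal (F x) \<partial>P) \<le> ennreal (\<epsilon> * real n * (K * C / v))" .
  have Fi: "integrable P F"
    using Fm le_less_trans[OF nn ennreal_less_top] by (intro integrableI_bounded) (auto simp: F_def)
  have F0: "0 \<le> F x" for x by (simp add: F_def)
  have "ennreal (\<integral>x. F x \<partial>P) \<le> ennreal (\<epsilon> * real n * (K * C / v))"
    using nn nn_integral_eq_integral[OF Fi] F0 by simp
  moreover have "0 \<le> \<epsilon> * real n * (K * C / v)" using \<epsilon> C0 by (intro mult_nonneg_nonneg) auto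
  ultimately have FI: "(\<integral>x. F x \<partial>P) \<le> \<epsilon> * real n * (K * C / v)"
    by (simp only: ennreal_le_iff)
  show "integrable P (\<lambda>x. cmod (bilin a j x - trc a j x))" unfolding F using Fi by simp
  have "(\<integral>x. F x \<partial>P) / real N \<le> \<epsilon> * real n * (K * C / v) / real N" using FI by (rule divide_right_mono) simp
  thus "(\<integral>x. cmod (bilin a j x - trc a j x) \<partial>P) \<le> \<epsilon> * (real n / real N) * (K * C / v)"
    unfolding F using Fi by (simp add: mult_ac)
qed

lemma ktr_kdiag: "ktr n (kmul n (kdiag c) A) = (\<Sum>i<n. c i * A i i)"
  unfolding ktr_def by (intro sum.cong) (auto simp: kmul_kdiag_left)

lemma trc_change:
  assumes "j < N" "\<And>i. i < n \<Longrightarrow> cmod (a i) \<le> C" "0 \<le> C"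
  shows "cmod ((\<Sum>i<n. of_real (t i) * a i * R x i i) / of_nat N - trc a j x) \<le> K * C / (v * real N)"
proof -
  have "kbounded n (K * C) (kdiag (\<lambda>i. of_real (t i) * a i))"
    by (rule kbounded_kdiag) (use t assms K0 in \<open>auto simp: norm_mult intro!: mult_mono\<close>)
  from ktr_kmul_smk_weight_bound[OF z this assms(1), of wt "r x" 0]
  have "cmod ((\<Sum>i<n. of_real (t i) * a i * R x i i) - (\<Sum>i<n. of_real (t i) * a i * R' j x i i)) \<le> K * C / v"
    unfolding ktr_kdiag R_def R'_def by simp
  thus ?thesis
    unfolding trc_def diff_divide_distrib[symmetric] norm_divide
    using N by (simp add: divide_right_mono field_simps)
qed

lemma mcdiarmid_difference:
  assumes "\<And>i. i < n \<Longrightarrow> cmod (a i) \<le> C" "0 \<le> C"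
  shows "cmod ((\<Sum>i<n. a i * R x i i) - (\<Sum>i<n. a i * R (x(j := y)) i i)) \<le> 2 * C / v"
proof -
  have "r (x(j := y)) = (r x)(j := (\<lambda>i. of_real (sqrt (t i)) * Y y i))"
    unfolding r_def by (auto simp: fun_eq_iff)
  thus ?thesis
    using ktr_kmul_smk_column_bound[OF z kbounded_kdiag[of n a C, OF assms], where w = wt and r = "r x" and J = N and j = j
      and q = "\<lambda>i. of_real (sqrt (t i)) * Y y i"]
    unfolding ktr_kdiag R_def by simp
qed

text \<open>One column moves \<open>g\<close> by at most \<open>2 * K / (v * real N)\<close>. Then
  \<open>mcdiarmid_L1\<close> gives \<open>8 * K / (v * sqrt (real N))\<close> for the real part and
  the same for the imaginary part.\<close>

lemma g_concentration: "(\<integral>x. cmod (\<gamma> - g x) \<partial>P) \<le> 16 * K / (v * sqrt (real N))"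
proof -
  let ?c = "2 * K / (v * real N)"
  have c: "0 < ?c" using K z N by simp
  have d: "cmod (g x - g (x(j := y))) \<le> ?c" for x j y
  proof -
    have "cmod ((\<Sum>i<n. of_real (t i) * R x i i) - (\<Sum>i<n. of_real (t i) * R (x(j := y)) i i)) \<le> 2 * K / v"
      by (rule mcdiarmid_difference) (use t K0 in auto)
    thus ?thesis unfolding g_def diff_divide_distrib[symmetric] norm_divide
      using N by (simp add: divide_right_mono field_simps)
  qed
  have cN: "4 * ?c * sqrt (real N) = 8 * K / (v * sqrt (real N))"
    using N z by (simp add: field_simps real_sqrt_mult_self)
  have b: "\<bar>Re (g x)\<bar> \<le> real n / real N * K / v" "\<bar>Im (g x)\<bar> \<le> real n / real N * K / v" for x
    using order_trans[OF abs_Re_le_cmod g_bound] order_trans[OF abs_Im_le_cmod g_bound] by auto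
  have d': "\<bar>Re (g x) - Re (g (x(j := y)))\<bar> \<le> ?c" "\<bar>Im (g x) - Im (g (x(j := y)))\<bar> \<le> ?c" for x j y
    using order_trans[OF abs_Re_le_cmod d] order_trans[OF abs_Im_le_cmod d] by auto
  have re: "(\<integral>x. \<bar>Re (g x) - (\<integral>x. Re (g x) \<partial>P)\<bar> \<partial>P) \<le> 4 * ?c * sqrt (real (card {..<N}))"
    by (rule mcdiarmid_L1[OF \<nu> _ _ c, where B = "real n / real N * K / v"])
       (use N g_measurable b(1) d'(1) in auto)
  have im: "(\<integral>x. \<bar>Im (g x) - (\<integral>x. Im (g x) \<partial>P)\<bar> \<partial>P) \<le> 4 * ?c * sqrt (real (card {..<N}))"
    by (rule mcdiarmid_L1[OF \<nu> _ _ c, where B = "real n / real N * K / v"])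
       (use N g_measurable b(2) d'(2) in auto)
  have \<gamma>: "Re \<gamma> = (\<integral>x. Re (g x) \<partial>P)" "Im \<gamma> = (\<integral>x. Im (g x) \<partial>P)"
    unfolding \<gamma>_def using g_integrable by simp_all
  have "(\<integral>x. cmod (\<gamma> - g x) \<partial>P) \<le> (\<integral>x. \<bar>Re (g x) - Re \<gamma>\<bar> + \<bar>Im (g x) - Im \<gamma>\<bar> \<partial>P)"
  proof (rule integral_mono)
    show "cmod (\<gamma> - g x) \<le> \<bar>Re (g x) - Re \<gamma>\<bar> + \<bar>Im (g x) - Im \<gamma>\<bar>" for x
      using cmod_le[of "g x - \<gamma>"] by (simp add: norm_minus_commute)
  qed (use g_integrable in auto)
  also have "\<dots> = (\<integral>x. \<bar>Re (g x) - Re \<gamma>\<bar> \<partial>P) + (\<integral>x. \<bar>Im (g x) - Im \<gamma>\<bar> \<partial>P)"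
    by (rule Bochner_Integration.integral_add) (use g_integrable in auto)
  also have "\<dots> \<le> 16 * K / (v * sqrt (real N))"
    using re im unfolding \<gamma> card_lessThan cN by simp
  finally show ?thesis .
qed

text \<open>The bound on one column's summand, integrated term by term: concentration of the form
  (factor \<epsilon>), rank one changes of traces (order \<open>1 / N\<close>), fluctuation of
  \<open>g\<close> (order \<open>1 / sqrt N\<close>). For fixed \<open>K\<close> and bounded
  \<open>n / N\<close> it tends to a multiple of \<epsilon> as \<open>N\<close> grows.\<close>

definition "err = K * (\<zeta> * (\<epsilon> * (real n / real N) * (K * (K / v) / v)) + \<zeta> * (K * (K / v) / (v * real N))
   + real n / real N * (K * (K / v)) / v * (K * \<zeta>\<^sup>2 * (16 * K / (v * sqrt (real N)) + K / (v * real N) + \<epsilon> * (real n / real N) * (K / v))))"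


end

lemma norm_triangle3: "cmod (x + y + u) \<le> cmod x + cmod y + cmod u"
  using norm_triangle_ineq[of "x + y" u] norm_triangle_ineq[of x y] by linarith

text \<open>In use, \<open>e\<close> is a form in column \<open>j\<close>, \<open>s\<close> its
  trace with the column removed, \<open>q\<close> the trace with all columns, and \<open>B\<close>,
  \<open>C\<close> are the random and the deterministic denominator.\<close>

lemma fraction_difference:
  fixes B C :: complex
  assumes "B \<noteq> 0" "C \<noteq> 0"
  shows "e / B - q / C = (1 / B) * (e - s) + (1 / B) * (s - q) + q * ((1 / B) * (1 / C) * (C - B))"
  using assms by (simp add: field_simps)

context matrix_model begin

text \<open>Applied twice: with \<open>a = t\<close> it closes the system for \<gamma> and
  \<open>om\<close>, and with \<open>a = 1\<close> it evaluates the normalised trace.\<close>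

lemma deterministic_equivalent:
  assumes a: "\<And>i. i < n \<Longrightarrow> cmod (a i) \<le> K"
  shows "cmod ((\<integral>x. (\<Sum>i<n. a i * R x i i) / of_nat N \<partial>P) - (\<Sum>i<n. a i * d i) / of_nat N) \<le> err"
proof -
  let ?u = "\<lambda>i. a i * d i"
  have ub: "cmod (?u i) \<le> K / v" if "i < n" for i
    using mult_mono[OF a[OF that] d_bound[OF that]] K0 by (simp add: norm_mult)
  have Kv: "0 < K / v" using K z by simp
  define q where "q x = (\<Sum>i<n. of_real (t i) * a i * d i * R x i i) / of_nat N" for x
  have qb: "cmod (q x) \<le> real n / real N * (K * (K / v)) / v" for x
    unfolding q_def
  proof (rule weighted_trace_bound)
    show "0 \<le> K * (K / v)" by (rule mult_nonneg_nonneg[OF K0 less_imp_le[OF Kv]])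
    fix i assume i: "i < n"
    have "cmod (of_real (t i) * ?u i) \<le> K * (K / v)"
      unfolding norm_mult[of "of_real (t i)"] by (rule mult_mono[OF _ ub[OF i]]) (use t[OF i] K0 in auto)
    thus "cmod (of_real (t i) * a i * d i) \<le> K * (K / v)" by (simp only: mult.assoc)
  qed
  \<comment> \<open>The summand of column \<open>j\<close> in \<open>sum_diagonal_deviation\<close>
    after \<open>kip_removed_column\<close>, up to the factor \<open>1 / N\<close>, which
    \<open>bilin\<close> and \<open>q\<close> already contain.\<close>
  define T where "T j x = of_real (w j) * (bilin ?u j x / (1 + of_real (w j) * b j x) - q x / (1 + of_real (w j) * \<gamma>))" for j x
  have \<zeta>0: "0 \<le> \<zeta>" using z by simp
  have trc1: "trc (\<lambda>_. 1) j x = g' j x" for j x unfolding trc_def g'_def by simp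
  have bilin1: "bilin (\<lambda>_. 1) j x = b j x" for j x unfolding bilin_def b_def by simp
  define bd where "bd j x = K * (\<zeta> * cmod (bilin ?u j x - trc ?u j x) + \<zeta> * (K * (K / v) / (v * real N))
      + real n / real N * (K * (K / v)) / v * (K * \<zeta>\<^sup>2 * (cmod (\<gamma> - g x) + K / (v * real N) + cmod (bilin (\<lambda>_. 1) j x - trc (\<lambda>_. 1) j x))))" for j x
  have Tb: "cmod (T j x) \<le> bd j x" if j: "j < N" for j x
  proof -
    let ?B = "1 + of_real (w j) * b j x" and ?\<Gamma> = "1 + of_real (w j) * \<gamma>"
    have wj: "0 \<le> w j" "w j \<le> K" using w[OF j] by auto
    have nz: "?B \<noteq> 0" "?\<Gamma> \<noteq> 0"
      using denominator_bound(2)[OF z Im_zb wj(1)] denominator_bound(2)[OF z Im_z\<gamma> wj(1)] by auto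
    have inv: "cmod (1 / ?B) \<le> \<zeta>" "cmod (1 / ?\<Gamma>) \<le> \<zeta>"
      using denominator_bound(3)[OF z Im_zb wj(1)] denominator_bound(3)[OF z Im_z\<gamma> wj(1)] by auto
    have eq: "T j x = of_real (w j) * ((1 / ?B) * (bilin ?u j x - trc ?u j x) + (1 / ?B) * (trc ?u j x - q x)
        + q x * (of_real (w j) * ((1 / ?B) * (1 / ?\<Gamma>)) * (\<gamma> - b j x)))"
    proof -
      have "?\<Gamma> - ?B = of_real (w j) * (\<gamma> - b j x)" by (simp add: algebra_simps)
      thus ?thesis unfolding T_def fraction_difference[OF nz, of "bilin ?u j x" "q x" "trc ?u j x"] by (simp add: mult_ac)
    qed
    have "cmod (T j x) \<le> K * (\<zeta> * cmod (bilin ?u j x - trc ?u j x) + \<zeta> * (K * (K / v) / (v * real N))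
        + real n / real N * (K * (K / v)) / v * (K * (\<zeta> * \<zeta>) * (cmod (\<gamma> - g x) + K / (v * real N) + cmod (g' j x - b j x))))"
    proof -
      have 1: "cmod ((1 / ?B) * (bilin ?u j x - trc ?u j x)) \<le> \<zeta> * cmod (bilin ?u j x - trc ?u j x)"
        unfolding norm_mult by (intro mult_right_mono inv) simp
      have 2: "cmod ((1 / ?B) * (trc ?u j x - q x)) \<le> \<zeta> * (K * (K / v) / (v * real N))"
        unfolding norm_mult proof (intro mult_mono inv \<zeta>0)
          show "cmod (trc ?u j x - q x) \<le> K * (K / v) / (v * real N)"
            using trc_change[OF j ub less_imp_le[OF Kv], where x = x]
            unfolding q_def mult.assoc by (subst norm_minus_commute) (simp only: mult.assoc)
        qed simp
      \<comment> \<open>The mean is replaced by \<open>g\<close> (bounded differences),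
        \<open>g\<close> by \<open>g'\<close> (rank one change) and \<open>g'\<close> by the form
        \<open>b\<close> (\<open>QF\<close>).\<close>
      have 3: "cmod (\<gamma> - b j x) \<le> cmod (\<gamma> - g x) + K / (v * real N) + cmod (g' j x - b j x)"
      proof -
        have "cmod (g x - g' j x) \<le> K / (v * real N)"
          using trc_change[OF j, of "\<lambda>_. 1" 1 x] unfolding trc1 by (simp add: g_def)
        thus ?thesis using norm_triangle3[of "\<gamma> - g x" "g x - g' j x" "g' j x - b j x"] by simp
      qed
      have 4: "cmod (q x * (of_real (w j) * ((1 / ?B) * (1 / ?\<Gamma>)) * (\<gamma> - b j x)))
         \<le> real n / real N * (K * (K / v)) / v * (K * (\<zeta> * \<zeta>) * (cmod (\<gamma> - g x) + K / (v * real N) + cmod (g' j x - b j x)))"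
      proof -
        have i: "cmod ((1 / ?B) * (1 / ?\<Gamma>)) \<le> \<zeta> * \<zeta>" unfolding norm_mult by (intro mult_mono inv \<zeta>0) simp
        have ii: "cmod (of_real (w j) * ((1 / ?B) * (1 / ?\<Gamma>))) \<le> K * (\<zeta> * \<zeta>)"
          unfolding norm_mult[of "of_real (w j)"] using wj K0 by (intro mult_mono i) auto
        have iii: "cmod (of_real (w j) * ((1 / ?B) * (1 / ?\<Gamma>)) * (\<gamma> - b j x)) \<le> K * (\<zeta> * \<zeta>) * (cmod (\<gamma> - g x) + K / (v * real N) + cmod (g' j x - b j x))"
          unfolding norm_mult[of "_ * _" "\<gamma> - b j x"] using K0 \<zeta>0 by (intro mult_mono ii 3) auto
        show ?thesis unfolding norm_mult[of "q x"]
          by (rule mult_mono[OF qb iii]) (use Kv z K0 in auto)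
      qed
      show ?thesis unfolding eq norm_mult[of "of_real (w j)"]
      proof (rule mult_mono)
        show "cmod ((1 / ?B) * (bilin ?u j x - trc ?u j x) + (1 / ?B) * (trc ?u j x - q x)
            + q x * (of_real (w j) * ((1 / ?B) * (1 / ?\<Gamma>)) * (\<gamma> - b j x)))
          \<le> \<zeta> * cmod (bilin ?u j x - trc ?u j x) + \<zeta> * (K * (K / v) / (v * real N))
            + real n / real N * (K * (K / v)) / v * (K * (\<zeta> * \<zeta>) * (cmod (\<gamma> - g x) + K / (v * real N) + cmod (g' j x - b j x)))"
          by (rule order_trans[OF norm_triangle3]) (intro add_mono 1 2 4)
      qed (use wj K0 in simp_all)
    qed
    thus ?thesis unfolding bd_def trc1 bilin1 power2_eq_square by (simp add: norm_minus_commute)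
  qed
  have qm: "q \<in> borel_measurable P"
    unfolding q_def by (intro borel_measurable_divide borel_measurable_sum borel_measurable_times borel_measurable_const R_measurable) auto
  have dev: "(\<Sum>i<n. a i * (d i - R x i i)) = (\<Sum>j<N. T j x)" for x
    unfolding sum_diagonal_deviation
  proof (rule sum.cong[OF refl])
    fix j assume "j \<in> {..<N}"
    hence j: "j < N" by simp
    show "of_real (wt j) * kip n (r x j) (kapp n (R x) (\<lambda>i. a i * d i * r x j i))
        - of_real (w j) / (1 + of_real (w j) * \<gamma>) * ((\<Sum>i<n. of_real (t i) * a i * d i * R x i i) / of_nat N) = T j x"
      unfolding kip_removed_column[OF j] T_def bilin_def q_def wt_def by (simp add: algebra_simps)
  qed
  have bdi: "integrable P (bd j)" if "j < N" for j
    unfolding bd_def using bilin_trc_L1(1)[OF that ub Kv] bilin_trc_L1(1)[OF that, of "\<lambda>_. 1" 1] g_integrable by simp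
  have bdI: "(\<integral>x. bd j x \<partial>P) \<le> err" if j: "j < N" for j
  proof -
    have "(\<integral>x. bd j x \<partial>P) = K * (\<zeta> * (\<integral>x. cmod (bilin ?u j x - trc ?u j x) \<partial>P) + \<zeta> * (K * (K / v) / (v * real N))
      + real n / real N * (K * (K / v)) / v * (K * \<zeta>\<^sup>2 * ((\<integral>x. cmod (\<gamma> - g x) \<partial>P) + K / (v * real N) + (\<integral>x. cmod (bilin (\<lambda>_. 1) j x - trc (\<lambda>_. 1) j x) \<partial>P))))"
      unfolding bd_def using bilin_trc_L1(1)[OF that ub Kv] bilin_trc_L1(1)[OF that, of "\<lambda>_. 1" 1] g_integrable
      by (simp add: P.prob_space)
    also have "\<dots> \<le> err"
      unfolding err_def
      using bilin_trc_L1(2)[OF that ub Kv] bilin_trc_L1(2)[OF that, of "\<lambda>_. 1" 1] g_concentration K0 \<zeta>0 Kv z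
      by (intro mult_left_mono add_mono order_refl) auto
    finally show ?thesis .
  qed
  let ?S = "\<lambda>x. (\<Sum>i<n. a i * R x i i) / of_nat N"
  have Si: "integrable P ?S"
    by (rule bounded_integrable[OF P.prob_space_axioms _ weighted_trace_bound[OF a K0]])
       (intro borel_measurable_divide borel_measurable_sum borel_measurable_times borel_measurable_const R_measurable, auto)
  have sbi: "integrable P (\<lambda>x. \<Sum>j<N. bd j x)"
    by (rule Bochner_Integration.integrable_sum) (simp add: bdi)
  have sbI: "(\<integral>x. (\<Sum>j<N. bd j x) \<partial>P) = (\<Sum>j<N. \<integral>x. bd j x \<partial>P)"
    by (rule Bochner_Integration.integral_sum) (simp add: bdi)
  have eq: "(\<integral>x. ?S x \<partial>P) - (\<Sum>i<n. a i * d i) / of_nat N = (\<integral>x. ?S x - (\<Sum>i<n. a i * d i) / of_nat N \<partial>P)"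
    using Si by (simp add: P.prob_space)
  have "cmod ((\<integral>x. ?S x \<partial>P) - (\<Sum>i<n. a i * d i) / of_nat N) \<le> (\<integral>x. cmod (?S x - (\<Sum>i<n. a i * d i) / of_nat N) \<partial>P)"
    unfolding eq by (rule integral_norm_bound)
  also have "\<dots> \<le> (\<integral>x. (\<Sum>j<N. bd j x) / real N \<partial>P)"
  proof (rule integral_mono)
    fix x
    have "cmod (?S x - (\<Sum>i<n. a i * d i) / of_nat N) = cmod (\<Sum>i<n. a i * (d i - R x i i)) / real N"
      unfolding diff_divide_distrib[symmetric] norm_divide right_diff_distrib sum_subtractf
      by (simp add: norm_minus_commute)
    also have "\<dots> \<le> (\<Sum>j<N. bd j x) / real N"
      unfolding dev by (intro divide_right_mono sum_norm_le Tb) auto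
    finally show "cmod (?S x - (\<Sum>i<n. a i * d i) / of_nat N) \<le> (\<Sum>j<N. bd j x) / real N" .
  qed (use Si sbi in auto)
  also have "\<dots> = (\<Sum>j<N. \<integral>x. bd j x \<partial>P) / real N" by (simp add: sbI)
  also have "\<dots> \<le> (\<Sum>j<N. err) / real N" by (intro divide_right_mono sum_mono bdI) auto
  also have "\<dots> = err" using N by simp
  finally show ?thesis .
qed

end

section \<open>The fixed point equation\<close>

definition solves_fp :: "real \<Rightarrow> real measure \<Rightarrow> real measure \<Rightarrow> complex \<Rightarrow> complex \<Rightarrow> bool" where
  "solves_fp c H D z w \<longleftrightarrow>
     (AE \<delta> in D. \<delta> \<noteq> 0 \<longrightarrow>
        (AE \<tau> in H. complex_of_real \<tau> * w - z \<noteq> 0) \<and>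
        integrable H (\<lambda>\<tau>. complex_of_real \<tau> / (complex_of_real \<tau> * w - z)) \<and>
        1 + complex_of_real (\<delta> * c) * (LINT \<tau>|H. complex_of_real \<tau> / (complex_of_real \<tau> * w - z)) \<noteq> 0) \<and>
     integrable D (\<lambda>\<delta>. complex_of_real \<delta> / (1 + complex_of_real (\<delta> * c) * (LINT \<tau>|H. complex_of_real \<tau> / (complex_of_real \<tau> * w - z)))) \<and>
     w = (LINT \<delta>|D. complex_of_real \<delta> / (1 + complex_of_real (\<delta> * c) * (LINT \<tau>|H. complex_of_real \<tau> / (complex_of_real \<tau> * w - z))))"

lemma solves_fixed_point_iff: "solves_fixed_point c H D z w = solves_fp c (interval_measure H) (interval_measure D) z w"
  unfolding solves_fixed_point_def solves_fp_def Let_def by simp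

text \<open>Stated with upper bounds \<open>p\<close>, \<open>q\<close> for the two integrals; a
  strict gap below \<open>p\<close> can then be carried through to the product, as the uniqueness
  proof requires.\<close>

lemma integral_mult_cauchy_schwarz:
  fixes f g :: "'a \<Rightarrow> complex"
  assumes f: "f \<in> borel_measurable M" and g: "g \<in> borel_measurable M"
    and i: "integrable M (\<lambda>x. (cmod (f x))\<^sup>2)" "integrable M (\<lambda>x. (cmod (g x))\<^sup>2)"
    and p: "(\<integral>x. (cmod (f x))\<^sup>2 \<partial>M) \<le> p" "(\<integral>x. (cmod (g x))\<^sup>2 \<partial>M) \<le> q" "0 < p" "0 < q"
  shows "integrable M (\<lambda>x. f x * g x)" "(cmod (\<integral>x. f x * g x \<partial>M))\<^sup>2 \<le> p * q"
proof -
  \<comment> \<open>The weight at which the two halves of the bound coincide.\<close>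
  define s where "s = sqrt (q / p)"
  have s: "0 < s" using p by (simp add: s_def)
  have b: "cmod (f x * g x) \<le> s / 2 * (cmod (f x))\<^sup>2 + 1 / (2 * s) * (cmod (g x))\<^sup>2" for x
  proof -
    have "0 \<le> (s * cmod (f x) - cmod (g x))\<^sup>2 / (2 * s)" using s by simp
    also have "\<dots> = s / 2 * (cmod (f x))\<^sup>2 + 1 / (2 * s) * (cmod (g x))\<^sup>2 - cmod (f x) * cmod (g x)"
      using s by (simp add: power2_eq_square field_simps)
    finally show ?thesis by (simp add: norm_mult)
  qed
  have bi: "integrable M (\<lambda>x. s / 2 * (cmod (f x))\<^sup>2 + 1 / (2 * s) * (cmod (g x))\<^sup>2)" using i by simp
  show int: "integrable M (\<lambda>x. f x * g x)"
    by (rule Bochner_Integration.integrable_bound[OF bi]) (use f g b in \<open>auto intro: order_trans[OF _ abs_ge_self]\<close>)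
  have "cmod (\<integral>x. f x * g x \<partial>M) \<le> (\<integral>x. cmod (f x * g x) \<partial>M)" by (rule integral_norm_bound)
  also have "\<dots> \<le> (\<integral>x. s / 2 * (cmod (f x))\<^sup>2 + 1 / (2 * s) * (cmod (g x))\<^sup>2 \<partial>M)"
    by (rule integral_mono[OF integrable_norm[OF int] bi b])
  also have "\<dots> = s / 2 * (\<integral>x. (cmod (f x))\<^sup>2 \<partial>M) + 1 / (2 * s) * (\<integral>x. (cmod (g x))\<^sup>2 \<partial>M)"
    using i by simp
  also have "\<dots> \<le> s / 2 * p + 1 / (2 * s) * q" using s p by (intro add_mono mult_left_mono) auto
  also have "\<dots> = sqrt (p * q)"
  proof -
    have "s * p = sqrt (p * q)" and "q / s = sqrt (p * q)"
      using p unfolding s_def by (simp_all add: real_sqrt_divide real_sqrt_mult field_simps)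
    thus ?thesis by simp
  qed
  finally have "(cmod (\<integral>x. f x * g x \<partial>M))\<^sup>2 \<le> (sqrt (p * q))\<^sup>2" by (rule power_mono) simp
  thus "(cmod (\<integral>x. f x * g x \<partial>M))\<^sup>2 \<le> p * q" using p by simp
qed

lemma integral_pos:
  fixes f :: "'a \<Rightarrow> real"
  assumes "integrable M f" "AE x in M. 0 \<le> f x" "\<not> (AE x in M. f x = 0)"
  shows "0 < (\<integral>x. f x \<partial>M)"
  using integral_nonneg_eq_0_iff_AE[OF assms(1,2)] integral_nonneg_AE[OF assms(2)] assms(3) by linarith

section \<open>Uniqueness of the solution\<close>

locale fixed_point =
  fixes c :: real and H D :: "real measure" and z :: complex
  assumes c: "0 < c" and HM: "real_distribution H" and DM: "real_distribution D"
    and H0: "AE \<tau> in H. 0 \<le> \<tau>" and D0: "AE \<delta> in D. 0 \<le> \<delta>" and D1: "integrable D (\<lambda>x. x)"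
    and z: "0 < Im z"
begin

sublocale H: real_distribution H by (rule HM)
sublocale D: real_distribution D by (rule DM)

abbreviation "v \<equiv> Im z"
abbreviation "\<zeta> \<equiv> cmod z / Im z"
definition "kr w \<tau> = complex_of_real \<tau> / (complex_of_real \<tau> * w - z)" for w and \<tau> :: real
definition "gg w = (\<integral>\<tau>. kr w \<tau> \<partial>H)" for w
definition "fr g \<delta> = complex_of_real \<delta> / (1 + complex_of_real (\<delta> * c) * g)" for g and \<delta> :: real

lemma solves_fp_alt: "solves_fp c H D z w \<longleftrightarrow>
    (AE \<delta> in D. \<delta> \<noteq> 0 \<longrightarrow> (AE \<tau> in H. complex_of_real \<tau> * w - z \<noteq> 0) \<and> integrable H (kr w) \<and>
        1 + complex_of_real (\<delta> * c) * gg w \<noteq> 0) \<and>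
     integrable D (fr (gg w)) \<and> w = (\<integral>\<delta>. fr (gg w) \<delta> \<partial>D)"
  unfolding solves_fp_def kr_def[abs_def] gg_def fr_def[abs_def] ..

lemma kr_measurable [measurable]: "kr w \<in> borel_measurable borel"
  and fr_measurable [measurable]: "fr g \<in> borel_measurable borel"
  unfolding kr_def[abs_def] fr_def[abs_def] by measurable

lemma Im_kr: "Im (kr w \<tau>) = \<tau> * (v - \<tau> * Im w) / (cmod (complex_of_real \<tau> * w - z))\<^sup>2"
  unfolding kr_def Im_divide cmod_power2 by (simp add: algebra_simps)

lemma Im_fr: "Im (fr g \<delta>) = - (\<delta>\<^sup>2 * c * Im g / (cmod (1 + complex_of_real (\<delta> * c) * g))\<^sup>2)"
  unfolding fr_def Im_divide cmod_power2 by (simp add: power2_eq_square mult.assoc)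

text \<open>If \<open>D\<close> or \<open>H\<close> is the point mass at 0, the strict inequalities
  of \<open>solution_properties\<close> fail, but the solution is explicit: 0 in the first case, the
  mean of \<open>D\<close> in the second.\<close>

lemma solution_degenerate_D:
  assumes "AE \<delta> in D. \<delta> = 0" "solves_fp c H D z w"
  shows "w = 0"
proof -
  have "w = (\<integral>\<delta>. fr (gg w) \<delta> \<partial>D)" using assms(2) solves_fp_alt by blast
  also have "\<dots> = (\<integral>\<delta>. 0 \<partial>D)"
    by (rule integral_cong_AE) (use assms(1) in \<open>auto simp: fr_def elim!: eventually_mono\<close>)
  finally show ?thesis by simp
qed

lemma gg_degenerate_H:
  assumes "AE \<tau> in H. \<tau> = 0"
  shows "gg w = 0"
proof -
  have "gg w = (\<integral>\<tau>. 0 \<partial>H)" unfolding gg_def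
    by (rule integral_cong_AE) (use assms in \<open>auto simp: kr_def elim!: eventually_mono\<close>)
  thus ?thesis by simp
qed

lemma solution_degenerate_H:
  assumes "AE \<tau> in H. \<tau> = 0" "solves_fp c H D z w"
  shows "w = (\<integral>\<delta>. complex_of_real \<delta> \<partial>D)"
  using assms(2) unfolding solves_fp_alt gg_degenerate_H[OF assms(1)] by (simp add: fr_def[abs_def])

text \<open>Let \<open>B\<close> and \<open>C\<close> be the integrals of the squared moduli of
  \<open>kr\<close> and \<open>fr\<close>. The imaginary part of the outer equation reads
  \<open>- Im w = c * Im (gg w) * C\<close>; that of the inner integral gives
  \<open>Im (gg w) > - Im w * B\<close>, the excess being \<open>v\<close> times the integral of
  \<tau> over the squared denominator. Together \<open>c * B * C < 1\<close>.\<close>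

lemma solution_properties:
  assumes nD: "\<not> (AE \<delta> in D. \<delta> = 0)" and nH: "\<not> (AE \<tau> in H. \<tau> = 0)"
    and sol: "solves_fp c H D z w" and Imw: "Im w \<le> 0"
  shows "Im w < 0" "integrable H (kr w)" "0 < Im (gg w)"
    "integrable H (\<lambda>\<tau>. (cmod (kr w \<tau>))\<^sup>2)"
    "integrable D (\<lambda>\<delta>. (cmod (fr (gg w) \<delta>))\<^sup>2)"
    "0 < (\<integral>\<delta>. (cmod (fr (gg w) \<delta>))\<^sup>2 \<partial>D)"
    "c * (\<integral>\<tau>. (cmod (kr w \<tau>))\<^sup>2 \<partial>H) * (\<integral>\<delta>. (cmod (fr (gg w) \<delta>))\<^sup>2 \<partial>D) < 1"
    "AE \<tau> in H. complex_of_real \<tau> * w - z \<noteq> 0"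
    "AE \<delta> in D. 1 + complex_of_real (\<delta> * c) * gg w \<noteq> 0"
proof -
  let ?X = "(AE \<tau> in H. complex_of_real \<tau> * w - z \<noteq> 0) \<and> integrable H (kr w)"
  have a: "AE \<delta> in D. \<delta> \<noteq> 0 \<longrightarrow> (AE \<tau> in H. complex_of_real \<tau> * w - z \<noteq> 0) \<and> integrable H (kr w) \<and> 1 + complex_of_real (\<delta> * c) * gg w \<noteq> 0"
    and fi: "integrable D (fr (gg w))" and weq: "w = (\<integral>\<delta>. fr (gg w) \<delta> \<partial>D)"
    using sol unfolding solves_fp_alt by auto
  \<comment> \<open>\<open>?X\<close> does not involve \<delta>: it holds as soon as the condition
    imposed for nonzero \<delta> is met at one such \<delta>.\<close>
  have "?X"
  proof (rule ccontr)
    assume "\<not> ?X"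
    hence "AE \<delta> in D. \<delta> = 0" using a by (auto elim!: eventually_mono)
    thus False using nD by simp
  qed
  hence nz: "AE \<tau> in H. complex_of_real \<tau> * w - z \<noteq> 0" and ki: "integrable H (kr w)" by auto
  show "integrable H (kr w)" by (rule ki)
  show "AE \<tau> in H. complex_of_real \<tau> * w - z \<noteq> 0" by (rule nz)
  have den: "AE \<delta> in D. 1 + complex_of_real (\<delta> * c) * gg w \<noteq> 0"
    using a by (auto elim!: eventually_mono)
  show "AE \<delta> in D. 1 + complex_of_real (\<delta> * c) * gg w \<noteq> 0" by (rule den)
  have Img: "Im (gg w) = (\<integral>\<tau>. Im (kr w \<tau>) \<partial>H)" unfolding gg_def using ki by simp
  have Imki: "integrable H (\<lambda>\<tau>. Im (kr w \<tau>))" using ki by simp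
  show gpos: "0 < Im (gg w)" unfolding Img
  proof (rule integral_pos[OF Imki])
    show "AE \<tau> in H. 0 \<le> Im (kr w \<tau>)"
      using H0 by eventually_elim (use z Imw in \<open>auto simp: Im_kr intro!: divide_nonneg_nonneg mult_nonneg_nonneg add_nonneg_nonneg simp: mult_nonneg_nonpos\<close>, smt (verit) mult_nonneg_nonpos)
    show "\<not> (AE \<tau> in H. Im (kr w \<tau>) = 0)"
    proof
      assume "AE \<tau> in H. Im (kr w \<tau>) = 0"
      hence "AE \<tau> in H. \<tau> = 0"
        using nz H0
      proof eventually_elim
        fix \<tau> assume h: "Im (kr w \<tau>) = 0" "complex_of_real \<tau> * w - z \<noteq> 0" "0 \<le> \<tau>"
        have "0 < v - \<tau> * Im w" using z Imw h(3) by (smt (verit) mult_nonneg_nonpos)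
        thus "\<tau> = 0" using h unfolding Im_kr by auto
      qed
      thus False using nH by simp
    qed
  qed
  have Imf: "Im w = (\<integral>\<delta>. Im (fr (gg w) \<delta>) \<partial>D)" using weq fi by (metis integral_Im)
  have sqf: "(cmod (fr (gg w) \<delta>))\<^sup>2 = \<delta>\<^sup>2 / (cmod (1 + complex_of_real (\<delta> * c) * gg w))\<^sup>2" for \<delta>
    unfolding fr_def by (simp add: norm_divide power_divide)
  have Imsq: "Im (fr (gg w) \<delta>) = - (c * Im (gg w)) * (cmod (fr (gg w) \<delta>))\<^sup>2" for \<delta>
    unfolding Im_fr sqf by simp
  have fi2: "integrable D (\<lambda>\<delta>. Im (fr (gg w) \<delta>))" using fi by simp
  \<comment> \<open>Square integrability of \<open>fr\<close>: its squared modulus is a multiple of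
    the imaginary part of an integrable function.\<close>
  have "(cmod (fr (gg w) \<delta>))\<^sup>2 = Im (fr (gg w) \<delta>) / (- (c * Im (gg w)))" for \<delta>
    using c gpos unfolding Imsq by simp
  thus fi3: "integrable D (\<lambda>\<delta>. (cmod (fr (gg w) \<delta>))\<^sup>2)" using fi2 by simp
  show Cpos: "0 < (\<integral>\<delta>. (cmod (fr (gg w) \<delta>))\<^sup>2 \<partial>D)"
  proof (rule integral_pos[OF fi3])
    show "\<not> (AE \<delta> in D. (cmod (fr (gg w) \<delta>))\<^sup>2 = 0)"
    proof
      assume "AE \<delta> in D. (cmod (fr (gg w) \<delta>))\<^sup>2 = 0"
      hence "AE \<delta> in D. \<delta> = 0" using den by eventually_elim (auto simp: fr_def)
      thus False using nD by simp
    qed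
  qed simp
  have u: "- Im w = c * Im (gg w) * (\<integral>\<delta>. (cmod (fr (gg w) \<delta>))\<^sup>2 \<partial>D)"
    unfolding Imf Imsq by simp
  show wneg: "Im w < 0" using u c gpos Cpos by (smt (verit) mult_pos_pos)
  have sqk: "(cmod (kr w \<tau>))\<^sup>2 = \<tau>\<^sup>2 / (cmod (complex_of_real \<tau> * w - z))\<^sup>2" for \<tau>
    unfolding kr_def by (simp add: norm_divide power_divide)
  have kb: "(cmod (kr w \<tau>))\<^sup>2 \<le> (1 / - Im w)\<^sup>2" if "0 \<le> \<tau>" for \<tau>
  proof (rule power_mono)
    have "\<tau> * - Im w \<le> \<bar>Im (complex_of_real \<tau> * w - z)\<bar>" using z by simp
    also have "\<dots> \<le> cmod (complex_of_real \<tau> * w - z)" by (rule abs_Im_le_cmod)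
    finally have *: "\<tau> * - Im w \<le> cmod (complex_of_real \<tau> * w - z)" .
    have "Im z \<le> cmod (complex_of_real \<tau> * w - z)" by (rule shifted_denominator(1)[OF z Imw that])
    hence "0 < cmod (complex_of_real \<tau> * w - z)" using z by linarith
    thus "cmod (kr w \<tau>) \<le> 1 / - Im w"
      unfolding kr_def norm_divide using * wneg that by (simp add: divide_simps mult.commute)
  qed simp
  show ki2: "integrable H (\<lambda>\<tau>. (cmod (kr w \<tau>))\<^sup>2)"
    by (rule H.integrable_const_bound[where B = "(1 / - Im w)\<^sup>2"])
       (use H0 in \<open>auto elim!: eventually_mono dest: kb\<close>)
  \<comment> \<open>This remainder is strictly positive off \<tau> = 0 and is the source of the
    strict inequality.\<close>
  have split: "Im (kr w \<tau>) - (- Im w) * (cmod (kr w \<tau>))\<^sup>2 = v * (\<tau> / (cmod (complex_of_real \<tau> * w - z))\<^sup>2)" for \<tau>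
    unfolding Im_kr sqk by (simp add: power2_eq_square diff_divide_distrib[symmetric] algebra_simps flip: add_divide_distrib)
  have "0 < (\<integral>\<tau>. Im (kr w \<tau>) - (- Im w) * (cmod (kr w \<tau>))\<^sup>2 \<partial>H)"
  proof (rule integral_pos)
    show "integrable H (\<lambda>\<tau>. Im (kr w \<tau>) - (- Im w) * (cmod (kr w \<tau>))\<^sup>2)" using Imki ki2 by simp
    show "AE \<tau> in H. 0 \<le> Im (kr w \<tau>) - (- Im w) * (cmod (kr w \<tau>))\<^sup>2"
      unfolding split using H0 by eventually_elim (use z in simp)
    show "\<not> (AE \<tau> in H. Im (kr w \<tau>) - (- Im w) * (cmod (kr w \<tau>))\<^sup>2 = 0)"
    proof
      assume "AE \<tau> in H. Im (kr w \<tau>) - (- Im w) * (cmod (kr w \<tau>))\<^sup>2 = 0"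
      hence "AE \<tau> in H. \<tau> = 0" unfolding split using nz by eventually_elim (use z in auto)
      thus False using nH by simp
    qed
  qed
  hence gB: "(- Im w) * (\<integral>\<tau>. (cmod (kr w \<tau>))\<^sup>2 \<partial>H) < Im (gg w)"
    using Imki ki2 unfolding Img by simp
  have "(- Im w) * (c * (\<integral>\<tau>. (cmod (kr w \<tau>))\<^sup>2 \<partial>H) * (\<integral>\<delta>. (cmod (fr (gg w) \<delta>))\<^sup>2 \<partial>D))
     = ((- Im w) * (\<integral>\<tau>. (cmod (kr w \<tau>))\<^sup>2 \<partial>H)) * (c * (\<integral>\<delta>. (cmod (fr (gg w) \<delta>))\<^sup>2 \<partial>D))" by simp
  also have "\<dots> < Im (gg w) * (c * (\<integral>\<delta>. (cmod (fr (gg w) \<delta>))\<^sup>2 \<partial>D))"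
    using gB c Cpos by (intro mult_strict_right_mono) auto
  also have "\<dots> = (- Im w) * 1" using u by simp
  finally show "c * (\<integral>\<tau>. (cmod (kr w \<tau>))\<^sup>2 \<partial>H) * (\<integral>\<delta>. (cmod (fr (gg w) \<delta>))\<^sup>2 \<partial>D) < 1"
    using wneg by (simp only: mult_less_cancel_left_pos neg_0_less_iff_less)
qed

text \<open>Subtracting the two equations gives \<open>w1 - w2 = c * (w1 - w2) * S * I\<close>,
  where \<open>S\<close> and \<open>I\<close> integrate the products of the two inner and of the two
  outer integrands. Cauchy-Schwarz and the bound \<open>c * B * C < 1\<close> at both solutions
  yield \<open>c * cmod S * cmod I < 1\<close>.\<close>

lemma fixed_point_unique:
  assumes s1: "solves_fp c H D z w1" "Im w1 \<le> 0" and s2: "solves_fp c H D z w2" "Im w2 \<le> 0"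
  shows "w1 = w2"
proof (cases "(AE \<delta> in D. \<delta> = 0) \<or> (AE \<tau> in H. \<tau> = 0)")
  case True
  thus ?thesis using solution_degenerate_D solution_degenerate_H s1 s2 by metis
next
  case False
  hence nd: "\<not> (AE \<delta> in D. \<delta> = 0)" "\<not> (AE \<tau> in H. \<tau> = 0)" by auto
  note p1 = solution_properties[OF nd s1] and p2 = solution_properties[OF nd s2]
  let ?B = "\<lambda>w. \<integral>\<tau>. (cmod (kr w \<tau>))\<^sup>2 \<partial>H" and ?C = "\<lambda>w. \<integral>\<delta>. (cmod (fr (gg w) \<delta>))\<^sup>2 \<partial>D"
  define S where "S = (\<integral>\<tau>. kr w1 \<tau> * kr w2 \<tau> \<partial>H)"
  define I where "I = (\<integral>\<delta>. fr (gg w1) \<delta> * fr (gg w2) \<delta> \<partial>D)"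
  \<comment> \<open>The largest value that \<open>solution_properties\<close> allows for the inner
    integral of squares; it is not attained.\<close>
  define p where "p w = 1 / (c * ?C w)" for w
  have pB: "?B w1 < p w1" "?B w2 < p w2" "0 < p w1" "0 < p w2"
    using p1(6,7) p2(6,7) c unfolding p_def by (auto simp: field_simps)
  have km: "kr w \<in> borel_measurable H" "fr g \<in> borel_measurable D" for w g
    using kr_measurable fr_measurable by simp_all
  have csH: "integrable H (\<lambda>\<tau>. kr w1 \<tau> * kr w2 \<tau>)" 
    using integral_mult_cauchy_schwarz(1)[OF km(1) km(1) p1(4) p2(4), of "p w1" "p w2"] pB by simp
  \<comment> \<open>A positive number strictly between the integral and \<open>p w1\<close>: it
    keeps the final inequality strict.\<close>
  define q where "q = (?B w1 + p w1) / 2"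
  have q: "?B w1 \<le> q" "0 < q" "q < p w1"
  proof -
    have "0 \<le> ?B w1" by simp
    thus "?B w1 \<le> q" "0 < q" "q < p w1" using pB(1,3) unfolding q_def by (simp_all add: add_nonneg_pos)
  qed
  have S2: "(cmod S)\<^sup>2 \<le> q * p w2"
    unfolding S_def using integral_mult_cauchy_schwarz(2)[OF km(1) km(1) p1(4) p2(4), of q "p w2"] pB q by simp
  have I2: "(cmod I)\<^sup>2 \<le> ?C w1 * ?C w2" and Ii: "integrable D (\<lambda>\<delta>. fr (gg w1) \<delta> * fr (gg w2) \<delta>)"
    unfolding I_def using integral_mult_cauchy_schwarz[OF km(2) km(2) p1(5) p2(5), of "?C w1" "?C w2"] p1(6) p2(6) by simp_all
  have w: "w1 = (\<integral>\<delta>. fr (gg w1) \<delta> \<partial>D)" "w2 = (\<integral>\<delta>. fr (gg w2) \<delta> \<partial>D)"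
    and fi: "integrable D (fr (gg w1))" "integrable D (fr (gg w2))"
    using s1 s2 unfolding solves_fp_alt by auto
  have "w1 - w2 = (\<integral>\<delta>. fr (gg w1) \<delta> - fr (gg w2) \<delta> \<partial>D)" using w fi by simp
  also have "\<dots> = (\<integral>\<delta>. of_real c * (gg w2 - gg w1) * (fr (gg w1) \<delta> * fr (gg w2) \<delta>) \<partial>D)"
  proof (rule integral_cong_AE)
    show "AE \<delta> in D. fr (gg w1) \<delta> - fr (gg w2) \<delta> = of_real c * (gg w2 - gg w1) * (fr (gg w1) \<delta> * fr (gg w2) \<delta>)"
      using p1(9) p2(9)
    proof eventually_elim
      fix \<delta> assume "1 + complex_of_real (\<delta> * c) * gg w1 \<noteq> 0" "1 + complex_of_real (\<delta> * c) * gg w2 \<noteq> 0"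
      thus "fr (gg w1) \<delta> - fr (gg w2) \<delta> = of_real c * (gg w2 - gg w1) * (fr (gg w1) \<delta> * fr (gg w2) \<delta>)"
        unfolding fr_def by (simp add: divide_simps) (simp add: algebra_simps)
    qed
  qed (use km in simp_all)
  also have "\<dots> = of_real c * (gg w2 - gg w1) * I" unfolding I_def by simp
  also have "gg w2 - gg w1 = (\<integral>\<tau>. kr w2 \<tau> - kr w1 \<tau> \<partial>H)"
    unfolding gg_def using p1(2) p2(2) by simp
  also have "\<dots> = (\<integral>\<tau>. (w1 - w2) * (kr w1 \<tau> * kr w2 \<tau>) \<partial>H)"
  proof (rule integral_cong_AE)
    show "AE \<tau> in H. kr w2 \<tau> - kr w1 \<tau> = (w1 - w2) * (kr w1 \<tau> * kr w2 \<tau>)"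
      using p1(8) p2(8)
    proof eventually_elim
      fix \<tau> assume "complex_of_real \<tau> * w1 - z \<noteq> 0" "complex_of_real \<tau> * w2 - z \<noteq> 0"
      thus "kr w2 \<tau> - kr w1 \<tau> = (w1 - w2) * (kr w1 \<tau> * kr w2 \<tau>)"
        unfolding kr_def by (simp add: divide_simps) (simp add: algebra_simps)
    qed
  qed (use km in simp_all)
  also have "\<dots> = (w1 - w2) * S" unfolding S_def by simp
  finally have eq: "w1 - w2 = of_real c * ((w1 - w2) * S) * I" .
  have "(c * cmod S * cmod I)\<^sup>2 = c\<^sup>2 * ((cmod S)\<^sup>2 * (cmod I)\<^sup>2)" by (simp add: power_mult_distrib)
  also have "\<dots> \<le> c\<^sup>2 * ((q * p w2) * (?C w1 * ?C w2))"
    using S2 I2 q pB by (intro mult_left_mono mult_mono) auto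
  also have "\<dots> < c\<^sup>2 * ((p w1 * p w2) * (?C w1 * ?C w2))"
    using q pB c p1(6) p2(6) by (intro mult_strict_left_mono mult_strict_right_mono) auto
  also have "\<dots> = 1" unfolding p_def using c p1(6) p2(6) by (simp add: power2_eq_square)
  finally have "c * cmod S * cmod I < 1"
    using power_less_imp_less_base[of "c * cmod S * cmod I" 2 1] by simp
  moreover have "cmod (w1 - w2) = (c * cmod S * cmod I) * cmod (w1 - w2)"
    using arg_cong[OF eq, of cmod] c by (simp add: norm_mult mult_ac)
  ultimately have "cmod (w1 - w2) = 0" by (smt (verit) mult_cancel_right1)
  thus ?thesis by simp
qed

end

text \<open>Values beyond \<open>K\<close> are moved to \<open>K\<close>, not to 0: the map is
  continuous, as weak convergence demands, and only the eigenvalues beyond \<open>K\<close> change,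
  as the rank inequalities demand.\<close>

definition cut :: "real \<Rightarrow> real \<Rightarrow> real" where
  "cut K x = max 0 (min x K)"

lemma cut_bounds: "0 \<le> cut K x" "0 \<le> K \<Longrightarrow> cut K x \<le> K" "0 \<le> x \<Longrightarrow> cut K x \<le> x" "0 \<le> x \<Longrightarrow> x \<le> K \<Longrightarrow> cut K x = x"
  unfolding cut_def by auto

lemma cut_continuous: "continuous_on A (cut K)"
  unfolding cut_def by (intro continuous_intros)

lemma cut_measurable [measurable]: "cut K \<in> borel_measurable borel"
  by (rule borel_measurable_continuous_onI[OF cut_continuous])

lemma cut_tendsto: "filterlim K at_top sequentially \<Longrightarrow> (\<lambda>k. cut (K k) x) \<longlonglongrightarrow> max 0 x"
proof (rule tendsto_eventually)
  assume "filterlim K at_top sequentially"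
  hence "eventually (\<lambda>k. x \<le> K k) sequentially" by (simp add: filterlim_at_top)
  thus "eventually (\<lambda>k. cut (K k) x = max 0 x) sequentially" by eventually_elim (auto simp: cut_def)
qed

lemma cut_tendsto_complex:
  assumes "filterlim K at_top sequentially" "0 \<le> x"
  shows "(\<lambda>k. complex_of_real (cut (K k) x)) \<longlonglongrightarrow> of_real x"
  using tendsto_of_real[OF cut_tendsto[OF assms(1), of x], where 'a = complex] assms(2) by (simp add: max_absorb2)

lemma weight_fraction_bound:
  assumes "0 < Im z" "0 \<le> Im (z * g)" "0 \<le> x"
  shows "cmod (of_real x / (1 + of_real x * g)) \<le> (cmod z / Im z) * x"
proof -
  have "cmod (of_real x / (1 + of_real x * g)) = x * cmod (1 / (1 + of_real x * g))"
    using assms(3) by (simp add: norm_divide)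
  also have "\<dots> \<le> x * (cmod z / Im z)" by (intro mult_left_mono denominator_bound(3) assms)
  finally show ?thesis by (simp add: mult.commute)
qed

lemma bounded_convergent_subsequence:
  fixes X :: "nat \<Rightarrow> complex"
  assumes "\<And>k. cmod (X k) \<le> C"
  obtains l s where "cmod l \<le> C" "strict_mono s" "(\<lambda>k. X (s k)) \<longlonglongrightarrow> l"
proof -
  have "seq_compact (cball (0::complex) C)" using compact_cball compact_imp_seq_compact by blast
  moreover have "\<forall>k. X k \<in> cball 0 C" using assms by simp
  ultimately obtain l s where "l \<in> cball 0 C" "strict_mono s" "(X \<circ> s) \<longlonglongrightarrow> l"
    by (rule seq_compactE)
  thus ?thesis using that[of l s] by (simp add: o_def)
qed

section \<open>Limits of solutions of the truncated equations\<close>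

context fixed_point begin

lemma measurable_D: "f \<in> borel_measurable borel \<Longrightarrow> f \<in> borel_measurable D"
  and measurable_H: "f \<in> borel_measurable borel \<Longrightarrow> f \<in> borel_measurable H"
  for f :: "real \<Rightarrow> complex"
  by simp_all

lemma integrable_\<zeta>: "integrable D (\<lambda>\<delta>. \<zeta> * \<delta>)"
  by (rule integrable_mult_right) (rule D1)

text \<open>The truncated equation as a system for \<omega> and \<gamma>, the latter including the
  factor \<open>c\<close>. The sign conditions are inherited from the finite resolvents and carry
  all denominator bounds in the limit.\<close>

definition cut_solution :: "real \<Rightarrow> complex \<Rightarrow> complex \<Rightarrow> bool" where
  "cut_solution K \<gamma> \<omega> \<longleftrightarrow> 0 \<le> Im \<gamma> \<and> 0 \<le> Im (z * \<gamma>) \<and>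
     \<omega> = (\<integral>\<delta>. of_real (cut K \<delta>) / (1 + of_real (cut K \<delta>) * \<gamma>) \<partial>D) \<and>
     \<gamma> = of_real c * (\<integral>\<tau>. of_real (cut K \<tau>) / (of_real (cut K \<tau>) * \<omega> - z) \<partial>H)"

lemma cut_solutionD:
  assumes "cut_solution K \<gamma> \<omega>"
  shows "0 \<le> Im \<gamma>" "0 \<le> Im (z * \<gamma>)"
    "\<omega> = (\<integral>\<delta>. of_real (cut K \<delta>) / (1 + of_real (cut K \<delta>) * \<gamma>) \<partial>D)"
    "\<gamma> = of_real c * (\<integral>\<tau>. of_real (cut K \<tau>) / (of_real (cut K \<tau>) * \<omega> - z) \<partial>H)"
  using assms unfolding cut_solution_def by blast+

lemma tendsto_subseq: "X \<longlonglongrightarrow> (l::'x::topological_space) \<Longrightarrow> strict_mono s \<Longrightarrow> (\<lambda>k. X (s k)) \<longlonglongrightarrow> l"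
  using LIMSEQ_subseq_LIMSEQ[of X l s] by (simp add: o_def)

lemma shifted_denominator_tendsto_integral:
  assumes w: "W \<longlonglongrightarrow> w" and Im: "\<And>k. Im (W k) \<le> 0" and K: "filterlim K at_top sequentially"
  shows "(\<lambda>k. \<integral>\<tau>. 1 / (complex_of_real (cut (K k) \<tau>) * W k - z) \<partial>H) \<longlonglongrightarrow> (\<integral>\<tau>. 1 / (complex_of_real \<tau> * w - z) \<partial>H)"
    "Im w \<le> 0"
proof -
  show Imw: "Im w \<le> 0"
    by (rule tendsto_upperbound[OF tendsto_Im[OF w]]) (use Im in auto)
  show "(\<lambda>k. \<integral>\<tau>. 1 / (complex_of_real (cut (K k) \<tau>) * W k - z) \<partial>H) \<longlonglongrightarrow> (\<integral>\<tau>. 1 / (complex_of_real \<tau> * w - z) \<partial>H)"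
  proof (rule integral_dominated_convergence[where w = "\<lambda>_. 1 / v"])
    show "AE \<tau> in H. (\<lambda>k. 1 / (complex_of_real (cut (K k) \<tau>) * W k - z)) \<longlonglongrightarrow> 1 / (complex_of_real \<tau> * w - z)"
      using H0
    proof eventually_elim
      fix \<tau> :: real assume t: "0 \<le> \<tau>"
      show "(\<lambda>k. 1 / (complex_of_real (cut (K k) \<tau>) * W k - z)) \<longlonglongrightarrow> 1 / (complex_of_real \<tau> * w - z)"
        by (intro tendsto_divide tendsto_diff tendsto_mult tendsto_const cut_tendsto_complex K t w
            shifted_denominator(2)[OF z Imw t])
    qed
    show "AE \<tau> in H. cmod (1 / (complex_of_real (cut (K k) \<tau>) * W k - z)) \<le> 1 / v" for k
      by (intro AE_I2 shifted_denominator(3)[OF z Im cut_bounds(1)])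
  qed (intro measurable_H, measurable)+
qed

text \<open>The bound on \<omega> is independent of \<open>K\<close>; the mean of \<open>D\<close>
  enters because clipping only decreases nonnegative values. This gives compactness in \<omega>,
  while \<gamma> has no such bound.\<close>

lemma cut_solution_bounds:
  assumes "cut_solution K \<gamma> \<omega>" "0 \<le> K"
  shows "Im \<omega> \<le> 0" "cmod \<omega> \<le> \<zeta> * (\<integral>x. x \<partial>D)"
proof -
  have \<gamma>: "0 \<le> Im \<gamma>" "0 \<le> Im (z * \<gamma>)"
    and \<omega>: "\<omega> = (\<integral>\<delta>. of_real (cut K \<delta>) / (1 + of_real (cut K \<delta>) * \<gamma>) \<partial>D)"
    by (rule cut_solutionD[OF assms(1)])+
  have b: "cmod (of_real (cut K \<delta>) / (1 + of_real (cut K \<delta>) * \<gamma>)) \<le> cut K \<delta> * \<zeta>" for \<delta>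
    using weight_fraction_bound[OF z \<gamma>(2) cut_bounds(1)[of K \<delta>]] by (simp add: mult.commute)
  have int: "integrable D (\<lambda>\<delta>. of_real (cut K \<delta>) / (1 + of_real (cut K \<delta>) * \<gamma>))"
  proof (rule D.integrable_const_bound[where B = "K * \<zeta>"])
    show "AE \<delta> in D. cmod (of_real (cut K \<delta>) / (1 + of_real (cut K \<delta>) * \<gamma>)) \<le> K * \<zeta>"
      by (intro AE_I2 order_trans[OF b] mult_right_mono cut_bounds assms) (use z in simp)
  qed simp
  have "Im \<omega> = (\<integral>\<delta>. Im (of_real (cut K \<delta>) / (1 + of_real (cut K \<delta>) * \<gamma>)) \<partial>D)"
    unfolding \<omega> using int by (rule integral_Im[symmetric])
  also have "\<dots> \<le> (\<integral>\<delta>. 0 \<partial>D)"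
    by (rule integral_mono) (use int Im_weight_div_nonpos[OF \<gamma>(1) cut_bounds(1)] in \<open>auto simp del: Im_divide_of_real\<close>)
  finally show "Im \<omega> \<le> 0" by simp
  have "cmod \<omega> \<le> (\<integral>\<delta>. cmod (of_real (cut K \<delta>) / (1 + of_real (cut K \<delta>) * \<gamma>)) \<partial>D)"
    unfolding \<omega> by (rule integral_norm_bound)
  also have "\<dots> \<le> (\<integral>\<delta>. \<zeta> * \<delta> \<partial>D)"
  proof (rule integral_mono_AE)
    show "AE \<delta> in D. cmod (of_real (cut K \<delta>) / (1 + of_real (cut K \<delta>) * \<gamma>)) \<le> \<zeta> * \<delta>"
      using D0
    proof eventually_elim
      fix \<delta> :: real assume "0 \<le> \<delta>"
      hence "cut K \<delta> * \<zeta> \<le> \<delta> * \<zeta>" using z by (intro mult_right_mono cut_bounds) auto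
      thus "cmod (of_real (cut K \<delta>) / (1 + of_real (cut K \<delta>) * \<gamma>)) \<le> \<zeta> * \<delta>"
        using b[of \<delta>] by (simp add: mult.commute)
    qed
  qed (use int integrable_\<zeta> in auto)
  finally show "cmod \<omega> \<le> \<zeta> * (\<integral>x. x \<partial>D)" by simp
qed

lemma omega_tendsto:
  assumes g: "g \<longlonglongrightarrow> \<gamma>" and Im: "\<And>k. 0 \<le> Im (z * g k)" and K: "filterlim K at_top sequentially"
  shows "(\<lambda>k. \<integral>\<delta>. of_real (cut (K k) \<delta>) / (1 + of_real (cut (K k) \<delta>) * g k) \<partial>D) \<longlonglongrightarrow> (\<integral>\<delta>. of_real \<delta> / (1 + of_real \<delta> * \<gamma>) \<partial>D)"
    "0 \<le> Im (z * \<gamma>)" "integrable D (\<lambda>\<delta>. of_real \<delta> / (1 + of_real \<delta> * \<gamma>))"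
proof -
  show Im\<gamma>: "0 \<le> Im (z * \<gamma>)"
    by (rule tendsto_lowerbound[OF tendsto_Im[OF tendsto_mult[OF tendsto_const g]]]) (use Im in auto)
  have b: "cmod (of_real x / (1 + of_real x * g)) \<le> \<zeta> * x" if "0 \<le> x" "0 \<le> Im (z * g)" for x g
    by (rule weight_fraction_bound[OF z that(2,1)])
  show "integrable D (\<lambda>\<delta>. of_real \<delta> / (1 + of_real \<delta> * \<gamma>))"
  proof (rule Bochner_Integration.integrable_bound[OF integrable_\<zeta>])
    show "AE \<delta> in D. norm (complex_of_real \<delta> / (1 + of_real \<delta> * \<gamma>)) \<le> norm (\<zeta> * \<delta>)"
      using D0 by eventually_elim (use b[OF _ Im\<gamma>] abs_ge_self in \<open>auto simp only: real_norm_def intro: order_trans\<close>)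
  qed (intro measurable_D, measurable)
  show "(\<lambda>k. \<integral>\<delta>. of_real (cut (K k) \<delta>) / (1 + of_real (cut (K k) \<delta>) * g k) \<partial>D) \<longlonglongrightarrow> (\<integral>\<delta>. of_real \<delta> / (1 + of_real \<delta> * \<gamma>) \<partial>D)"
  proof (rule integral_dominated_convergence[where w = "\<lambda>\<delta>. \<zeta> * \<delta>"])
    show "AE \<delta> in D. (\<lambda>k. of_real (cut (K k) \<delta>) / (1 + of_real (cut (K k) \<delta>) * g k)) \<longlonglongrightarrow> of_real \<delta> / (1 + of_real \<delta> * \<gamma>)"
      using D0
    proof eventually_elim
      fix \<delta> :: real assume t: "0 \<le> \<delta>"
      show "(\<lambda>k. of_real (cut (K k) \<delta>) / (1 + of_real (cut (K k) \<delta>) * g k)) \<longlonglongrightarrow> of_real \<delta> / (1 + of_real \<delta> * \<gamma>)"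
        by (intro tendsto_divide tendsto_add tendsto_mult tendsto_const cut_tendsto_complex K t g
            denominator_bound(2)[OF z Im\<gamma> t])
    qed
    show "AE \<delta> in D. cmod (of_real (cut (K k) \<delta>) / (1 + of_real (cut (K k) \<delta>) * g k)) \<le> \<zeta> * \<delta>" for k
      using D0
    proof eventually_elim
      fix \<delta> :: real assume "0 \<le> \<delta>"
      hence "\<zeta> * cut (K k) \<delta> \<le> \<zeta> * \<delta>" using z by (intro mult_left_mono cut_bounds) auto
      thus "cmod (of_real (cut (K k) \<delta>) / (1 + of_real (cut (K k) \<delta>) * g k)) \<le> \<zeta> * \<delta>"
        by (rule order_trans[OF b[OF cut_bounds(1) Im]])
    qed
  qed (rule integrable_\<zeta> | (intro measurable_D, measurable))+
qed

text \<open>If the auxiliary quantities \<open>g\<close> of solutions of the truncated equations were unbounded,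
  then \<open>\<omega> g\<close> would converge both to the mass of \<open>D\<close> off zero and to zero.\<close>

lemma gamma_not_to_infinity:
  assumes nD: "\<not> (AE \<delta> in D. \<delta> = 0)" and K: "filterlim K at_top sequentially" "\<And>k. 0 \<le> K k"
    and sol: "\<And>k. cut_solution (K k) (g k) (W k)"
    and p: "(\<lambda>k. 1 / (g k + \<i>)) \<longlonglongrightarrow> 0"
  shows False
proof -
  have Img: "0 \<le> Im (g k)" "0 \<le> Im (z * g k)" for k by (rule cut_solutionD[OF sol])+
  have gi: "g k + \<i> \<noteq> 0" for k using Img(1)[of k] by (auto simp: complex_eq_iff)
  \<comment> \<open>\<open>g k + \<i>\<close> has imaginary part at least 1, so divergence of
    \<open>g\<close> can be expressed as \<open>p\<close> tending to 0.\<close>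
  define p where "p k = 1 / (g k + \<i>)" for k
  have p0: "p \<longlonglongrightarrow> 0" using p unfolding p_def .
  have den: "1 + of_real x * g k \<noteq> 0" if "0 \<le> x" for x k
    by (rule denominator_bound(2)[OF z Img(2) that])
  have invlim: "(\<lambda>k. 1 / (1 + of_real (cut (K k) \<delta>) * g k)) \<longlonglongrightarrow> (if \<delta> = 0 then 1 else 0)" if d: "0 \<le> \<delta>" for \<delta> :: real
  proof (cases "\<delta> = 0")
    case True
    hence "cut (K k) \<delta> = 0" for k using K(2)[of k] by (simp add: cut_def)
    thus ?thesis using True by simp
  next
    case False
    have "1 / (1 + of_real (cut (K k) \<delta>) * g k) = p k / (p k + of_real (cut (K k) \<delta>) * (1 - \<i> * p k))" for k
    proof -
      have "p k + of_real (cut (K k) \<delta>) * (1 - \<i> * p k) = p k * (1 + of_real (cut (K k) \<delta>) * g k)"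
        using gi[of k] unfolding p_def by (simp add: field_simps)
      moreover have "p k \<noteq> 0" using gi[of k] by (simp add: p_def)
      ultimately show ?thesis by simp
    qed
    moreover have "(\<lambda>k. p k / (p k + of_real (cut (K k) \<delta>) * (1 - \<i> * p k))) \<longlonglongrightarrow> 0 / (0 + of_real (max 0 \<delta>) * (1 - \<i> * 0))"
      using False d
      by (intro tendsto_divide tendsto_add tendsto_diff tendsto_mult tendsto_const p0 tendsto_of_real cut_tendsto K) auto
    ultimately show ?thesis using False by simp
  qed
  have invb: "cmod (1 / (1 + of_real (cut (K k) \<delta>) * g k)) \<le> \<zeta>" for k \<delta>
    by (rule denominator_bound(3)[OF z Img(2) cut_bounds(1)])
  have W: "W k = (\<integral>\<delta>. of_real (cut (K k) \<delta>) / (1 + of_real (cut (K k) \<delta>) * g k) \<partial>D)"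
    and g: "g k = of_real c * (\<integral>\<tau>. of_real (cut (K k) \<tau>) / (of_real (cut (K k) \<tau>) * W k - z) \<partial>H)" for k
    by (rule cut_solutionD[OF sol])+
  have ImW: "Im (W k) \<le> 0" for k by (rule cut_solution_bounds(1)[OF sol K(2)])
  have W0: "W \<longlonglongrightarrow> 0"
  proof -
    have "(\<lambda>k. \<integral>\<delta>. of_real (cut (K k) \<delta>) / (1 + of_real (cut (K k) \<delta>) * g k) \<partial>D) \<longlonglongrightarrow> (\<integral>\<delta>. 0 \<partial>D)"
    proof (rule integral_dominated_convergence[where w = "\<lambda>\<delta>. \<zeta> * \<delta>"])
      show "AE \<delta> in D. (\<lambda>k. of_real (cut (K k) \<delta>) / (1 + of_real (cut (K k) \<delta>) * g k)) \<longlonglongrightarrow> 0"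
        using D0
      proof eventually_elim
        fix \<delta> :: real assume t: "0 \<le> \<delta>"
        have "(\<lambda>k. of_real (cut (K k) \<delta>) * (1 / (1 + of_real (cut (K k) \<delta>) * g k))) \<longlonglongrightarrow> of_real (max 0 \<delta>) * (if \<delta> = 0 then 1 else 0)"
          by (intro tendsto_mult tendsto_of_real cut_tendsto K invlim t)
        moreover have "complex_of_real (max 0 \<delta>) * (if \<delta> = 0 then 1 else 0) = 0" by simp
        ultimately show "(\<lambda>k. of_real (cut (K k) \<delta>) / (1 + of_real (cut (K k) \<delta>) * g k)) \<longlonglongrightarrow> 0"
          by (simp only: times_divide_eq_right mult_1_right)
      qed
      show "AE \<delta> in D. cmod (of_real (cut (K k) \<delta>) / (1 + of_real (cut (K k) \<delta>) * g k)) \<le> \<zeta> * \<delta>" for k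
        using D0
      proof eventually_elim
        fix \<delta> :: real assume "0 \<le> \<delta>"
        hence "\<zeta> * cut (K k) \<delta> \<le> \<zeta> * \<delta>" using z by (intro mult_left_mono cut_bounds) auto
        thus "cmod (of_real (cut (K k) \<delta>) / (1 + of_real (cut (K k) \<delta>) * g k)) \<le> \<zeta> * \<delta>"
          by (rule order_trans[OF weight_fraction_bound[OF z Img(2) cut_bounds(1)]])
      qed
    qed (rule integrable_\<zeta> | (intro measurable_D, measurable))+
    thus ?thesis unfolding W[symmetric] by simp
  qed
  \<comment> \<open>The outer integrand times \<open>g\<close> is
    \<open>1 - 1 / (1 + \<delta> g)\<close>, which tends to the indicator of nonzero
    \<delta>.\<close>
  have 1: "(\<lambda>k. W k * g k) \<longlonglongrightarrow> (\<integral>\<delta>. (if \<delta> = 0 then 0 else 1) \<partial>D)"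
  proof -
    have "(\<lambda>k. \<integral>\<delta>. 1 - 1 / (1 + of_real (cut (K k) \<delta>) * g k) \<partial>D) \<longlonglongrightarrow> (\<integral>\<delta>. (if \<delta> = 0 then 0 else 1) \<partial>D)"
    proof (rule integral_dominated_convergence[where w = "\<lambda>\<delta>. 1 + \<zeta>"])
      show "AE \<delta> in D. (\<lambda>k. 1 - 1 / (1 + of_real (cut (K k) \<delta>) * g k)) \<longlonglongrightarrow> (if \<delta> = 0 then 0 else 1)"
        using D0
      proof eventually_elim
        fix \<delta> :: real assume t: "0 \<le> \<delta>"
        have "(\<lambda>k. 1 - 1 / (1 + of_real (cut (K k) \<delta>) * g k)) \<longlonglongrightarrow> 1 - (if \<delta> = 0 then 1 else 0)"
          by (intro tendsto_diff tendsto_const invlim t)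
        moreover have "1 - (if \<delta> = 0 then 1 else 0) = (if \<delta> = 0 then 0 else 1 :: complex)" by simp
        ultimately show "(\<lambda>k. 1 - 1 / (1 + of_real (cut (K k) \<delta>) * g k)) \<longlonglongrightarrow> (if \<delta> = 0 then 0 else 1)" by (simp only:)
      qed
      show "AE \<delta> in D. cmod (1 - 1 / (1 + of_real (cut (K k) \<delta>) * g k)) \<le> 1 + \<zeta>" for k
      proof (rule AE_I2)
        fix \<delta> :: real
        show "cmod (1 - 1 / (1 + of_real (cut (K k) \<delta>) * g k)) \<le> 1 + \<zeta>"
          using norm_triangle_ineq4[of 1 "1 / (1 + of_real (cut (K k) \<delta>) * g k)"] invb[of k \<delta>] unfolding norm_one by linarith
      qed
    qed (simp | (intro measurable_D, measurable))+
    moreover have "(\<integral>\<delta>. 1 - 1 / (1 + of_real (cut (K k) \<delta>) * g k) \<partial>D) = W k * g k" for k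
    proof -
      have "W k * g k = (\<integral>\<delta>. of_real (cut (K k) \<delta>) / (1 + of_real (cut (K k) \<delta>) * g k) * g k \<partial>D)"
        unfolding integral_mult_left_zero W[symmetric] ..
      also have "\<dots> = (\<integral>\<delta>. 1 - 1 / (1 + of_real (cut (K k) \<delta>) * g k) \<partial>D)"
        by (rule Bochner_Integration.integral_cong) (use den[OF cut_bounds(1)] in \<open>auto simp: field_simps\<close>)
      finally show ?thesis by simp
    qed
    ultimately show ?thesis by simp
  qed
  \<comment> \<open>The inner integrand times \<open>W\<close> is
    \<open>1 + z / (\<tau> W - z)\<close>, which tends to 0 since \<open>W\<close> does.\<close>
  have 2: "(\<lambda>k. W k * g k) \<longlonglongrightarrow> of_real c * (\<integral>\<tau>. 0 \<partial>H)"
  proof -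
    have "(\<lambda>k. \<integral>\<tau>. 1 + z * (1 / (of_real (cut (K k) \<tau>) * W k - z)) \<partial>H) \<longlonglongrightarrow> (\<integral>\<tau>. 0 \<partial>H)"
    proof (rule integral_dominated_convergence[where w = "\<lambda>\<delta>. 1 + \<zeta>"])
      show "AE \<tau> in H. (\<lambda>k. 1 + z * (1 / (of_real (cut (K k) \<tau>) * W k - z))) \<longlonglongrightarrow> 0"
      proof (rule AE_I2)
        fix \<tau> :: real
        have z0: "z \<noteq> 0" using z by auto
        have "(\<lambda>k. 1 + z * (1 / (of_real (cut (K k) \<tau>) * W k - z))) \<longlonglongrightarrow> 1 + z * (1 / (of_real (max 0 \<tau>) * 0 - z))"
          using z0 by (intro tendsto_add tendsto_divide tendsto_mult tendsto_diff tendsto_const tendsto_of_real cut_tendsto K W0) auto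
        thus "(\<lambda>k. 1 + z * (1 / (of_real (cut (K k) \<tau>) * W k - z))) \<longlonglongrightarrow> 0" using z0 by simp
      qed
      show "AE \<tau> in H. cmod (1 + z * (1 / (of_real (cut (K k) \<tau>) * W k - z))) \<le> 1 + \<zeta>" for k
      proof (rule AE_I2)
        fix \<tau> :: real
        have "cmod (z * (1 / (of_real (cut (K k) \<tau>) * W k - z))) \<le> cmod z * (1 / v)"
          unfolding norm_mult[of z] by (intro mult_left_mono shifted_denominator(3)[OF z ImW cut_bounds(1)]) simp
        thus "cmod (1 + z * (1 / (of_real (cut (K k) \<tau>) * W k - z))) \<le> 1 + \<zeta>"
          using norm_triangle_ineq[of 1 "z * (1 / (of_real (cut (K k) \<tau>) * W k - z))"] by simp
      qed
    qed (simp | (intro measurable_H, measurable))+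
    hence "(\<lambda>k. of_real c * (\<integral>\<tau>. 1 + z * (1 / (of_real (cut (K k) \<tau>) * W k - z)) \<partial>H)) \<longlonglongrightarrow> of_real c * (\<integral>\<tau>. 0 \<partial>H)"
      by (intro tendsto_mult tendsto_const)
    moreover have "of_real c * (\<integral>\<tau>. 1 + z * (1 / (of_real (cut (K k) \<tau>) * W k - z)) \<partial>H) = W k * g k" for k
    proof -
      have "W k * g k = of_real c * (\<integral>\<tau>. W k * (of_real (cut (K k) \<tau>) / (of_real (cut (K k) \<tau>) * W k - z)) \<partial>H)"
        unfolding integral_mult_right_zero using g[of k] by (simp add: mult_ac)
      also have "(\<integral>\<tau>. W k * (of_real (cut (K k) \<tau>) / (of_real (cut (K k) \<tau>) * W k - z)) \<partial>H)
          = (\<integral>\<tau>. 1 + z * (1 / (of_real (cut (K k) \<tau>) * W k - z)) \<partial>H)"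
        by (rule Bochner_Integration.integral_cong)
           (use shifted_denominator(2)[OF z ImW cut_bounds(1)] in \<open>auto simp: field_simps\<close>)
      finally show ?thesis by simp
    qed
    ultimately show ?thesis by simp
  qed
  have "(\<integral>\<delta>. complex_of_real (if \<delta> = 0 then 0 else 1) \<partial>D) = 0"
    using LIMSEQ_unique[OF 1 2] by (simp add: if_distrib cong: if_cong)
  hence "(\<integral>\<delta>. (if \<delta> = 0 then 0 else 1::real) \<partial>D) = 0" unfolding integral_complex_of_real of_real_eq_0_iff .
  moreover have "0 < (\<integral>\<delta>. (if \<delta> = 0 then 0 else 1::real) \<partial>D)"
  proof (rule integral_pos)
    show "integrable D (\<lambda>\<delta>. if \<delta> = 0 then 0 else 1::real)" by (rule D.integrable_const_bound[where B = 1]) auto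
    show "\<not> (AE \<delta> in D. (if \<delta> = 0 then 0 else 1::real) = 0)"
      using nD by (auto elim!: eventually_mono simp: split: if_splits)
  qed auto
  ultimately show False by simp
qed

lemma kernel_bound:
  assumes "Im w < 0" "0 \<le> x"
  shows "cmod (of_real x / (of_real x * w - z)) \<le> 1 / - Im w"
proof -
  have "x * - Im w \<le> \<bar>Im (complex_of_real x * w - z)\<bar>" using z by simp
  also have "\<dots> \<le> cmod (complex_of_real x * w - z)" by (rule abs_Im_le_cmod)
  finally have *: "x * - Im w \<le> cmod (complex_of_real x * w - z)" .
  have "Im z \<le> cmod (complex_of_real x * w - z)" by (rule shifted_denominator(1)[OF z less_imp_le[OF assms(1)] assms(2)])
  hence "0 < cmod (complex_of_real x * w - z)" using z by linarith
  thus ?thesis unfolding norm_divide using * assms by (simp add: divide_simps mult.commute)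
qed

lemma Im_weight_fraction:
  "Im (of_real x / (1 + of_real x * g)) = - (x\<^sup>2 * Im g / (cmod (1 + of_real x * g))\<^sup>2)"
  unfolding Im_divide cmod_power2 by (simp add: power2_eq_square)

text \<open>The imaginary part of the inner integrand is bounded below by a fixed function of the
  clipped value, since all \<open>W k\<close> lie in one disc of radius \<open>C\<close>. Its
  integral over \<open>H\<close> is positive unless \<open>H\<close> sits at 0.\<close>

lemma Im_gamma_limit_pos:
  assumes nH: "\<not> (AE \<tau> in H. \<tau> = 0)" and K: "filterlim K at_top sequentially" "\<And>k. 0 \<le> K k"
    and sol: "\<And>k. cut_solution (K k) (g k) (W k)" and g: "g \<longlonglongrightarrow> \<gamma>"
  shows "0 < Im \<gamma>"
proof -
  define C where "C = \<zeta> * (\<integral>x. x \<partial>D)"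
  have ImW: "Im (W k) \<le> 0" and Wb: "cmod (W k) \<le> C" for k
    unfolding C_def by (rule cut_solution_bounds[OF sol K(2)])+
  have C0: "0 \<le> C" using order_trans[OF norm_ge_zero Wb] .
  \<comment> \<open>Minorises \<open>Im (kr W x)\<close> for \<open>Im W \<le> 0\<close> and
    \<open>cmod W \<le> C\<close>. The cap 1 keeps \<open>q\<close> bounded also when
    \<open>C = 0\<close>.\<close>
  define q where "q x = min 1 (x * v / (x * C + cmod z)\<^sup>2)" for x
  have zp: "0 < cmod z" using z by auto
  have qc: "isCont q x" if "0 \<le> x" for x
  proof -
    have "x * C + cmod z > 0" using that C0 zp by (simp add: add_nonneg_pos)
    thus ?thesis unfolding q_def by (intro continuous_intros) auto
  qed
  have qm: "q \<in> borel_measurable borel" unfolding q_def by measurable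
  have qb: "0 \<le> q x" "q x \<le> 1" if "0 \<le> x" for x
    using that z unfolding q_def by simp_all
  have "(\<lambda>k. \<integral>\<tau>. q (cut (K k) \<tau>) \<partial>H) \<longlonglongrightarrow> (\<integral>\<tau>. q \<tau> \<partial>H)"
  proof (rule integral_dominated_convergence[where w = "\<lambda>_. 1"])
    show "AE \<tau> in H. (\<lambda>k. q (cut (K k) \<tau>)) \<longlonglongrightarrow> q \<tau>"
      using H0
    proof eventually_elim
      fix \<tau> :: real assume t: "0 \<le> \<tau>"
      have "(\<lambda>k. cut (K k) \<tau>) \<longlonglongrightarrow> \<tau>" using cut_tendsto[OF K(1), of \<tau>] t by (simp add: max_absorb2)
      thus "(\<lambda>k. q (cut (K k) \<tau>)) \<longlonglongrightarrow> q \<tau>" by (rule isCont_tendsto_compose[OF qc[OF t]])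
    qed
    show "AE \<tau> in H. norm (q (cut (K k) \<tau>)) \<le> 1" for k
      using qb[OF cut_bounds(1)] by (intro AE_I2) simp
  qed (use qm in simp_all)
  hence "(\<lambda>k. c * (\<integral>\<tau>. q (cut (K k) \<tau>) \<partial>H)) \<longlonglongrightarrow> c * (\<integral>\<tau>. q \<tau> \<partial>H)" by (intro tendsto_intros)
  moreover have "(\<lambda>k. Im (g k)) \<longlonglongrightarrow> Im \<gamma>" by (rule tendsto_Im[OF g])
  moreover have "c * (\<integral>\<tau>. q (cut (K k) \<tau>) \<partial>H) \<le> Im (g k)" for k
  proof -
    let ?f = "\<lambda>\<tau>. complex_of_real (cut (K k) \<tau>) / (of_real (cut (K k) \<tau>) * W k - z)"
    have fi: "integrable H ?f"
    proof (rule H.integrable_const_bound[where B = "K k * (1 / v)"])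
      show "AE \<tau> in H. cmod (?f \<tau>) \<le> K k * (1 / v)"
      proof (rule AE_I2)
        fix \<tau>
        have "cmod (?f \<tau>) = cut (K k) \<tau> * cmod (1 / (of_real (cut (K k) \<tau>) * W k - z))"
          using cut_bounds(1)[of "K k" \<tau>] by (simp add: norm_divide)
        also have "\<dots> \<le> K k * (1 / v)"
          by (intro mult_mono cut_bounds K shifted_denominator(3)[OF z ImW]) simp
        finally show "cmod (?f \<tau>) \<le> K k * (1 / v)" .
      qed
    qed (intro measurable_H, measurable)
    have "(\<integral>\<tau>. q (cut (K k) \<tau>) \<partial>H) \<le> (\<integral>\<tau>. Im (?f \<tau>) \<partial>H)"
    proof (rule integral_mono)
      show "integrable H (\<lambda>\<tau>. q (cut (K k) \<tau>))"
        by (rule H.integrable_const_bound[where B = 1]) (use qb[OF cut_bounds(1)] qm in simp_all)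
      show "integrable H (\<lambda>\<tau>. Im (?f \<tau>))" by (rule integrable_Im[OF fi])
      fix \<tau>
      define x where "x = cut (K k) \<tau>"
      have x: "0 \<le> x" unfolding x_def by (rule cut_bounds)
      have d0: "0 < cmod (of_real x * W k - z)"
        using shifted_denominator(1)[OF z ImW x, of k] z by linarith
      have "cmod (of_real x * W k - z) \<le> x * cmod (W k) + cmod z"
        using norm_triangle_ineq4[of "of_real x * W k" z] x by (simp add: norm_mult)
      also have "\<dots> \<le> x * C + cmod z" using x Wb by (simp add: mult_left_mono)
      finally have d: "(cmod (of_real x * W k - z))\<^sup>2 \<le> (x * C + cmod z)\<^sup>2" by (rule power_mono) simp
      have "q x \<le> x * v / (x * C + cmod z)\<^sup>2" unfolding q_def by simp
      also have "\<dots> \<le> x * v / (cmod (of_real x * W k - z))\<^sup>2"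
      proof (rule divide_left_mono[OF d])
        have "0 < x * C + cmod z" using x C0 zp by (simp add: add_nonneg_pos)
        thus "0 < (x * C + cmod z)\<^sup>2 * (cmod (of_real x * W k - z))\<^sup>2" using d0 by simp
      qed (use x z in simp)
      also have "\<dots> \<le> x * (v - x * Im (W k)) / (cmod (of_real x * W k - z))\<^sup>2"
        using x ImW[of k] by (intro divide_right_mono mult_left_mono) (auto simp: mult_nonneg_nonpos)
      also have "\<dots> = Im (of_real x / (of_real x * W k - z))"
        using Im_kr[of "W k" x] by (simp add: kr_def)
      finally show "q (cut (K k) \<tau>) \<le> Im (?f \<tau>)" unfolding x_def .
    qed
    also have "\<dots> = Im (\<integral>\<tau>. ?f \<tau> \<partial>H)" by (rule integral_Im[OF fi])
    finally have "c * (\<integral>\<tau>. q (cut (K k) \<tau>) \<partial>H) \<le> c * Im (\<integral>\<tau>. ?f \<tau> \<partial>H)" using c by simp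
    also have "\<dots> = Im (of_real c * (\<integral>\<tau>. ?f \<tau> \<partial>H))" by simp
    also have "of_real c * (\<integral>\<tau>. ?f \<tau> \<partial>H) = g k" by (rule cut_solutionD(4)[OF sol, symmetric])
    finally show ?thesis .
  qed
  ultimately have "c * (\<integral>\<tau>. q \<tau> \<partial>H) \<le> Im \<gamma>" by (intro LIMSEQ_le) auto
  moreover have "0 < (\<integral>\<tau>. q \<tau> \<partial>H)"
  proof (rule integral_pos)
    show "integrable H q"
      by (rule H.integrable_const_bound[where B = 1]) (use H0 qb qm in \<open>auto elim!: eventually_mono\<close>)
    show "AE \<tau> in H. 0 \<le> q \<tau>" using H0 by eventually_elim (rule qb)
    show "\<not> (AE \<tau> in H. q \<tau> = 0)"
    proof
      assume "AE \<tau> in H. q \<tau> = 0"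
      hence "AE \<tau> in H. \<tau> = 0" using H0
      proof eventually_elim
        fix \<tau> assume "q \<tau> = 0" "0 \<le> \<tau>"
        moreover have "\<tau> * C + cmod z > 0" using \<open>0 \<le> \<tau>\<close> C0 zp by (simp add: add_nonneg_pos)
        ultimately show "\<tau> = 0" using z unfolding q_def by (auto simp: min_def split: if_splits)
      qed
      thus False using nH by simp
    qed
  qed
  ultimately show ?thesis using c by (smt (verit) mult_pos_pos)
qed

text \<open>In the nondegenerate case \<gamma> stays bounded along a subsequence and its limit has
  positive imaginary part; the outer equation then forces \<open>Im w < 0\<close>. This bounds the
  kernel \<open>\<tau> / (\<tau> w - z)\<close> uniformly in \<tau>, so the inner integral passes to
  the limit even when \<open>H\<close> has infinite mean.\<close>

lemma cut_solutions_converge: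
  assumes K: "filterlim K at_top sequentially" "\<And>k. 0 \<le> K k"
    and sol: "\<And>k. cut_solution (K k) (g k) (W k)"
  obtains s w where "strict_mono s" "(\<lambda>k. W (s k)) \<longlonglongrightarrow> w" "Im w \<le> 0" "solves_fp c H D z w"
    "cmod w \<le> \<zeta> * (\<integral>x. x \<partial>D)"
proof -
  define C where "C = \<zeta> * (\<integral>x. x \<partial>D)"
  have ImW: "Im (W k) \<le> 0" and Wb: "cmod (W k) \<le> C" for k
    unfolding C_def by (rule cut_solution_bounds[OF sol K(2)])+
  obtain w s1 where w: "cmod w \<le> C" and s1: "strict_mono s1" "(\<lambda>k. W (s1 k)) \<longlonglongrightarrow> w"
    using bounded_convergent_subsequence[of W C] Wb by blast
  have Imw: "Im w \<le> 0"
    by (rule tendsto_upperbound[OF tendsto_Im[OF s1(2)]]) (use ImW in auto)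
  have wC: "cmod w \<le> \<zeta> * (\<integral>x. x \<partial>D)" using w by (simp add: C_def)
  consider (D) "AE \<delta> in D. \<delta> = 0" | (H) "AE \<tau> in H. \<tau> = 0"
    | (nd) "\<not> (AE \<delta> in D. \<delta> = 0)" "\<not> (AE \<tau> in H. \<tau> = 0)" by blast
  thus ?thesis
  proof cases
    case D
    have "W k = (\<integral>\<delta>. 0 \<partial>D)" for k
      unfolding cut_solutionD(3)[OF sol[of k]]
    proof (rule integral_cong_AE)
      show "AE \<delta> in D. of_real (cut (K k) \<delta>) / (1 + of_real (cut (K k) \<delta>) * g k) = 0"
        using D by eventually_elim (use K(2)[of k] in \<open>simp add: cut_def\<close>)
    qed (intro measurable_D, measurable)+
    hence "(\<lambda>k. W (s1 k)) = (\<lambda>_. 0)" by simp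
    hence "w = 0" using s1(2) by (simp add: LIMSEQ_const_iff)
    \<comment> \<open>\<open>fr g 0 = 0\<close> for every \<open>g\<close>, including the default
      value 0 which \<open>gg 0\<close> takes when the inner integral diverges.\<close>
    moreover have "integrable D (fr (gg 0))" "(\<integral>\<delta>. fr (gg 0) \<delta> \<partial>D) = 0"
    proof -
      have "AE \<delta> in D. fr (gg 0) \<delta> = 0" using D by eventually_elim (simp add: fr_def)
      moreover have "fr (gg 0) \<in> borel_measurable D" by (rule measurable_D[OF fr_measurable])
      ultimately show "integrable D (fr (gg 0))" "(\<integral>\<delta>. fr (gg 0) \<delta> \<partial>D) = 0"
        using integrable_cong_AE[of "fr (gg 0)" D "\<lambda>_. 0"] integral_cong_AE[of "fr (gg 0)" D "\<lambda>_. 0"] by simp_all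
    qed
    ultimately have "solves_fp c H D z w"
      unfolding solves_fp_alt using D by (auto elim!: eventually_mono)
    thus ?thesis using that[OF s1 Imw _ wC] by blast
  next
    case H
    have "g k = 0" for k
    proof -
      have "(\<integral>\<tau>. of_real (cut (K k) \<tau>) / (of_real (cut (K k) \<tau>) * W k - z) \<partial>H) = (\<integral>\<tau>. (0::complex) \<partial>H)"
      proof (rule integral_cong_AE)
        show "AE \<tau> in H. of_real (cut (K k) \<tau>) / (of_real (cut (K k) \<tau>) * W k - z) = 0"
          using H by eventually_elim (use K(2)[of k] in \<open>simp add: cut_def\<close>)
      qed (intro measurable_H, measurable)+
      thus ?thesis using cut_solutionD(4)[OF sol[of k]] by simp
    qed
    hence g0: "g = (\<lambda>_. 0)" by auto
    have g0': "g \<longlonglongrightarrow> 0" unfolding g0 by (rule tendsto_const)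
    have "W \<longlonglongrightarrow> (\<integral>\<delta>. of_real \<delta> / (1 + of_real \<delta> * 0) \<partial>D)"
      using omega_tendsto(1)[OF g0' cut_solutionD(2)[OF sol] K(1)]
      unfolding cut_solutionD(3)[OF sol, symmetric] .
    hence "(\<lambda>k. W (s1 k)) \<longlonglongrightarrow> (\<integral>\<delta>. of_real \<delta> / (1 + of_real \<delta> * 0) \<partial>D)" using s1(1) by (rule tendsto_subseq)
    from LIMSEQ_unique[OF s1(2) this] have weq: "w = (\<integral>\<delta>. complex_of_real \<delta> \<partial>D)" by simp
    have "AE \<delta> in D. \<delta> \<noteq> 0 \<longrightarrow> (AE \<tau> in H. complex_of_real \<tau> * w - z \<noteq> 0) \<and> integrable H (kr w) \<and> 1 + complex_of_real (\<delta> * c) * gg w \<noteq> 0"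
    proof (rule AE_I2, intro impI conjI)
      show "AE \<tau> in H. complex_of_real \<tau> * w - z \<noteq> 0" using H by eventually_elim (use z in auto)
      have "AE \<tau> in H. kr w \<tau> = 0" using H by eventually_elim (simp add: kr_def)
      thus "integrable H (kr w)"
        using integrable_cong_AE[of "kr w" H "\<lambda>_. 0"] measurable_H[OF kr_measurable] by simp
      show "1 + complex_of_real (\<delta> * c) * gg w \<noteq> 0" for \<delta> by (simp add: gg_degenerate_H[OF H])
    qed
    moreover have "fr (gg w) = complex_of_real" by (simp add: gg_degenerate_H[OF H] fr_def fun_eq_iff)
    ultimately have "solves_fp c H D z w"
      unfolding solves_fp_alt using weq integrable_of_real[OF D1, where 'a = complex] by auto
    thus ?thesis using that[OF s1 Imw _ wC] by blast
  next
    case nd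
    have Img: "0 \<le> Im (g k)" "0 \<le> Im (z * g k)" for k by (rule cut_solutionD[OF sol])+
    \<comment> \<open>Compactifies the possibly unbounded \<gamma>; the limit point 0, that is
      infinity for \<gamma>, is excluded by \<open>gamma_not_to_infinity\<close>.\<close>
    define p where "p k = 1 / (g (s1 k) + \<i>)" for k
    have gi: "g k + \<i> \<noteq> 0" for k using Img(1)[of k] by (auto simp: complex_eq_iff)
    have "cmod (p k) \<le> 1" for k
    proof -
      have "1 \<le> Im (g (s1 k) + \<i>)" using Img(1) by simp
      also have "\<dots> \<le> cmod (g (s1 k) + \<i>)" by (rule order_trans[OF abs_ge_self abs_Im_le_cmod])
      finally show ?thesis unfolding p_def norm_divide by (simp add: divide_le_eq)
    qed
    then obtain p0 s2 where s2: "strict_mono s2" "(\<lambda>k. p (s2 k)) \<longlonglongrightarrow> p0"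
      using bounded_convergent_subsequence[of p 1] by blast
    define s where "s k = s1 (s2 k)" for k
    have s: "strict_mono s" using s1(1) s2(1) unfolding s_def strict_mono_def by blast
    have Ks: "filterlim (\<lambda>k. K (s k)) at_top sequentially"
      by (rule filterlim_compose[OF K(1) filterlim_subseq[OF s]])
    have Ws: "(\<lambda>k. W (s k)) \<longlonglongrightarrow> w" unfolding s_def by (rule tendsto_subseq[OF s1(2) s2(1)])
    have p0: "p0 \<noteq> 0"
    proof
      assume "p0 = 0"
      hence "(\<lambda>k. 1 / (g (s k) + \<i>)) \<longlonglongrightarrow> 0" using s2(2) unfolding p_def s_def by simp
      thus False using gamma_not_to_infinity[OF nd(1) Ks K(2) sol] by blast
    qed
    define \<gamma> where "\<gamma> = 1 / p0 - \<i>"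
    have "(\<lambda>k. 1 / p (s2 k) - \<i>) \<longlonglongrightarrow> \<gamma>"
      unfolding \<gamma>_def by (intro tendsto_diff tendsto_divide tendsto_const s2(2) p0)
    hence gs: "(\<lambda>k. g (s k)) \<longlonglongrightarrow> \<gamma>" unfolding p_def s_def by simp
    have Im\<gamma>: "0 < Im \<gamma>" by (rule Im_gamma_limit_pos[OF nd(2) Ks K(2) sol gs])
    note om = omega_tendsto[OF gs Img(2) Ks]
    have "(\<lambda>k. W (s k)) \<longlonglongrightarrow> (\<integral>\<delta>. of_real \<delta> / (1 + of_real \<delta> * \<gamma>) \<partial>D)"
      using om(1) unfolding cut_solutionD(3)[OF sol, symmetric] .
    hence weq: "w = (\<integral>\<delta>. of_real \<delta> / (1 + of_real \<delta> * \<gamma>) \<partial>D)" using Ws LIMSEQ_unique by blast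
    have Imwneg: "Im w < 0"
    proof -
      have "Im w = (\<integral>\<delta>. Im (of_real \<delta> / (1 + of_real \<delta> * \<gamma>)) \<partial>D)"
        unfolding weq by (rule integral_Im[OF om(3), symmetric])
      hence "- Im w = (\<integral>\<delta>. \<delta>\<^sup>2 * Im \<gamma> / (cmod (1 + of_real \<delta> * \<gamma>))\<^sup>2 \<partial>D)"
        unfolding Im_weight_fraction by simp
      also have "0 < \<dots>"
      proof (rule integral_pos)
        show "integrable D (\<lambda>\<delta>. \<delta>\<^sup>2 * Im \<gamma> / (cmod (1 + of_real \<delta> * \<gamma>))\<^sup>2)"
          using integrable_minus[OF integrable_Im[OF om(3)]] unfolding Im_weight_fraction by simp
        show "AE \<delta> in D. 0 \<le> \<delta>\<^sup>2 * Im \<gamma> / (cmod (1 + of_real \<delta> * \<gamma>))\<^sup>2" using Im\<gamma> by simp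
        show "\<not> (AE \<delta> in D. \<delta>\<^sup>2 * Im \<gamma> / (cmod (1 + of_real \<delta> * \<gamma>))\<^sup>2 = 0)"
        proof
          assume "AE \<delta> in D. \<delta>\<^sup>2 * Im \<gamma> / (cmod (1 + of_real \<delta> * \<gamma>))\<^sup>2 = 0"
          hence "AE \<delta> in D. \<delta> = 0" using D0
            by eventually_elim (use Im\<gamma> denominator_bound(2)[OF z om(2)] in auto)
          thus False using nd(1) by simp
        qed
      qed
      finally show ?thesis by simp
    qed
    \<comment> \<open>From here on \<open>kernel_bound\<close> dominates the inner integrands by the
      constant \<open>1 / (- Im w / 2)\<close>.\<close>
    have "eventually (\<lambda>k. Im (W (s k)) < Im w / 2) sequentially"
      by (rule order_tendstoD(2)[OF tendsto_Im[OF Ws]]) (use Imwneg in simp)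
    then obtain k0 where k0: "\<And>k. k0 \<le> k \<Longrightarrow> Im (W (s k)) < Im w / 2" unfolding eventually_sequentially by blast
    have sh: "strict_mono (\<lambda>k. k + k0)" by (simp add: strict_mono_def)
    let ?r = "\<lambda>k. s (k + k0)"
    have "(\<lambda>k. \<integral>\<tau>. of_real (cut (K (?r k)) \<tau>) / (of_real (cut (K (?r k)) \<tau>) * W (?r k) - z) \<partial>H) \<longlonglongrightarrow> (\<integral>\<tau>. of_real \<tau> / (of_real \<tau> * w - z) \<partial>H)"
    proof (rule integral_dominated_convergence[where w = "\<lambda>_. 1 / (- Im w / 2)"])
      have Kr: "filterlim (\<lambda>k. K (?r k)) at_top sequentially"
        by (rule filterlim_compose[OF Ks filterlim_subseq[OF sh]])
      have Wr: "(\<lambda>k. W (?r k)) \<longlonglongrightarrow> w" by (rule tendsto_subseq[OF Ws sh])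
      show "AE \<tau> in H. (\<lambda>k. of_real (cut (K (?r k)) \<tau>) / (of_real (cut (K (?r k)) \<tau>) * W (?r k) - z)) \<longlonglongrightarrow> of_real \<tau> / (of_real \<tau> * w - z)"
        using H0
      proof eventually_elim
        fix \<tau> :: real assume t: "0 \<le> \<tau>"
        show "(\<lambda>k. of_real (cut (K (?r k)) \<tau>) / (of_real (cut (K (?r k)) \<tau>) * W (?r k) - z)) \<longlonglongrightarrow> of_real \<tau> / (of_real \<tau> * w - z)"
          by (intro tendsto_divide tendsto_diff tendsto_mult tendsto_const cut_tendsto_complex Kr t Wr
            shifted_denominator(2)[OF z Imw t])
      qed
      show "AE \<tau> in H. cmod (of_real (cut (K (?r k)) \<tau>) / (of_real (cut (K (?r k)) \<tau>) * W (?r k) - z)) \<le> 1 / (- Im w / 2)" for k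
      proof (rule AE_I2)
        fix \<tau> :: real
        have i: "Im (W (?r k)) < Im w / 2" by (rule k0) simp
        have "cmod (of_real (cut (K (?r k)) \<tau>) / (of_real (cut (K (?r k)) \<tau>) * W (?r k) - z)) \<le> 1 / - Im (W (?r k))"
          by (rule kernel_bound) (use i Imwneg cut_bounds(1) in auto)
        also have "\<dots> \<le> 1 / (- Im w / 2)" using i Imwneg by (intro divide_left_mono) (auto intro!: mult_neg_neg)
        finally show "cmod (of_real (cut (K (?r k)) \<tau>) / (of_real (cut (K (?r k)) \<tau>) * W (?r k) - z)) \<le> 1 / (- Im w / 2)" .
      qed
    qed (simp | (intro measurable_H, measurable))+
    hence "(\<lambda>k. of_real c * (\<integral>\<tau>. of_real (cut (K (?r k)) \<tau>) / (of_real (cut (K (?r k)) \<tau>) * W (?r k) - z) \<partial>H)) \<longlonglongrightarrow> of_real c * gg w"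
      unfolding gg_def kr_def by (intro tendsto_mult tendsto_const)
    hence "(\<lambda>k. g (?r k)) \<longlonglongrightarrow> of_real c * gg w" unfolding cut_solutionD(4)[OF sol, symmetric] .
    hence \<gamma>eq: "\<gamma> = of_real c * gg w" using tendsto_subseq[OF gs sh] LIMSEQ_unique by blast
    have ki: "integrable H (kr w)"
    proof (rule H.integrable_const_bound[where B = "1 / - Im w"])
      show "AE \<tau> in H. cmod (kr w \<tau>) \<le> 1 / - Im w"
        using H0 by eventually_elim (unfold kr_def, rule kernel_bound[OF Imwneg])
    qed (rule measurable_H[OF kr_measurable])
    have den: "complex_of_real (\<delta> * c) * gg w = of_real \<delta> * \<gamma>" for \<delta> unfolding \<gamma>eq by simp
    have "AE \<delta> in D. \<delta> \<noteq> 0 \<longrightarrow> (AE \<tau> in H. complex_of_real \<tau> * w - z \<noteq> 0) \<and> integrable H (kr w) \<and> 1 + complex_of_real (\<delta> * c) * gg w \<noteq> 0"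
      using D0
    proof eventually_elim
      fix \<delta> :: real assume "0 \<le> \<delta>"
      hence "1 + complex_of_real (\<delta> * c) * gg w \<noteq> 0"
        unfolding den by (rule denominator_bound(2)[OF z om(2)])
      moreover have "AE \<tau> in H. complex_of_real \<tau> * w - z \<noteq> 0"
        using H0 by eventually_elim (rule shifted_denominator(2)[OF z Imw])
      ultimately show "\<delta> \<noteq> 0 \<longrightarrow> (AE \<tau> in H. complex_of_real \<tau> * w - z \<noteq> 0) \<and> integrable H (kr w) \<and> 1 + complex_of_real (\<delta> * c) * gg w \<noteq> 0"
        using ki by blast
    qed
    moreover have "fr (gg w) = (\<lambda>\<delta>. of_real \<delta> / (1 + of_real \<delta> * \<gamma>))"
      by (rule ext) (simp only: fr_def den)
    ultimately have "solves_fp c H D z w"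
      unfolding solves_fp_alt using om(3) weq by simp
    thus ?thesis using that[OF s Ws Imw _ wC] by blast
  qed
qed

end

section \<open>Cauchy-Stieltjes transforms and weak convergence\<close>

definition stieltjes :: "real measure \<Rightarrow> complex \<Rightarrow> complex" where
  "stieltjes M z = (\<integral>x. 1 / (complex_of_real x - z) \<partial>M)"

lemma norm_of_real_minus_ge: "\<bar>Im z\<bar> \<le> cmod (complex_of_real x - z)"
  using abs_Im_le_cmod[of "complex_of_real x - z"] by simp

lemma stieltjes_kernel_bound:
  assumes "0 < e" "e \<le> Im z" shows "cmod (1 / (complex_of_real x - z)) \<le> 1 / e"
  using norm_of_real_minus_ge[of z x] assms by (simp add: norm_divide frac_le)

section \<open>Inversion of the transform and tail bounds\<close>

context
  fixes M :: "real measure"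
  assumes M: "real_distribution M"
begin

interpretation real_distribution M by (rule M)

lemma stieltjes_integrable: "0 < Im z \<Longrightarrow> integrable M (\<lambda>x. 1 / (complex_of_real x - z))"
  by (rule integrable_const_bound[where B = "1 / Im z"]) (auto intro!: stieltjes_kernel_bound simp del: norm_divide)

lemma stieltjes_tendsto:
  assumes "Z \<longlonglongrightarrow> z" "0 < Im z" "\<And>k. Im z \<le> Im (Z k)"
  shows "(\<lambda>k. stieltjes M (Z k)) \<longlonglongrightarrow> stieltjes M z"
  unfolding stieltjes_def
proof (rule integral_dominated_convergence[where w = "\<lambda>_. 1 / Im z"])
  show "AE x in M. (\<lambda>k. 1 / (complex_of_real x - Z k)) \<longlonglongrightarrow> 1 / (complex_of_real x - z)"
    using assms(2) by (intro AE_I2 tendsto_divide tendsto_diff tendsto_const assms(1)) auto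
  show "AE x in M. cmod (1 / (complex_of_real x - Z k)) \<le> 1 / Im z" for k
    by (intro AE_I2 stieltjes_kernel_bound assms)
qed simp_all

text \<open>The imaginary part of the kernel at \<open>u + \<i> y\<close> is the Poisson kernel,
  whose primitive in \<open>u\<close> is an arctangent; Fubini exchanges the integrals over
  \<open>u\<close> and \<open>M\<close>.\<close>

lemma stieltjes_arctan:
  assumes y: "0 < y" and ab: "a \<le> b"
  shows "(\<integral>u. Im (stieltjes M (Complex u y)) * indicator {a..b} u \<partial>lborel) = (\<integral>x. arctan ((b - x) / y) - arctan ((a - x) / y) \<partial>M)"
proof -
  define f where "f u x = y / ((x - u)\<^sup>2 + y\<^sup>2)" for u x :: real
  define L where "L = restrict_space lborel {a..b}"
  have fL: "finite_measure L"
    unfolding L_def by (rule finite_measureI) (simp add: emeasure_restrict_space space_restrict_space ab)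
  interpret L: finite_measure L by (rule fL)
  interpret LM: pair_sigma_finite L M by unfold_locales
  have ff: "finite_measure (L \<Otimes>\<^sub>M M)" by (rule finite_measure_pair_measure[OF finite_measure_axioms fL])
  have pos: "0 < (x - u)\<^sup>2 + y\<^sup>2" for x u using y by (simp add: add_nonneg_pos)
  have fb: "norm (f u x) \<le> 1 / y" for u x
  proof -
    have "y * y \<le> (x - u)\<^sup>2 + y\<^sup>2" by (simp add: power2_eq_square)
    thus ?thesis using y pos[of x u] unfolding f_def by (simp add: divide_simps)
  qed
  have Imf: "Im (1 / (complex_of_real x - Complex u y)) = f u x" for u x
    unfolding f_def Im_divide by simp
  have "(\<lambda>p. f (fst p) (snd p)) \<in> borel_measurable (L \<Otimes>\<^sub>M M)"
  proof -
    have "fst \<in> borel_measurable (L \<Otimes>\<^sub>M M)"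
      unfolding L_def by (rule measurable_compose[OF measurable_fst measurable_restrict_space1]) simp
    moreover have "snd \<in> borel_measurable (L \<Otimes>\<^sub>M M)"
      using measurable_snd[of L M] by simp
    ultimately show ?thesis unfolding f_def by simp
  qed
  hence int: "integrable (L \<Otimes>\<^sub>M M) (\<lambda>(u, x). f u x)"
    by (intro finite_measure.integrable_const_bound[OF ff, where B = "1 / y"]) (use fb in \<open>auto simp: case_prod_beta\<close>)
  have "(\<integral>u. Im (stieltjes M (Complex u y)) * indicator {a..b} u \<partial>lborel) = (\<integral>u. Im (stieltjes M (Complex u y)) \<partial>L)"
    unfolding L_def by (subst integral_restrict_space) (auto simp: mult.commute)
  also have "\<dots> = (\<integral>u. (\<integral>x. f u x \<partial>M) \<partial>L)"
    unfolding stieltjes_def Imf[symmetric] using stieltjes_integrable[of "Complex _ y"] y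
    by (intro Bochner_Integration.integral_cong refl integral_Im[symmetric]) simp
  also have "\<dots> = (\<integral>x. (\<integral>u. f u x \<partial>L) \<partial>M)" by (rule LM.Fubini_integral[OF int, symmetric])
  also have "\<dots> = (\<integral>x. arctan ((b - x) / y) - arctan ((a - x) / y) \<partial>M)"
  proof (rule Bochner_Integration.integral_cong[OF refl])
    fix x
    have "(\<integral>u. f u x \<partial>L) = (\<integral>u. f u x * indicator {a..b} u \<partial>lborel)"
      unfolding L_def by (subst integral_restrict_space) (auto simp: mult.commute)
    also have "\<dots> = arctan ((b - x) / y) - arctan ((a - x) / y)"
    proof (rule integral_FTC_Icc_real[OF ab])
      fix u
      have "((\<lambda>u. arctan ((u - x) / y)) has_real_derivative (1 / y) * inverse (1 + ((u - x) / y)\<^sup>2)) (at u)"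
        using y by (auto intro!: derivative_eq_intros)
      moreover have "(1 / y) * inverse (1 + ((u - x) / y)\<^sup>2) = f u x"
      proof -
        have "y * (1 + ((u - x) / y)\<^sup>2) = ((x - u)\<^sup>2 + y\<^sup>2) / y" using y by (simp add: power2_eq_square field_simps)
        hence "(1 / y) * inverse (1 + ((u - x) / y)\<^sup>2) = 1 / (((x - u)\<^sup>2 + y\<^sup>2) / y)" using y by (metis divide_inverse inverse_mult_distrib mult_1)
        thus ?thesis unfolding f_def by simp
      qed
      ultimately show "DERIV (\<lambda>u. arctan ((u - x) / y)) u :> f u x" by simp
      show "isCont (\<lambda>u. f u x) u" unfolding f_def using pos[of x u] by (intro continuous_intros) auto
    qed
    finally show "(\<integral>u. f u x \<partial>L) = arctan ((b - x) / y) - arctan ((a - x) / y)" .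
  qed
  finally show ?thesis .
qed

lemma arctan_bound: "\<bar>arctan x\<bar> \<le> 2"
  using arctan_bounded[of x] pi_less_4 by linarith

lemma arctan_scaled_tendsto: "(\<lambda>k. arctan (x / (1 / real (Suc k)))) \<longlonglongrightarrow> pi / 2 * sgn x"
proof -
  have s: "filterlim (\<lambda>k. real (Suc k)) at_top sequentially"
    by (rule filterlim_compose[OF filterlim_real_sequentially filterlim_Suc])
  consider "x = 0" | "0 < x" | "x < 0" by linarith
  thus ?thesis
  proof cases
    case 2
    have "filterlim (\<lambda>k. x * real (Suc k)) at_top sequentially" by (rule filterlim_tendsto_pos_mult_at_top[OF tendsto_const 2 s])
    from filterlim_compose[OF tendsto_arctan_at_top this] show ?thesis using 2 by simp
  next
    case 3
    have "filterlim (\<lambda>k. x * real (Suc k)) at_bot sequentially" by (rule filterlim_tendsto_neg_mult_at_bot[OF tendsto_const 3 s])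
    from filterlim_compose[OF tendsto_arctan_at_bot this] show ?thesis using 3 by simp
  qed simp
qed

lemma integral_bounded_tendsto:
  fixes f :: "nat \<Rightarrow> real \<Rightarrow> real"
  assumes "\<And>k. f k \<in> borel_measurable borel" "g \<in> borel_measurable borel" "\<And>x. (\<lambda>k. f k x) \<longlonglongrightarrow> g x" "\<And>k x. \<bar>f k x\<bar> \<le> B"
  shows "(\<lambda>k. \<integral>x. f k x \<partial>M) \<longlonglongrightarrow> (\<integral>x. g x \<partial>M)"
  by (rule integral_dominated_convergence[where w = "\<lambda>_. B"]) (use assms in auto)

text \<open>Since \<open>sgn 0 = 0\<close>, the endpoints count with half weight. The next two
  limits remove this: the left end goes to minus infinity, and the right end approaches
  \<open>b\<close> from above, which restores the full mass at \<open>b\<close>.\<close>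

lemma sgn_diff_limit:
  assumes ab: "a \<le> b"
  shows "(\<lambda>k. \<integral>x. arctan ((b - x) / (1 / real (Suc k))) - arctan ((a - x) / (1 / real (Suc k))) \<partial>M)
    \<longlonglongrightarrow> (\<integral>x. pi / 2 * sgn (b - x) - pi / 2 * sgn (a - x) \<partial>M)"
proof (rule integral_bounded_tendsto[where B = 4])
  show "(\<lambda>k. arctan ((b - x) / (1 / real (Suc k))) - arctan ((a - x) / (1 / real (Suc k)))) \<longlonglongrightarrow> pi / 2 * sgn (b - x) - pi / 2 * sgn (a - x)" for x
    by (intro tendsto_diff arctan_scaled_tendsto)
  show "\<bar>arctan ((b - x) / (1 / real (Suc k))) - arctan ((a - x) / (1 / real (Suc k)))\<bar> \<le> 4" for k x
    using arctan_bound[of "(b - x) / (1 / real (Suc k))"] arctan_bound[of "(a - x) / (1 / real (Suc k))"] by linarith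
qed measurable

lemma sgn_left_limit:
  "(\<lambda>k. \<integral>x. pi / 2 * sgn (b - x) - pi / 2 * sgn (b - real k - x) \<partial>M) \<longlonglongrightarrow> (\<integral>x. pi / 2 * sgn (b - x) + pi / 2 \<partial>M)"
proof (rule integral_bounded_tendsto[where B = 8])
  show "(\<lambda>k. pi / 2 * sgn (b - x) - pi / 2 * sgn (b - real k - x)) \<longlonglongrightarrow> pi / 2 * sgn (b - x) + pi / 2" for x
  proof (rule tendsto_eventually)
    have "eventually (\<lambda>k. b - x < real k) sequentially"
      by (rule filterlim_real_sequentially[THEN filterlim_at_top_dense[THEN iffD1], rule_format])
    thus "eventually (\<lambda>k. pi / 2 * sgn (b - x) - pi / 2 * sgn (b - real k - x) = pi / 2 * sgn (b - x) + pi / 2) sequentially"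
      by eventually_elim simp
  qed
  show "\<bar>pi / 2 * sgn (b - x) - pi / 2 * sgn (b - real k - x)\<bar> \<le> 8" for k x
    using pi_less_4 pi_gt_zero by (auto simp: sgn_if)
qed measurable

lemma sgn_right_limit:
  "(\<lambda>k. \<integral>x. pi / 2 * sgn (b + 1 / real (Suc k) - x) + pi / 2 \<partial>M) \<longlonglongrightarrow> pi * cdf M b"
proof -
  have "(\<lambda>k. \<integral>x. pi / 2 * sgn (b + 1 / real (Suc k) - x) + pi / 2 \<partial>M) \<longlonglongrightarrow> (\<integral>x. pi * indicator {..b} x \<partial>M)"
  proof (rule integral_bounded_tendsto[where B = 8])
    show "(\<lambda>k. pi / 2 * sgn (b + 1 / real (Suc k) - x) + pi / 2) \<longlonglongrightarrow> pi * indicator {..b} x" for x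
    proof (rule tendsto_eventually)
      have l: "(\<lambda>k. 1 / real (Suc k)) \<longlonglongrightarrow> 0" by (rule LIMSEQ_Suc[OF lim_1_over_n])
      show "eventually (\<lambda>k. pi / 2 * sgn (b + 1 / real (Suc k) - x) + pi / 2 = pi * indicator {..b} x) sequentially"
      proof (cases "x \<le> b")
        case True
        have "sgn (b + 1 / real (Suc k) - x) = 1" for k
        proof -
          have "0 < 1 / real (Suc k)" by simp
          hence "0 < b + 1 / real (Suc k) - x" using True by linarith
          thus ?thesis by (rule sgn_pos)
        qed
        thus ?thesis using True by (intro always_eventually allI) (simp only: indicator_simps atMost_iff mult_1_right field_sum_of_halves)
      next
        case False
        hence "eventually (\<lambda>k. 1 / real (Suc k) < x - b) sequentially" using order_tendstoD(2)[OF l, of "x - b"] by simp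
        thus ?thesis by eventually_elim (use False in simp)
      qed
    qed
    show "\<bar>pi / 2 * sgn (b + 1 / real (Suc k) - x) + pi / 2\<bar> \<le> 8" for k x
      using pi_less_4 pi_gt_zero by (auto simp: sgn_if)
  qed measurable
  also have "(\<integral>x. pi * indicator {..b} x \<partial>M) = pi * cdf M b" by (simp add: cdf_def)
  finally show ?thesis .
qed

text \<open>The real part of \<open>- \<i> y m(\<i> y)\<close> is the integral of
  \<open>y\<^sup>2 / (x\<^sup>2 + y\<^sup>2)\<close>, and 1 minus this integrand is at least
  \<open>1/2\<close> where \<open>y \<le> \<bar>x\<bar>\<close>.\<close>

lemma stieltjes_tail:
  assumes y: "0 < y"
  shows "measure M {x. y \<le> \<bar>x\<bar>} \<le> 2 * (1 - Re (- \<i> * of_real y * stieltjes M (\<i> * of_real y)))"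
proof -
  let ?z = "\<i> * complex_of_real y"
  have i: "integrable M (\<lambda>x. 1 / (complex_of_real x - ?z))" by (rule stieltjes_integrable) (use y in simp)
  have pos: "0 < x\<^sup>2 + y\<^sup>2" for x :: real using y by (simp add: add_nonneg_pos)
  define h where "h x = y\<^sup>2 / (x\<^sup>2 + y\<^sup>2)" for x
  have e: "Re (- \<i> * of_real y * (1 / (complex_of_real x - ?z))) = h x" for x
    by (simp add: Re_divide Im_divide power2_eq_square h_def)
  have ie: "integrable M h"
    unfolding e[symmetric, abs_def] using i by (intro integrable_Re integrable_mult_right)
  have ie2: "integrable M (\<lambda>x. 2 * (1 - h x))" using ie by simp
  have "Re (- \<i> * of_real y * stieltjes M ?z) = Re (\<integral>x. - \<i> * of_real y * (1 / (complex_of_real x - ?z)) \<partial>M)"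
    unfolding stieltjes_def by (subst integral_mult_right_zero) simp
  also have "\<dots> = (\<integral>x. h x \<partial>M)"
    unfolding e[symmetric] by (rule integral_Re[symmetric]) (rule integrable_mult_right[OF i])
  finally have "2 * (1 - Re (- \<i> * of_real y * stieltjes M ?z)) = 2 * (1 - (\<integral>x. h x \<partial>M))" by (simp only:)
  also have "\<dots> = (\<integral>x. 2 * (1 - h x) \<partial>M)"
    using ie prob_space by simp
  finally have eq: "2 * (1 - Re (- \<i> * of_real y * stieltjes M ?z)) = (\<integral>x. 2 * (1 - h x) \<partial>M)" .
  have "measure M {x. y \<le> \<bar>x\<bar>} = (\<integral>x. indicator {x. y \<le> \<bar>x\<bar>} x \<partial>M)" by simp
  also have "\<dots> \<le> (\<integral>x. 2 * (1 - h x) \<partial>M)"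
  proof (rule integral_mono[OF _ ie2])
    show "integrable M (indicat_real {x. y \<le> \<bar>x\<bar>})"
      by (rule integrable_const_bound[where B = 1]) (auto intro!: borel_measurable_indicator)
    show "indicator {x. y \<le> \<bar>x\<bar>} x \<le> 2 * (1 - h x)" for x
    proof (cases "y \<le> \<bar>x\<bar>")
      case True
      hence "y\<^sup>2 \<le> x\<^sup>2" using y by (simp add: abs_le_square_iff[symmetric])
      thus ?thesis using True pos[of x] by (simp add: h_def field_simps)
    next
      case False
      thus ?thesis using pos[of x] by (simp add: h_def field_simps)
    qed
  qed
  finally show ?thesis unfolding eq .
qed

end

lemma stieltjes_unique:
  assumes M1: "real_distribution M1" and M2: "real_distribution M2"
    and eq: "\<And>z. 0 < Im z \<Longrightarrow> stieltjes M1 z = stieltjes M2 z"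
  shows "M1 = M2"
proof (rule cdf_unique[OF M1 M2], rule ext)
  fix b
  have at: "(\<integral>x. arctan ((b - x) / y) - arctan ((a - x) / y) \<partial>M1) = (\<integral>x. arctan ((b - x) / y) - arctan ((a - x) / y) \<partial>M2)"
    if "0 < y" "a \<le> b" for y a b
    unfolding stieltjes_arctan[OF M1 that, symmetric] stieltjes_arctan[OF M2 that, symmetric]
    using eq[of "Complex _ y"] that by simp
  have 1: "(\<integral>x. pi / 2 * sgn (b - x) - pi / 2 * sgn (a - x) \<partial>M1) = (\<integral>x. pi / 2 * sgn (b - x) - pi / 2 * sgn (a - x) \<partial>M2)"
    if "a \<le> b" for a b
    using LIMSEQ_unique[OF sgn_diff_limit[OF M1 that]] sgn_diff_limit[OF M2 that] at[OF _ that, of "1 / real (Suc _)"] by simp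
  have 2: "(\<integral>x. pi / 2 * sgn (b - x) + pi / 2 \<partial>M1) = (\<integral>x. pi / 2 * sgn (b - x) + pi / 2 \<partial>M2)" for b
    using LIMSEQ_unique[OF sgn_left_limit[OF M1, of b]] sgn_left_limit[OF M2, of b] 1[of "b - real _" b] by simp
  have "pi * cdf M1 b = pi * cdf M2 b"
    using LIMSEQ_unique[OF sgn_right_limit[OF M1, of b]] sgn_right_limit[OF M2, of b] 2 by simp
  thus "cdf M1 b = cdf M2 b" by simp
qed

text \<open>A countable set, so that almost sure convergence holds at all its points simultaneously;
  it contains the integer points of the imaginary axis used for tightness.\<close>

definition rational_upper_half :: "complex set" where
  "rational_upper_half = {z. Re z \<in> \<rat> \<and> Im z \<in> \<rat> \<and> 0 < Im z}"

lemma countable_rational_upper_half: "countable rational_upper_half"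
proof -
  have "rational_upper_half \<subseteq> (\<lambda>(a, b). Complex a b) ` (\<rat> \<times> \<rat>)"
    by (auto simp: rational_upper_half_def image_iff) (metis complex.collapse)
  thus ?thesis by (rule countable_subset) (intro countable_image countable_SIGMA countable_rat)
qed

lemma stieltjes_unique_rational:
  assumes M1: "real_distribution M1" and M2: "real_distribution M2"
    and eq: "\<And>z. z \<in> rational_upper_half \<Longrightarrow> stieltjes M1 z = stieltjes M2 z"
  shows "M1 = M2"
proof (rule stieltjes_unique[OF M1 M2])
  fix z assume z: "0 < Im z"
  have "\<exists>q\<in>\<rat>. x < q \<and> q < x + 1 / real (Suc k)" for x :: real and k
    using Rats_dense_in_real[of x "x + 1 / real (Suc k)"] by auto
  \<comment> \<open>Approximation from above keeps \<open>Im (Z k) \<ge> Im z\<close>, hence one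
    dominating constant for all \<open>k\<close>.\<close>
  then obtain q where q: "\<And>x k. q x k \<in> \<rat> \<and> x < q x k \<and> q x k < x + 1 / real (Suc k)" by metis
  have ql: "(\<lambda>k. q x k) \<longlonglongrightarrow> x" for x
  proof (rule tendsto_sandwich[OF _ _ tendsto_const])
    show "(\<lambda>k. x + 1 / real (Suc k)) \<longlonglongrightarrow> x"
      using tendsto_add[OF tendsto_const[of x] LIMSEQ_Suc[OF lim_1_over_n]] by simp
  qed (use q in \<open>auto intro!: always_eventually less_imp_le\<close>)
  define Z where "Z k = Complex (q (Re z) k) (q (Im z) k)" for k
  have "Z \<longlonglongrightarrow> Complex (Re z) (Im z)" unfolding Z_def by (intro tendsto_Complex ql)
  hence Zl: "Z \<longlonglongrightarrow> z" by simp
  have Zi: "Im z \<le> Im (Z k)" for k using q[of "Im z" k] by (simp add: Z_def)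
  have ZQ: "Z k \<in> rational_upper_half" for k
    using q[of "Im z" k] q[of "Re z" k] z unfolding Z_def rational_upper_half_def by auto
  show "stieltjes M1 z = stieltjes M2 z"
    using LIMSEQ_unique[OF stieltjes_tendsto[OF M1 Zl z Zi]] stieltjes_tendsto[OF M2 Zl z Zi] eq[OF ZQ] by simp
qed

text \<open>A point far up the imaginary axis makes the tail bound for \<open>m\<close> small;
  convergence there transfers it to all large \<open>n\<close>, and the finitely many remaining
  measures are tight individually.\<close>

lemma tight_from_stieltjes:
  assumes \<mu>: "\<And>n. real_distribution (\<mu> n)"
    and lim: "\<And>k::nat. 0 < k \<Longrightarrow> (\<lambda>n. stieltjes (\<mu> n) (\<i> * of_nat k)) \<longlonglongrightarrow> m (\<i> * of_nat k)"
    and mlim: "(\<lambda>k::nat. - \<i> * of_nat k * m (\<i> * of_nat k)) \<longlonglongrightarrow> 1"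
  shows "tight \<mu>"
  unfolding tight_def
proof (intro conjI allI impI \<mu>)
  fix \<epsilon> :: real assume e: "0 < \<epsilon>"
  let ?T = "\<lambda>n k. measure (\<mu> n) {x. real k \<le> \<bar>x\<bar>}"
  have mono: "?T n k \<le> ?T n l" if "l \<le> k" for n k l
  proof -
    interpret real_distribution "\<mu> n" by (rule \<mu>)
    show ?thesis by (rule finite_measure_mono) (use that in auto)
  qed
  have single: "\<exists>k. ?T n k < \<epsilon>" for n
  proof -
    interpret real_distribution "\<mu> n" by (rule \<mu>)
    have "(\<lambda>k. ?T n k) \<longlonglongrightarrow> measure (\<mu> n) (\<Inter>k. {x. real k \<le> \<bar>x\<bar>})"
      by (rule finite_Lim_measure_decseq) (auto simp: decseq_def)
    moreover have "(\<Inter>k. {x::real. real k \<le> \<bar>x\<bar>}) = {}"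
    proof -
      have "x \<notin> (\<Inter>k. {x::real. real k \<le> \<bar>x\<bar>})" for x
      proof -
        obtain k where "\<bar>x\<bar> < real k" using reals_Archimedean2 by blast
        thus ?thesis by (auto simp: not_le intro!: exI[of _ k])
      qed
      thus ?thesis by blast
    qed
    ultimately have "(\<lambda>k. ?T n k) \<longlonglongrightarrow> 0" by simp
    hence "eventually (\<lambda>k. ?T n k < \<epsilon>) sequentially" by (rule order_tendstoD) (rule e)
    thus ?thesis by (auto simp: eventually_sequentially)
  qed
  then obtain k1 where k1: "\<And>n. ?T n (k1 n) < \<epsilon>" by metis
  have "(\<lambda>k::nat. 2 * (1 - Re (- \<i> * of_nat k * m (\<i> * of_nat k)))) \<longlonglongrightarrow> 2 * (1 - Re 1)"
    by (intro tendsto_intros mlim)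
  hence "eventually (\<lambda>k::nat. 2 * (1 - Re (- \<i> * of_nat k * m (\<i> * of_nat k))) < \<epsilon>) sequentially"
    by (rule order_tendstoD) (use e in simp)
  then obtain j :: nat where j: "\<And>k. j \<le> k \<Longrightarrow> 2 * (1 - Re (- \<i> * of_nat k * m (\<i> * of_nat k))) < \<epsilon>"
    unfolding eventually_sequentially by blast
  define k0 where "k0 = Suc j"
  have k0: "0 < k0" "2 * (1 - Re (- \<i> * of_nat k0 * m (\<i> * of_nat k0))) < \<epsilon>"
    using j[of k0] by (simp_all add: k0_def)
  have "(\<lambda>n. 2 * (1 - Re (- \<i> * of_nat k0 * stieltjes (\<mu> n) (\<i> * of_nat k0)))) \<longlonglongrightarrow> 2 * (1 - Re (- \<i> * of_nat k0 * m (\<i> * of_nat k0)))"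
    by (intro tendsto_intros lim k0)
  hence "eventually (\<lambda>n. 2 * (1 - Re (- \<i> * of_nat k0 * stieltjes (\<mu> n) (\<i> * of_nat k0))) < \<epsilon>) sequentially"
    by (rule order_tendstoD) (rule k0)
  then obtain n0 where n0: "\<And>n. n0 \<le> n \<Longrightarrow> 2 * (1 - Re (- \<i> * of_nat k0 * stieltjes (\<mu> n) (\<i> * of_nat k0))) < \<epsilon>"
    unfolding eventually_sequentially by blast
  have big: "?T n k0 < \<epsilon>" if "n0 \<le> n" for n
  proof -
    have "?T n k0 \<le> 2 * (1 - Re (- \<i> * of_real (real k0) * stieltjes (\<mu> n) (\<i> * of_real (real k0))))"
      by (rule stieltjes_tail[OF \<mu>]) (use k0(1) in simp)
    thus ?thesis using n0[OF that] unfolding of_real_of_nat_eq by (rule le_less_trans)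
  qed
  define k where "k = Suc (Max (insert k0 (k1 ` {..<n0})))"
  have kk: "?T n (k - 1) < \<epsilon>" for n
  proof (cases "n0 \<le> n")
    case True
    have "k0 \<le> k - 1" unfolding k_def by simp
    thus ?thesis using mono[of k0 "k - 1" n] big[OF True] by linarith
  next
    case False
    hence "k1 n \<le> k - 1" unfolding k_def by (auto intro!: Max_ge)
    thus ?thesis using mono[of "k1 n" "k - 1" n] k1[of n] by linarith
  qed
  show "\<exists>a b. a < b \<and> (\<forall>n. 1 - \<epsilon> < measure (\<mu> n) {a<..b})"
  proof (intro exI conjI allI)
    show "- real k < real k" unfolding k_def by simp
    fix n
    interpret real_distribution "\<mu> n" by (rule \<mu>)
    have "1 - measure (\<mu> n) {- real k<..real k} = measure (\<mu> n) (- {- real k<..real k})"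
      using prob_compl[of "{- real k<..real k}"] by (simp add: Compl_eq_Diff_UNIV)
    also have "\<dots> \<le> ?T n (k - 1)" by (rule finite_measure_mono) (auto simp: k_def)
    finally show "1 - \<epsilon> < measure (\<mu> n) {- real k<..real k}" using kk[of n] by linarith
  qed
qed

lemma stieltjes_weak_limit:
  assumes \<mu>: "\<And>n. real_distribution (\<mu> n)" and M: "real_distribution M" and w: "weak_conv_m \<mu> M" and z: "0 < Im z"
  shows "(\<lambda>n. stieltjes (\<mu> n) z) \<longlonglongrightarrow> stieltjes M z"
  unfolding stieltjes_def
proof (rule weak_conv_imp_integral_bdd_continuous_conv[OF \<mu> M w])
  show "isCont (\<lambda>x. 1 / (complex_of_real x - z)) x" for x using z by (intro continuous_intros) auto
  show "cmod (1 / (complex_of_real x - z)) \<le> 1 / Im z" for x by (rule stieltjes_kernel_bound[OF z order_refl])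
qed

text \<open>By tightness it suffices to identify the limits of weakly convergent subsequences; each
  of them has the transform of \<open>M\<close> at the rational points.\<close>

lemma weak_conv_from_stieltjes:
  assumes \<mu>: "\<And>n. real_distribution (\<mu> n)" and M: "real_distribution M" and t: "tight \<mu>"
    and lim: "\<And>z. z \<in> rational_upper_half \<Longrightarrow> (\<lambda>n. stieltjes (\<mu> n) z) \<longlonglongrightarrow> stieltjes M z"
  shows "weak_conv_m \<mu> M"
proof (rule tight_subseq_weak_converge[OF \<mu> M t])
  fix s \<nu> assume s: "strict_mono s" and \<nu>: "real_distribution \<nu>" and w: "weak_conv_m (\<mu> \<circ> s) \<nu>"
  have "\<nu> = M"
  proof (rule stieltjes_unique_rational[OF \<nu> M])
    fix z assume z: "z \<in> rational_upper_half"
    have "(\<lambda>n. stieltjes (\<mu> (s n)) z) \<longlonglongrightarrow> stieltjes M z"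
      using LIMSEQ_subseq_LIMSEQ[OF lim[OF z] s] by (simp add: o_def)
    moreover have "(\<lambda>n. stieltjes ((\<mu> \<circ> s) n) z) \<longlonglongrightarrow> stieltjes \<nu> z"
      by (rule stieltjes_weak_limit[OF _ \<nu> w]) (use \<mu> z in \<open>auto simp: rational_upper_half_def\<close>)
    ultimately show "stieltjes \<nu> z = stieltjes M z" using LIMSEQ_unique by (simp add: o_def)
  qed
  thus "weak_conv_m (\<mu> \<circ> s) M" using w by simp
qed

text \<open>For use when \<open>m\<close> is only known as a formula in the solution of the
  equation: tightness of one sequence shows that \<open>m\<close> is a transform on the rational
  points.\<close>

lemma weak_limit_exists:
  assumes \<mu>: "\<And>n. real_distribution (\<mu> n)" and t: "tight \<mu>"
    and lim: "\<And>z. z \<in> rational_upper_half \<Longrightarrow> (\<lambda>n. stieltjes (\<mu> n) z) \<longlonglongrightarrow> m z"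
  obtains M where "real_distribution M" "\<And>z. z \<in> rational_upper_half \<Longrightarrow> stieltjes M z = m z"
proof -
  obtain r M where r: "strict_mono r" and M: "real_distribution M" and w: "weak_conv_m (\<mu> \<circ> id \<circ> r) M"
    using tight_imp_convergent_subsubsequence[OF t strict_mono_id] by auto
  have "stieltjes M z = m z" if z: "z \<in> rational_upper_half" for z
  proof -
    have "(\<lambda>n. stieltjes ((\<mu> \<circ> id \<circ> r) n) z) \<longlonglongrightarrow> stieltjes M z"
      by (rule stieltjes_weak_limit[OF _ M w]) (use \<mu> z in \<open>auto simp: rational_upper_half_def\<close>)
    moreover have "(\<lambda>n. stieltjes (\<mu> (r n)) z) \<longlonglongrightarrow> m z"
      using LIMSEQ_subseq_LIMSEQ[OF lim[OF z] r] by (simp add: o_def)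
    ultimately show ?thesis using LIMSEQ_unique by (simp add: o_def)
  qed
  thus ?thesis using that M by blast
qed

section \<open>Spectral decompositions\<close>

text \<open>Kernels are total functions whose entries beyond \<open>n\<close> are arbitrary;
  multiplication by \<open>kone\<close>, for instance, reproduces entries only below
  \<open>n\<close>.\<close>

definition keq :: "nat \<Rightarrow> (nat \<Rightarrow> nat \<Rightarrow> complex) \<Rightarrow> (nat \<Rightarrow> nat \<Rightarrow> complex) \<Rightarrow> bool" where
  "keq n A B \<longleftrightarrow> (\<forall>i<n. \<forall>k<n. A i k = B i k)"

abbreviation "kone \<equiv> kdiag (\<lambda>_. 1)"

lemma keq_refl [simp]: "keq n A A" and keq_sym: "keq n A B \<Longrightarrow> keq n B A"
  and keq_trans: "keq n A B \<Longrightarrow> keq n B C \<Longrightarrow> keq n A C"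
  unfolding keq_def by auto

lemma keqD: "keq n A B \<Longrightarrow> i < n \<Longrightarrow> k < n \<Longrightarrow> A i k = B i k"
  unfolding keq_def by auto

lemma kmul_keq: "keq n A A' \<Longrightarrow> keq n B B' \<Longrightarrow> keq n (kmul n A B) (kmul n A' B')"
  unfolding keq_def kmul_def by auto

lemma kapp_keq: "keq n A A' \<Longrightarrow> i < n \<Longrightarrow> kapp n A x i = kapp n A' x i"
  unfolding keq_def by (intro kapp_cong) auto

lemma kmul_kone: "keq n (kmul n kone A) A" "keq n (kmul n A kone) A"
  unfolding keq_def by (auto simp: kmul_kdiag_left kmul_kdiag_right)

lemma kadj_kmul: "kadj (kmul n A B) = kmul n (kadj B) (kadj A)"
  unfolding kadj_def kmul_def by (simp add: fun_eq_iff mult.commute)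

lemma kunitary_keq: "kunitary n U \<longleftrightarrow> keq n (kmul n U (kadj U)) kone \<and> keq n (kmul n (kadj U) U) kone"
  unfolding kunitary_def keq_def kdiag_def by simp

lemma keq_cancel_middle:
  assumes "keq n (kmul n B C) kone"
  shows "keq n (kmul n (kmul n A B) (kmul n C D)) (kmul n A D)"
proof -
  have "kmul n (kmul n A B) (kmul n C D) = kmul n A (kmul n (kmul n B C) D)" by (simp add: kmul_assoc)
  moreover have "keq n (kmul n (kmul n B C) D) D"
    by (rule keq_trans[OF kmul_keq[OF assms keq_refl] kmul_kone(1)])
  ultimately show ?thesis by (simp add: kmul_keq)
qed

lemma kunitary_kmul:
  assumes "kunitary n U" "kunitary n V"
  shows "kunitary n (kmul n U V)"
  using assms unfolding kunitary_keq kadj_kmul by (blast intro: keq_trans[OF keq_cancel_middle])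

definition kspectral :: "nat \<Rightarrow> (nat \<Rightarrow> nat \<Rightarrow> complex) \<Rightarrow> (nat \<Rightarrow> real) \<Rightarrow> nat \<Rightarrow> nat \<Rightarrow> complex" where
  "kspectral n U \<mu> = kmul n U (kmul n (kdiag (\<lambda>l. of_real (\<mu> l))) (kadj U))"

lemma kspectral_eq: "i < n \<Longrightarrow> kspectral n U \<mu> i k = (\<Sum>l<n. U i l * of_real (\<mu> l) * cnj (U k l))"
  unfolding kspectral_def kmul_def[of n U] by (intro sum.cong) (auto simp: kmul_kdiag_left kadj_def)

lemma kherm_eigenvector:
  fixes A :: "nat \<Rightarrow> nat \<Rightarrow> complex"
  obtains x e where "knorm (Suc n) x = 1" "\<And>i. i < Suc n \<Longrightarrow> kapp (Suc n) A x i = e * x i"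
proof -
  let ?m = "Suc n"
  define M where "M = mat ?m ?m (\<lambda>(i, k). A i k)"
  have M: "M \<in> carrier_mat ?m ?m" by (simp add: M_def)
  have "degree (char_poly M) = ?m" using degree_monic_char_poly[OF M] by simp
  hence "\<not> constant (poly (char_poly M))" by (simp add: constant_degree)
  then obtain e where "poly (char_poly M) e = 0" using fundamental_theorem_of_algebra by blast
  hence "eigenvalue M e" by (simp add: eigenvalue_root_char_poly[OF M])
  then obtain y where "eigenvector M y e" unfolding eigenvalue_def by blast
  hence y: "y \<in> carrier_vec ?m" "y \<noteq> 0\<^sub>v ?m" "M *\<^sub>v y = e \<cdot>\<^sub>v y" using M by (auto simp: eigenvector_def)
  define x where "x i = y $ i" for i
  have ev: "kapp ?m A x i = e * x i" if i: "i < ?m" for i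
  proof -
    have "(M *\<^sub>v y) $ i = (\<Sum>k<?m. A i k * y $ k)"
      using i y(1) by (simp add: M_def scalar_prod_def lessThan_atLeast0)
    thus ?thesis using y(1,3) i by (simp add: kapp_def x_def)
  qed
  have nz: "knorm ?m x \<noteq> 0"
  proof
    assume "knorm ?m x = 0"
    hence "y = 0\<^sub>v ?m" using y(1) by (intro eq_vecI) (auto simp: knorm_eq_0 x_def)
    thus False using y by simp
  qed
  define c where "c = complex_of_real (1 / knorm ?m x)"
  have "(knorm ?m (\<lambda>i. c * x i))\<^sup>2 = (cmod c)\<^sup>2 * (knorm ?m x)\<^sup>2"
    unfolding knorm_sq by (simp add: norm_mult power_mult_distrib sum_distrib_left del: sum.lessThan_Suc)
  also have "\<dots> = 1" using nz by (simp add: c_def norm_divide power_divide)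
  finally have "knorm ?m (\<lambda>i. c * x i) = 1" by (simp add: power2_eq_1_iff) (use knorm_nonneg[of ?m "\<lambda>i. c * x i"] in linarith)
  moreover have "kapp ?m A (\<lambda>i. c * x i) i = e * (c * x i)" if "i < ?m" for i
    unfolding kapp_smult ev[OF that] by simp
  ultimately show ?thesis using that by blast
qed

lemma reflection_product:
  fixes p q a b w w' s :: complex
  shows "(p - a * w' / s) * (q - w * b / s) = p * q - p * (w * b / s) - q * (a * w' / s) + a * b / s\<^sup>2 * (w * w')"
  by (simp add: divide_inverse algebra_simps power2_eq_square)

lemma reflection_cancel:
  fixes s :: complex
  shows "s \<noteq> 0 \<Longrightarrow> d - y / s - y / s + y / s\<^sup>2 * (2 * s) = d"
  by (simp add: field_simps power2_eq_square)

text \<open>The reflection exchanging \<open>x\<close> and the last basis vector; the phase of \<open>x\<close> is chosen such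
  that its last entry is nonpositive, so that the reflection is defined in all cases.\<close>

lemma householder:
  assumes x: "knorm (Suc n) x = 1" and xn: "Im (x n) = 0" "Re (x n) \<le> 0"
    and u_def: "u = (\<lambda>i. (if i = n then 1 else 0) - x i)"
    and W_def: "W = (\<lambda>i k. (if i = k then 1 else 0) - u i * cnj (u k) / (1 - x n))"
  shows "kadj W = W" "keq (Suc n) (kmul (Suc n) W W) kone" "W i n = x i"
proof -
  have xr: "cnj (x n) = x n" using xn(1) by (simp add: complex_eq_iff)
  have s0: "1 - x n \<noteq> 0" using xn(2) by (auto simp: complex_eq_iff)
  show W: "kadj W = W" unfolding kadj_def W_def by (auto simp: fun_eq_iff xr)
  have un: "u n = 1 - x n" by (simp add: u_def)
  show "W i n = x i" using s0 unfolding W_def un by (simp add: u_def xr)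
  have "(\<Sum>l<Suc n. u l * cnj (u l)) = (\<Sum>l<n. x l * cnj (x l)) + (1 - x n) * cnj (1 - x n)"
    unfolding u_def by simp
  also have "\<dots> = (\<Sum>l<Suc n. x l * cnj (x l)) + 1 - 2 * x n" by (simp add: xr algebra_simps)
  also have "(\<Sum>l<Suc n. x l * cnj (x l)) = of_real ((knorm (Suc n) x)\<^sup>2)"
    unfolding knorm_sq of_real_sum by (intro sum.cong refl) (simp add: complex_norm_square del: of_real_power)
  finally have uu: "(\<Sum>l<Suc n. u l * cnj (u l)) = 2 * (1 - x n)" using x by simp
  show "keq (Suc n) (kmul (Suc n) W W) kone"
    unfolding keq_def
  proof (intro allI impI)
    fix i k assume ik: "i < Suc n" "k < Suc n"
    have "kmul (Suc n) W W i k = (\<Sum>l<Suc n. (if i = l then 1 else 0) * (if l = k then 1 else 0)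
        - (if i = l then 1 else 0) * (u l * cnj (u k) / (1 - x n)) - (if l = k then 1 else 0) * (u i * cnj (u l) / (1 - x n))
        + u i * cnj (u k) / (1 - x n)\<^sup>2 * (u l * cnj (u l)))"
      unfolding kmul_def W_def reflection_product ..
    also have "\<dots> = (\<Sum>l<Suc n. (if i = l then 1 else 0) * (if l = k then 1 else 0))
        - (\<Sum>l<Suc n. (if i = l then 1 else 0) * (u l * cnj (u k) / (1 - x n)))
        - (\<Sum>l<Suc n. (if l = k then 1 else 0) * (u i * cnj (u l) / (1 - x n)))
        + u i * cnj (u k) / (1 - x n)\<^sup>2 * (\<Sum>l<Suc n. u l * cnj (u l))"
      unfolding sum.distrib sum_subtractf sum_distrib_left ..
    also have "(\<Sum>l<Suc n. (if i = l then 1 else 0) * (if l = k then 1 else 0::complex)) = (if i = k then 1 else 0)"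
      using ik by (subst sum.remove[of _ i]) (auto intro!: sum.neutral)
    also have "(\<Sum>l<Suc n. (if i = l then 1 else 0) * (u l * cnj (u k) / (1 - x n))) = u i * cnj (u k) / (1 - x n)"
      using ik by (subst sum.remove[of _ i]) (auto intro!: sum.neutral)
    also have "(\<Sum>l<Suc n. (if l = k then 1 else 0) * (u i * cnj (u l) / (1 - x n))) = u i * cnj (u k) / (1 - x n)"
      using ik by (subst sum.remove[of _ k]) (auto intro!: sum.neutral)
    also note uu
    finally show "kmul (Suc n) W W i k = kone i k"
      unfolding reflection_cancel[OF s0] by (simp add: kdiag_def)
  qed
qed

text \<open>Conjugation by the reflection \<open>W\<close> sends an eigenvector to the last basis
  vector. The last column is then diagonal, by Hermitian symmetry so is the last row, and the
  induction hypothesis applies to the remaining block.\<close>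

theorem kspectral_exists:
  "kherm n A \<Longrightarrow> \<exists>U \<mu>. kunitary n U \<and> keq n A (kspectral n U \<mu>)"
proof (induction n arbitrary: A)
  case 0
  show ?case by (simp add: kunitary_def keq_def)
next
  case (Suc n)
  let ?m = "Suc n"
  obtain y e where y: "knorm ?m y = 1" and yev: "\<And>i. i < ?m \<Longrightarrow> kapp ?m A y i = e * y i"
    using kherm_eigenvector[of n A] by blast
  define c where "c = (if y n = 0 then 1 else - cnj (y n) / of_real (cmod (y n)))"
  have c1: "cmod c = 1" by (auto simp: c_def norm_divide)
  define x where "x i = c * y i" for i
  have x1: "knorm ?m x = 1" using y unfolding knorm_def x_def by (simp add: norm_mult c1)
  have xn: "x n = - of_real (cmod (y n))"
  proof (cases "y n = 0")
    case False
    have "cnj (y n) * y n = of_real (cmod (y n)) * of_real (cmod (y n))"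
      using complex_norm_square[of "y n"] by (simp add: power2_eq_square mult.commute)
    thus ?thesis using False unfolding x_def c_def by (simp add: field_simps)
  qed (simp add: x_def)
  have xev: "kapp ?m A x i = e * x i" if "i < ?m" for i
    unfolding x_def kapp_smult yev[OF that] by simp
  have "kip ?m x (kapp ?m A x) = e * kip ?m x x"
    unfolding kip_smult_right[symmetric] by (rule kip_cong) (use xev in auto)
  hence "Im e = 0" using Im_kip_kherm[OF Suc.prems, of x] x1 by (simp add: kip_self)
  hence er: "e = of_real (Re e)" by (simp add: complex_eq_iff)
  define u where "u = (\<lambda>i. (if i = n then 1 else 0) - x i)"
  define W where "W = (\<lambda>i k. (if i = k then 1 else 0) - u i * cnj (u k) / (1 - x n))"
  note hh = householder[OF x1 _ _ u_def W_def]
  have Wh: "kadj W = W" and WW: "keq ?m (kmul ?m W W) kone" and Wn: "\<And>i. W i n = x i"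
    using hh xn by auto
  have Wu: "kunitary ?m W" unfolding kunitary_keq Wh using WW by simp
  define A' where "A' = kmul ?m W (kmul ?m A W)"
  have Ah: "keq ?m (kadj A) A" unfolding keq_def kadj_def using khermD[OF Suc.prems] by simp
  have A'h: "keq ?m (kadj A') A'"
    unfolding A'_def kadj_kmul Wh kmul_assoc by (intro kmul_keq keq_refl Ah)
  have A'n: "A' i n = (if i = n then e else 0)" if i: "i < ?m" for i
  proof -
    have "A' i n = kapp ?m W (kapp ?m A x) i"
      unfolding A'_def kmul_def kapp_def Wn ..
    also have "\<dots> = kapp ?m W (\<lambda>i. e * x i) i" by (rule kapp_cong) (use xev in auto)
    also have "\<dots> = e * kmul ?m W W i n" unfolding kapp_smult by (simp add: kapp_def kmul_def Wn)
    also have "kmul ?m W W i n = kone i n" by (rule keqD[OF WW]) (use i in auto)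
    finally show ?thesis by (simp add: kdiag_def)
  qed
  have "kherm n A'"
    unfolding kherm_def
  proof (intro allI impI)
    fix i k assume "i < n" "k < n"
    hence "kadj A' i k = A' i k" by (intro keqD[OF A'h]) auto
    thus "A' i k = cnj (A' k i)" by (simp add: kadj_def)
  qed
  from Suc.IH[OF this] obtain V \<mu> where V: "kunitary n V" and VA: "keq n A' (kspectral n V \<mu>)" by blast
  \<comment> \<open>The block diagonal extension of \<open>V\<close> by 1, matching the split-off
    eigenvalue \<open>Re e\<close> in \<open>\<mu>'\<close>.\<close>
  define V' where "V' = (\<lambda>i l. if i < n \<and> l < n then V i l else if i = n \<and> l = n then 1 else 0)"
  define \<mu>' where "\<mu>' l = (if l = n then Re e else \<mu> l)" for l
  have V'u: "kunitary ?m V'"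
    unfolding kunitary_def
  proof (intro conjI allI impI)
    fix i k assume ik: "i < ?m" "k < ?m"
    have 1: "kmul ?m V' (kadj V') i k = (if i < n \<and> k < n then kmul n V (kadj V) i k else if i = k then 1 else 0)"
      using ik by (auto simp: kmul_def kadj_def V'_def less_Suc_eq)
    have 2: "kmul ?m (kadj V') V' i k = (if i < n \<and> k < n then kmul n (kadj V) V i k else if i = k then 1 else 0)"
      using ik by (auto simp: kmul_def kadj_def V'_def less_Suc_eq)
    show "kmul ?m V' (kadj V') i k = (if i = k then 1 else 0)" "kmul ?m (kadj V') V' i k = (if i = k then 1 else 0)"
      unfolding 1 2 using V by (auto simp: kunitary_def)
  qed
  have A'V: "keq ?m A' (kspectral ?m V' \<mu>')"
    unfolding keq_def
  proof (intro allI impI)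
    fix i k assume ik: "i < ?m" "k < ?m"
    have r: "kspectral ?m V' \<mu>' i k = (if i < n \<and> k < n then kspectral n V \<mu> i k else if i = k then e else 0)"
      using ik by (auto simp: kspectral_eq V'_def \<mu>'_def less_Suc_eq er[symmetric])
    have l: "A' n k = (if k = n then e else 0)"
      using A'n[OF ik(2)] keqD[OF A'h, of n k] ik er by (auto simp: kadj_def complex_eq_iff)
    show "A' i k = kspectral ?m V' \<mu>' i k"
      unfolding r using ik keqD[OF VA] A'n[OF ik(1)] l by (auto simp: less_Suc_eq)
  qed
  define D where "D = kdiag (\<lambda>l. complex_of_real (\<mu>' l))"
  have "kmul ?m W (kmul ?m A' W) = kmul ?m (kmul ?m W W) (kmul ?m A (kmul ?m W W))"
    unfolding A'_def by (simp only: kmul_assoc)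
  moreover have "keq ?m (kmul ?m (kmul ?m W W) (kmul ?m A (kmul ?m W W))) (kmul ?m kone (kmul ?m A kone))"
    by (intro kmul_keq WW keq_refl)
  moreover have "keq ?m (kmul ?m kone (kmul ?m A kone)) A"
    by (rule keq_trans[OF kmul_kone(1) kmul_kone(2)])
  ultimately have 1: "keq ?m (kmul ?m W (kmul ?m A' W)) A" using keq_trans by metis
  have 2: "keq ?m (kmul ?m W (kmul ?m A' W)) (kmul ?m W (kmul ?m (kspectral ?m V' \<mu>') W))" by (intro kmul_keq keq_refl A'V)
  have 3: "kmul ?m W (kmul ?m (kspectral ?m V' \<mu>') W) = kspectral ?m (kmul ?m W V') \<mu>'"
    unfolding kspectral_def kadj_kmul Wh by (simp only: kmul_assoc)
  have "keq ?m A (kspectral ?m (kmul ?m W V') \<mu>')"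
    using keq_trans[OF keq_sym[OF 1] 2] unfolding 3 .
  thus ?case using kunitary_kmul[OF Wu V'u] by blast
qed

lemma kspectral_column:
  assumes U: "kunitary n U" and A: "keq n A (kspectral n U \<mu>)" and l: "l < n" and i: "i < n"
  shows "kapp n A (\<lambda>i. U i l) i = of_real (\<mu> l) * U i l"
proof -
  have "kapp n A (\<lambda>i. U i l) i = kmul n (kspectral n U \<mu>) U i l"
    unfolding kapp_keq[OF A i] by (simp add: kapp_def kmul_def)
  also have "\<dots> = kmul n (kmul n U (kdiag (\<lambda>l. of_real (\<mu> l)))) (kmul n (kadj U) U) i l"
    unfolding kspectral_def by (simp add: kmul_assoc)
  also have "\<dots> = kmul n (kmul n U (kdiag (\<lambda>l. of_real (\<mu> l)))) kone i l"
    by (rule keqD[OF kmul_keq[OF keq_refl] i l]) (use U in \<open>simp add: kunitary_keq\<close>)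
  also have "\<dots> = of_real (\<mu> l) * U i l"
    using l by (simp add: kmul_kdiag_right)
  finally show ?thesis .
qed

lemma knorm_unitary_column:
  assumes U: "kunitary n U" and l: "l < n"
  shows "knorm n (\<lambda>i. U i l) = 1"
proof -
  have "complex_of_real ((knorm n (\<lambda>i. U i l))\<^sup>2) = kmul n (kadj U) U l l"
    unfolding kip_self[symmetric] by (simp add: kip_def kmul_def kadj_def)
  also have "\<dots> = 1" using U l by (simp add: kunitary_def)
  finally have "(knorm n (\<lambda>i. U i l))\<^sup>2 = 1" by (simp only: of_real_eq_1_iff)
  thus ?thesis using knorm_nonneg[of n "\<lambda>i. U i l"] by (simp add: power2_eq_1_iff)
qed

section \<open>Non-negative kernels, their square roots and resolvents\<close>

definition kpsd :: "nat \<Rightarrow> (nat \<Rightarrow> nat \<Rightarrow> complex) \<Rightarrow> bool" where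
  "kpsd n A \<longleftrightarrow> kherm n A \<and> (\<forall>x. 0 \<le> Re (kip n x (kapp n A x)))"

lemma kpsd_eigenvalue:
  assumes "kpsd n A" "kunitary n U" "keq n A (kspectral n U \<mu>)" "l < n"
  shows "0 \<le> \<mu> l"
proof -
  let ?x = "\<lambda>i. U i l"
  have "kip n ?x (kapp n A ?x) = of_real (\<mu> l) * kip n ?x ?x"
    unfolding kip_smult_right[symmetric]
    by (rule kip_cong) (use kspectral_column[OF assms(2-4)] in auto)
  hence "Re (kip n ?x (kapp n A ?x)) = \<mu> l" by (simp add: kip_self knorm_unitary_column[OF assms(2,4)])
  thus ?thesis using assms(1) by (metis kpsd_def)
qed

lemma kapp_matrix_diff: "kapp n (\<lambda>i k. A i k - B i k) x = (\<lambda>i. kapp n A x i - kapp n B x i)"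
  unfolding kapp_def by (simp add: fun_eq_iff left_diff_distrib sum_subtractf)

text \<open>With \<open>D = S - S'\<close> one has \<open>S D + D S' = 0\<close>. On a unit
  eigenvector of \<open>D\<close> with eigenvalue \<mu>, the forms \<open>a\<close>,
  \<open>b\<close> of \<open>S\<close>, \<open>S'\<close> satisfy \<open>\<mu> * (a + b) = 0\<close>
  and \<open>a - b = \<mu>\<close>; as their real parts are nonnegative, \<mu> = 0.\<close>

lemma kpsd_sqrt_unique:
  assumes S: "kpsd n S" and S': "kpsd n S'" and eq: "keq n (kmul n S S) (kmul n S' S')"
  shows "keq n S S'"
proof -
  define D where "D = (\<lambda>i k. S i k - S' i k)"
  have hS: "kherm n S" "kherm n S'" using S S' by (auto simp: kpsd_def)
  have "kherm n D" unfolding kherm_def D_def using khermD[OF hS(1)] khermD[OF hS(2)] by simp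
  then obtain U \<mu> where U: "kunitary n U" and D: "keq n D (kspectral n U \<mu>)" using kspectral_exists by blast
  have "\<mu> l = 0" if l: "l < n" for l
  proof (rule ccontr)
    assume nz: "\<mu> l \<noteq> 0"
    define x where "x = (\<lambda>i. U i l)"
    define a where "a = kip n x (kapp n S x)"
    define b where "b = kip n x (kapp n S' x)"
    have Dx: "kapp n D x i = of_real (\<mu> l) * x i" if "i < n" for i
      unfolding x_def by (rule kspectral_column[OF U D l that])
    have Dx': "kapp n D x = (\<lambda>i. kapp n S x i - kapp n S' x i)" unfolding D_def by (rule kapp_matrix_diff)
    have "kip n x (kapp n S (kapp n D x)) = of_real (\<mu> l) * a"
      unfolding a_def kip_smult_right[symmetric] kapp_smult[symmetric]
      by (rule kip_cong[OF refl], rule kapp_cong[OF refl], rule Dx)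
    moreover have "kip n x (kapp n D (kapp n S' x)) = of_real (\<mu> l) * b"
    proof -
      have "kip n x (kapp n D (kapp n S' x)) = kip n (kapp n D x) (kapp n S' x)" by (rule kip_kherm) fact
      also have "\<dots> = kip n (\<lambda>i. of_real (\<mu> l) * x i) (kapp n S' x)" by (rule kip_cong) (simp_all add: Dx)
      finally show ?thesis by (simp add: kip_smult_left b_def)
    qed
    moreover have "kip n x (kapp n S (kapp n D x)) + kip n x (kapp n D (kapp n S' x)) = 0"
    proof -
      have SS: "kapp n S (kapp n S x) i = kapp n S' (kapp n S' x) i" if "i < n" for i
        unfolding kapp_kmul[symmetric] by (rule kapp_keq[OF eq that])
      have "kip n x (kapp n S (kapp n D x)) + kip n x (kapp n D (kapp n S' x))
        = kip n x (kapp n S (kapp n S x)) - kip n x (kapp n S' (kapp n S' x))"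
        unfolding Dx' kapp_diff kip_diff_right D_def kapp_matrix_diff by simp
      also have "kip n x (kapp n S (kapp n S x)) = kip n x (kapp n S' (kapp n S' x))"
        by (rule kip_cong[OF refl SS])
      finally show ?thesis by simp
    qed
    ultimately have "of_real (\<mu> l) * (a + b) = 0" by (simp add: algebra_simps)
    hence "Re (a + b) = 0" using nz by auto
    moreover have "0 \<le> Re a" "0 \<le> Re b" unfolding a_def b_def using S S' by (auto simp: kpsd_def)
    ultimately have "Re a = 0" "Re b = 0" by auto
    moreover have "a - b = of_real (\<mu> l)"
    proof -
      have "a - b = kip n x (kapp n D x)" unfolding a_def b_def Dx' kip_diff_right ..
      also have "\<dots> = kip n x (\<lambda>i. of_real (\<mu> l) * x i)" by (rule kip_cong) (simp_all add: Dx)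
      finally show ?thesis by (simp add: kip_smult_right kip_self x_def knorm_unitary_column[OF U l])
    qed
    ultimately show False using nz by (auto simp: complex_eq_iff)
  qed
  hence "D i k = 0" if "i < n" "k < n" for i k
    unfolding keqD[OF D that] kspectral_eq[OF that(1)] by (intro sum.neutral) auto
  thus ?thesis unfolding keq_def D_def by auto
qed

lemma kspectral_kmul:
  assumes "kunitary n U"
  shows "keq n (kmul n (kspectral n U a) (kspectral n U b)) (kspectral n U (\<lambda>l. a l * b l))"
proof -
  let ?D = "\<lambda>a. kdiag (\<lambda>l. complex_of_real (a l))"
  have e1: "kmul n (kspectral n U a) (kspectral n U b)
      = kmul n (kmul n (kmul n U (?D a)) (kadj U)) (kmul n U (kmul n (?D b) (kadj U)))"
    unfolding kspectral_def by (simp only: kmul_assoc)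
  have e2: "keq n (kmul n (kmul n (kmul n U (?D a)) (kadj U)) (kmul n U (kmul n (?D b) (kadj U))))
      (kmul n (kmul n U (?D a)) (kmul n (?D b) (kadj U)))"
    by (rule keq_cancel_middle) (use assms in \<open>simp add: kunitary_keq\<close>)
  have e3: "kmul n (kmul n U (?D a)) (kmul n (?D b) (kadj U)) = kmul n U (kmul n (kmul n (?D a) (?D b)) (kadj U))"
    by (simp only: kmul_assoc)
  have e4: "keq n (kmul n U (kmul n (kmul n (?D a) (?D b)) (kadj U))) (kspectral n U (\<lambda>l. a l * b l))"
    unfolding kspectral_def
    by (intro kmul_keq keq_refl) (auto simp: keq_def kmul_kdiag_left, auto simp: kdiag_def)
  show ?thesis using keq_trans[OF e2[unfolded e3] e4] unfolding e1 .
qed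

lemma kherm_kspectral: "kherm n (kspectral n U a)"
  unfolding kherm_def by (simp add: kspectral_eq mult_ac)

lemma kip_kspectral: "kip n x (kapp n (kspectral n U a) x) = of_real (\<Sum>l<n. a l * (cmod (kapp n (kadj U) x l))\<^sup>2)"
proof -
  let ?y = "kapp n (kadj U) x"
  have "kip n x (kapp n (kspectral n U a) x) = kip n x (kapp n U (kapp n (kdiag (\<lambda>l. of_real (a l))) ?y))"
    unfolding kspectral_def by (intro kip_cong) (auto simp: kapp_kmul[abs_def])
  also have "\<dots> = kip n ?y (kapp n (kdiag (\<lambda>l. of_real (a l))) ?y)" unfolding kip_kapp_adj[of n x U] ..
  also have "\<dots> = (\<Sum>l<n. of_real (a l) * (cnj (?y l) * ?y l))"
    unfolding kip_def by (intro sum.cong) (auto simp: kapp_kdiag)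
  finally show ?thesis by (simp add: complex_norm_square mult.commute del: of_real_power)
qed

lemma kpsd_kspectral: "(\<And>l. l < n \<Longrightarrow> 0 \<le> a l) \<Longrightarrow> kpsd n (kspectral n U a)"
  unfolding kpsd_def kip_kspectral by (auto intro!: kherm_kspectral sum_nonneg)

lemma fraction_shift:
  fixes m z a b :: complex
  assumes "m - z \<noteq> 0"
  shows "a * m * (1 / (m - z) * b) - z * (a * (1 / (m - z) * b)) = a * b"
proof -
  define q where "q = 1 / (m - z)"
  have "a * m * (q * b) - z * (a * (q * b)) = a * b * ((m - z) * q)" by (simp add: algebra_simps)
  moreover have "(m - z) * q = 1" using assms by (simp add: q_def)
  ultimately show ?thesis unfolding q_def by simp
qed

lemma resolvent_kspectral:
  assumes "kunitary n U" "keq n A (kspectral n U \<mu>)" "0 < Im z"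
  defines "R \<equiv> kmul n U (kmul n (kdiag (\<lambda>l. 1 / (of_real (\<mu> l) - z))) (kadj U))"
  shows "is_resolvent n A z R" "ktr n R = (\<Sum>l<n. 1 / (of_real (\<mu> l) - z))"
proof -
  let ?D = "kdiag (\<lambda>l. complex_of_real (\<mu> l))" and ?E = "kdiag (\<lambda>l. 1 / (complex_of_real (\<mu> l) - z))"
  have UU: "keq n (kmul n (kadj U) U) kone" "keq n (kmul n U (kadj U)) kone" using assms(1) by (auto simp: kunitary_keq)
  have nz: "of_real (\<mu> l) - z \<noteq> 0" for l using assms(3) by (auto simp: complex_eq_iff)
  have e1: "kmul n (kspectral n U \<mu>) R = kmul n (kmul n (kmul n U ?D) (kadj U)) (kmul n U (kmul n ?E (kadj U)))"
    unfolding kspectral_def R_def by (simp only: kmul_assoc)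
  have e2: "keq n (kmul n (kmul n (kmul n U ?D) (kadj U)) (kmul n U (kmul n ?E (kadj U)))) (kmul n (kmul n U ?D) (kmul n ?E (kadj U)))"
    by (rule keq_cancel_middle[OF UU(1)])
  have 1: "keq n (kmul n A R) (kmul n (kmul n U ?D) (kmul n ?E (kadj U)))"
    by (rule keq_trans[OF kmul_keq[OF assms(2) keq_refl]]) (unfold e1, rule e2)
  have *: "kmul n A R i k - z * R i k = (if i = k then 1 else 0)" if ik: "i < n" "k < n" for i k
  proof -
    have AR: "kmul n A R i k = (\<Sum>l<n. U i l * of_real (\<mu> l) * (1 / (of_real (\<mu> l) - z) * cnj (U k l)))"
      by (subst keqD[OF 1 ik]) (simp add: kmul_def[of n "kmul n U ?D"] kmul_kdiag_left kmul_kdiag_right kadj_def)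
    have Rik: "R i k = (\<Sum>l<n. U i l * (1 / (of_real (\<mu> l) - z) * cnj (U k l)))"
      by (simp add: R_def kmul_def[of n U] kmul_kdiag_left kadj_def)
    have "kmul n A R i k - z * R i k = (\<Sum>l<n. U i l * cnj (U k l))"
      unfolding AR Rik sum_distrib_left sum_subtractf[symmetric]
      by (intro sum.cong refl fraction_shift nz)
    also have "\<dots> = kmul n U (kadj U) i k" by (simp add: kmul_def kadj_def)
    finally show ?thesis using keqD[OF UU(2) ik] by (simp add: kdiag_def)
  qed
  have e: "kmul n A R i k = z * R i k + (if i = k then 1 else 0)" if "i < n" "k < n" for i k
    using *[OF that] unfolding diff_eq_eq by (simp only: add.commute)
  show "is_resolvent n A z R"
    unfolding is_resolvent_def
  proof (intro allI impI)
    fix x i assume i: "i < n"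
    have "kapp n A (kapp n R x) i = (\<Sum>k<n. (z * R i k + (if i = k then 1 else 0)) * x k)"
      unfolding kapp_kmul[symmetric] by (simp add: kapp_def e i)
    also have "\<dots> = z * kapp n R x i + (\<Sum>k<n. (if i = k then x k else 0))"
      unfolding kapp_def distrib_right sum.distrib sum_distrib_left
      by (simp add: mult.assoc if_distrib[of "\<lambda>y. y * _"] cong: if_cong)
    also have "(\<Sum>k<n. (if i = k then x k else 0)) = x i" using i by simp
    finally show "kapp n A (kapp n R x) i - z * kapp n R x i = x i" by simp
  qed
  have "ktr n R = ktr n (kmul n (kmul n ?E (kadj U)) U)" unfolding R_def by (rule ktr_kmul_commute)
  also have "\<dots> = (\<Sum>l<n. 1 / (of_real (\<mu> l) - z) * kmul n (kadj U) U l l)"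
    unfolding ktr_def kmul_assoc by (intro sum.cong) (auto simp: kmul_kdiag_left)
  also have "\<dots> = (\<Sum>l<n. 1 / (of_real (\<mu> l) - z))"
    by (intro sum.cong) (auto simp: keqD[OF UU(1)] kdiag_def)
  finally show "ktr n R = (\<Sum>l<n. 1 / (of_real (\<mu> l) - z))" .
qed

section \<open>Empirical distributions and the transfer to \<open>complex mat\<close>\<close>

definition emp :: "nat \<Rightarrow> (nat \<Rightarrow> real) \<Rightarrow> real measure" where
  "emp n \<mu> = distr (measure_pmf (pmf_of_set {..<n})) borel \<mu>"

lemma emp_integral:
  fixes f :: "real \<Rightarrow> 'b::{banach, second_countable_topology}"
  assumes "0 < n" "f \<in> borel_measurable borel"
  shows "(\<integral>x. f x \<partial>emp n \<mu>) = (\<Sum>i<n. f (\<mu> i)) /\<^sub>R real n"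
proof -
  have "(\<integral>x. f x \<partial>emp n \<mu>) = (\<integral>i. f (\<mu> i) \<partial>measure_pmf (pmf_of_set {..<n}))"
    unfolding emp_def by (rule integral_distr) (use assms in auto)
  also have "\<dots> = (\<Sum>i<n. f (\<mu> i)) /\<^sub>R real n"
    using assms(1) by (subst integral_measure_pmf[of "{..<n}"])
      (auto simp: lessThan_empty_iff pmf_of_set scaleR_right.sum divide_inverse_commute intro!: sum.cong)
  finally show ?thesis .
qed

lemma emp_real_distribution: "real_distribution (emp n \<mu>)"
  unfolding emp_def
  by (intro real_distribution.intro prob_space.prob_space_distr real_distribution_axioms.intro) (auto intro: prob_space_measure_pmf)

lemma emp_cdf: "0 < n \<Longrightarrow> cdf (emp n \<mu>) x = (\<Sum>i<n. indicator {\<mu> i..} x) / real n"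
proof -
  assume n: "0 < n"
  interpret real_distribution "emp n \<mu>" by (rule emp_real_distribution)
  have "cdf (emp n \<mu>) x = (\<integral>y. indicator {..x} y \<partial>emp n \<mu>)" by (simp add: cdf_def)
  also have "\<dots> = (\<Sum>i<n. indicator {..x} (\<mu> i)) / real n"
    by (subst emp_integral[OF n]) (simp_all add: divide_inverse mult.commute)
  also have "(\<Sum>i<n. indicator {..x} (\<mu> i) :: real) = (\<Sum>i<n. indicator {\<mu> i..} x)"
    by (intro sum.cong) (auto simp: indicator_def)
  finally show ?thesis .
qed

lemma emp_stieltjes: "0 < n \<Longrightarrow> stieltjes (emp n \<mu>) z = (\<Sum>i<n. 1 / (complex_of_real (\<mu> i) - z)) / of_nat n"
  unfolding stieltjes_def by (subst emp_integral) (simp_all add: scaleR_conv_of_real divide_inverse mult.commute)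

definition kmat :: "complex mat \<Rightarrow> nat \<Rightarrow> nat \<Rightarrow> complex" where
  "kmat A = (\<lambda>i k. A $$ (i, k))"

lemma mat_adjoint_dim [simp]: "dim_row (mat_adjoint A) = dim_col A" "dim_col (mat_adjoint A) = dim_row A"
  unfolding mat_adjoint_def by simp_all

lemma mat_adjoint_index: "i < dim_col A \<Longrightarrow> k < dim_row A \<Longrightarrow> mat_adjoint A $$ (i, k) = cnj (A $$ (k, i))" for A :: "complex mat"
  unfolding mat_adjoint_def by (simp add: mat_of_rows_def)

lemma mult_index: "A \<in> carrier_mat n m \<Longrightarrow> B \<in> carrier_mat m p \<Longrightarrow> i < n \<Longrightarrow> k < p \<Longrightarrow>
    (A * B) $$ (i, k) = (\<Sum>l<m. A $$ (i, l) * B $$ (l, k))"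
  by (simp add: scalar_prod_def lessThan_atLeast0)

lemma proots_prod_linear: "proots (prod_list (map (\<lambda>a. [:- a, 1:]) xs)) = mset xs" for xs :: "complex list"
proof (induction xs)
  case (Cons a xs)
  have "prod_list (map (\<lambda>a. [:- a, 1:]) xs) \<noteq> 0" by (auto simp: prod_list_zero_iff)
  hence "proots ([:- a, 1:] * prod_list (map (\<lambda>a. [:- a, 1:]) xs)) = proots [:- a, 1:] + proots (prod_list (map (\<lambda>a. [:- a, 1:]) xs))"
    by (intro proots_mult) auto
  moreover have "proots [:- a, 1:] = {#a#}" by simp
  ultimately show ?case using Cons.IH by simp
qed simp

lemma esd_upper_triangular:
  assumes "A \<in> carrier_mat n n" "upper_triangular A" "\<And>i. i < n \<Longrightarrow> A $$ (i, i) = complex_of_real (\<mu> i)" "0 < n"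
  shows "esd A = cdf (emp n \<mu>)"
proof
  fix x
  have "proots (char_poly A) = mset (diag_mat A)"
    unfolding char_poly_upper_triangular[OF assms(1,2)] by (rule proots_prod_linear)
  moreover have "diag_mat A = map (\<lambda>i. complex_of_real (\<mu> i)) [0..<n]"
    unfolding diag_mat_def using assms(1,3) by auto
  ultimately have "proots (char_poly A) = image_mset (\<lambda>i. complex_of_real (\<mu> i)) (mset_set {..<n})"
    by (simp add: lessThan_atLeast0)
  hence "esd A x = (1 / real n) * (\<Sum>i<n. indicator {\<mu> i..} x)"
    unfolding esd_def using assms(1) by (simp add: sum_unfold_sum_mset image_mset.compositionality comp_def)
  thus "esd A x = cdf (emp n \<mu>) x" using emp_cdf[OF assms(4)] by simp
qed

lemma esd_kspectral:
  assumes A: "A \<in> carrier_mat n n" and U: "kunitary n U" and eq: "keq n (kmat A) (kspectral n U \<mu>)" and n: "0 < n"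
  shows "esd A = cdf (emp n \<mu>)"
proof -
  define D where "D = Matrix.mat n n (\<lambda>(i, k). kdiag (\<lambda>l. complex_of_real (\<mu> l)) i k)"
  define P where "P = Matrix.mat n n (\<lambda>(i, k). U i k)"
  define Q where "Q = Matrix.mat n n (\<lambda>(i, k). kadj U i k)"
  have c: "D \<in> carrier_mat n n" "P \<in> carrier_mat n n" "Q \<in> carrier_mat n n" by (auto simp: D_def P_def Q_def)
  have UU: "keq n (kmul n U (kadj U)) kone" "keq n (kmul n (kadj U) U) kone" using U by (simp_all add: kunitary_keq)
  have PQ: "P * Q = 1\<^sub>m n"
  proof (rule eq_matI)
    fix i k assume "i < dim_row (1\<^sub>m n :: complex mat)" "k < dim_col (1\<^sub>m n :: complex mat)"
    hence ik: "i < n" "k < n" by auto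
    have "(P * Q) $$ (i, k) = kmul n U (kadj U) i k"
      unfolding mult_index[OF c(2,3) ik] kmul_def by (intro sum.cong) (use ik in \<open>auto simp: P_def Q_def\<close>)
    thus "(P * Q) $$ (i, k) = 1\<^sub>m n $$ (i, k)" using keqD[OF UU(1) ik] ik by (simp add: kdiag_def)
  qed (use c in auto)
  have QP: "Q * P = 1\<^sub>m n"
  proof (rule eq_matI)
    fix i k assume "i < dim_row (1\<^sub>m n :: complex mat)" "k < dim_col (1\<^sub>m n :: complex mat)"
    hence ik: "i < n" "k < n" by auto
    have "(Q * P) $$ (i, k) = kmul n (kadj U) U i k"
      unfolding mult_index[OF c(3,2) ik] kmul_def by (intro sum.cong) (use ik in \<open>auto simp: P_def Q_def\<close>)
    thus "(Q * P) $$ (i, k) = 1\<^sub>m n $$ (i, k)" using keqD[OF UU(2) ik] ik by (simp add: kdiag_def)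
  qed (use c in auto)
  have "A = P * D * Q"
  proof (rule eq_matI)
    fix i k assume "i < dim_row (P * D * Q)" "k < dim_col (P * D * Q)"
    hence ik: "i < n" "k < n" using c by auto
    have "(P * D * Q) $$ (i, k) = (\<Sum>l<n. (P * D) $$ (i, l) * Q $$ (l, k))"
      by (rule mult_index) (use c ik in auto)
    also have "\<dots> = (\<Sum>l<n. kmul n U (kdiag (\<lambda>l. complex_of_real (\<mu> l))) i l * kadj U l k)"
    proof (intro sum.cong refl)
      fix l assume "l \<in> {..<n}"
      hence l: "l < n" by simp
      have "(P * D) $$ (i, l) = (\<Sum>j<n. P $$ (i, j) * D $$ (j, l))" by (rule mult_index[OF c(2,1) ik(1) l])
      also have "\<dots> = kmul n U (kdiag (\<lambda>l. complex_of_real (\<mu> l))) i l"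
        unfolding kmul_def by (intro sum.cong) (use ik l in \<open>auto simp: P_def D_def\<close>)
      finally show "(P * D) $$ (i, l) * Q $$ (l, k) = kmul n U (kdiag (\<lambda>l. complex_of_real (\<mu> l))) i l * kadj U l k"
        using l ik by (simp add: Q_def)
    qed
    also have "\<dots> = kmul n (kmul n U (kdiag (\<lambda>l. complex_of_real (\<mu> l)))) (kadj U) i k" by (simp add: kmul_def)
    also have "\<dots> = kspectral n U \<mu> i k" by (simp add: kspectral_def kmul_assoc)
    also have "\<dots> = A $$ (i, k)" using keqD[OF eq ik] by (simp add: kmat_def)
    finally show "A $$ (i, k) = (P * D * Q) $$ (i, k)" by simp
  qed (use A c in auto)
  hence "similar_mat A D" using A c PQ QP by (intro similar_matI[of A D P Q n]) auto
  hence "char_poly A = char_poly D" by (rule char_poly_similar)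
  hence "esd A = esd D" unfolding esd_def using A c by (auto simp: fun_eq_iff)
  also have "\<dots> = cdf (emp n \<mu>)"
    by (rule esd_upper_triangular[OF c(1) _ _ n]) (auto simp: D_def kdiag_def upper_triangular_def)
  finally show ?thesis .
qed

lemma mult_vec_scalar_prod:
  fixes A :: "complex mat" and y :: "complex Matrix.vec"
  assumes "A \<in> carrier_mat n n" "y \<in> carrier_vec n"
  shows "(A *\<^sub>v y) \<bullet>c y = kip n (vec_index y) (kapp n (kmat A) (vec_index y))"
  unfolding kip_def kapp_def kmat_def
  using assms by (simp add: scalar_prod_def lessThan_atLeast0 mult.commute)

lemma kpsd_kmat:
  assumes "nonneg_definite A" "A \<in> carrier_mat n n"
  shows "kpsd n (kmat A)"
  unfolding kpsd_def
proof (intro conjI allI)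
  have adj: "mat_adjoint A = A" using assms(1) by (simp add: nonneg_definite_def)
  show "kherm n (kmat A)"
    unfolding kherm_def
  proof (intro allI impI)
    fix i k assume "i < n" "k < n"
    hence "mat_adjoint A $$ (i, k) = cnj (A $$ (k, i))" using assms(2) by (intro mat_adjoint_index) auto
    thus "kmat A i k = cnj (kmat A k i)" unfolding adj by (simp add: kmat_def)
  qed
  fix x :: "nat \<Rightarrow> complex"
  define y where "y = Matrix.vec n x"
  have yc: "y \<in> carrier_vec n" by (simp add: y_def)
  have yi: "vec_index y i = x i" if "i < n" for i using that by (simp add: y_def)
  have "kip n (vec_index y) (kapp n (kmat A) (vec_index y)) = kip n x (kapp n (kmat A) x)"
    unfolding kip_def kapp_def by (intro sum.cong arg_cong2[of _ _ _ _ "(*)"]) (auto simp: yi)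
  moreover have "0 \<le> Re ((A *\<^sub>v y) \<bullet>c y)"
    using assms yc unfolding nonneg_definite_def by simp
  ultimately show "0 \<le> Re (kip n x (kapp n (kmat A) x))"
    unfolding mult_vec_scalar_prod[OF assms(2) yc] by simp
qed

lemma nonneg_definite_mat:
  assumes "kpsd n S"
  shows "nonneg_definite (Matrix.mat n n (\<lambda>(i, k). S i k))"
  unfolding nonneg_definite_def
proof (intro conjI ballI)
  let ?M = "Matrix.mat n n (\<lambda>(i, k). S i k)"
  have h: "kherm n S" using assms by (simp add: kpsd_def)
  show "square_mat ?M" by simp
  show "mat_adjoint ?M = ?M"
  proof (rule eq_matI)
    fix i k assume "i < dim_row ?M" "k < dim_col ?M"
    hence ik: "i < n" "k < n" by auto
    hence "mat_adjoint ?M $$ (i, k) = cnj (?M $$ (k, i))" by (intro mat_adjoint_index) auto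
    thus "mat_adjoint ?M $$ (i, k) = ?M $$ (i, k)" using khermD[OF h ik] ik by simp
  qed simp_all
  fix y :: "complex Matrix.vec" assume y: "y \<in> carrier_vec (dim_row ?M)"
  have M: "?M \<in> carrier_mat n n" by simp
  have yc: "y \<in> carrier_vec n" using y by simp
  have "kip n (vec_index y) (kapp n (kmat ?M) (vec_index y)) = kip n (vec_index y) (kapp n S (vec_index y))"
    unfolding kip_def kapp_def kmat_def by (intro sum.cong arg_cong2[of _ _ _ _ "(*)"]) auto
  thus "0 \<le> Re ((?M *\<^sub>v y) \<bullet>c y)"
    unfolding mult_vec_scalar_prod[OF M yc] using assms by (simp add: kpsd_def)
qed

text \<open>Existence by taking roots of the eigenvalues, uniqueness by
  \<open>kpsd_sqrt_unique\<close>: together they justify the definite description in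
  \<open>psd_sqrt\<close>.\<close>

lemma psd_sqrt_kspectral:
  assumes A: "A \<in> carrier_mat n n" and psd: "nonneg_definite A" and U: "kunitary n U" and eq: "keq n (kmat A) (kspectral n U t)"
  shows "psd_sqrt A \<in> carrier_mat n n" "keq n (kmat (psd_sqrt A)) (kspectral n U (\<lambda>l. sqrt (t l)))"
proof -
  have t: "0 \<le> t l" if "l < n" for l by (rule kpsd_eigenvalue[OF kpsd_kmat[OF psd A] U eq that])
  define K where "K = kspectral n U (\<lambda>l. sqrt (t l))"
  define S where "S = Matrix.mat n n (\<lambda>(i, k). K i k)"
  have S: "S \<in> carrier_mat n n" by (simp add: S_def)
  have kS: "keq n (kmat S) K" by (simp add: keq_def kmat_def S_def)
  have Kpsd: "kpsd n K" unfolding K_def by (rule kpsd_kspectral) (use t in simp)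
  have KK: "keq n (kmul n K K) (kmat A)"
  proof -
    have "keq n (kmul n K K) (kspectral n U (\<lambda>l. sqrt (t l) * sqrt (t l)))" unfolding K_def by (rule kspectral_kmul[OF U])
    moreover have "keq n (kspectral n U (\<lambda>l. sqrt (t l) * sqrt (t l))) (kspectral n U t)"
      unfolding keq_def using t by (auto simp: kspectral_eq intro!: sum.cong)
    ultimately show ?thesis using keq_trans keq_sym[OF eq] by blast
  qed
  have mulk: "keq n (kmat (M * M)) (kmul n (kmat M) (kmat M))" if "M \<in> carrier_mat n n" for M
    unfolding keq_def kmat_def kmul_def using mult_index[OF that that] by simp
  have SS: "S * S = A"
  proof (rule eq_matI)
    fix i k assume "i < dim_row A" "k < dim_col A"
    hence ik: "i < n" "k < n" using A by auto
    have "keq n (kmat (S * S)) (kmat A)"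
      by (rule keq_trans[OF mulk[OF S] keq_trans[OF kmul_keq[OF kS kS] KK]])
    from keqD[OF this ik] show "(S * S) $$ (i, k) = A $$ (i, k)" by (simp add: kmat_def)
  qed (use A S in auto)
  have "psd_sqrt A = S"
    unfolding psd_sqrt_def
  proof (rule the_equality)
    show "nonneg_definite S \<and> S * S = A" using nonneg_definite_mat[OF Kpsd] SS by (simp add: S_def)
    fix M assume M: "nonneg_definite M \<and> M * M = A"
    hence "square_mat M" by (simp add: nonneg_definite_def)
    moreover have "dim_row M = n" using M A by (metis carrier_matD(1) index_mult_mat(2))
    ultimately have Mc: "M \<in> carrier_mat n n" by auto
    have "keq n (kmul n (kmat M) (kmat M)) (kmul n K K)"
      using keq_trans[OF keq_sym[OF mulk[OF Mc]]] M keq_sym[OF KK] by simp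
    hence "keq n (kmat M) K" by (rule kpsd_sqrt_unique[OF kpsd_kmat[OF _ Mc] Kpsd, rotated]) (use M in simp)
    thus "M = S" using Mc S by (intro eq_matI) (auto simp: keq_def kmat_def S_def)
  qed
  thus "psd_sqrt A \<in> carrier_mat n n" "keq n (kmat (psd_sqrt A)) (kspectral n U (\<lambda>l. sqrt (t l)))"
    using S kS by (auto simp: K_def)
qed

definition scaled :: "nat \<Rightarrow> (nat \<Rightarrow> nat \<Rightarrow> complex) \<Rightarrow> (nat \<Rightarrow> real) \<Rightarrow> (nat \<Rightarrow> nat \<Rightarrow> complex) \<Rightarrow> nat \<Rightarrow> nat \<Rightarrow> complex" where
  "scaled n U t x = (\<lambda>j i. of_real (sqrt (t i)) * kapp n (kadj U) (x j) i)"

definition norm_trace :: "complex \<Rightarrow> nat \<Rightarrow> nat \<Rightarrow> (nat \<Rightarrow> nat \<Rightarrow> complex) \<Rightarrow> (nat \<Rightarrow> real) \<Rightarrow> (nat \<Rightarrow> real) \<Rightarrow> (nat \<Rightarrow> nat \<Rightarrow> complex) \<Rightarrow> complex" where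
  "norm_trace z n N U t w x = ktr n (smk n z (\<lambda>j. w j / real N) (scaled n U t x) (scaled n U t x) N) / of_nat n"

lemma norm_trace_cong:
  assumes "\<And>j i. j < N \<Longrightarrow> i < n \<Longrightarrow> x j i = x' j i"
  shows "norm_trace z n N U t w x = norm_trace z n N U t w x'"
proof -
  have "scaled n U t x j = scaled n U t x' j" if "j < N" for j
    unfolding scaled_def kapp_def using assms[OF that] by simp
  hence "smk n z (\<lambda>j. w j / real N) (scaled n U t x) (scaled n U t x) N = smk n z (\<lambda>j. w j / real N) (scaled n U t x') (scaled n U t x') N"
    by (intro smk_cong) auto
  thus ?thesis by (simp add: norm_trace_def)
qed

text \<open>The left hand side is a rational function of the entries of \<open>A\<close> and \<open>x\<close>; this is what makes
  the normalised trace measurable jointly in the two random matrices.\<close>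

lemma norm_trace_kspectral:
  assumes eq: "keq n A (kspectral n U t)" and tpos: "\<And>l. l < n \<Longrightarrow> 0 \<le> t l"
  shows "ktr n (smk n z (\<lambda>j. w j / real N) (\<lambda>j. kapp n A (x j)) x N) / of_nat n = norm_trace z n N U t w x"
proof -
  \<comment> \<open>\<open>A\<close> is \<open>?Q\<close> times its adjoint, so the vectors
    \<open>kapp n A (x j)\<close> are \<open>?Q\<close> applied to the scaled columns, and the
    latter are the adjoint of \<open>?Q\<close> applied to \<open>x j\<close>.\<close>
  let ?Q = "kmul n U (kdiag (\<lambda>i. complex_of_real (sqrt (t i))))"
  have "ktr n (smk n z (\<lambda>j. w j / real N) (\<lambda>j. kapp n A (x j)) x N)
    = ktr n (smk n z (\<lambda>j. w j / real N) (scaled n U t x) (scaled n U t x) N)"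
  proof (rule conjunct2[OF smk_intertwine[where Q = ?Q]])
    fix j i assume i: "i < n"
    let ?y = "kapp n (kadj U) (x j)"
    have "kapp n A (x j) i = kapp n U (kapp n (kdiag (\<lambda>l. of_real (t l))) ?y) i"
      unfolding kapp_keq[OF eq i] kspectral_def by (simp only: kapp_kmul kapp_kmul[abs_def])
    also have "\<dots> = kapp n U (kapp n (kdiag (\<lambda>i. complex_of_real (sqrt (t i)))) (scaled n U t x j)) i"
    proof (rule kapp_cong[OF refl])
      fix k assume k: "k < n"
      have "complex_of_real (sqrt (t k)) * complex_of_real (sqrt (t k)) = of_real (t k)"
        using tpos[OF k] by (simp flip: of_real_mult)
      thus "kapp n (kdiag (\<lambda>l. of_real (t l))) ?y k = kapp n (kdiag (\<lambda>i. complex_of_real (sqrt (t i)))) (scaled n U t x j) k"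
        using k by (simp add: kapp_kdiag scaled_def flip: mult.assoc)
    qed
    also have "\<dots> = kapp n ?Q (scaled n U t x j) i" by (simp only: kapp_kmul)
    finally show "kapp n A (x j) i = kapp n ?Q (scaled n U t x j) i" .
  next
    fix j i assume i: "i < n"
    have "kapp n (kadj ?Q) (x j) i = kapp n (kadj (kdiag (\<lambda>i. complex_of_real (sqrt (t i))))) (kapp n (kadj U) (x j)) i"
      unfolding kadj_kmul by (rule kapp_kmul)
    also have "kadj (kdiag (\<lambda>i. complex_of_real (sqrt (t i)))) = kdiag (\<lambda>i. complex_of_real (sqrt (t i)))"
      by (auto simp: kadj_def kdiag_def fun_eq_iff)
    finally show "scaled n U t x j i = kapp n (kadj ?Q) (x j) i" using i by (simp add: kapp_kdiag scaled_def)
  qed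
  thus ?thesis by (simp add: norm_trace_def)
qed

text \<open>\<open>B\<close> is the Gram kernel of the columns multiplied by the root of
  \<open>T\<close>; a further rotation by \<open>U\<close> replaces the root by
  \<open>diag(sqrt t)\<close> without changing traces of resolvents. The eigenvalues of
  \<open>B\<close> serve for the distribution and for all \<open>z\<close> at once.\<close>

lemma separable_stieltjes:
  assumes n: "0 < n" and T: "T \<in> carrier_mat n n" "nonneg_definite T" and U: "kunitary n U" and eq: "keq n (kmat T) (kspectral n U t)"
    and Z: "Z \<in> carrier_mat n N" and W: "W \<in> carrier_mat N N" "diagonal_mat W"
    and w: "\<And>j. j < N \<Longrightarrow> W $$ (j, j) = complex_of_real (w j)"
  defines "B \<equiv> (1 / complex_of_real (real N)) \<cdot>\<^sub>m (psd_sqrt T * Z * W * mat_adjoint Z * psd_sqrt T)"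
  shows "\<exists>\<mu>. esd B = cdf (emp n \<mu>) \<and>
    (\<forall>z. 0 < Im z \<longrightarrow> stieltjes (emp n \<mu>) z = norm_trace z n N U t w (\<lambda>j k. Z $$ (k, j)))"
proof -
  define zc where "zc j = (\<lambda>k. Z $$ (k, j))" for j
  define r where "r = scaled n U t zc"
  have rdef: "r j i = of_real (sqrt (t i)) * kapp n (kadj U) (zc j) i" for j i by (simp add: r_def scaled_def)
  define S where "S = psd_sqrt T"
  have S: "S \<in> carrier_mat n n" and kS: "keq n (kmat S) (kspectral n U (\<lambda>l. sqrt (t l)))"
    unfolding S_def by (rule psd_sqrt_kspectral[OF T U eq])+
  have hS: "cnj (S $$ (m, k)) = S $$ (k, m)" if "k < n" "m < n" for k m
    using khermD[OF kherm_kspectral, of k n m U "\<lambda>l. sqrt (t l)"] keqD[OF kS that] keqD[OF kS that(2,1)] that by (simp add: kmat_def)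
  define s where "s j = kapp n (kmat S) (zc j)" for j
  define wt where "wt j = w j / real N" for j
  have BB: "B \<in> carrier_mat n n" unfolding B_def S_def[symmetric] using S Z by auto
  have kB: "keq n (kmat B) (kgram wt s N)"
    unfolding keq_def
  proof (intro allI impI)
    fix i k assume ik: "i < n" "k < n"
    have c: "S * Z \<in> carrier_mat n N" "S * Z * W \<in> carrier_mat n N" "mat_adjoint Z \<in> carrier_mat N n" "mat_adjoint Z * S \<in> carrier_mat N n"
      using S Z W by (auto intro!: carrier_matI)
    have SZ: "(S * Z) $$ (i, j) = s j i" if "i < n" "j < N" for i j
      unfolding mult_index[OF S Z that] s_def kapp_def kmat_def zc_def ..
    have SZW: "(S * Z * W) $$ (i, j) = s j i * of_real (w j)" if "i < n" "j < N" for i j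
    proof -
      have "(S * Z * W) $$ (i, j) = (\<Sum>l<N. (S * Z) $$ (i, l) * W $$ (l, j))" by (rule mult_index[OF c(1) W(1) that])
      also have "\<dots> = (\<Sum>l<N. if l = j then s j i * of_real (w j) else 0)"
        by (intro sum.cong refl) (use W that w SZ in \<open>auto simp: diagonal_mat_def\<close>)
      finally show ?thesis using that by simp
    qed
    have ZS: "(mat_adjoint Z * S) $$ (j, k) = cnj (s j k)" if "j < N" "k < n" for j k
    proof -
      have "(mat_adjoint Z * S) $$ (j, k) = (\<Sum>m<n. mat_adjoint Z $$ (j, m) * S $$ (m, k))" by (rule mult_index[OF c(3) S that])
      also have "\<dots> = (\<Sum>m<n. cnj (S $$ (k, m) * Z $$ (m, j)))"
        by (intro sum.cong refl) (use Z that hS in \<open>auto simp: mat_adjoint_index mult.commute\<close>)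
      finally show ?thesis by (simp add: s_def kapp_def kmat_def zc_def)
    qed
    have "S * Z * W * mat_adjoint Z * S = (S * Z * W) * (mat_adjoint Z * S)"
      by (rule assoc_mult_mat[OF c(2,3) S])
    hence "B $$ (i, k) = (1 / of_real (real N)) * ((S * Z * W) * (mat_adjoint Z * S)) $$ (i, k)"
      unfolding B_def S_def[symmetric] using ik S c by simp
    also have "((S * Z * W) * (mat_adjoint Z * S)) $$ (i, k) = (\<Sum>j<N. s j i * of_real (w j) * cnj (s j k))"
      unfolding mult_index[OF c(2,4) ik] by (intro sum.cong refl) (use ik SZW ZS in simp)
    also have "(1 / of_real (real N)) * \<dots> = kgram wt s N i k"
      unfolding kgram_def sum_distrib_left by (intro sum.cong refl) (simp add: wt_def mult_ac)
    finally show "kmat B i k = kgram wt s N i k" by (simp add: kmat_def)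
  qed
  have "kherm n (kmat B)"
    unfolding kherm_def
  proof (intro allI impI)
    fix i k assume ik: "i < n" "k < n"
    show "kmat B i k = cnj (kmat B k i)"
      unfolding keqD[OF kB ik] keqD[OF kB ik(2,1)] using khermD[OF kherm_kgram ik] by simp
  qed
  then obtain V \<mu> where V: "kunitary n V" and VB: "keq n (kmat B) (kspectral n V \<mu>)" using kspectral_exists by blast
  have "esd B = cdf (emp n \<mu>)" by (rule esd_kspectral[OF BB V VB n])
  moreover have "stieltjes (emp n \<mu>) z = norm_trace z n N U t w (\<lambda>j k. Z $$ (k, j))" if z: "0 < Im z" for z
  proof -
    have kV: "keq n (kgram wt s N) (kspectral n V \<mu>)" using keq_trans[OF keq_sym[OF kB] VB] .
    note rs = resolvent_kspectral[OF V kV z]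
    have "ktr n (smk n z wt s s N) = (\<Sum>l<n. 1 / (of_real (\<mu> l) - z))"
      unfolding rs(2)[symmetric] unfolding ktr_def
      by (intro sum.cong refl resolvent_kernel_unique[OF kherm_kgram z is_resolvent_smk[OF z] rs(1)]) auto
    moreover have "ktr n (smk n z wt s s N) = ktr n (smk n z wt r r N)"
    proof (rule conjunct2[OF smk_intertwine[where Q = U]])
      fix j i assume i: "i < n"
      have "s j i = kapp n U (kapp n (kdiag (\<lambda>l. of_real (sqrt (t l)))) (kapp n (kadj U) (zc j))) i"
        unfolding s_def kapp_keq[OF kS i] kspectral_def by (simp only: kapp_kmul kapp_kmul[abs_def])
      also have "\<dots> = kapp n U (r j) i"
        by (rule kapp_cong[OF refl]) (simp add: kapp_kdiag rdef)
      finally show si: "s j i = kapp n U (r j) i" .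
    next
      fix j i assume i: "i < n"
      have si: "s j k = kapp n U (r j) k" if "k < n" for k
      proof -
        have "s j k = kapp n U (kapp n (kdiag (\<lambda>l. of_real (sqrt (t l)))) (kapp n (kadj U) (zc j))) k"
          unfolding s_def kapp_keq[OF kS that] kspectral_def by (simp only: kapp_kmul kapp_kmul[abs_def])
        also have "\<dots> = kapp n U (r j) k"
          by (rule kapp_cong[OF refl]) (simp add: kapp_kdiag rdef)
        finally show ?thesis .
      qed
      have "kapp n (kadj U) (s j) i = kapp n (kadj U) (kapp n U (r j)) i" by (rule kapp_cong[OF refl]) (rule si)
      also have "\<dots> = kapp n kone (r j) i"
        unfolding kapp_kmul[symmetric] by (rule kapp_keq[OF _ i]) (use U in \<open>simp add: kunitary_keq\<close>)
      finally show "r j i = kapp n (kadj U) (s j) i" using i by (simp add: kapp_kdiag)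
    qed
    ultimately show ?thesis unfolding emp_stieltjes[OF n] norm_trace_def wt_def r_def zc_def by simp
  qed
  ultimately show ?thesis by blast
qed

section \<open>Convergence of the mean\<close>

text \<open>Outer index column, inner index row, the reverse of matrix notation: the bounded
  difference inequality treats whole columns as independent coordinates.\<close>

abbreviation columns :: "complex measure \<Rightarrow> nat \<Rightarrow> nat \<Rightarrow> (nat \<Rightarrow> nat \<Rightarrow> complex) measure" where
  "columns \<mu> n N \<equiv> PiM {..<N} (\<lambda>_. PiM {..<n} (\<lambda>_. \<mu>))"

definition mean_trace :: "complex measure \<Rightarrow> complex \<Rightarrow> nat \<Rightarrow> nat \<Rightarrow> (nat \<Rightarrow> nat \<Rightarrow> complex) \<Rightarrow> (nat \<Rightarrow> real) \<Rightarrow> (nat \<Rightarrow> real) \<Rightarrow> complex" where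
  "mean_trace \<mu> z n N U t w = (\<integral>x. norm_trace z n N U t w x \<partial>columns \<mu> n N)"

lemma smk_bounded: "0 < Im z \<Longrightarrow> kbounded n (1 / Im z) (smk n z w r r J)"
  using knorm_resolvent[OF kherm_kgram _ is_resolvent_smk] by blast

lemma norm_trace_bound:
  assumes "0 < n" "0 < Im z"
  shows "cmod (norm_trace z n N U t w x) \<le> 1 / Im z"
  using kbounded_ktr[OF smk_bounded[OF assms(2), of n "\<lambda>j. w j / real N" "scaled n U t x" N]] assms
  by (simp add: norm_trace_def norm_divide field_simps)

lemma prob_space_columns: "prob_space \<mu> \<Longrightarrow> prob_space (columns \<mu> n N)"
  by (intro prob_space_PiM)

lemma column_entry_measurable:
  assumes "sets \<mu> = sets borel" "i < n" "j < N"
  shows "(\<lambda>x. x j i) \<in> borel_measurable (columns \<mu> n N)"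
proof -
  have [measurable_cong]: "sets \<mu> = sets borel" by (rule assms(1))
  have "(\<lambda>x. x j) \<in> measurable (columns \<mu> n N) (PiM {..<n} (\<lambda>_. \<mu>))" using assms(3) by (intro measurable_component_singleton) simp
  moreover have "(\<lambda>x. x i) \<in> measurable (PiM {..<n} (\<lambda>_. \<mu>)) \<mu>" using assms(2) by (intro measurable_component_singleton) simp
  ultimately have "(\<lambda>x. x j i) \<in> measurable (columns \<mu> n N) \<mu>" by (rule measurable_compose)
  thus ?thesis using measurable_cong_sets[OF refl assms(1)] by blast
qed

lemma norm_trace_measurable:
  assumes "sets \<mu> = sets borel"
  shows "norm_trace z n N U t w \<in> borel_measurable (columns \<mu> n N)"
  unfolding norm_trace_def ktr_def scaled_def
  by (intro borel_measurable_divide borel_measurable_sum smk_measurable borel_measurable_times borel_measurable_const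
      kapp_measurable column_entry_measurable[OF assms]) auto

lemma mean_trace_bound:
  assumes "prob_space \<mu>" "sets \<mu> = sets borel" "0 < n" "0 < Im z"
  shows "cmod (mean_trace \<mu> z n N U t w) \<le> 1 / Im z"
  unfolding mean_trace_def
  by (intro bounded_integral_norm_le prob_space_columns assms norm_trace_measurable norm_trace_bound)

text \<open>Each clipped weight is one rank one change, each clipped eigenvalue of \<open>T\<close>
  changes one row and one column; hence the coefficients 1 and 2.\<close>

lemma norm_trace_cut_bound:
  assumes n: "0 < n" and z: "0 < Im z" and K: "0 \<le> K" and t: "\<And>i. i < n \<Longrightarrow> 0 \<le> t i" and w: "\<And>j. j < N \<Longrightarrow> 0 \<le> w j"
  shows "cmod (norm_trace z n N U t w x - norm_trace z n N U (\<lambda>i. cut K (t i)) (\<lambda>j. cut K (w j)) x)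
    \<le> (real (card {j. j < N \<and> K < w j}) + 2 * real (card {i. i < n \<and> K < t i})) / (real n * Im z)"
proof -
  let ?tr = "\<lambda>t w. ktr n (smk n z (\<lambda>j. w j / real N) (scaled n U t x) (scaled n U t x) N)"
  let ?t = "\<lambda>i. cut K (t i)" and ?w = "\<lambda>j. cut K (w j)"
  have cw: "real (card {j. j < N \<and> w j / real N \<noteq> ?w j / real N}) \<le> real (card {j. j < N \<and> K < w j})"
    by (intro of_nat_mono card_mono) (use w K in \<open>auto simp: cut_def max_def min_def split: if_splits\<close>)
  have ct: "real (card {i. i < n \<and> sqrt (t i) \<noteq> sqrt (?t i)}) \<le> real (card {i. i < n \<and> K < t i})"
    by (intro of_nat_mono card_mono) (use t K in \<open>auto simp: cut_def max_def min_def split: if_splits\<close>)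
  have 1: "cmod (?tr t w - ?tr t ?w) \<le> real (card {j. j < N \<and> K < w j}) / Im z"
    by (rule order_trans[OF ktr_smk_weights_bound[OF z] divide_right_mono[OF cw]]) (use z in simp)
  have "cmod (?tr t ?w - ?tr ?t ?w) \<le> 2 * real (card {i. i < n \<and> sqrt (t i) \<noteq> sqrt (?t i)}) / Im z"
    unfolding scaled_def by (rule ktr_smk_scale_bound[OF z])
  hence 2: "cmod (?tr t ?w - ?tr ?t ?w) \<le> 2 * real (card {i. i < n \<and> K < t i}) / Im z"
    by (rule order_trans) (use ct z in \<open>auto intro!: divide_right_mono\<close>)
  have "cmod (?tr t w - ?tr ?t ?w) \<le> cmod (?tr t w - ?tr t ?w) + cmod (?tr t ?w - ?tr ?t ?w)"
    by (rule norm_diff_triangle_le) auto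
  hence "cmod (?tr t w - ?tr ?t ?w) \<le> (real (card {j. j < N \<and> K < w j}) + 2 * real (card {i. i < n \<and> K < t i})) / Im z"
    using 1 2 by (simp add: add_divide_distrib)
  hence "cmod (?tr t w - ?tr ?t ?w) / real n
     \<le> (real (card {j. j < N \<and> K < w j}) + 2 * real (card {i. i < n \<and> K < t i})) / Im z / real n"
    by (rule divide_right_mono) simp
  moreover have "norm_trace z n N U t w x - norm_trace z n N U ?t ?w x = (?tr t w - ?tr ?t ?w) / of_nat n"
    by (simp add: norm_trace_def diff_divide_distrib)
  ultimately show ?thesis by (simp add: norm_divide mult.commute)
qed

lemma mean_trace_cut_bound:
  assumes \<mu>: "prob_space \<mu>" "sets \<mu> = sets borel" and n: "0 < n" and z: "0 < Im z" and K: "0 \<le> K"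
    and t: "\<And>i. i < n \<Longrightarrow> 0 \<le> t i" and w: "\<And>j. j < N \<Longrightarrow> 0 \<le> w j"
  shows "cmod (mean_trace \<mu> z n N U t w - mean_trace \<mu> z n N U (\<lambda>i. cut K (t i)) (\<lambda>j. cut K (w j)))
    \<le> (real (card {j. j < N \<and> K < w j}) + 2 * real (card {i. i < n \<and> K < t i})) / (real n * Im z)"
proof -
  let ?P = "columns \<mu> n N"
  note P = prob_space_columns[OF \<mu>(1), where n = n and N = N]
  have i: "integrable ?P (norm_trace z n N U t w)" for t w
    by (rule bounded_integrable[OF P norm_trace_measurable[OF \<mu>(2)] norm_trace_bound[OF n z]])
  have "mean_trace \<mu> z n N U t w - mean_trace \<mu> z n N U (\<lambda>i. cut K (t i)) (\<lambda>j. cut K (w j))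
    = (\<integral>x. norm_trace z n N U t w x - norm_trace z n N U (\<lambda>i. cut K (t i)) (\<lambda>j. cut K (w j)) x \<partial>?P)"
    unfolding mean_trace_def using i by simp
  also have "cmod \<dots> \<le> (real (card {j. j < N \<and> K < w j}) + 2 * real (card {i. i < n \<and> K < t i})) / (real n * Im z)"
    by (rule bounded_integral_norm_le[OF P _ norm_trace_cut_bound[OF n z K t w]])
       (use norm_trace_measurable[OF \<mu>(2)] in \<open>auto intro: borel_measurable_diff\<close>)
  finally show ?thesis .
qed

text \<open>The form of a rotated vector in \<open>A\<close> is the form of the original vector in
  the rotated kernel, with the same trace and bound. Concentration, proved for independent entries,
  thereby extends to rotated columns.\<close>

lemma quadratic_form_unitary:
  assumes U: "kunitary n U"
  defines "y \<equiv> \<lambda>x. kapp n (kadj U) x" and "A' \<equiv> \<lambda>A. kmul n U (kmul n A (kadj U))"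
  shows "kip n (y x) (kapp n A (y x)) = kip n x (kapp n (A' A) x)" "ktr n (A' A) = ktr n A"
    "kbounded n C A \<Longrightarrow> kbounded n C (A' A)"
proof -
  have "kip n x (kapp n (A' A) x) = kip n x (kapp n U (kapp n A (y x)))"
    unfolding A'_def y_def by (simp only: kapp_kmul kapp_kmul[abs_def])
  thus "kip n (y x) (kapp n A (y x)) = kip n x (kapp n (A' A) x)" unfolding y_def kip_kapp_adj[of n x U] by simp
  have "ktr n (A' A) = ktr n (kmul n A (kmul n (kadj U) U))"
    unfolding A'_def ktr_kmul_commute[of n U] kmul_assoc ..
  also have "\<dots> = ktr n A"
    unfolding ktr_def
  proof (intro sum.cong refl)
    fix i assume i: "i \<in> {..<n}"
    have "kmul n A (kmul n (kadj U) U) i i = (\<Sum>l<n. if l = i then A i l else 0)"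
      unfolding kmul_def[of n A] by (intro sum.cong refl) (use U i in \<open>auto simp: kunitary_def\<close>)
    thus "kmul n A (kmul n (kadj U) U) i i = A i i" using i by simp
  qed
  finally show "ktr n (A' A) = ktr n A" .
  assume "kbounded n C A"
  from kbounded_kmul[OF kunitary_kbounded[OF U] kbounded_kmul[OF this kunitary_kbounded_adj[OF U]]]
  show "kbounded n C (A' A)" by (simp add: A'_def)
qed

lemma matrix_model_columns:
  assumes \<mu>: "prob_space \<mu>" "sets \<mu> = sets borel" and N: "0 < N" and z: "0 < Im z" and K: "1 \<le> K" and e: "0 \<le> e"
    and U: "kunitary n U"
    and QF: "\<And>A C. 0 < C \<Longrightarrow> kbounded n C A \<Longrightarrow>
      integrable (PiM {..<n} (\<lambda>_. \<mu>)) (\<lambda>x. kip n x (kapp n A x) - ktr n A) \<and>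
      (\<integral>x. cmod (kip n x (kapp n A x) - ktr n A) \<partial>PiM {..<n} (\<lambda>_. \<mu>)) \<le> e * real n * C"
  shows "matrix_model (PiM {..<n} (\<lambda>_. \<mu>)) n N z (\<lambda>i. cut K (t i)) (\<lambda>j. cut K (w j)) K e (kapp n (kadj U))"
proof (rule matrix_model.intro)
  show "prob_space (PiM {..<n} (\<lambda>_. \<mu>))" by (intro prob_space_PiM \<mu>)
  show "(\<lambda>x. kapp n (kadj U) x i) \<in> borel_measurable (PiM {..<n} (\<lambda>_. \<mu>))" for i
  proof (intro kapp_measurable borel_measurable_const)
    fix k assume "k < n"
    hence "(\<lambda>x. x k) \<in> measurable (PiM {..<n} (\<lambda>_. \<mu>)) \<mu>" by (intro measurable_component_singleton) simp
    thus "(\<lambda>x. x k) \<in> borel_measurable (PiM {..<n} (\<lambda>_. \<mu>))" using measurable_cong_sets[OF refl \<mu>(2)] by blast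
  qed
  fix A C assume C: "0 < (C::real)" and b: "kbounded n C A"
  show "integrable (PiM {..<n} (\<lambda>_. \<mu>)) (\<lambda>x. kip n (kapp n (kadj U) x) (kapp n A (kapp n (kadj U) x)) - ktr n A) \<and>
      (\<integral>x. cmod (kip n (kapp n (kadj U) x) (kapp n A (kapp n (kadj U) x)) - ktr n A) \<partial>PiM {..<n} (\<lambda>_. \<mu>)) \<le> e * real n * C"
    using QF[OF C quadratic_form_unitary(3)[OF U b]] unfolding quadratic_form_unitary(1)[OF U] quadratic_form_unitary(2)[OF U] .
qed (use N z K e cut_bounds[of K] in auto)

section \<open>Passage to the limit along deterministic sequences of spectra\<close>

lemma emp_sum:
  fixes f :: "real \<Rightarrow> complex"
  assumes "0 < n" "f \<in> borel_measurable borel"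
  shows "(\<Sum>i<n. f (\<mu> i)) / of_nat N = of_real (real n / real N) * (\<integral>x. f x \<partial>emp n \<mu>)"
  using assms(1) by (simp only: emp_integral[OF assms] scaleR_conv_of_real) (simp add: field_simps)

text \<open>The integrands depend on the index through the converging \<gamma> and \<omega>; on
  clipped arguments this dependence is uniform.\<close>

lemma weak_conv_uniform:
  fixes F :: "real \<Rightarrow> complex"
  assumes \<mu>: "\<And>k. real_distribution (\<mu> k)" and M: "real_distribution M" and w: "weak_conv_m \<mu> M"
    and cont: "\<And>x. isCont F x" and B: "\<And>x. cmod (F x) \<le> B"
    and Fk: "\<And>k. Fk k \<in> borel_measurable borel" and near: "\<And>k x. cmod (Fk k x - F x) \<le> b k" and b: "b \<longlonglongrightarrow> 0"
  shows "(\<lambda>k. \<integral>x. Fk k x \<partial>\<mu> k) \<longlonglongrightarrow> (\<integral>x. F x \<partial>M)"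
proof -
  have F: "F \<in> borel_measurable borel" using cont by (simp add: borel_measurable_continuous_onI continuous_at_imp_continuous_on)
  have 1: "(\<lambda>k. \<integral>x. F x \<partial>\<mu> k) \<longlonglongrightarrow> (\<integral>x. F x \<partial>M)" by (rule weak_conv_imp_integral_bdd_continuous_conv[OF \<mu> M w cont B])
  have "(\<lambda>k. (\<integral>x. Fk k x \<partial>\<mu> k) - (\<integral>x. F x \<partial>\<mu> k)) \<longlonglongrightarrow> 0"
  proof (rule Lim_null_comparison[OF _ b], intro always_eventually allI)
    fix k
    interpret real_distribution "\<mu> k" by (rule \<mu>)
    have Fi: "integrable (\<mu> k) F" by (rule bounded_integrable[OF prob_space_axioms]) (use F B in auto)
    have Fki: "integrable (\<mu> k) (Fk k)"
    proof (rule bounded_integrable[OF prob_space_axioms])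
      show "cmod (Fk k x) \<le> b k + B" for x
        using norm_triangle_ineq[of "Fk k x - F x" "F x"] near[of k x] B[of x] by simp
    qed (use Fk in simp)
    have "(\<integral>x. Fk k x \<partial>\<mu> k) - (\<integral>x. F x \<partial>\<mu> k) = (\<integral>x. Fk k x - F x \<partial>\<mu> k)" using Fi Fki by simp
    also have "cmod \<dots> \<le> b k"
      by (rule bounded_integral_norm_le[OF prob_space_axioms]) (use F Fk near in auto)
    finally show "cmod ((\<integral>x. Fk k x \<partial>\<mu> k) - (\<integral>x. F x \<partial>\<mu> k)) \<le> b k" .
  qed
  from tendsto_add[OF this 1] show ?thesis by simp
qed

text \<open>\<open>e\<close> is the accuracy of \<open>quadratic_form_concentration\<close>: at each
  accuracy the limiting error is \<open>E * e\<close>, and the accuracy is arbitrary.\<close>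

lemma tendsto_zero_eventually_bound:
  fixes X :: "nat \<Rightarrow> complex"
  assumes "\<And>e::real. 0 < e \<Longrightarrow> eventually (\<lambda>k. cmod (X k) \<le> b e k) sequentially" "\<And>e. 0 < e \<Longrightarrow> b e \<longlonglongrightarrow> E * e" "0 \<le> E"
  shows "X \<longlonglongrightarrow> 0"
proof (rule tendstoI)
  fix d :: real assume d: "0 < d"
  define e where "e = d / (E + 1)"
  have e: "0 < e" "E * e < d" using d assms(3) by (auto simp: e_def field_simps)
  have "eventually (\<lambda>k. b e k < d) sequentially" by (rule order_tendstoD(2)[OF assms(2)[OF e(1)] e(2)])
  with assms(1)[OF e(1)] show "eventually (\<lambda>k. dist (X k) 0 < d) sequentially" by eventually_elim simp
qed

lemma tendsto_by_subsequences:
  fixes X :: "nat \<Rightarrow> complex"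
  assumes b: "\<And>k. cmod (X k) \<le> C" and s: "\<And>l s. strict_mono s \<Longrightarrow> (\<lambda>k. X (s k)) \<longlonglongrightarrow> l \<Longrightarrow> l = m"
  shows "X \<longlonglongrightarrow> m"
proof (rule ccontr)
  assume "\<not> X \<longlonglongrightarrow> m"
  then obtain e where e: "0 < e" "\<And>n0. \<exists>n\<ge>n0. e \<le> dist (X n) m"
    unfolding lim_sequentially by (meson not_le)
  have inf: "infinite {n. e \<le> dist (X n) m}" unfolding infinite_nat_iff_unbounded_le using e(2) by auto
  define s1 where "s1 = enumerate {n. e \<le> dist (X n) m}"
  have s1: "strict_mono s1" "e \<le> dist (X (s1 k)) m" for k
    using strict_mono_enumerate[OF inf] enumerate_in_set[OF inf, of k] by (auto simp: s1_def)
  obtain l s2 where s2: "strict_mono s2" "(\<lambda>k. X (s1 (s2 k))) \<longlonglongrightarrow> l"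
    using bounded_convergent_subsequence[of "\<lambda>k. X (s1 k)" C] b by blast
  have "l = m" by (rule s[of "s1 \<circ> s2"]) (use strict_mono_o[OF s1(1) s2(1)] s2(2) in \<open>simp_all add: o_def\<close>)
  hence "(\<lambda>k. dist (X (s1 (s2 k))) m) \<longlonglongrightarrow> 0" using tendsto_dist[OF s2(2) tendsto_const[of l]] by simp
  moreover have "(\<lambda>k. dist (X (s1 (s2 k))) m) \<longlonglongrightarrow> 0 \<Longrightarrow> e \<le> 0"
    by (rule tendsto_lowerbound) (use s1(2) in auto)
  ultimately show False using e(1) by simp
qed

lemma weight_fraction_lipschitz:
  assumes z: "0 < Im z" and g: "0 \<le> Im (z * g)" "0 \<le> Im (z * h)" and a: "0 \<le> a" "a \<le> K"
  shows "cmod (of_real a / (1 + of_real a * g) - of_real a / (1 + of_real a * h)) \<le> (K * (cmod z / Im z))\<^sup>2 * cmod (g - h)"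
proof -
  note d1 = denominator_bound[OF z g(1) a(1)] and d2 = denominator_bound[OF z g(2) a(1)]
  have "of_real a / (1 + of_real a * g) - of_real a / (1 + of_real a * h)
    = (of_real a * (1 / (1 + of_real a * g))) * (of_real a * (1 / (1 + of_real a * h))) * (h - g)"
    using d1(2) d2(2) by (simp add: field_simps)
  hence "cmod (of_real a / (1 + of_real a * g) - of_real a / (1 + of_real a * h))
    = (a * cmod (1 / (1 + of_real a * g))) * (a * cmod (1 / (1 + of_real a * h))) * cmod (g - h)"
    using a by (simp only: norm_mult norm_of_real norm_minus_commute[of h g])
  moreover have "(a * cmod (1 / (1 + of_real a * g))) * (a * cmod (1 / (1 + of_real a * h))) \<le> (K * (cmod z / Im z)) * (K * (cmod z / Im z))"
    using d1(3) d2(3) a z by (intro mult_mono) auto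
  ultimately show ?thesis unfolding power2_eq_square by (simp only: mult_right_mono[OF _ norm_ge_zero])
qed

lemma shifted_denominator_lipschitz:
  assumes z: "0 < Im z" and g: "Im g \<le> 0" "Im h \<le> 0" and a: "0 \<le> a" "a \<le> K"
  shows "cmod (1 / (of_real a * g - z) - 1 / (of_real a * h - z)) \<le> K / (Im z)\<^sup>2 * cmod (g - h)"
proof -
  note d1 = shifted_denominator[OF z g(1) a(1)] and d2 = shifted_denominator[OF z g(2) a(1)]
  have "1 / (of_real a * g - z) - 1 / (of_real a * h - z)
    = (of_real a * ((1 / (of_real a * g - z)) * (1 / (of_real a * h - z)))) * (h - g)"
    using d1(2) d2(2) by (simp add: field_simps)
  hence "cmod (1 / (of_real a * g - z) - 1 / (of_real a * h - z))
    = (a * (cmod (1 / (of_real a * g - z)) * cmod (1 / (of_real a * h - z)))) * cmod (g - h)"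
    using a by (simp only: norm_mult norm_of_real norm_minus_commute[of h g])
  moreover have "a * (cmod (1 / (of_real a * g - z)) * cmod (1 / (of_real a * h - z))) \<le> K * (1 / Im z * (1 / Im z))"
    using d1(3) d2(3) a z by (intro mult_mono) auto
  moreover have "K * (1 / Im z * (1 / Im z)) = K / (Im z)\<^sup>2" by (simp add: power2_eq_square)
  ultimately show ?thesis by (simp only: mult_right_mono[OF _ norm_ge_zero])
qed

text \<open>Everything is deterministic: the locale is meant for one fixed realisation of
  \<open>T\<close> and \<open>W\<close>. Sizes \<open>n k\<close> are left general so that it is
  closed under subsequences, on which the compactness arguments run.\<close>

locale model_sequence = fixed_point c H D z for c H D z +
  fixes \<mu> :: "complex measure" and n N :: "nat \<Rightarrow> nat" and U :: "nat \<Rightarrow> nat \<Rightarrow> nat \<Rightarrow> complex"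
    and t w :: "nat \<Rightarrow> nat \<Rightarrow> real"
  assumes \<mu>: "prob_space \<mu>" "sets \<mu> = sets borel" and mean: "(\<integral>y. y \<partial>\<mu>) = 0"
    and var: "integrable \<mu> (\<lambda>y. (cmod y)\<^sup>2)" "(\<integral>y. (cmod y)\<^sup>2 \<partial>\<mu>) = 1"
    and n: "\<And>k. 0 < n k" and N: "\<And>k. 0 < N k" and n_top: "filterlim n at_top sequentially"
    and ratio: "(\<lambda>k. real (n k) / real (N k)) \<longlonglongrightarrow> c"
    and U: "\<And>k. kunitary (n k) (U k)"
    and t: "\<And>k i. i < n k \<Longrightarrow> 0 \<le> t k i" and w: "\<And>k j. j < N k \<Longrightarrow> 0 \<le> w k j"
    and t_conv: "weak_conv_m (\<lambda>k. emp (n k) (t k)) H" and w_conv: "weak_conv_m (\<lambda>k. emp (N k) (w k)) D"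
begin

lemma subsequence:
  assumes "strict_mono s"
  shows "model_sequence c H D z \<mu> (\<lambda>k. n (s k)) (\<lambda>k. N (s k)) (\<lambda>k. U (s k)) (\<lambda>k. t (s k)) (\<lambda>k. w (s k))"
proof (intro model_sequence.intro model_sequence_axioms.intro fixed_point_axioms \<mu> mean var n N U)
  note sub = filterlim_subseq[OF assms]
  show "filterlim (\<lambda>k. n (s k)) at_top sequentially" by (rule filterlim_compose[OF n_top sub])
  show "(\<lambda>k. real (n (s k)) / real (N (s k))) \<longlonglongrightarrow> c" by (rule filterlim_compose[OF ratio sub])
  show "weak_conv_m (\<lambda>k. emp (n (s k)) (t (s k))) H" "weak_conv_m (\<lambda>k. emp (N (s k)) (w (s k))) D"
    using t_conv w_conv unfolding weak_conv_m_def weak_conv_def by (auto intro: filterlim_compose[OF _ sub])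
qed (use t w in auto)

lemma N_top: "filterlim (\<lambda>k. real (N k)) at_top sequentially"
proof -
  have "(\<lambda>k. 1 / (real (n k) / real (N k))) \<longlonglongrightarrow> 1 / c" by (intro tendsto_intros ratio) (use c in auto)
  hence "filterlim (\<lambda>k. 1 / (real (n k) / real (N k)) * real (n k)) at_top sequentially"
    by (rule filterlim_tendsto_pos_mult_at_top) (use c filterlim_compose[OF filterlim_real_sequentially n_top] in auto)
  thus ?thesis using n N by simp
qed

definition cut_mean :: "real \<Rightarrow> nat \<Rightarrow> complex" where
  "cut_mean K k = mean_trace \<mu> z (n k) (N k) (U k) (\<lambda>i. cut K (t k i)) (\<lambda>j. cut K (w k j))"

definition cut_gamma :: "real \<Rightarrow> nat \<Rightarrow> complex" where
  "cut_gamma K k = (\<integral>x. (\<Sum>i<n k. of_real (cut K (t k i)) *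
     smk (n k) z (\<lambda>j. cut K (w k j) / real (N k)) (scaled (n k) (U k) (\<lambda>i. cut K (t k i)) x) (scaled (n k) (U k) (\<lambda>i. cut K (t k i)) x) (N k) i i)
     / of_nat (N k) \<partial>columns \<mu> (n k) (N k))"

definition cut_omega :: "real \<Rightarrow> nat \<Rightarrow> complex" where
  "cut_omega K k = (\<integral>\<delta>. of_real (cut K \<delta>) / (1 + of_real (cut K \<delta>) * cut_gamma K k) \<partial>emp (N k) (w k))"

text \<open>The quantity \<open>matrix_model.err\<close> at accuracy \<open>e\<close> along the
  sequence.\<close>

definition cut_err :: "real \<Rightarrow> real \<Rightarrow> nat \<Rightarrow> real" where
  "cut_err K e k = K * (\<zeta> * (e * (real (n k) / real (N k)) * (K * (K / v) / v)) + \<zeta> * (K * (K / v) / (v * real (N k)))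
   + real (n k) / real (N k) * (K * (K / v)) / v * (K * \<zeta>\<^sup>2 * (16 * K / (v * sqrt (real (N k))) + K / (v * real (N k)) + e * (real (n k) / real (N k)) * (K / v))))"

lemma cut_err_limit:
  "cut_err K e \<longlonglongrightarrow> (K * (\<zeta> * (c * (K * (K / v) / v)) + c * (K * (K / v)) / v * (K * \<zeta>\<^sup>2 * (c * (K / v))))) * e"
proof -
  have 1: "(\<lambda>k. a / (v * real (N k))) \<longlonglongrightarrow> 0" for a
    by (intro tendsto_divide_0[OF tendsto_const] filterlim_at_top_imp_at_infinity filterlim_tendsto_pos_mult_at_top[OF tendsto_const z] N_top)
  have 2: "(\<lambda>k. a / (v * sqrt (real (N k)))) \<longlonglongrightarrow> 0" for a
    by (intro tendsto_divide_0[OF tendsto_const] filterlim_at_top_imp_at_infinity filterlim_tendsto_pos_mult_at_top[OF tendsto_const z]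
        filterlim_compose[OF sqrt_at_top] N_top)
  have "cut_err K e \<longlonglongrightarrow> K * (\<zeta> * (e * c * (K * (K / v) / v)) + \<zeta> * 0
   + c * (K * (K / v)) / v * (K * \<zeta>\<^sup>2 * (0 + 0 + e * c * (K / v))))"
    unfolding cut_err_def[abs_def] by (intro tendsto_intros 1 2 ratio) (use z in auto)
  thus ?thesis by (simp add: algebra_simps)
qed

lemma cut_model:
  assumes K: "1 \<le> K" and e: "0 < e"
  shows "eventually (\<lambda>k. 0 \<le> Im (cut_gamma K k) \<and> 0 \<le> Im (z * cut_gamma K k) \<and>
    cmod (cut_gamma K k) \<le> real (n k) / real (N k) * K / v \<and> Im (cut_omega K k) \<le> 0 \<and>
    cmod (cut_gamma K k - of_real (real (n k) / real (N k)) *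
      (\<integral>\<tau>. of_real (cut K \<tau>) / (of_real (cut K \<tau>) * cut_omega K k - z) \<partial>emp (n k) (t k))) \<le> cut_err K e k \<and>
    cmod (of_real (real (n k) / real (N k)) * cut_mean K k - of_real (real (n k) / real (N k)) *
      (\<integral>\<tau>. 1 / (of_real (cut K \<tau>) * cut_omega K k - z) \<partial>emp (n k) (t k))) \<le> cut_err K e k) sequentially"
proof -
  obtain n0 where n0: "\<And>m A C. n0 \<le> m \<Longrightarrow> 0 < C \<Longrightarrow> kbounded m C A \<Longrightarrow>
    integrable (PiM {..<m} (\<lambda>_. \<mu>)) (\<lambda>x. kip m x (kapp m A x) - ktr m A) \<and>
    (\<integral>x. cmod (kip m x (kapp m A x) - ktr m A) \<partial>PiM {..<m} (\<lambda>_. \<mu>)) \<le> e * real m * C"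
    using quadratic_form_concentration[OF \<mu> mean var e] by blast
  have "eventually (\<lambda>k. n0 \<le> n k) sequentially" using n_top by (simp add: filterlim_at_top)
  thus ?thesis
  proof eventually_elim
    case (elim k)
    interpret mm: matrix_model "PiM {..<n k} (\<lambda>_. \<mu>)" "n k" "N k" z "\<lambda>i. cut K (t k i)" "\<lambda>j. cut K (w k j)" K e "kapp (n k) (kadj (U k))"
      by (rule matrix_model_columns[OF \<mu> N z K less_imp_le[OF e] U n0[OF elim]])
    have r: "mm.r = scaled (n k) (U k) (\<lambda>i. cut K (t k i))"
      by (intro ext) (simp add: mm.r_def scaled_def)
    have R: "mm.R x = smk (n k) z (\<lambda>j. cut K (w k j) / real (N k)) (scaled (n k) (U k) (\<lambda>i. cut K (t k i)) x) (scaled (n k) (U k) (\<lambda>i. cut K (t k i)) x) (N k)" for x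
      unfolding mm.R_def r mm.wt_def[abs_def] ..
    have g: "mm.\<gamma> = cut_gamma K k" unfolding mm.\<gamma>_def mm.g_def R cut_gamma_def ..
    have om: "mm.om = cut_omega K k"
      unfolding mm.om_def cut_omega_def g emp_sum[OF N[of k]]
      by (subst emp_sum[OF N[of k]]) (use N[of k] in auto)
    have d: "mm.d i = 1 / (of_real (cut K (t k i)) * cut_omega K k - z)" for i by (simp add: mm.d_def om)
    have err: "mm.err = cut_err K e k" by (simp add: mm.err_def cut_err_def)
    have 1: "cmod (cut_gamma K k - (\<Sum>i<n k. of_real (cut K (t k i)) * mm.d i) / of_nat (N k)) \<le> cut_err K e k"
      using mm.deterministic_equivalent[of "\<lambda>i. of_real (cut K (t k i))"] mm.t unfolding g[symmetric] mm.\<gamma>_def mm.g_def err by simp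
    have s1: "(\<Sum>i<n k. of_real (cut K (t k i)) * mm.d i) / of_nat (N k) = of_real (real (n k) / real (N k)) *
      (\<integral>\<tau>. of_real (cut K \<tau>) / (of_real (cut K \<tau>) * cut_omega K k - z) \<partial>emp (n k) (t k))"
      unfolding d by (subst emp_sum[OF n[of k], symmetric]) auto
    have m: "(\<integral>x. (\<Sum>i<n k. 1 * mm.R x i i) / of_nat (N k) \<partial>mm.P) = of_real (real (n k) / real (N k)) * cut_mean K k"
    proof -
      have eq: "(\<Sum>i<n k. 1 * mm.R x i i) / of_nat (N k)
        = of_real (real (n k) / real (N k)) * norm_trace z (n k) (N k) (U k) (\<lambda>i. cut K (t k i)) (\<lambda>j. cut K (w k j)) x" for x
        using n[of k] unfolding norm_trace_def R ktr_def by simp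
      show ?thesis unfolding eq cut_mean_def mean_trace_def by (rule integral_mult_right_zero)
    qed
    have 2: "cmod ((\<integral>x. (\<Sum>i<n k. 1 * mm.R x i i) / of_nat (N k) \<partial>mm.P) - (\<Sum>i<n k. 1 * mm.d i) / of_nat (N k)) \<le> cut_err K e k"
      unfolding err[symmetric] by (rule mm.deterministic_equivalent) (use K in simp)
    have s2: "(\<Sum>i<n k. 1 * mm.d i) / of_nat (N k) = of_real (real (n k) / real (N k)) *
      (\<integral>\<tau>. 1 / (of_real (cut K \<tau>) * cut_omega K k - z) \<partial>emp (n k) (t k))"
      unfolding d by (subst emp_sum[OF n[of k], symmetric]) auto
    show ?case
      using mm.Im_\<gamma> mm.Im_z\<gamma> mm.\<gamma>_bound mm.Im_om 1 2 unfolding s1 s2 m g om by blast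
  qed
qed


text \<open>At fixed \<open>K\<close> the \<gamma> are bounded by a multiple of \<open>K\<close>, so
  a subsequence converges, and \<omega> and the means follow. The two uses of
  \<open>deterministic_equivalent\<close> become the equation for \<gamma> and the formula for the
  limit of the means.\<close>

lemma cut_limit:
  assumes K: "1 \<le> K"
  obtains s g om where "strict_mono s" "cut_solution K g om"
    "(\<lambda>k. cut_mean K (s k)) \<longlonglongrightarrow> (\<integral>\<tau>. 1 / (of_real (cut K \<tau>) * om - z) \<partial>H)"
proof -
  have K0: "0 \<le> K" using K by simp
  let ?IH = "\<lambda>k. \<integral>\<tau>. of_real (cut K \<tau>) / (of_real (cut K \<tau>) * cut_omega K k - z) \<partial>emp (n k) (t k)"
  let ?I1 = "\<lambda>k. \<integral>\<tau>. 1 / (of_real (cut K \<tau>) * cut_omega K k - z) \<partial>emp (n k) (t k)"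
  let ?\<rho> = "\<lambda>k. complex_of_real (real (n k) / real (N k))"
  note cm = cut_model[OF K]
  have ev1: "eventually (\<lambda>k. real (n k) / real (N k) < c + 1) sequentially" by (rule order_tendstoD(2)[OF ratio]) simp
  have e1: "0 < (1::real)" by simp
  have "eventually (\<lambda>k. 0 \<le> Im (cut_gamma K k) \<and> 0 \<le> Im (z * cut_gamma K k) \<and>
    cmod (cut_gamma K k) \<le> (c + 1) * K / v \<and> Im (cut_omega K k) \<le> 0) sequentially"
    using ev1 cm[OF e1]
  proof eventually_elim
    case (elim k)
    have "real (n k) / real (N k) * K / v \<le> (c + 1) * K / v"
      using less_imp_le[OF elim(1)] K0 z by (intro divide_right_mono mult_right_mono) (auto simp del: divide_le_eq)
    thus ?case using elim(2) order_trans by blast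
  qed
  then obtain k0 where k0: "\<And>k. k0 \<le> k \<Longrightarrow> 0 \<le> Im (cut_gamma K k)" "\<And>k. k0 \<le> k \<Longrightarrow> 0 \<le> Im (z * cut_gamma K k)"
    "\<And>k. k0 \<le> k \<Longrightarrow> cmod (cut_gamma K k) \<le> (c + 1) * K / v" "\<And>k. k0 \<le> k \<Longrightarrow> Im (cut_omega K k) \<le> 0"
    unfolding eventually_sequentially by blast
  obtain g s0 where s0: "strict_mono s0" "(\<lambda>k. cut_gamma K (s0 k + k0)) \<longlonglongrightarrow> g"
    by (rule bounded_convergent_subsequence[of "\<lambda>k. cut_gamma K (k + k0)" "(c + 1) * K / v"]) (use k0(3) in auto)
  define s where "s k = s0 k + k0" for k
  have s: "strict_mono s" using s0(1) by (simp add: s_def strict_mono_def)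
  have sk0: "k0 \<le> s k" for k by (simp add: s_def)
  have g: "(\<lambda>k. cut_gamma K (s k)) \<longlonglongrightarrow> g" using s0(2) by (simp add: s_def)
  interpret S: model_sequence c H D z \<mu> "\<lambda>k. n (s k)" "\<lambda>k. N (s k)" "\<lambda>k. U (s k)" "\<lambda>k. t (s k)" "\<lambda>k. w (s k)"
    by (rule subsequence[OF s])
  have Img: "0 \<le> Im g" by (rule tendsto_lowerbound[OF tendsto_Im[OF g]]) (use k0(1)[OF sk0] in auto)
  have Imzg: "0 \<le> Im (z * g)"
    by (rule tendsto_lowerbound[OF tendsto_Im[OF tendsto_mult[OF tendsto_const g]]]) (use k0(2)[OF sk0] in auto)
  define om where "om = (\<integral>\<delta>. of_real (cut K \<delta>) / (1 + of_real (cut K \<delta>) * g) \<partial>D)"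
  have ab: "0 \<le> cut K x" "cut K x \<le> K" for x by (rule cut_bounds cut_bounds(2)[OF K0])+
  have contcut: "isCont (cut K) x" for x
    using cut_continuous[of UNIV K] by (simp add: continuous_on_eq_continuous_at)
  have om: "(\<lambda>k. cut_omega K (s k)) \<longlonglongrightarrow> om"
    unfolding cut_omega_def om_def
  proof (rule weak_conv_uniform[OF emp_real_distribution DM S.w_conv])
    show "isCont (\<lambda>\<delta>. complex_of_real (cut K \<delta>) / (1 + of_real (cut K \<delta>) * g)) x" for x
      by (intro continuous_intros contcut) (rule denominator_bound(2)[OF z Imzg ab(1)])
    show "cmod (of_real (cut K x) / (1 + of_real (cut K x) * g)) \<le> \<zeta> * K" for x
      by (rule order_trans[OF weight_fraction_bound[OF z Imzg ab(1)] mult_left_mono[OF ab(2)]]) (use z in simp)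
    show "cmod (of_real (cut K x) / (1 + of_real (cut K x) * cut_gamma K (s k)) - of_real (cut K x) / (1 + of_real (cut K x) * g))
        \<le> (K * \<zeta>)\<^sup>2 * cmod (cut_gamma K (s k) - g)" for k x
      by (rule weight_fraction_lipschitz[OF z k0(2)[OF sk0] Imzg ab])
    show "(\<lambda>k. (K * \<zeta>)\<^sup>2 * cmod (cut_gamma K (s k) - g)) \<longlonglongrightarrow> 0"
      by (intro tendsto_mult_right_zero tendsto_norm_zero) (use g in \<open>simp add: LIM_zero_iff\<close>)
  qed measurable
  have Imom: "Im om \<le> 0" by (rule tendsto_upperbound[OF tendsto_Im[OF om]]) (use k0(4)[OF sk0] in auto)
  have near: "cmod (1 / (of_real (cut K x) * cut_omega K (s k) - z) - 1 / (of_real (cut K x) * om - z))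
      \<le> K / v\<^sup>2 * cmod (cut_omega K (s k) - om)" for k x
    by (rule shifted_denominator_lipschitz[OF z k0(4)[OF sk0] Imom ab])
  have contden: "isCont (\<lambda>\<tau>. 1 / (complex_of_real (cut K \<tau>) * om - z)) x" for x
    by (intro continuous_intros contcut) (rule shifted_denominator(2)[OF z Imom ab(1)])
  have bden: "cmod (1 / (of_real (cut K x) * om - z)) \<le> 1 / v" for x by (rule shifted_denominator(3)[OF z Imom ab(1)])
  have omz: "(\<lambda>k. C * (K / v\<^sup>2 * cmod (cut_omega K (s k) - om))) \<longlonglongrightarrow> 0" for C
    by (intro tendsto_mult_right_zero tendsto_norm_zero) (use om in \<open>simp add: LIM_zero_iff\<close>)
  have I1: "(\<lambda>k. ?I1 (s k)) \<longlonglongrightarrow> (\<integral>\<tau>. 1 / (of_real (cut K \<tau>) * om - z) \<partial>H)"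
    by (rule weak_conv_uniform[OF emp_real_distribution HM S.t_conv contden bden _ near]) (use omz[of 1] in \<open>simp_all, measurable\<close>)
  have IH: "(\<lambda>k. ?IH (s k)) \<longlonglongrightarrow> (\<integral>\<tau>. of_real (cut K \<tau>) / (of_real (cut K \<tau>) * om - z) \<partial>H)"
  proof (rule weak_conv_uniform[OF emp_real_distribution HM S.t_conv _ _ _ _ omz[of K]])
    show "isCont (\<lambda>\<tau>. complex_of_real (cut K \<tau>) / (of_real (cut K \<tau>) * om - z)) x" for x
      by (intro continuous_intros contcut) (rule shifted_denominator(2)[OF z Imom ab(1)])
    show "cmod (of_real (cut K x) / (of_real (cut K x) * om - z)) \<le> K * (1 / v)" for x
      using mult_mono[OF ab(2)[of x] bden[of x]] K0 ab(1)[of x] by (simp add: norm_divide)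
    show "cmod (of_real (cut K x) / (of_real (cut K x) * cut_omega K (s k) - z) - of_real (cut K x) / (of_real (cut K x) * om - z))
      \<le> K * (K / v\<^sup>2 * cmod (cut_omega K (s k) - om))" for k x
    proof -
      have "of_real (cut K x) / (of_real (cut K x) * cut_omega K (s k) - z) - of_real (cut K x) / (of_real (cut K x) * om - z)
        = of_real (cut K x) * (1 / (of_real (cut K x) * cut_omega K (s k) - z) - 1 / (of_real (cut K x) * om - z))"
        by (simp add: right_diff_distrib)
      moreover have "cmod (of_real (cut K x) * (1 / (of_real (cut K x) * cut_omega K (s k) - z) - 1 / (of_real (cut K x) * om - z)))
        \<le> K * (K / v\<^sup>2 * cmod (cut_omega K (s k) - om))"
        unfolding norm_mult by (rule mult_mono[OF _ near]) (use ab[of x] K0 in auto)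
      ultimately show ?thesis by simp
    qed
  qed measurable
  let ?E = "K * (\<zeta> * (c * (K * (K / v) / v)) + c * (K * (K / v)) / v * (K * \<zeta>\<^sup>2 * (c * (K / v))))"
  have E: "0 \<le> ?E" using K0 c z by simp
  have D1: "(\<lambda>k. cut_gamma K k - ?\<rho> k * ?IH k) \<longlonglongrightarrow> 0"
    by (rule tendsto_zero_eventually_bound[OF _ cut_err_limit[of K] E]) (rule eventually_mono[OF cm], assumption, blast)
  have D2: "(\<lambda>k. ?\<rho> k * cut_mean K k - ?\<rho> k * ?I1 k) \<longlonglongrightarrow> 0"
    by (rule tendsto_zero_eventually_bound[OF _ cut_err_limit[of K] E]) (rule eventually_mono[OF cm], assumption, blast)
  have \<rho>: "?\<rho> \<longlonglongrightarrow> of_real c" by (intro tendsto_of_real ratio)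
  note \<rho>s = tendsto_subseq[OF \<rho> s]
  have "(\<lambda>k. cut_gamma K (s k) - ?\<rho> (s k) * ?IH (s k) + ?\<rho> (s k) * ?IH (s k)) \<longlonglongrightarrow>
      0 + of_real c * (\<integral>\<tau>. of_real (cut K \<tau>) / (of_real (cut K \<tau>) * om - z) \<partial>H)"
    by (intro tendsto_add tendsto_subseq[OF D1 s] tendsto_mult \<rho>s IH)
  hence "g = of_real c * (\<integral>\<tau>. of_real (cut K \<tau>) / (of_real (cut K \<tau>) * om - z) \<partial>H)"
    using LIMSEQ_unique[OF g] by simp
  hence cs: "cut_solution K g om" unfolding cut_solution_def using Img Imzg om_def by blast
  have "(\<lambda>k. (?\<rho> (s k) * cut_mean K (s k) - ?\<rho> (s k) * ?I1 (s k)) / ?\<rho> (s k) + ?I1 (s k)) \<longlonglongrightarrow>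
      0 / of_real c + (\<integral>\<tau>. 1 / (of_real (cut K \<tau>) * om - z) \<partial>H)"
    by (intro tendsto_add tendsto_divide tendsto_subseq[OF D2 s] \<rho>s I1) (use c in simp)
  moreover have "(?\<rho> k * cut_mean K k - ?\<rho> k * ?I1 k) / ?\<rho> k + ?I1 k = cut_mean K k" for k
    using n[of k] N[of k] by (simp only: right_diff_distrib[symmetric]) simp
  ultimately have "(\<lambda>k. cut_mean K (s k)) \<longlonglongrightarrow> (\<integral>\<tau>. 1 / (of_real (cut K \<tau>) * om - z) \<partial>H)" by simp
  from that[OF s cs this] show ?thesis .
qed

end

text \<open>A continuous majorant of the indicator of values beyond \<open>K\<close>, zero up to
  \<open>K - 1\<close>; being continuous and bounded it turns counts of large eigenvalues into
  quantities controlled by weak convergence.\<close>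

definition tail_cutoff :: "real \<Rightarrow> real \<Rightarrow> real" where
  "tail_cutoff K x = min 1 (max 0 (x - (K - 1)))"

lemma tail_cutoff_continuous: "isCont (tail_cutoff K) x"
  unfolding tail_cutoff_def by (intro continuous_intros)

lemma tail_cutoff_measurable [measurable]: "tail_cutoff K \<in> borel_measurable borel"
  by (intro borel_measurable_continuous_onI continuous_at_imp_continuous_on ballI tail_cutoff_continuous)

lemma tail_cutoff_bounds: "0 \<le> tail_cutoff K x" "tail_cutoff K x \<le> 1" "\<bar>tail_cutoff K x\<bar> \<le> 1" "K < x \<Longrightarrow> tail_cutoff K x = 1"
  unfolding tail_cutoff_def by auto

lemma card_le_tail_cutoff:
  assumes "0 < n"
  shows "real (card {i. i < n \<and> K < \<mu> i}) \<le> real n * (\<integral>x. tail_cutoff K x \<partial>emp n \<mu>)"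
proof -
  have "real (card {i. i < n \<and> K < \<mu> i}) = (\<Sum>i | i < n \<and> K < \<mu> i. tail_cutoff K (\<mu> i))" using tail_cutoff_bounds(4) by simp
  also have "\<dots> \<le> (\<Sum>i<n. tail_cutoff K (\<mu> i))" by (rule sum_mono2) (auto simp: tail_cutoff_bounds)
  finally show ?thesis using assms by (simp add: emp_integral field_simps)
qed

lemma tail_cutoff_vanishes:
  assumes "real_distribution M" "filterlim K at_top sequentially"
  shows "(\<lambda>k. \<integral>x. tail_cutoff (K k) x \<partial>M) \<longlonglongrightarrow> 0"
proof -
  interpret real_distribution M by (rule assms)
  have "(\<lambda>k. \<integral>x. tail_cutoff (K k) x \<partial>M) \<longlonglongrightarrow> (\<integral>x. 0 \<partial>M)"
  proof (rule integral_dominated_convergence[where w = "\<lambda>_. 1"])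
    show "AE x in M. (\<lambda>k. tail_cutoff (K k) x) \<longlonglongrightarrow> 0"
    proof (intro AE_I2 tendsto_eventually)
      fix x
      have "eventually (\<lambda>k. x + 1 \<le> K k) sequentially" using assms(2) by (simp add: filterlim_at_top)
      thus "eventually (\<lambda>k. tail_cutoff (K k) x = 0) sequentially" by eventually_elim (auto simp: tail_cutoff_def)
    qed
  qed (auto simp: tail_cutoff_bounds)
  thus ?thesis by simp
qed

context model_sequence begin

definition "means k = mean_trace \<mu> z (n k) (N k) (U k) (t k) (w k)"

lemma means_bound: "cmod (means k) \<le> 1 / v"
  unfolding means_def by (rule mean_trace_bound[OF \<mu> n z])

definition "trunc_err K k = (1 / (real (n k) / real (N k)) * (\<integral>x. tail_cutoff K x \<partial>emp (N k) (w k)) + 2 * (\<integral>x. tail_cutoff K x \<partial>emp (n k) (t k))) / v"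

lemma cut_mean_error:
  assumes "0 \<le> K"
  shows "cmod (means k - cut_mean K k) \<le> trunc_err K k"
proof -
  let ?cw = "real (card {j. j < N k \<and> K < w k j})" and ?ct = "real (card {i. i < n k \<and> K < t k i})"
  let ?hw = "\<integral>x. tail_cutoff K x \<partial>emp (N k) (w k)" and ?ht = "\<integral>x. tail_cutoff K x \<partial>emp (n k) (t k)"
  have nv: "0 < real (n k) * v" using n[of k] z by simp
  have "cmod (means k - cut_mean K k) \<le> (?cw + 2 * ?ct) / (real (n k) * v)"
    unfolding means_def cut_mean_def by (rule mean_trace_cut_bound[OF \<mu> n z assms t w])
  also have "\<dots> \<le> (real (N k) * ?hw + 2 * (real (n k) * ?ht)) / (real (n k) * v)"
    using card_le_tail_cutoff[OF N[of k], of K "w k"] card_le_tail_cutoff[OF n[of k], of K "t k"] nv by (intro divide_right_mono) auto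
  also have "\<dots> = trunc_err K k" unfolding trunc_err_def using n[of k] N[of k] z by (simp add: field_simps)
  finally show ?thesis .
qed

lemma trunc_err_limit: "trunc_err K \<longlonglongrightarrow> (1 / c * (\<integral>x. tail_cutoff K x \<partial>D) + 2 * (\<integral>x. tail_cutoff K x \<partial>H)) / v"
  unfolding trunc_err_def[abs_def]
  by (intro tendsto_intros ratio weak_conv_imp_integral_bdd_continuous_conv[OF emp_real_distribution DM w_conv]
      weak_conv_imp_integral_bdd_continuous_conv[OF emp_real_distribution HM t_conv])
     (use c z tail_cutoff_continuous tail_cutoff_bounds(3) in auto)

text \<open>For every level the truncation error passes to the limit in \<open>n\<close>, so
  \<open>l\<close> is within \<open>\<eta> p\<close> of the value at some truncated solution. As the
  level grows, \<open>\<eta> p\<close> becomes a tail of \<open>D\<close> and \<open>H\<close> and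
  vanishes, while the truncated solutions accumulate at a solution.\<close>

lemma limit_identified:
  assumes l: "means \<longlonglongrightarrow> l"
  obtains w0 where "Im w0 \<le> 0" "solves_fp c H D z w0" "cmod w0 \<le> \<zeta> * (\<integral>x. x \<partial>D)"
    "l = (\<integral>\<tau>. 1 / (of_real \<tau> * w0 - z) \<partial>H)"
proof -
  define K where "K p = real (Suc p)" for p
  have K1: "1 \<le> K p" for p by (simp add: K_def)
  have K0: "0 \<le> K p" for p by (simp add: K_def)
  have K_top: "filterlim K at_top sequentially" unfolding K_def[abs_def]
    by (rule filterlim_compose[OF filterlim_real_sequentially filterlim_Suc])
  let ?I = "\<lambda>p om. \<integral>\<tau>. 1 / (of_real (cut (K p) \<tau>) * om - z) \<partial>H"
  define \<eta> where "\<eta> p = (1 / c * (\<integral>x. tail_cutoff (K p) x \<partial>D) + 2 * (\<integral>x. tail_cutoff (K p) x \<partial>H)) / v" for p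
  have "\<exists>g om. cut_solution (K p) g om \<and> cmod (l - ?I p om) \<le> \<eta> p" for p
  proof -
    obtain s g om where s: "strict_mono s" and cs: "cut_solution (K p) g om" and lim: "(\<lambda>k. cut_mean (K p) (s k)) \<longlonglongrightarrow> ?I p om"
      by (rule cut_limit[OF K1])
    have "(\<lambda>k. cmod (means (s k) - cut_mean (K p) (s k))) \<longlonglongrightarrow> cmod (l - ?I p om)"
      by (intro tendsto_norm tendsto_diff tendsto_subseq[OF l s] lim)
    moreover have "(\<lambda>k. trunc_err (K p) (s k)) \<longlonglongrightarrow> \<eta> p"
      unfolding \<eta>_def by (rule tendsto_subseq[OF trunc_err_limit s])
    ultimately have "cmod (l - ?I p om) \<le> \<eta> p" by (rule LIMSEQ_le) (use cut_mean_error[OF K0] in blast)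
    thus ?thesis using cs by blast
  qed
  then obtain g om where cs: "\<And>p. cut_solution (K p) (g p) (om p)" and b: "\<And>p. cmod (l - ?I p (om p)) \<le> \<eta> p" by metis
  obtain s w0 where s: "strict_mono s" and om: "(\<lambda>p. om (s p)) \<longlonglongrightarrow> w0" and w0: "Im w0 \<le> 0" "solves_fp c H D z w0" "cmod w0 \<le> \<zeta> * (\<integral>x. x \<partial>D)"
    by (rule cut_solutions_converge[OF K_top K0 cs])
  have I: "(\<lambda>p. ?I (s p) (om (s p))) \<longlonglongrightarrow> (\<integral>\<tau>. 1 / (of_real \<tau> * w0 - z) \<partial>H)"
    by (rule shifted_denominator_tendsto_integral(1)[OF om cut_solution_bounds(1)[OF cs K0] filterlim_compose[OF K_top filterlim_subseq[OF s]]])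
  have "\<eta> \<longlonglongrightarrow> (1 / c * 0 + 2 * 0) / v"
    unfolding \<eta>_def[abs_def] by (intro tendsto_intros tail_cutoff_vanishes DM HM K_top) (use z in auto)
  hence "(\<lambda>p. \<eta> (s p)) \<longlonglongrightarrow> 0" using tendsto_subseq[OF _ s] by fastforce
  hence "(\<lambda>p. l - ?I (s p) (om (s p))) \<longlonglongrightarrow> 0"
    by (rule Lim_null_comparison[rotated]) (use b in auto)
  hence "(\<lambda>p. ?I (s p) (om (s p))) \<longlonglongrightarrow> l"
    using tendsto_diff[OF tendsto_const[of l]] by fastforce
  hence "l = (\<integral>\<tau>. 1 / (of_real \<tau> * w0 - z) \<partial>H)" by (rule LIMSEQ_unique[OF _ I])
  from that[OF w0 this] show ?thesis .
qed

text \<open>The limit along any subsequence is the same function of a solution, and the solution is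
  unique.\<close>

lemma means_converge:
  obtains w0 where "Im w0 \<le> 0" "solves_fp c H D z w0" "cmod w0 \<le> \<zeta> * (\<integral>x. x \<partial>D)"
    "means \<longlonglongrightarrow> (\<integral>\<tau>. 1 / (of_real \<tau> * w0 - z) \<partial>H)"
proof -
  have sub: thesis if s: "strict_mono s" and l: "(\<lambda>k. means (s k)) \<longlonglongrightarrow> l"
    and that: "\<And>w0. Im w0 \<le> 0 \<Longrightarrow> solves_fp c H D z w0 \<Longrightarrow> cmod w0 \<le> \<zeta> * (\<integral>x. x \<partial>D) \<Longrightarrow>
      l = (\<integral>\<tau>. 1 / (of_real \<tau> * w0 - z) \<partial>H) \<Longrightarrow> thesis" for s l thesis
  proof -
    interpret S: model_sequence c H D z \<mu> "\<lambda>k. n (s k)" "\<lambda>k. N (s k)" "\<lambda>k. U (s k)" "\<lambda>k. t (s k)" "\<lambda>k. w (s k)"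
      by (rule subsequence[OF s])
    have "S.means = (\<lambda>k. means (s k))" by (simp add: S.means_def[abs_def] means_def)
    thus ?thesis using S.limit_identified[of l] l that by metis
  qed
  obtain l s where "strict_mono s" "(\<lambda>k. means (s k)) \<longlonglongrightarrow> l"
    by (rule bounded_convergent_subsequence[OF means_bound])
  then obtain w0 where w0: "Im w0 \<le> 0" "solves_fp c H D z w0" "cmod w0 \<le> \<zeta> * (\<integral>x. x \<partial>D)" using sub by blast
  have "means \<longlonglongrightarrow> (\<integral>\<tau>. 1 / (of_real \<tau> * w0 - z) \<partial>H)"
  proof (rule tendsto_by_subsequences[OF means_bound])
    fix l' s' assume "strict_mono s'" "(\<lambda>k. means (s' k)) \<longlonglongrightarrow> l'"
    then obtain w1 where w1: "Im w1 \<le> 0" "solves_fp c H D z w1" "l' = (\<integral>\<tau>. 1 / (of_real \<tau> * w1 - z) \<partial>H)" using sub by blast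
    have "w1 = w0" by (rule fixed_point_unique[OF w1(2,1) w0(2,1)])
    thus "l' = (\<integral>\<tau>. 1 / (of_real \<tau> * w0 - z) \<partial>H)" using w1(3) by simp
  qed
  from that[OF w0 this] show ?thesis .
qed

end

section \<open>Almost sure convergence\<close>

text \<open>The index pairs are grouped by column: independence of the blocks gives the outer
  product measure, independence within a block the inner one.\<close>

lemma (in prob_space) array_law:
  fixes X :: "nat \<times> nat \<Rightarrow> 'a \<Rightarrow> complex"
  assumes ind: "indep_vars (\<lambda>_. borel) X ({..<n} \<times> {..<N})"
    and law: "\<And>i j. i < n \<Longrightarrow> j < N \<Longrightarrow> distr M borel (X (i, j)) = \<mu>" and n: "0 < n" and N: "0 < N"
  shows "distr M (columns \<mu> n N) (\<lambda>\<omega>. \<lambda>j\<in>{..<N}. \<lambda>i\<in>{..<n}. X (i, j) \<omega>) = columns \<mu> n N"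
proof -
  let ?I = "{..<n}" and ?J = "{..<N}"
  let ?col = "\<lambda>j \<omega>. \<lambda>i\<in>?I. X (i, j) \<omega>"
  have ne: "?I \<noteq> {}" "?J \<noteq> {}" using n N by (auto simp: lessThan_empty_iff)
  have rv: "random_variable borel (X (i, j))" if "i < n" "j < N" for i j
    using ind that by (auto simp: indep_vars_def)
  have sets: "sets \<mu> = sets borel" using law[OF n N] by (metis sets_distr)
  have colrv: "random_variable (PiM ?I (\<lambda>_. borel)) (?col j)" if "j < N" for j
    by (intro measurable_restrict rv) (use that in auto)
  have colind: "indep_vars (\<lambda>_. PiM ?I (\<lambda>_. borel)) ?col ?J"
  proof -
    let ?K = "\<lambda>j. ?I \<times> {j}"
    have "indep_vars (\<lambda>j. PiM (?K j) (\<lambda>_. borel)) (\<lambda>j \<omega>. restrict (\<lambda>i. X i \<omega>) (?K j)) ?J"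
      by (rule indep_vars_restrict[OF ind]) (auto simp: disjoint_family_on_def)
    hence "indep_vars (\<lambda>_. PiM ?I (\<lambda>_. borel)) (\<lambda>j \<omega>. (\<lambda>i\<in>?I. restrict (\<lambda>i. X i \<omega>) (?K j) (i, j))) ?J"
      by (rule indep_vars_compose2) (intro measurable_restrict measurable_component_singleton, auto)
    moreover have "(\<lambda>\<omega>. (\<lambda>i\<in>?I. restrict (\<lambda>i. X i \<omega>) (?K j) (i, j))) = ?col j" for j
      by (intro ext) (simp add: restrict_def)
    ultimately show ?thesis by simp
  qed
  have collaw: "distr M (PiM ?I (\<lambda>_. borel)) (?col j) = PiM ?I (\<lambda>_. \<mu>)" if j: "j < N" for j
  proof -
    let ?K = "\<lambda>i. {(i, j)}"
    have "indep_vars (\<lambda>i. PiM (?K i) (\<lambda>_. borel)) (\<lambda>i \<omega>. restrict (\<lambda>i. X i \<omega>) (?K i)) ?I"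
      by (rule indep_vars_restrict[OF ind]) (use j in \<open>auto simp: disjoint_family_on_def\<close>)
    hence "indep_vars (\<lambda>_. borel) (\<lambda>i \<omega>. restrict (\<lambda>i. X i \<omega>) (?K i) (i, j)) ?I"
      by (rule indep_vars_compose2) (intro measurable_component_singleton, auto)
    hence "indep_vars (\<lambda>_. borel) (\<lambda>i. X (i, j)) ?I" by simp
    hence "distr M (PiM ?I (\<lambda>_. borel)) (?col j) = PiM ?I (\<lambda>i. distr M borel (X (i, j)))"
      by (subst (asm) indep_vars_iff_distr_eq_PiM'[OF ne(1)]) (use rv j in auto)
    moreover have "PiM ?I (\<lambda>i. distr M borel (X (i, j))) = PiM ?I (\<lambda>_. \<mu>)"
      by (rule PiM_cong[OF refl]) (use law j in auto)
    ultimately show ?thesis by simp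
  qed
  have "distr M (PiM ?J (\<lambda>_. PiM ?I (\<lambda>_. borel))) (\<lambda>\<omega>. \<lambda>j\<in>?J. ?col j \<omega>)
      = PiM ?J (\<lambda>j. distr M (PiM ?I (\<lambda>_. borel)) (?col j))"
    using colind by (subst (asm) indep_vars_iff_distr_eq_PiM'[OF ne(2)]) (use colrv in auto)
  also have "\<dots> = columns \<mu> n N" by (rule PiM_cong[OF refl]) (use collaw in auto)
  finally have "distr M (PiM ?J (\<lambda>_. PiM ?I (\<lambda>_. borel))) (\<lambda>\<omega>. \<lambda>j\<in>?J. ?col j \<omega>) = columns \<mu> n N" .
  moreover have "sets (PiM ?J (\<lambda>_. PiM ?I (\<lambda>_. borel))) = sets (columns \<mu> n N)"
    by (intro sets_PiM_cong refl) (simp add: sets)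
  ultimately show ?thesis by (metis (no_types, lifting) distr_cong)
qed

text \<open>\<^const>\<open>prob_space.indep_var\<close> relates variables of one common type only, hence the detour through
  \<open>f\<close> and \<open>g\<close>.\<close>

lemma (in prob_space) indep_var_distr_pair:
  assumes ind: "indep_var A X B Y" and f: "f \<in> measurable A A'" and g: "g \<in> measurable B B'"
  shows "distr M A' (\<lambda>\<omega>. f (X \<omega>)) \<Otimes>\<^sub>M distr M B' (\<lambda>\<omega>. g (Y \<omega>)) = distr M (A' \<Otimes>\<^sub>M B') (\<lambda>\<omega>. (f (X \<omega>), g (Y \<omega>)))"
proof -
  have X: "X \<in> measurable M A" and Y: "Y \<in> measurable M B" and law: "distr M A X \<Otimes>\<^sub>M distr M B Y = distr M (A \<Otimes>\<^sub>M B) (\<lambda>\<omega>. (X \<omega>, Y \<omega>))"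
    using ind unfolding indep_var_distribution_eq by auto
  have f': "f \<in> measurable (distr M A X) A'" and g': "g \<in> measurable (distr M B Y) B'" using f g by simp_all
  have fg: "(\<lambda>(x, y). (f x, g y)) \<in> measurable (A \<Otimes>\<^sub>M B) (A' \<Otimes>\<^sub>M B')"
    using measurable_Pair[OF measurable_compose[OF measurable_fst f] measurable_compose[OF measurable_snd g]] by (simp add: case_prod_beta')
  have "prob_space (distr (distr M B Y) B' g)"
    by (intro prob_space.prob_space_distr prob_space_distr Y g')
  hence sf: "sigma_finite_measure (distr (distr M B Y) B' g)" by (simp add: prob_space_imp_sigma_finite)
  have "distr M A' (\<lambda>\<omega>. f (X \<omega>)) \<Otimes>\<^sub>M distr M B' (\<lambda>\<omega>. g (Y \<omega>)) = distr (distr M A X) A' f \<Otimes>\<^sub>M distr (distr M B Y) B' g"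
    by (simp add: distr_distr[OF f X] distr_distr[OF g Y] comp_def)
  also have "\<dots> = distr (distr M A X \<Otimes>\<^sub>M distr M B Y) (A' \<Otimes>\<^sub>M B') (\<lambda>(x, y). (f x, g y))"
    by (rule pair_measure_distr[OF f' g' sf])
  also have "\<dots> = distr M (A' \<Otimes>\<^sub>M B') ((\<lambda>(x, y). (f x, g y)) \<circ> (\<lambda>\<omega>. (X \<omega>, Y \<omega>)))"
    unfolding law by (rule distr_distr[OF fg measurable_Pair[OF X Y]])
  finally show ?thesis by (simp add: comp_def)
qed

text \<open>Conditioning by Fubini: \<open>Q\<close> is frozen and the bound is integrated. It is
  required only at values \<open>Q \<omega>\<close> that are attained, where the matrices have the
  structure from which the bound is derived.\<close>

lemma (in prob_space) independent_tail:
  assumes X: "X \<in> measurable M A" and Q: "Q \<in> measurable M B"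
    and law: "distr M A X \<Otimes>\<^sub>M distr M B Q = distr M (A \<Otimes>\<^sub>M B) (\<lambda>\<omega>. (X \<omega>, Q \<omega>))" and E: "E \<in> sets (A \<Otimes>\<^sub>M B)"
    and b: "\<And>\<omega>. \<omega> \<in> space M \<Longrightarrow> emeasure (distr M A X) {x \<in> space A. (x, Q \<omega>) \<in> E} \<le> b"
  shows "emeasure M {\<omega> \<in> space M. (X \<omega>, Q \<omega>) \<in> E} \<le> b"
proof -
  interpret X: prob_space "distr M A X" by (rule prob_space_distr[OF X])
  interpret Q: prob_space "distr M B Q" by (rule prob_space_distr[OF Q])
  interpret pair_sigma_finite "distr M A X" "distr M B Q" ..
  have E': "E \<in> sets (distr M A X \<Otimes>\<^sub>M distr M B Q)" using E by (simp cong: sets_pair_measure_cong)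
  have "{\<omega> \<in> space M. (X \<omega>, Q \<omega>) \<in> E} = (\<lambda>\<omega>. (X \<omega>, Q \<omega>)) -` E \<inter> space M" by auto
  hence "emeasure M {\<omega> \<in> space M. (X \<omega>, Q \<omega>) \<in> E} = emeasure (distr M (A \<Otimes>\<^sub>M B) (\<lambda>\<omega>. (X \<omega>, Q \<omega>))) E"
    using emeasure_distr[OF measurable_Pair[OF X Q] E] by simp
  also have "\<dots> = (\<integral>\<^sup>+q. emeasure (distr M A X) ((\<lambda>x. (x, q)) -` E) \<partial>distr M B Q)"
    unfolding law[symmetric] by (rule emeasure_pair_measure_alt2[OF E'])
  also have "\<dots> = (\<integral>\<^sup>+\<omega>. emeasure (distr M A X) ((\<lambda>x. (x, Q \<omega>)) -` E) \<partial>M)"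
    by (rule nn_integral_distr[OF Q]) (use measurable_emeasure_Pair2[OF E'] in simp)
  also have "\<dots> \<le> (\<integral>\<^sup>+\<omega>. b \<partial>M)"
  proof (rule nn_integral_mono)
    fix \<omega> assume \<omega>: "\<omega> \<in> space M"
    have "(\<lambda>x. (x, Q \<omega>)) -` E = {x \<in> space A. (x, Q \<omega>) \<in> E}"
      using sets.sets_into_space[OF E] by (auto simp: space_pair_measure)
    thus "emeasure (distr M A X) ((\<lambda>x. (x, Q \<omega>)) -` E) \<le> b" using b[OF \<omega>] by simp
  qed
  also have "\<dots> = b" by (simp add: emeasure_space_1)
  finally show ?thesis .
qed

lemma norm_trace_column_change:
  assumes n: "0 < n" and z: "0 < Im z"
  shows "cmod (norm_trace z n N U t w x - norm_trace z n N U t w (x(j := y))) \<le> 2 / (real n * Im z)"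
proof -
  let ?q = "\<lambda>i. of_real (sqrt (t i)) * kapp n (kadj U) y i"
  let ?S = "\<lambda>r. smk n z (\<lambda>j. w j / real N) r r N"
  have sc: "scaled n U t (x(j := y)) = (scaled n U t x)(j := ?q)" by (auto simp: scaled_def fun_eq_iff)
  have "cmod (ktr n (?S (scaled n U t x)) - ktr n (?S ((scaled n U t x)(j := ?q)))) \<le> 2 * 1 / Im z"
    using ktr_kmul_smk_column_bound[OF z kbounded_id] unfolding ktr_kmul_id .
  hence "cmod (ktr n (?S (scaled n U t x)) - ktr n (?S ((scaled n U t x)(j := ?q)))) / real n \<le> 2 * 1 / Im z / real n"
    by (rule divide_right_mono) simp
  moreover have "norm_trace z n N U t w x - norm_trace z n N U t w (x(j := y))
    = (ktr n (?S (scaled n U t x)) - ktr n (?S ((scaled n U t x)(j := ?q)))) / of_nat n"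
    unfolding norm_trace_def sc by (simp add: diff_divide_distrib)
  ultimately show ?thesis by (simp add: norm_divide mult.commute)
qed

text \<open>A deviation of modulus \<open>e\<close> forces one of the four one-sided deviations of
  real and imaginary part to reach \<open>e / 2\<close>. With differences
  \<open>2 / (real n * Im z)\<close> and \<open>N\<close> columns the exponent is \<open>e\<^sup>2 *
  (Im z)\<^sup>2 * (real n)\<^sup>2 / (32 * real N)\<close>.\<close>

lemma norm_trace_tail:
  assumes \<mu>: "prob_space \<mu>" "sets \<mu> = sets borel" and n: "0 < n" and N: "0 < N" and z: "0 < Im z" and e: "0 < e"
  shows "emeasure (columns \<mu> n N) {x \<in> space (columns \<mu> n N). e \<le> cmod (norm_trace z n N U t w x - mean_trace \<mu> z n N U t w)}
    \<le> ennreal (4 * exp (- (e\<^sup>2 * (Im z)\<^sup>2 * (real n)\<^sup>2 / (32 * real N))))"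
proof -
  let ?P = "columns \<mu> n N" and ?f = "norm_trace z n N U t w" and ?c = "2 / (real n * Im z)"
  note P = prob_space_columns[OF \<mu>(1), where n = n and N = N]
  have fm [measurable]: "?f \<in> borel_measurable ?P" by (rule norm_trace_measurable[OF \<mu>(2)])
  have fi: "integrable ?P ?f" by (rule bounded_integrable[OF P fm norm_trace_bound[OF n z]])
  have c: "0 < ?c" using n z by simp
  have I: "finite {..<N}" "{..<N} \<noteq> {}" using N by (auto simp: lessThan_empty_iff)
  define u where "u = exp (- (e\<^sup>2 * (Im z)\<^sup>2 * (real n)\<^sup>2 / (32 * real N)))"
  have tail: "emeasure ?P {x \<in> space ?P. e / 2 \<le> h (?f x) - (\<integral>x. h (?f x) \<partial>?P)} \<le> ennreal u"
    if h: "h = Re \<or> h = Im \<or> h = (\<lambda>x. - Re x) \<or> h = (\<lambda>x. - Im x)" for h :: "complex \<Rightarrow> real"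
  proof -
    have hm: "(\<lambda>x. h (?f x)) \<in> borel_measurable ?P" using h by auto
    have h1: "\<bar>h a\<bar> \<le> cmod a" and h2: "\<bar>h a - h b\<bar> \<le> cmod (a - b)" for a b
      using h abs_Re_le_cmod[of a] abs_Im_le_cmod[of a] abs_Re_le_cmod[of "a - b"] abs_Im_le_cmod[of "a - b"] by auto
    have "emeasure ?P {x \<in> space ?P. e / 2 \<le> h (?f x) - (\<integral>x. h (?f x) \<partial>?P)} \<le> ennreal (exp (- (e / 2)\<^sup>2 / (2 * ?c\<^sup>2 * real (card {..<N}))))"
    proof (rule mcdiarmid_tail[OF prob_space_PiM[OF \<mu>(1)] I c _ hm])
      show "0 < e / 2" using e by simp
      show "\<bar>h (?f x)\<bar> \<le> 1 / Im z" for x by (rule order_trans[OF h1 norm_trace_bound[OF n z]])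
      show "\<bar>h (?f x) - h (?f (x(j := y)))\<bar> \<le> ?c" for x j y by (rule order_trans[OF h2 norm_trace_column_change[OF n z]])
    qed
    also have "- (e / 2)\<^sup>2 / (2 * ?c\<^sup>2 * real (card {..<N})) = - (e\<^sup>2 * (Im z)\<^sup>2 * (real n)\<^sup>2 / (32 * real N))"
      using n N z by (simp add: field_simps power2_eq_square)
    finally show ?thesis by (simp add: u_def)
  qed
  let ?A = "\<lambda>h::complex \<Rightarrow> real. {x \<in> space ?P. e / 2 \<le> h (?f x) - (\<integral>x. h (?f x) \<partial>?P)}"
  have Am: "?A h \<in> sets ?P" if "h = Re \<or> h = Im \<or> h = (\<lambda>x. - Re x) \<or> h = (\<lambda>x. - Im x)" for h :: "complex \<Rightarrow> real"
  proof -
    have [measurable]: "(\<lambda>x. h (?f x)) \<in> borel_measurable ?P" using that by auto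
    show ?thesis by measurable
  qed
  have sub: "{x \<in> space ?P. e \<le> cmod (?f x - mean_trace \<mu> z n N U t w)} \<subseteq> (?A Re \<union> ?A Im) \<union> (?A (\<lambda>x. - Re x) \<union> ?A (\<lambda>x. - Im x))"
  proof
    fix x assume x: "x \<in> {x \<in> space ?P. e \<le> cmod (?f x - mean_trace \<mu> z n N U t w)}"
    have "Re (mean_trace \<mu> z n N U t w) = (\<integral>x. Re (?f x) \<partial>?P)" "Im (mean_trace \<mu> z n N U t w) = (\<integral>x. Im (?f x) \<partial>?P)"
      unfolding mean_trace_def using fi by simp_all
    moreover have "e \<le> \<bar>Re (?f x - mean_trace \<mu> z n N U t w)\<bar> + \<bar>Im (?f x - mean_trace \<mu> z n N U t w)\<bar>"
      using x cmod_le[of "?f x - mean_trace \<mu> z n N U t w"] by auto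
    ultimately show "x \<in> (?A Re \<union> ?A Im) \<union> (?A (\<lambda>x. - Re x) \<union> ?A (\<lambda>x. - Im x))"
      using x by (auto simp: abs_real_def split: if_splits)
  qed
  have "emeasure ?P {x \<in> space ?P. e \<le> cmod (?f x - mean_trace \<mu> z n N U t w)}
      \<le> emeasure ?P ((?A Re \<union> ?A Im) \<union> (?A (\<lambda>x. - Re x) \<union> ?A (\<lambda>x. - Im x)))"
    by (rule emeasure_mono[OF sub]) (intro sets.Un Am; simp)
  also have "\<dots> \<le> (emeasure ?P (?A Re) + emeasure ?P (?A Im)) + (emeasure ?P (?A (\<lambda>x. - Re x)) + emeasure ?P (?A (\<lambda>x. - Im x)))"
    by (intro order_trans[OF emeasure_subadditive] add_mono emeasure_subadditive sets.Un Am) auto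
  also have "\<dots> \<le> (ennreal u + ennreal u) + (ennreal u + ennreal u)"
    by (intro add_mono tail) auto
  also have "\<dots> = ennreal (4 * u)" by (simp add: u_def flip: ennreal_plus)
  finally show ?thesis by (simp add: u_def)
qed

lemma borel_mat_entry:
  assumes "i < r" "k < c"
  shows "(\<lambda>A. A $$ (i, k)) \<in> borel_measurable (borel_mat r c)"
proof -
  have "(\<lambda>A. \<lambda>ij \<in> {..<r} \<times> {..<c}. A $$ ij) \<in> measurable (borel_mat r c) (\<Pi>\<^sub>M ij \<in> {..<r} \<times> {..<c}. borel)"
    unfolding borel_mat_def by (rule measurable_vimage_algebra1) (auto simp: space_PiM)
  moreover have "(\<lambda>x. x (i, k)) \<in> borel_measurable (\<Pi>\<^sub>M ij \<in> {..<r} \<times> {..<c}. (borel :: complex measure))"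
    by (rule measurable_component_singleton) (use assms in auto)
  ultimately have "(\<lambda>A. (\<lambda>ij \<in> {..<r} \<times> {..<c}. A $$ ij) (i, k)) \<in> borel_measurable (borel_mat r c)"
    by (rule measurable_compose)
  thus ?thesis using assms by simp
qed

text \<open>\<open>U\<close> and \<open>t\<close> are arbitrary choices for each realisation. The
  trace and its conditional mean are rewritten as functions of the entries of \<open>T\<close> and
  the diagonal of \<open>W\<close>, jointly measurable with the columns; this makes \<open>S\<close>
  an event and allows conditioning on \<open>T\<close> and \<open>W\<close>.\<close>

lemma (in prob_space) model_tail:
  fixes Z T W :: "'a \<Rightarrow> complex mat"
  assumes n: "0 < n" and N: "0 < N" and z: "0 < Im z" and e: "0 < e"
    and Z_indep: "indep_vars (\<lambda>_. borel) (\<lambda>ij \<omega>. Z \<omega> $$ ij) ({..<n} \<times> {..<N})"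
    and law: "\<And>i j. i < n \<Longrightarrow> j < N \<Longrightarrow> distr M borel (\<lambda>\<omega>. Z \<omega> $$ (i, j)) = \<mu>"
    and ind: "indep_vars (\<lambda>k. [borel_mat n N, borel_mat n n, borel_mat N N] ! k) (\<lambda>k. [Z, T, W] ! k) {0, 1, 2}"
    and T: "\<And>\<omega>. \<omega> \<in> space M \<Longrightarrow> keq n (kmat (T \<omega>)) (kspectral n (U \<omega>) (t \<omega>))" "\<And>\<omega> i. \<omega> \<in> space M \<Longrightarrow> i < n \<Longrightarrow> 0 \<le> t \<omega> i"
    and W: "\<And>\<omega> j. \<omega> \<in> space M \<Longrightarrow> j < N \<Longrightarrow> W \<omega> $$ (j, j) = complex_of_real (w \<omega> j)"
  defines "S \<equiv> {\<omega> \<in> space M. e \<le> cmod (norm_trace z n N (U \<omega>) (t \<omega>) (w \<omega>) (\<lambda>j i. Z \<omega> $$ (i, j))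
      - mean_trace \<mu> z n N (U \<omega>) (t \<omega>) (w \<omega>))}"
  shows "S \<in> sets M" "emeasure M S \<le> ennreal (4 * exp (- (e\<^sup>2 * (Im z)\<^sup>2 * (real n)\<^sup>2 / (32 * real N))))"
proof -
  let ?ET = "PiM ({..<n} \<times> {..<n}) (\<lambda>_. borel :: complex measure)" and ?EW = "PiM {..<N} (\<lambda>_. borel :: complex measure)"
  let ?P = "columns \<mu> n N" and ?M' = "\<lambda>k. [borel_mat n N, borel_mat n n, borel_mat N N] ! k"
  have \<mu>: "prob_space \<mu>" "sets \<mu> = sets borel"
  proof -
    have "(\<lambda>\<omega>. Z \<omega> $$ (0, 0)) \<in> borel_measurable M" using Z_indep n N by (auto simp: indep_vars_def)
    thus "prob_space \<mu>" unfolding law[OF n N, symmetric] by (rule prob_space_distr)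
    show "sets \<mu> = sets borel" unfolding law[OF n N, symmetric] by simp
  qed
  define C where "C \<omega> = (\<lambda>j\<in>{..<N}. \<lambda>i\<in>{..<n}. Z \<omega> $$ (i, j))" for \<omega>
  define Q where "Q \<omega> = (\<lambda>ij\<in>{..<n} \<times> {..<n}. T \<omega> $$ ij, \<lambda>j\<in>{..<N}. W \<omega> $$ (j, j))" for \<omega>
  have rv: "C \<in> measurable M ?P" "Q \<in> measurable M (?ET \<Otimes>\<^sub>M ?EW)"
    and lawCQ: "distr M ?P C \<Otimes>\<^sub>M distr M (?ET \<Otimes>\<^sub>M ?EW) Q = distr M (?P \<Otimes>\<^sub>M (?ET \<Otimes>\<^sub>M ?EW)) (\<lambda>\<omega>. (C \<omega>, Q \<omega>))"
  proof -
    \<comment> \<open>Independence is given for the family indexed by 0, 1, 2; \<open>f\<close>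
      reads the columns from component 0, and \<open>g\<close> the pair of \<open>T\<close> and
      \<open>W\<close> from components 1 and 2.\<close>
    define f where "f x = (\<lambda>j\<in>{..<N}. \<lambda>i\<in>{..<n}. x (0::nat) $$ (i, j))" for x :: "nat \<Rightarrow> complex mat"
    define g where "g x = (\<lambda>ij\<in>{..<n} \<times> {..<n}. x (1::nat) $$ ij, \<lambda>j\<in>{..<N}. x (2::nat) $$ (j, j))" for x :: "nat \<Rightarrow> complex mat"
    have comp: "(\<lambda>x. x k $$ (i, j)) \<in> borel_measurable (PiM A ?M')" if "k \<in> A" "?M' k = borel_mat r s" "i < r" "j < s" for k A i j r s
    proof (rule measurable_compose[OF _ borel_mat_entry[OF that(3,4)]])
      show "(\<lambda>x. x k) \<in> measurable (PiM A ?M') (borel_mat r s)"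
        using measurable_component_singleton[OF that(1), of ?M'] unfolding that(2) .
    qed
    have f: "f \<in> measurable (PiM {0} ?M') ?P"
      unfolding f_def
    proof (intro measurable_restrict)
      fix i j assume "j \<in> {..<N}" "i \<in> {..<n}"
      hence "(\<lambda>x. x 0 $$ (i, j)) \<in> borel_measurable (PiM {0} ?M')" by (intro comp) auto
      thus "(\<lambda>x. x 0 $$ (i, j)) \<in> measurable (PiM {0} ?M') \<mu>" using measurable_cong_sets[OF refl \<mu>(2)] by blast
    qed
    have g: "g \<in> measurable (PiM {1, 2} ?M') (?ET \<Otimes>\<^sub>M ?EW)"
      unfolding g_def
    proof (intro measurable_Pair measurable_restrict)
      fix ij assume "ij \<in> {..<n} \<times> {..<n}"
      then obtain i j where "ij = (i, j)" "i < n" "j < n" by auto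
      thus "(\<lambda>x. x 1 $$ ij) \<in> borel_measurable (PiM {1, 2} ?M')" by (simp only:) (rule comp, auto)
    next
      fix j assume "j \<in> {..<N}"
      thus "(\<lambda>x. x 2 $$ (j, j)) \<in> borel_measurable (PiM {1, 2} ?M')" by (intro comp) auto
    qed
    let ?X = "\<lambda>\<omega>. \<lambda>k\<in>{0}. ([Z, T, W] ! k) \<omega>" and ?Y = "\<lambda>\<omega>. \<lambda>k\<in>{1, 2}. ([Z, T, W] ! k) \<omega>"
    have iv: "indep_var (PiM {0} ?M') ?X (PiM {1, 2} ?M') ?Y" by (rule indep_var_restrict[OF ind]) auto
    have C: "C = (\<lambda>\<omega>. f (?X \<omega>))" by (simp add: fun_eq_iff f_def C_def)
    have Q: "Q = (\<lambda>\<omega>. g (?Y \<omega>))" by (simp add: fun_eq_iff g_def Q_def)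
    show "C \<in> measurable M ?P" "Q \<in> measurable M (?ET \<Otimes>\<^sub>M ?EW)"
      unfolding C Q using iv by (auto simp: indep_var_distribution_eq intro!: measurable_compose[OF _ f] measurable_compose[OF _ g])
    show "distr M ?P C \<Otimes>\<^sub>M distr M (?ET \<Otimes>\<^sub>M ?EW) Q = distr M (?P \<Otimes>\<^sub>M (?ET \<Otimes>\<^sub>M ?EW)) (\<lambda>\<omega>. (C \<omega>, Q \<omega>))"
      unfolding C Q by (rule indep_var_distr_pair[OF iv f g])
  qed
  have lawC: "distr M ?P C = ?P"
    unfolding C_def by (rule array_law[OF Z_indep law n N])
  \<comment> \<open>The trace built from the entries alone. On values attained by \<open>Q\<close>
    it equals \<open>norm_trace\<close> by \<open>norm_trace_kspectral\<close>; elsewhere it is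
    still measurable, though it need not be bounded.\<close>
  define h where "h q x = ktr n (smk n z (\<lambda>j. Re (snd q j) / real N) (\<lambda>j. kapp n (\<lambda>i k. fst q (i, k)) (x j)) x N) / of_nat n"
    for q :: "(nat \<times> nat \<Rightarrow> complex) \<times> (nat \<Rightarrow> complex)" and x
  have h_meas: "case_prod h \<in> borel_measurable ((?ET \<Otimes>\<^sub>M ?EW) \<Otimes>\<^sub>M ?P)"
  proof -
    have 1: "(\<lambda>p. snd p j i) \<in> borel_measurable ((?ET \<Otimes>\<^sub>M ?EW) \<Otimes>\<^sub>M ?P)" if "j < N" "i < n" for i j
      using measurable_compose[OF measurable_snd column_entry_measurable[OF \<mu>(2) that(2,1)]] .
    have 2: "(\<lambda>p. fst (fst p) (i, k)) \<in> borel_measurable ((?ET \<Otimes>\<^sub>M ?EW) \<Otimes>\<^sub>M ?P)" if "i < n" "k < n" for i k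
      by (rule measurable_compose[OF measurable_fst measurable_compose[OF measurable_fst measurable_component_singleton]]) (use that in auto)
    have 3: "(\<lambda>p. snd (fst p) j) \<in> borel_measurable ((?ET \<Otimes>\<^sub>M ?EW) \<Otimes>\<^sub>M ?P)" if "j < N" for j
      by (rule measurable_compose[OF measurable_fst measurable_compose[OF measurable_snd measurable_component_singleton]]) (use that in auto)
    show ?thesis
      unfolding h_def case_prod_beta ktr_def
      by (intro borel_measurable_divide borel_measurable_sum borel_measurable_const smk_measurable kapp_measurable
          measurable_compose[OF 3 borel_measurable_Re] 1 2) auto
  qed
  define E where "E = {p \<in> space (?P \<Otimes>\<^sub>M (?ET \<Otimes>\<^sub>M ?EW)). e \<le> cmod (h (snd p) (fst p) - (\<integral>x. h (snd p) x \<partial>?P))}"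
  interpret P: prob_space ?P by (rule prob_space_columns[OF \<mu>(1)])
  have E: "E \<in> sets (?P \<Otimes>\<^sub>M (?ET \<Otimes>\<^sub>M ?EW))"
  proof -
    have [measurable]: "(\<lambda>p. h (snd p) (fst p)) \<in> borel_measurable (?P \<Otimes>\<^sub>M (?ET \<Otimes>\<^sub>M ?EW))"
      using measurable_compose[OF measurable_Pair[OF measurable_snd measurable_fst] h_meas] by simp
    have [measurable]: "(\<lambda>p. \<integral>x. h (snd p) x \<partial>?P) \<in> borel_measurable (?P \<Otimes>\<^sub>M (?ET \<Otimes>\<^sub>M ?EW))"
      by (rule measurable_compose[OF measurable_snd P.borel_measurable_lebesgue_integral[OF h_meas]])
    show ?thesis unfolding E_def by measurable
  qed
  have hQ: "h (Q \<omega>) x = norm_trace z n N (U \<omega>) (t \<omega>) (w \<omega>) x" if \<omega>: "\<omega> \<in> space M" for \<omega> x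
  proof -
    have keq: "keq n (\<lambda>i k. fst (Q \<omega>) (i, k)) (kspectral n (U \<omega>) (t \<omega>))"
      unfolding keq_def using keqD[OF T(1)[OF \<omega>]] by (simp add: Q_def kmat_def)
    have "smk n z (\<lambda>j. Re (snd (Q \<omega>) j) / real N) (\<lambda>j. kapp n (\<lambda>i k. fst (Q \<omega>) (i, k)) (x j)) x N
        = smk n z (\<lambda>j. w \<omega> j / real N) (\<lambda>j. kapp n (\<lambda>i k. fst (Q \<omega>) (i, k)) (x j)) x N"
      by (rule smk_cong) (use W[OF \<omega>] in \<open>simp_all add: Q_def\<close>)
    thus ?thesis using norm_trace_kspectral[OF keq T(2)[OF \<omega>]] by (simp add: h_def)
  qed
  have hint: "(\<integral>x. h (Q \<omega>) x \<partial>?P) = mean_trace \<mu> z n N (U \<omega>) (t \<omega>) (w \<omega>)" if "\<omega> \<in> space M" for \<omega>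
    unfolding hQ[OF that] mean_trace_def ..
  have SE: "S = {\<omega> \<in> space M. (C \<omega>, Q \<omega>) \<in> E}"
  proof -
    have "norm_trace z n N (U \<omega>) (t \<omega>) (w \<omega>) (C \<omega>) = norm_trace z n N (U \<omega>) (t \<omega>) (w \<omega>) (\<lambda>j i. Z \<omega> $$ (i, j))" for \<omega>
      by (rule norm_trace_cong) (simp add: C_def)
    thus ?thesis
      using measurable_space[OF rv(1)] measurable_space[OF rv(2)] unfolding S_def E_def
      by (auto simp: hQ hint space_pair_measure[of ?P])
  qed
  have "{\<omega> \<in> space M. (C \<omega>, Q \<omega>) \<in> E} = (\<lambda>\<omega>. (C \<omega>, Q \<omega>)) -` E \<inter> space M" by auto
  thus "S \<in> sets M" unfolding SE using measurable_sets[OF measurable_Pair[OF rv] E] by simp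
  show "emeasure M S \<le> ennreal (4 * exp (- (e\<^sup>2 * (Im z)\<^sup>2 * (real n)\<^sup>2 / (32 * real N))))"
    unfolding SE
  proof (rule independent_tail[OF rv lawCQ E])
    fix \<omega> assume \<omega>: "\<omega> \<in> space M"
    have Qs: "Q \<omega> \<in> space (?ET \<Otimes>\<^sub>M ?EW)" by (rule measurable_space[OF rv(2) \<omega>])
    have "{x \<in> space ?P. (x, Q \<omega>) \<in> E} = {x \<in> space ?P. e \<le> cmod (norm_trace z n N (U \<omega>) (t \<omega>) (w \<omega>) x
        - mean_trace \<mu> z n N (U \<omega>) (t \<omega>) (w \<omega>))}"
      using Qs unfolding E_def by (auto simp: hQ[OF \<omega>] hint[OF \<omega>] space_pair_measure[of ?P])
    thus "emeasure (distr M ?P C) {x \<in> space ?P. (x, Q \<omega>) \<in> E} \<le> ennreal (4 * exp (- (e\<^sup>2 * (Im z)\<^sup>2 * (real n)\<^sup>2 / (32 * real N))))"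
      unfolding lawC using norm_trace_tail[OF \<mu> n N z e] by simp
  qed
qed

text \<open>Borel-Cantelli at the countably many levels \<open>1 / real (Suc p)\<close>.\<close>

lemma (in prob_space) AE_tendsto_zero:
  fixes X :: "nat \<Rightarrow> 'a \<Rightarrow> complex"
  assumes S: "\<And>e k. 0 < e \<Longrightarrow> {\<omega> \<in> space M. e \<le> cmod (X k \<omega>)} \<in> sets M"
    and b: "\<And>e k. 0 < e \<Longrightarrow> emeasure M {\<omega> \<in> space M. e \<le> cmod (X k \<omega>)} \<le> ennreal (b e k)"
    and b0: "\<And>e k. 0 \<le> b e k" and sum: "\<And>e. 0 < e \<Longrightarrow> summable (b e)"
  shows "AE \<omega> in M. (\<lambda>k. X k \<omega>) \<longlonglongrightarrow> 0"
proof -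
  have "AE \<omega> in M. \<forall>p::nat. eventually (\<lambda>k. cmod (X k \<omega>) < 1 / real (Suc p)) sequentially"
    unfolding AE_all_countable
  proof
    fix p :: nat
    let ?e = "1 / real (Suc p)" and ?S = "\<lambda>k. {\<omega> \<in> space M. 1 / real (Suc p) \<le> cmod (X k \<omega>)}"
    have e: "0 < ?e" by simp
    have "summable (\<lambda>k. measure M (?S k))"
    proof (rule summable_comparison_test'[OF sum[OF e]])
      fix k
      have "ennreal (measure M (?S k)) \<le> ennreal (b ?e k)" using b[OF e, of k] by (simp add: emeasure_eq_measure)
      thus "norm (measure M (?S k)) \<le> b ?e k" using b0[of ?e k] by (simp add: ennreal_le_iff)
    qed
    hence "AE \<omega> in M. eventually (\<lambda>k. \<omega> \<in> space M - ?S k) sequentially"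
      by (intro borel_cantelli_AE1 S e) (auto simp: emeasure_eq_measure)
    thus "AE \<omega> in M. eventually (\<lambda>k. cmod (X k \<omega>) < ?e) sequentially"
      by (rule AE_mp) (auto intro!: AE_I2 elim!: eventually_mono)
  qed
  thus ?thesis
  proof eventually_elim
    fix \<omega> assume *: "\<forall>p::nat. eventually (\<lambda>k. cmod (X k \<omega>) < 1 / real (Suc p)) sequentially"
    show "(\<lambda>k. X k \<omega>) \<longlonglongrightarrow> 0"
    proof (rule tendstoI)
      fix e :: real assume "0 < e"
      then obtain p where "1 / real (Suc p) < e" using nat_approx_posE by blast
      with *[rule_format, of p] show "eventually (\<lambda>k. dist (X k \<omega>) 0 < e) sequentially"
        by (auto elim!: eventually_mono)
    qed
  qed
qed

text \<open>As \<open>n / N\<close> eventually exceeds \<open>c / 2\<close>, the exponent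
  \<open>n\<^sup>2 / N\<close> grows at least linearly in \<open>n\<close>, and a geometric series
  dominates.\<close>

lemma summable_tail:
  fixes N :: "nat \<Rightarrow> nat"
  assumes ratio: "(\<lambda>n. real n / real (N n)) \<longlonglongrightarrow> c" and c: "0 < c" and a: "0 < a"
  shows "summable (\<lambda>k. 4 * exp (- (a * (real (Suc k))\<^sup>2 / (32 * real (N (Suc k))))))"
proof -
  define q where "q = exp (- (a * (c / 2) / 32))"
  have q: "0 < q" "q < 1" using a c by (auto simp: q_def)
  have "eventually (\<lambda>n. c / 2 < real n / real (N n)) sequentially" by (rule order_tendstoD(1)[OF ratio]) (use c in simp)
  hence e: "eventually (\<lambda>k. c / 2 < real (Suc k) / real (N (Suc k))) sequentially" by (subst eventually_sequentially_Suc)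
  have eq1: "a / 32 * (x * (c / 2)) = x * (a * (c / 2) / 32)" and eq2: "a / 32 * (x * (x / y)) = a * x\<^sup>2 / (32 * y)" for x y :: real
    by (simp_all add: power2_eq_square)
  from e have ev: "eventually (\<lambda>k. norm (4 * exp (- (a * (real (Suc k))\<^sup>2 / (32 * real (N (Suc k)))))) \<le> 4 * q ^ Suc k) sequentially"
  proof eventually_elim
    case (elim k)
    have "real (Suc k) * (c / 2) \<le> real (Suc k) * (real (Suc k) / real (N (Suc k)))" using elim by (intro mult_left_mono) auto
    hence "a / 32 * (real (Suc k) * (c / 2)) \<le> a / 32 * (real (Suc k) * (real (Suc k) / real (N (Suc k))))" by (rule mult_left_mono) (use a in simp)
    hence "real (Suc k) * (a * (c / 2) / 32) \<le> a * (real (Suc k))\<^sup>2 / (32 * real (N (Suc k)))" by (simp only: eq1 eq2)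
    hence "exp (- (a * (real (Suc k))\<^sup>2 / (32 * real (N (Suc k))))) \<le> exp (real (Suc k) * - (a * (c / 2) / 32))" by (simp only: exp_le_cancel_iff mult_minus_right neg_le_iff_le)
    also have "\<dots> = q ^ Suc k" unfolding q_def by (rule exp_of_nat_mult)
    finally show ?case by simp
  qed
  have "summable (\<lambda>k. 4 * q ^ Suc k)" using q by (intro summable_mult summable_Suc_iff[THEN iffD2] summable_geometric) auto
  thus ?thesis by (rule summable_comparison_test_ev[OF ev])
qed

section \<open>Distribution functions and the behaviour on the imaginary axis\<close>

lemma interval_measure_nonneg:
  assumes "prob_distribution_function_nonneg F"
  shows "real_distribution (interval_measure F)" "cdf (interval_measure F) = F" "AE x in interval_measure F. 0 \<le> x"
proof -
  have F: "\<And>x y. x \<le> y \<Longrightarrow> F x \<le> F y" "\<And>a. continuous (at_right a) F" "(F \<longlongrightarrow> 0) at_bot" "(F \<longlongrightarrow> 1) at_top" "\<And>x. x < 0 \<Longrightarrow> F x = 0"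
    using assms unfolding prob_distribution_function_nonneg_def prob_distribution_function_def by (auto dest: monoD)
  show rd: "real_distribution (interval_measure F)" by (rule real_distribution_interval_measure[OF F(1-4)])
  show cdf: "cdf (interval_measure F) = F" by (rule cdf_interval_measure[OF F(1-3)])
  interpret real_distribution "interval_measure F" by (rule rd)
  have "(F \<longlongrightarrow> measure (interval_measure F) {..<0}) (at_left 0)" using cdf_at_left[of 0] unfolding cdf .
  moreover have "(F \<longlongrightarrow> 0) (at_left 0)"
    by (rule tendsto_eventually) (use F(5) in \<open>auto simp: eventually_at_filter\<close>)
  ultimately have "measure (interval_measure F) {..<0} = 0" by (rule tendsto_unique[rotated]) simp
  hence "{..<0} \<in> null_sets (interval_measure F)" by (simp add: null_sets_def emeasure_eq_measure)
  hence "AE x in interval_measure F. x \<notin> {..<0}" by (rule AE_not_in)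
  thus "AE x in interval_measure F. 0 \<le> x" by eventually_elim (simp add: not_less)
qed

text \<open>At \<open>z = \<i> k\<close> the integrand \<open>- z / (\<tau> s - z)\<close> differs
  from 1 by \<open>\<tau> s / (\<tau> s - z)\<close> up to sign. This is at most
  \<open>\<tau> C / k\<close> because \<open>s\<close> is bounded and \<open>Im s \<le> 0\<close>,
  so the limit is the total mass of \<open>H\<close>.\<close>

lemma imaginary_axis_limit:
  fixes s :: "nat \<Rightarrow> complex"
  assumes H: "real_distribution H" and H0: "AE \<tau> in H. 0 \<le> \<tau>"
    and s: "\<And>k. 0 < k \<Longrightarrow> Im (s k) \<le> 0" "\<And>k. 0 < k \<Longrightarrow> cmod (s k) \<le> C"
  shows "(\<lambda>k::nat. - \<i> * of_nat k * (\<integral>\<tau>. 1 / (complex_of_real \<tau> * s k - \<i> * of_nat k) \<partial>H)) \<longlonglongrightarrow> 1"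
proof -
  interpret real_distribution H by (rule H)
  let ?z = "\<lambda>k. \<i> * of_nat (Suc k)" and ?s = "\<lambda>k. s (Suc k)"
  let ?f = "\<lambda>k \<tau>. - ?z k * (1 / (complex_of_real \<tau> * ?s k - ?z k))"
  have z: "0 < Im (?z k)" for k by simp
  have den: "cmod (1 / (complex_of_real \<tau> * ?s k - ?z k)) \<le> 1 / real (Suc k)" "complex_of_real \<tau> * ?s k - ?z k \<noteq> 0" if "0 \<le> \<tau>" for \<tau> k
    using shifted_denominator[OF z s(1)[of "Suc k"] that, of k] by simp_all
  have "(\<lambda>k. \<integral>\<tau>. ?f k \<tau> \<partial>H) \<longlonglongrightarrow> (\<integral>\<tau>. 1 \<partial>H)"
  proof (rule integral_dominated_convergence[where w = "\<lambda>_. 1"])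
    show "AE \<tau> in H. (\<lambda>k. ?f k \<tau>) \<longlonglongrightarrow> 1" using H0
    proof eventually_elim
      fix \<tau> :: real assume \<tau>: "0 \<le> \<tau>"
      have "(\<lambda>k. ?f k \<tau> - 1) \<longlonglongrightarrow> 0"
      proof (rule Lim_null_comparison)
        show "(\<lambda>k. \<tau> * C * (1 / real (Suc k))) \<longlonglongrightarrow> 0"
          using tendsto_mult_right_zero[OF LIMSEQ_inverse_real_of_nat, of "\<tau> * C"] by (simp add: inverse_eq_divide)
        show "eventually (\<lambda>k. cmod (?f k \<tau> - 1) \<le> \<tau> * C * (1 / real (Suc k))) sequentially"
        proof (intro always_eventually allI)
          fix k
          have "?f k \<tau> - 1 = - (of_real \<tau> * ?s k) * (1 / (complex_of_real \<tau> * ?s k - ?z k))"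
            using den(2)[OF \<tau>, of k] by (simp add: field_simps)
          also have "cmod \<dots> = (\<tau> * cmod (?s k)) * cmod (1 / (complex_of_real \<tau> * ?s k - ?z k))"
            using \<tau> by (simp only: norm_mult norm_minus_cancel norm_of_real abs_of_nonneg)
          also have "\<dots> \<le> (\<tau> * C) * (1 / real (Suc k))"
            by (rule mult_mono[OF mult_left_mono[OF s(2) \<tau>] den(1)[OF \<tau>]]) (use \<tau> order_trans[OF norm_ge_zero s(2)[of 1]] in auto)
          finally show "cmod (?f k \<tau> - 1) \<le> \<tau> * C * (1 / real (Suc k))" .
        qed
      qed
      thus "(\<lambda>k. ?f k \<tau>) \<longlonglongrightarrow> 1" by (simp only: LIM_zero_iff)
    qed
    show "AE \<tau> in H. cmod (?f k \<tau>) \<le> 1" for k using H0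
    proof eventually_elim
      fix \<tau> :: real assume \<tau>: "0 \<le> \<tau>"
      have "cmod (?f k \<tau>) = real (Suc k) * cmod (1 / (complex_of_real \<tau> * ?s k - ?z k))"
        unfolding norm_mult norm_minus_cancel by (simp del: of_nat_Suc)
      also have "\<dots> \<le> real (Suc k) * (1 / real (Suc k))" by (rule mult_left_mono[OF den(1)[OF \<tau>]]) simp
      finally show "cmod (?f k \<tau>) \<le> 1" by simp
    qed
  qed simp_all
  moreover have "(\<integral>\<tau>. ?f k \<tau> \<partial>H) = - ?z k * (\<integral>\<tau>. 1 / (complex_of_real \<tau> * ?s k - ?z k) \<partial>H)" for k
    by (rule integral_mult_right_zero)
  moreover have "(\<integral>\<tau>. 1 \<partial>H) = (1::complex)" using prob_space by simp
  ultimately have "(\<lambda>k. - ?z k * (\<integral>\<tau>. 1 / (complex_of_real \<tau> * ?s k - ?z k) \<partial>H)) \<longlonglongrightarrow> 1"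
    by (simp only:)
  hence "(\<lambda>k. - \<i> * of_nat (Suc k) * (\<integral>\<tau>. 1 / (complex_of_real \<tau> * s (Suc k) - \<i> * of_nat (Suc k)) \<partial>H)) \<longlonglongrightarrow> 1"
    by (simp only: mult_minus_left)
  thus ?thesis by (rule filterlim_sequentially_Suc[THEN iffD1])
qed

text \<open>The assumptions on the matrices start at size 1; sequences are therefore indexed by
  \<open>Suc k\<close>.\<close>

lemma weak_conv_shift:
  assumes "\<And>k. F (Suc k) = G k"
  shows "weak_conv G H \<longleftrightarrow> weak_conv F H"
  unfolding weak_conv_def assms[symmetric] by (subst filterlim_sequentially_Suc) (rule refl)

lemma (in prob_space) AE_obtain_witness:
  assumes "AE \<omega> in M. P \<omega>"
  obtains \<omega> where "\<omega> \<in> space M" "P \<omega>"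
proof -
  have "\<exists>\<omega>\<in>space M. P \<omega>"
  proof (rule ccontr)
    assume "\<not> (\<exists>\<omega>\<in>space M. P \<omega>)"
    with assms have "AE \<omega> in M. False" by (auto elim: AE_mp intro!: AE_I2)
    thus False by simp
  qed
  thus thesis using that by blast
qed

section \<open>From single realisations to the nonrandom limit\<close>

theorem theorem2:
  fixes M :: "'a measure"
    and N :: "nat \<Rightarrow> nat"
    and Z T W B :: "nat \<Rightarrow> 'a \<Rightarrow> complex mat"
    and c :: real
    and H D :: "real \<Rightarrow> real"
  assumes "prob_space M"
    and N_pos: "\<And>n. n \<ge> 1 \<Longrightarrow> N n > 0"
    and Z_meas: "\<And>n. n \<ge> 1 \<Longrightarrow> Z n \<in> measurable M (borel_mat n (N n))"
    and T_meas: "\<And>n. n \<ge> 1 \<Longrightarrow> T n \<in> measurable M (borel_mat n n)"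
    and W_meas: "\<And>n. n \<ge> 1 \<Longrightarrow> W n \<in> measurable M (borel_mat (N n) (N n))"
    and T_nonneg: "\<And>n \<omega>. n \<ge> 1 \<Longrightarrow> \<omega> \<in> space M \<Longrightarrow> nonneg_definite (T n \<omega>)"
    and W_diag: "\<And>n \<omega>. n \<ge> 1 \<Longrightarrow> \<omega> \<in> space M \<Longrightarrow> diagonal_mat (W n \<omega>)"
    and W_nonneg: "\<And>n \<omega> j. n \<ge> 1 \<Longrightarrow> \<omega> \<in> space M \<Longrightarrow> j < N n \<Longrightarrow>
          W n \<omega> $$ (j, j) \<in> \<real> \<and> 0 \<le> Re (W n \<omega> $$ (j, j))"
    and B_def: "\<And>n \<omega>. B n \<omega> = (1 / complex_of_real (real (N n))) \<cdot>\<^sub>m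
          (psd_sqrt (T n \<omega>) * Z n \<omega> * W n \<omega> * mat_adjoint (Z n \<omega>) * psd_sqrt (T n \<omega>))"
    and Z_indep: "\<And>n. n \<ge> 1 \<Longrightarrow>
          prob_space.indep_vars M (\<lambda>_. borel) (\<lambda>ij \<omega>. Z n \<omega> $$ ij) ({..<n} \<times> {..<N n})"
    and Z_ident: "\<And>n i j n' i' j'. n \<ge> 1 \<Longrightarrow> i < n \<Longrightarrow> j < N n \<Longrightarrow>
          n' \<ge> 1 \<Longrightarrow> i' < n' \<Longrightarrow> j' < N n' \<Longrightarrow>
          distr M borel (\<lambda>\<omega>. Z n \<omega> $$ (i, j)) = distr M borel (\<lambda>\<omega>. Z n' \<omega> $$ (i', j'))"
    and Z_mean: "\<And>n i j. n \<ge> 1 \<Longrightarrow> i < n \<Longrightarrow> j < N n \<Longrightarrow>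
          integrable M (\<lambda>\<omega>. Z n \<omega> $$ (i, j)) \<and>
          (LINT \<omega>|M. Z n \<omega> $$ (i, j)) = 0"
    and Z_var: "\<And>n i j. n \<ge> 1 \<Longrightarrow> i < n \<Longrightarrow> j < N n \<Longrightarrow>
          integrable M (\<lambda>\<omega>. (cmod (Z n \<omega> $$ (i, j)))\<^sup>2) \<and>
          (LINT \<omega>|M. (cmod (Z n \<omega> $$ (i, j)))\<^sup>2) = 1"
    and ratio: "(\<lambda>n. real n / real (N n)) \<longlonglongrightarrow> c" and c_pos: "0 < c"
    and H: "prob_distribution_function_nonneg H"
    and T_conv: "AE \<omega> in M. weak_conv (\<lambda>n. esd (T n \<omega>)) H"
    and D: "prob_distribution_function_nonneg D"
    and D_mean: "integrable (interval_measure D) (\<lambda>x. x)"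
    and W_conv: "AE \<omega> in M. weak_conv (\<lambda>n. esd (W n \<omega>)) D"
    and W_mean_conv: "AE \<omega> in M. (\<lambda>n. LINT x|interval_measure (esd (W n \<omega>)). x)
          \<longlonglongrightarrow> (LINT x|interval_measure D. x)"
    and ZTW_indep: "\<And>n. n \<ge> 1 \<Longrightarrow> prob_space.indep_vars M
          (\<lambda>k. [borel_mat n (N n), borel_mat n n, borel_mat (N n) (N n)] ! k)
          (\<lambda>k. [Z n, T n, W n] ! k) {0, 1, 2}"
  shows "\<exists>F. prob_distribution_function F \<and>
          (AE \<omega> in M. weak_conv (\<lambda>n. esd (B n \<omega>)) F) \<and>
          (\<exists>mt. \<forall>z \<in> upper_half_plane.
             mt z \<in> - upper_half_plane \<and>
             solves_fixed_point c H D z (mt z) \<and>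
             (\<forall>w \<in> - upper_half_plane. solves_fixed_point c H D z w \<longrightarrow> w = mt z) \<and>
             integrable (interval_measure H)
               (\<lambda>\<tau>. 1 / (complex_of_real \<tau> * mt z - z)) \<and>
             cauchy_stieltjes F z =
               (LINT \<tau>|interval_measure H. 1 / (complex_of_real \<tau> * mt z - z)))"
proof -
  interpret prob_space M by fact
  let ?H = "interval_measure H" and ?D = "interval_measure D"
  note Hm = interval_measure_nonneg[OF H] and Dm = interval_measure_nonneg[OF D]
  define \<mu> where "\<mu> = distr M borel (\<lambda>\<omega>. Z 1 \<omega> $$ (0, 0))"
  have N1: "0 < N 1" by (rule N_pos) simp
  have law: "distr M borel (\<lambda>\<omega>. Z n \<omega> $$ (i, j)) = \<mu>" if "1 \<le> n" "i < n" "j < N n" for n i j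
    unfolding \<mu>_def by (rule Z_ident) (use that N1 in auto)
  have Z1: "(\<lambda>\<omega>. Z 1 \<omega> $$ (0, 0)) \<in> borel_measurable M"
    using Z_indep[of 1] N1 by (auto simp: indep_vars_def)
  have \<mu>: "prob_space \<mu>" "sets \<mu> = sets borel" unfolding \<mu>_def by (rule prob_space_distr[OF Z1]) simp
  have mean: "(\<integral>y. y \<partial>\<mu>) = 0"
    unfolding \<mu>_def by (subst integral_distr[OF Z1]) (use Z_mean[of 1 0 0] N1 in auto)
  have var: "integrable \<mu> (\<lambda>y. (cmod y)\<^sup>2)" "(\<integral>y. (cmod y)\<^sup>2 \<partial>\<mu>) = 1"
    unfolding \<mu>_def using Z_var[of 1 0 0] N1 by (simp_all del: One_nat_def add: integrable_distr_eq[OF Z1] integral_distr[OF Z1])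
  have carrier: "Z n \<omega> \<in> carrier_mat n (N n)" "T n \<omega> \<in> carrier_mat n n" "W n \<omega> \<in> carrier_mat (N n) (N n)"
    if "1 \<le> n" "\<omega> \<in> space M" for n \<omega>
    using measurable_space[OF Z_meas that(2)] measurable_space[OF T_meas that(2)] measurable_space[OF W_meas that(2)] that(1)
    by (auto simp: borel_mat_def)
  have "\<exists>U t. kunitary n U \<and> keq n (kmat (T n \<omega>)) (kspectral n U t)" if "1 \<le> n" "\<omega> \<in> space M" for n \<omega>
    using kspectral_exists kpsd_kmat[OF T_nonneg[OF that] carrier(2)[OF that]] unfolding kpsd_def by blast
  \<comment> \<open>A choice for each realisation, with no measurability in \<omega>.\<close>
  then obtain U t where U: "\<And>n \<omega>. 1 \<le> n \<Longrightarrow> \<omega> \<in> space M \<Longrightarrow> kunitary n (U n \<omega>)"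
    and Tt: "\<And>n \<omega>. 1 \<le> n \<Longrightarrow> \<omega> \<in> space M \<Longrightarrow> keq n (kmat (T n \<omega>)) (kspectral n (U n \<omega>) (t n \<omega>))" by metis
  have t0: "0 \<le> t n \<omega> i" if "1 \<le> n" "\<omega> \<in> space M" "i < n" for n \<omega> i
    by (rule kpsd_eigenvalue[OF kpsd_kmat[OF T_nonneg carrier(2)] U Tt]) (use that in auto)
  define w where "w n \<omega> j = Re (W n \<omega> $$ (j, j))" for n \<omega> j
  have w: "W n \<omega> $$ (j, j) = complex_of_real (w n \<omega> j)" "0 \<le> w n \<omega> j" if "1 \<le> n" "\<omega> \<in> space M" "j < N n" for n \<omega> j
    using W_nonneg[OF that] by (auto simp: w_def of_real_Re)
  define S where "S z n \<omega> = norm_trace z n (N n) (U n \<omega>) (t n \<omega>) (w n \<omega>) (\<lambda>j i. Z n \<omega> $$ (i, j))" for z n \<omega>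
  define E where "E z n \<omega> = mean_trace \<mu> z n (N n) (U n \<omega>) (t n \<omega>) (w n \<omega>)" for z n \<omega>
  have "\<exists>\<beta>. esd (B n \<omega>) = cdf (emp n \<beta>) \<and> (\<forall>z. 0 < Im z \<longrightarrow> stieltjes (emp n \<beta>) z = S z n \<omega>)"
    if "1 \<le> n" "\<omega> \<in> space M" for n \<omega>
    unfolding B_def S_def
    by (rule separable_stieltjes) (use that carrier T_nonneg U Tt W_diag w in auto)
  then obtain \<beta> where \<beta>: "\<And>n \<omega>. 1 \<le> n \<Longrightarrow> \<omega> \<in> space M \<Longrightarrow> esd (B n \<omega>) = cdf (emp n (\<beta> n \<omega>))"
    and \<beta>S: "\<And>n \<omega> z. 1 \<le> n \<Longrightarrow> \<omega> \<in> space M \<Longrightarrow> 0 < Im z \<Longrightarrow> stieltjes (emp n (\<beta> n \<omega>)) z = S z n \<omega>" by metis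

  have concentration: "AE \<omega> in M. (\<lambda>k. S z (Suc k) \<omega> - E z (Suc k) \<omega>) \<longlonglongrightarrow> 0" if z: "0 < Im z" for z
  proof (rule AE_tendsto_zero[where b = "\<lambda>e k. 4 * exp (- (e\<^sup>2 * (Im z)\<^sup>2 * (real (Suc k))\<^sup>2 / (32 * real (N (Suc k)))))"])
    fix e :: real and k :: nat assume e: "0 < e"
    have k: "1 \<le> Suc k" by simp
    note mt = model_tail[OF zero_less_Suc N_pos[OF k] z e Z_indep[OF k] law[OF k] ZTW_indep[OF k] Tt[OF k] t0[OF k] w(1)[OF k]]
    show "{\<omega> \<in> space M. e \<le> cmod (S z (Suc k) \<omega> - E z (Suc k) \<omega>)} \<in> sets M"
      "emeasure M {\<omega> \<in> space M. e \<le> cmod (S z (Suc k) \<omega> - E z (Suc k) \<omega>)}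
        \<le> ennreal (4 * exp (- (e\<^sup>2 * (Im z)\<^sup>2 * (real (Suc k))\<^sup>2 / (32 * real (N (Suc k))))))"
      unfolding S_def E_def by (rule mt; assumption)+
  next
    fix e :: real assume "0 < e"
    thus "summable (\<lambda>k. 4 * exp (- (e\<^sup>2 * (Im z)\<^sup>2 * (real (Suc k))\<^sup>2 / (32 * real (N (Suc k))))))"
      using z by (intro summable_tail[OF ratio c_pos]) simp
  qed simp

  have fp: "fixed_point c ?H ?D z" if "0 < Im z" for z
    by (rule fixed_point.intro) (use c_pos Hm Dm D_mean that in auto)
  have model: "model_sequence c ?H ?D z \<mu> Suc (\<lambda>k. N (Suc k)) (\<lambda>k. U (Suc k) \<omega>) (\<lambda>k. t (Suc k) \<omega>) (\<lambda>k. w (Suc k) \<omega>)"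
    if z: "0 < Im z" and \<omega>: "\<omega> \<in> space M" and conv: "weak_conv (\<lambda>n. esd (T n \<omega>)) H" "weak_conv (\<lambda>n. esd (W n \<omega>)) D" for z \<omega>
  proof (intro model_sequence.intro model_sequence_axioms.intro fp[OF z] \<mu> mean var)
    have k: "1 \<le> Suc k" for k by simp
    show "(\<lambda>k. real (Suc k) / real (N (Suc k))) \<longlonglongrightarrow> c" using ratio by (rule LIMSEQ_Suc)
    have "esd (T (Suc k) \<omega>) = cdf (emp (Suc k) (t (Suc k) \<omega>))" for k
      by (rule esd_kspectral[OF carrier(2)[OF k \<omega>] U[OF k \<omega>] Tt[OF k \<omega>]]) simp
    thus "weak_conv_m (\<lambda>k. emp (Suc k) (t (Suc k) \<omega>)) ?H"
      using conv(1) unfolding weak_conv_m_def Hm(2) by (subst weak_conv_shift)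
    have "esd (W (Suc k) \<omega>) = cdf (emp (N (Suc k)) (w (Suc k) \<omega>))" for k
      by (rule esd_upper_triangular[OF carrier(3)[OF k \<omega>] _ w(1)[OF k \<omega>] N_pos[OF k]])
         (use W_diag[OF k \<omega>] carrier_matD[OF carrier(3)[OF k \<omega>]] in \<open>auto simp: diagonal_mat_def upper_triangular_def\<close>)
    thus "weak_conv_m (\<lambda>k. emp (N (Suc k)) (w (Suc k) \<omega>)) ?D"
      using conv(2) unfolding weak_conv_m_def Dm(2) by (subst weak_conv_shift)
  qed (use N_pos U t0 w \<omega> in \<open>auto intro: filterlim_Suc\<close>)
  \<comment> \<open>Depends on \<open>c\<close>, \<open>H\<close>, \<open>D\<close> and
    \<open>z\<close> only, hence nonrandom. That a solution exists is supplied by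
    \<open>means_converge\<close>.\<close>
  define sol where "sol z = (SOME s. Im s \<le> 0 \<and> solves_fp c ?H ?D z s)" for z
  define m where "m z = (\<integral>\<tau>. 1 / (complex_of_real \<tau> * sol z - z) \<partial>?H)" for z
  have limit: "(Im (sol z) \<le> 0 \<and> solves_fp c ?H ?D z (sol z) \<and> cmod (sol z) \<le> cmod z / Im z * (\<integral>x. x \<partial>?D)) \<and>
      (\<lambda>k. E z (Suc k) \<omega>) \<longlonglongrightarrow> m z"
    if z: "0 < Im z" and \<omega>: "\<omega> \<in> space M" and conv: "weak_conv (\<lambda>n. esd (T n \<omega>)) H" "weak_conv (\<lambda>n. esd (W n \<omega>)) D" for z \<omega>
  proof -
    interpret S: model_sequence c ?H ?D z \<mu> Suc "\<lambda>k. N (Suc k)" "\<lambda>k. U (Suc k) \<omega>" "\<lambda>k. t (Suc k) \<omega>" "\<lambda>k. w (Suc k) \<omega>"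
      by (rule model[OF that])
    obtain s where s: "Im s \<le> 0" "solves_fp c ?H ?D z s" "cmod s \<le> cmod z / Im z * (\<integral>x. x \<partial>?D)"
      and lim: "S.means \<longlonglongrightarrow> (\<integral>\<tau>. 1 / (of_real \<tau> * s - z) \<partial>?H)" by (rule S.means_converge)
    have "Im (sol z) \<le> 0 \<and> solves_fp c ?H ?D z (sol z)"
      unfolding sol_def by (rule someI[of _ s]) (use s in blast)
    hence "sol z = s" using S.fixed_point_unique[OF _ _ s(2,1)] by blast
    moreover have "S.means = (\<lambda>k. E z (Suc k) \<omega>)" by (simp add: fun_eq_iff S.means_def E_def)
    ultimately show ?thesis using s lim by (simp add: m_def)
  qed
  have conv: "AE \<omega> in M. \<omega> \<in> space M \<and> weak_conv (\<lambda>n. esd (T n \<omega>)) H \<and> weak_conv (\<lambda>n. esd (W n \<omega>)) D"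
    using T_conv W_conv by auto
  \<comment> \<open>One realisation along which the spectra of \<open>T\<close> and \<open>W\<close>
    converge suffices for the deterministic facts about \<open>sol\<close>, at every
    \<open>z\<close>.\<close>
  then obtain \<omega>1 where "\<omega>1 \<in> space M" "weak_conv (\<lambda>n. esd (T n \<omega>1)) H" "weak_conv (\<lambda>n. esd (W n \<omega>1)) D"
    using AE_obtain_witness by blast
  note sol = conjunct1[OF limit[OF _ this]]
  have pointwise: "AE \<omega> in M. (\<lambda>k. stieltjes (emp (Suc k) (\<beta> (Suc k) \<omega>)) z) \<longlonglongrightarrow> m z" if z: "0 < Im z" for z
    using conv concentration[OF z]
  proof eventually_elim
    fix \<omega> assume \<omega>: "\<omega> \<in> space M \<and> weak_conv (\<lambda>n. esd (T n \<omega>)) H \<and> weak_conv (\<lambda>n. esd (W n \<omega>)) D"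
      and S: "(\<lambda>k. S z (Suc k) \<omega> - E z (Suc k) \<omega>) \<longlonglongrightarrow> 0"
    have "(\<lambda>k. E z (Suc k) \<omega>) \<longlonglongrightarrow> m z" using limit[OF z] \<omega> by blast
    from tendsto_add[OF S this] show "(\<lambda>k. stieltjes (emp (Suc k) (\<beta> (Suc k) \<omega>)) z) \<longlonglongrightarrow> m z"
      using \<beta>S[OF _ _ z] \<omega> by simp
  qed
  have rational: "AE \<omega> in M. \<forall>z\<in>rational_upper_half. (\<lambda>k. stieltjes (emp (Suc k) (\<beta> (Suc k) \<omega>)) z) \<longlonglongrightarrow> m z"
    unfolding AE_ball_countable[OF countable_rational_upper_half] using pointwise by (auto simp: rational_upper_half_def)
  \<comment> \<open>On the imaginary axis \<open>cmod z / Im z = 1\<close>, so \<open>sol\<close> is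
    bounded there by the mean of \<open>D\<close>.\<close>
  have mlim: "(\<lambda>k::nat. - \<i> * of_nat k * m (\<i> * of_nat k)) \<longlonglongrightarrow> 1"
    unfolding m_def
  proof (rule imaginary_axis_limit[OF Hm(1,3)])
    fix k :: nat assume "0 < k"
    hence "0 < Im (\<i> * of_nat k)" by simp
    from sol[OF this] \<open>0 < k\<close> show "Im (sol (\<i> * of_nat k)) \<le> 0" "cmod (sol (\<i> * of_nat k)) \<le> (\<integral>x. x \<partial>?D)"
      by (simp_all add: norm_mult)
  qed
  have tight: "tight (\<lambda>k. emp (Suc k) (\<beta> (Suc k) \<omega>))"
    if "\<forall>z\<in>rational_upper_half. (\<lambda>k. stieltjes (emp (Suc k) (\<beta> (Suc k) \<omega>)) z) \<longlonglongrightarrow> m z" for \<omega>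
    by (rule tight_from_stieltjes[OF emp_real_distribution _ mlim]) (use that in \<open>auto simp: rational_upper_half_def\<close>)
  \<comment> \<open>The limit measure is extracted from one realisation; as \<open>m\<close> is
    nonrandom, it is the limit for almost every other one.\<close>
  obtain M0 where M0: "real_distribution M0" "\<And>z. z \<in> rational_upper_half \<Longrightarrow> stieltjes M0 z = m z"
  proof -
    obtain \<omega>2 where "\<forall>z\<in>rational_upper_half. (\<lambda>k. stieltjes (emp (Suc k) (\<beta> (Suc k) \<omega>2)) z) \<longlonglongrightarrow> m z"
      using AE_obtain_witness[OF rational] by blast
    with weak_limit_exists[OF emp_real_distribution tight[OF this]] that show thesis by blast
  qed
  have weak: "AE \<omega> in M. weak_conv_m (\<lambda>k. emp (Suc k) (\<beta> (Suc k) \<omega>)) M0"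
    using rational
  proof eventually_elim
    fix \<omega> assume r: "\<forall>z\<in>rational_upper_half. (\<lambda>k. stieltjes (emp (Suc k) (\<beta> (Suc k) \<omega>)) z) \<longlonglongrightarrow> m z"
    show "weak_conv_m (\<lambda>k. emp (Suc k) (\<beta> (Suc k) \<omega>)) M0"
      by (rule weak_conv_from_stieltjes[OF emp_real_distribution M0(1) tight[OF r]]) (use r M0(2) in simp)
  qed
  \<comment> \<open>From rational points to every \<open>z\<close>: for a given \<open>z\<close>,
    some realisation has both the weak convergence and the convergence of transforms at
    \<open>z\<close>.\<close>
  have M0m: "stieltjes M0 z = m z" if z: "0 < Im z" for z
  proof -
    have "AE \<omega> in M. weak_conv_m (\<lambda>k. emp (Suc k) (\<beta> (Suc k) \<omega>)) M0 \<and> (\<lambda>k. stieltjes (emp (Suc k) (\<beta> (Suc k) \<omega>)) z) \<longlonglongrightarrow> m z"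
      using weak pointwise[OF z] by auto
    then obtain \<omega> where "weak_conv_m (\<lambda>k. emp (Suc k) (\<beta> (Suc k) \<omega>)) M0"
      and l: "(\<lambda>k. stieltjes (emp (Suc k) (\<beta> (Suc k) \<omega>)) z) \<longlonglongrightarrow> m z" using AE_obtain_witness by blast
    from stieltjes_weak_limit[OF emp_real_distribution M0(1) this(1) z] l show ?thesis by (rule LIMSEQ_unique)
  qed
  interpret M0: real_distribution M0 by (rule M0(1))
  have F: "prob_distribution_function (cdf M0)"
    unfolding prob_distribution_function_def
    by (intro conjI allI monoI M0.cdf_nondecreasing M0.cdf_is_right_cont M0.cdf_lim_at_bot M0.cdf_lim_at_top_prob)
  have F0: "interval_measure (cdf M0) = M0"
  proof (rule cdf_unique)
    show "real_distribution (interval_measure (cdf M0))"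
      by (rule real_distribution_interval_measure[OF M0.cdf_nondecreasing M0.cdf_is_right_cont M0.cdf_lim_at_bot M0.cdf_lim_at_top_prob])
    show "cdf (interval_measure (cdf M0)) = cdf M0"
      by (rule cdf_interval_measure[OF M0.cdf_nondecreasing M0.cdf_is_right_cont M0.cdf_lim_at_bot])
  qed (rule M0(1))
  show ?thesis
  proof (intro exI[of _ "cdf M0"] exI[of _ sol] conjI ballI impI F)
    show "AE \<omega> in M. weak_conv (\<lambda>n. esd (B n \<omega>)) (cdf M0)"
      using weak AE_space
    proof eventually_elim
      fix \<omega> assume wk: "weak_conv_m (\<lambda>k. emp (Suc k) (\<beta> (Suc k) \<omega>)) M0" and \<omega>: "\<omega> \<in> space M"
      have "esd (B (Suc k) \<omega>) = cdf (emp (Suc k) (\<beta> (Suc k) \<omega>))" for k by (rule \<beta>) (use \<omega> in auto)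
      thus "weak_conv (\<lambda>n. esd (B n \<omega>)) (cdf M0)"
        using wk unfolding weak_conv_m_def by (subst (asm) weak_conv_shift)
    qed
  next
    fix z assume "z \<in> upper_half_plane"
    hence z: "0 < Im z" by (simp add: upper_half_plane_def)
    note s = sol[OF z]
    interpret H: real_distribution ?H by (rule Hm(1))
    interpret fixed_point c ?H ?D z by (rule fp[OF z])
    show "sol z \<in> - upper_half_plane" using s by (simp add: upper_half_plane_def not_less)
    show "solves_fixed_point c H D z (sol z)" using s by (simp add: solves_fixed_point_iff)
    show "w' = sol z" if "w' \<in> - upper_half_plane" "solves_fixed_point c H D z w'" for w'
      using fixed_point_unique[of w' "sol z"] that s by (simp add: upper_half_plane_def not_less solves_fixed_point_iff)
    show "integrable ?H (\<lambda>\<tau>. 1 / (complex_of_real \<tau> * sol z - z))"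
    proof (rule H.integrable_const_bound[where B = "1 / Im z"])
      show "AE \<tau> in ?H. cmod (1 / (complex_of_real \<tau> * sol z - z)) \<le> 1 / Im z"
        using Hm(3) by eventually_elim (rule shifted_denominator(3)[OF z], use s in auto)
    qed simp
    show "cauchy_stieltjes (cdf M0) z = (LINT \<tau>|?H. 1 / (complex_of_real \<tau> * sol z - z))"
      using M0m[OF z] unfolding cauchy_stieltjes_def F0 stieltjes_def m_def .
  qed
qed

end
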